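(* Let $(M^d,[g],I)$ be a scalar negative (directed) almost Einstein manifold in Riemannian signature with $d\ge3$ odd and non-empty scale singularity set $\Sigma$. Let $(\tilde M,\tilde h)$ be a Fefferman–Graham ambient metric for $(M,[g])$, Ricci-flat to all orders, and let $\tilde I$ be the parallel 1-form field on $\tilde M$ corresponding to $I$. Let $\tilde\Sigma$ be the hypersurface in $\tilde M$ given as the zero set of $\tilde\sigma:=\tilde h(\tilde X,\tilde I)$, and let $\tilde h_{\tilde\Sigma}$ be the metric induced on $\tilde\Sigma$ from $\tilde h$. Then $\tilde\Sigma$ is totally geodesic, and $(\tilde\Sigma,\tilde h_{\tilde\Sigma})$ is a Fefferman–Graham metric for $(\Sigma,[g_\Sigma])$, which is formally smooth and Ricci-flat to all orders. (All statements about ambient metrics are understood formally, to all orders along the bundle of metrics.)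
   Context: Tractors. $\mathcal{E}[w]$ is the density bundle of weight $w$ of $(M,[g])$, $\boldsymbol{g}$ the conformal metric, and $P$ the Schouten tensor ($\mathrm{Ric}=(d-2)P+Jg$). The standard tractor bundle $\mathcal{T}$ is identified, for each $g\in[g]$, with $\mathcal{E}[1]\oplus T^*M[1]\oplus\mathcal{E}[-1]$, with change $(\sigma,\mu_b,\rho)\mapsto(\sigma,\mu_b+\sigma\Upsilon_b,\rho-\Upsilon^b\mu_b-\frac12\sigma\Upsilon^b\Upsilon_b)$ for $\hat g=e^{2\omega}g$, $\Upsilon=d\omega$. It has tractor metric $h$ with quadratic form $\boldsymbol{g}^{-1}(\mu,\mu)+2\sigma\rho$, connection $\nabla_a(\sigma,\mu_b,\rho)=(\nabla_a\sigma-\mu_a,\nabla_a\mu_b+\boldsymbol{g}_{ab}\rho+P_{ab}\sigma,\nabla_a\rho-P_{ab}\mu^b)$, and canonical section $X=(0,0,1)$ of $\mathcal{T}[1]$. A (directed) almost Einstein structure $(M,[g],I)$ ($M$ connected) is a conformal manifold with a non-zero parallel section $I$ of $\mathcal{T}$; $\sigma:=h(X,I)$ and $\Sigma=\{\sigma=0\}$. It is scalar negative if $S(I):=-h(I,I)<0$; then $\Sigma$, if non-empty, is a hypersurface, and $[g_\Sigma]$ is the conformal class of pullbacks of metrics in $[g]$. Ambient metrics. For a conformal manifold of dimension $m$ let $\pi:\mathcal{Q}\to M$ be the $\mathbb{R}_+$-bundle of metrics in $[g]$, with action $(x,g_x)\mapsto(x,s^2g_x)$. An ambient manifold is a smooth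 $(m+2)$-manifold $\tilde M$ with a free $\mathbb{R}_+$-action and an $\mathbb{R}_+$-equivariant embedding $i:\mathcal{Q}\to\tilde M$; $\tilde X$ is the vector field generating the action. An ambient metric is a metric $\tilde h$ of signature $(m+1,1)$ on $\tilde M$ with (i) $\mathcal{L}_{\tilde X}\tilde h=2\tilde h$, and (ii) $\tilde h(i_*\xi,i_*\eta)=g_x(\pi_*\xi,\pi_*\eta)$ for $u=(x,g_x)\in\mathcal{Q}$, $\xi,\eta\in T_u\mathcal{Q}$. It is called a Fefferman–Graham metric if it is Ricci-flat, formally along $\mathcal{Q}$; for $m$ odd this can be achieved to all orders. For $(\Sigma,[g_\Sigma])$ the bundle of metrics is identified with $\pi^{-1}(\Sigma)\subset\mathcal{Q}$. Correspondence. Sections of $\mathcal{E}[w]$ are functions on $\mathcal{Q}$ homogeneous of degree $w$. Sections of $\mathcal{T}$ correspond to sections $U$ of $T\tilde M|_{\mathcal{Q}}$ with $\tilde\nabla_{\tilde X}U=0$ ($\tilde\nabla$ the Levi-Civita connection of $\tilde h$), in such a way that $\tilde X$ corresponds to $X$, $\tilde h$ to $h$, and $\tilde\nabla$ along $\mathcal{Q}$ to the tractor connection. For $d$ odd there is a 1-form field $\tilde I$ on $\tilde M$, parallel to all orders along $\mathcal{Q}$, with $\tilde I|_{\mathcal{Q}}$ the homogeneous (weight 0) section corresponding to $I$ (indices moved by $\tilde h$). One has $\tilde I=d\tilde\sigma$, where $\tilde\sigma$ is homogeneous of degree 1 and extends the function on $\mathcal{Q}$ corresponding to $\sigma$. This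 is the $\tilde I$ of the claim. *)

theory Defs
  imports "HOL-Analysis.Analysis"
begin

section \<open>Calculus on open subsets of a Euclidean space\<close>

definition dpartial :: "'e \<Rightarrow> ('e::euclidean_space \<Rightarrow> 'b::real_normed_vector) \<Rightarrow> 'e \<Rightarrow> 'b" where
  "dpartial b f x = frechet_derivative f (at x) b"

fun iter_partial :: "'e list \<Rightarrow> ('e::euclidean_space \<Rightarrow> 'b::real_normed_vector) \<Rightarrow> 'e \<Rightarrow> 'b" where
  "iter_partial [] f = f"
| "iter_partial (b # bs) f = iter_partial bs (dpartial b f)"

text \<open>Only used for open \<open>S\<close>, where this is the usual $C^\infty$ condition.\<close>

definition smooth_on :: "'e::euclidean_space set \<Rightarrow> ('e \<Rightarrow> 'b::real_normed_vector) \<Rightarrow> bool" where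
  "smooth_on S f \<longleftrightarrow> (\<forall>bs. set bs \<subseteq> Basis \<longrightarrow> iter_partial bs f differentiable_on S)"

definition vanishes_all_orders :: "('e::euclidean_space \<Rightarrow> real) \<Rightarrow> 'e \<Rightarrow> bool" where
  "vanishes_all_orders f x \<longleftrightarrow> (\<forall>bs. set bs \<subseteq> Basis \<longrightarrow> iter_partial bs f x = 0)"

text \<open>In the following, \<open>G x v w\<close> is a pseudo-Riemannian metric on an open set, \<open>Basis\<close> is the
  coordinate frame, and \<open>ginv (G x) i j\<close> is the entry $g^{ij}$ of the inverse matrix.\<close>

definition ginv :: "('e::euclidean_space \<Rightarrow> 'e \<Rightarrow> real) \<Rightarrow> 'e \<Rightarrow> 'e \<Rightarrow> real" where
  "ginv B i j = (THE v. \<forall>w. B v w = j \<bullet> w) \<bullet> i"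

text \<open>\<open>christoffel G x i j k\<close> is $\Gamma^k_{ij}$.\<close>

definition christoffel ::
  "('e::euclidean_space \<Rightarrow> 'e \<Rightarrow> 'e \<Rightarrow> real) \<Rightarrow> 'e \<Rightarrow> 'e \<Rightarrow> 'e \<Rightarrow> 'e \<Rightarrow> real" where
  "christoffel G x i j k = 1/2 * (\<Sum>l\<in>Basis. ginv (G x) k l *
      (dpartial i (\<lambda>y. G y j l) x + dpartial j (\<lambda>y. G y i l) x - dpartial l (\<lambda>y. G y i j) x))"

text \<open>Sign: positive on round spheres.\<close>

definition ricci :: "('e::euclidean_space \<Rightarrow> 'e \<Rightarrow> 'e \<Rightarrow> real) \<Rightarrow> 'e \<Rightarrow> 'e \<Rightarrow> 'e \<Rightarrow> real" where
  "ricci G x j k = (\<Sum>i\<in>Basis.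
      dpartial i (\<lambda>y. christoffel G y j k i) x - dpartial k (\<lambda>y. christoffel G y i j i) x
      + (\<Sum>l\<in>Basis. christoffel G x i l i * christoffel G x j k l
                     - christoffel G x k l i * christoffel G x i j l))"

definition scalar_curv :: "('e::euclidean_space \<Rightarrow> 'e \<Rightarrow> 'e \<Rightarrow> real) \<Rightarrow> 'e \<Rightarrow> real" where
  "scalar_curv G x = (\<Sum>a\<in>Basis. \<Sum>b\<in>Basis. ginv (G x) a b * ricci G x a b)"

text \<open>$\mathrm{Ric} = (d-2)P + J g$ with $J = g^{ab}P_{ab}$, that is $J = \mathrm{Sc}/(2(d-1))$.\<close>

definition schouten :: "('e::euclidean_space \<Rightarrow> 'e \<Rightarrow> 'e \<Rightarrow> real) \<Rightarrow> 'e \<Rightarrow> 'e \<Rightarrow> 'e \<Rightarrow> real" where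
  "schouten G x a b =
     (ricci G x a b - scalar_curv G x / (2 * (real DIM('e) - 1)) * G x a b) / (real DIM('e) - 2)"

definition nabla_form ::
  "('e::euclidean_space \<Rightarrow> 'e \<Rightarrow> 'e \<Rightarrow> real) \<Rightarrow> ('e \<Rightarrow> 'e \<Rightarrow> real) \<Rightarrow> 'e \<Rightarrow> 'e \<Rightarrow> 'e \<Rightarrow> real" where
  "nabla_form G m x a b =
     dpartial a (\<lambda>y. m y b) x - (\<Sum>k\<in>Basis. christoffel G x a b k * m x k)"

definition has_signature :: "('e::euclidean_space \<Rightarrow> 'e \<Rightarrow> real) \<Rightarrow> nat \<Rightarrow> nat \<Rightarrow> bool" where
  "has_signature B p q \<longleftrightarrow> (\<exists>P N. finite P \<and> finite N \<and> P \<inter> N = {} \<and> card P = p \<and> card N = q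
      \<and> independent (P \<union> N) \<and> span (P \<union> N) = UNIV
      \<and> (\<forall>v\<in>P. B v v > 0) \<and> (\<forall>v\<in>N. B v v < 0)
      \<and> (\<forall>v\<in>P \<union> N. \<forall>w\<in>P \<union> N. v \<noteq> w \<longrightarrow> B v w = 0))"

section \<open>Smooth manifolds\<close>

type_synonym ('a, 'e) chart = "'a set \<times> ('a \<Rightarrow> 'e)"

text \<open>The type \<open>'e\<close> is the model space, so the dimension is \<open>DIM('e)\<close>.\<close>

datatype ('a, 'e) mfd = Mfd (mtop: "'a topology") (atlas: "('a, 'e) chart set")

abbreviation points :: "('a, 'e) mfd \<Rightarrow> 'a set" where
  "points M \<equiv> topspace (mtop M)"

definition cinv :: "('a, 'e) chart \<Rightarrow> 'e \<Rightarrow> 'a" where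
  "cinv c = inv_into (fst c) (snd c)"

definition smooth_manifold :: "('a, 'e::euclidean_space) mfd \<Rightarrow> bool" where
  "smooth_manifold M \<longleftrightarrow> Hausdorff_space (mtop M) \<and> second_countable (mtop M)
     \<and> (\<Union>c\<in>atlas M. fst c) = points M
     \<and> (\<forall>c\<in>atlas M. openin (mtop M) (fst c) \<and> open (snd c ` fst c)
          \<and> homeomorphic_map (subtopology (mtop M) (fst c)) (top_of_set (snd c ` fst c)) (snd c))
     \<and> (\<forall>c\<in>atlas M. \<forall>c'\<in>atlas M. smooth_on (snd c ` (fst c \<inter> fst c')) (snd c' \<circ> cinv c))"

definition fun_smooth :: "('a, 'e::euclidean_space) mfd \<Rightarrow> 'a set \<Rightarrow> ('a \<Rightarrow> real) \<Rightarrow> bool" where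
  "fun_smooth M W f \<longleftrightarrow> (\<forall>c\<in>atlas M. smooth_on (snd c ` (fst c \<inter> W)) (f \<circ> cinv c))"

definition smooth_near :: "('a, 'e::euclidean_space) mfd \<Rightarrow> 'a \<Rightarrow> ('a \<Rightarrow> real) \<Rightarrow> bool" where
  "smooth_near M p f \<longleftrightarrow> (\<exists>W. openin (mtop M) W \<and> p \<in> W \<and> fun_smooth M W f)"

text \<open>A tangent vector at \<open>p\<close> is a derivation on the functions that are smooth near \<open>p\<close>; it takes
  the value \<open>0\<close> on all other functions, so that equality of tangent vectors is equality in HOL.
  \<open>tv M c p v\<close> is the vector with coordinates \<open>v\<close> in the chart \<open>c\<close>; conversely, a vector
  \<open>\<xi>\<close> has the \<open>k\<close>-th coordinate \<open>\<xi> (coordf c k)\<close>.\<close>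

type_synonym 'a tvec = "('a \<Rightarrow> real) \<Rightarrow> real"

definition tv :: "('a, 'e::euclidean_space) mfd \<Rightarrow> ('a, 'e) chart \<Rightarrow> 'a \<Rightarrow> 'e \<Rightarrow> 'a tvec" where
  "tv M c p v = (\<lambda>f. if smooth_near M p f then dpartial v (f \<circ> cinv c) (snd c p) else 0)"

definition coordf :: "('a, 'e::euclidean_space) chart \<Rightarrow> 'e \<Rightarrow> 'a \<Rightarrow> real" where
  "coordf c k = (\<lambda>p. snd c p \<bullet> k)"

definition tangent_space :: "('a, 'e::euclidean_space) mfd \<Rightarrow> 'a \<Rightarrow> 'a tvec set" where
  "tangent_space M p = {tv M c p v | c v. c \<in> atlas M \<and> p \<in> fst c}"

definition smooth_map ::
  "('a, 'e::euclidean_space) mfd \<Rightarrow> ('b, 'f::euclidean_space) mfd \<Rightarrow> ('a \<Rightarrow> 'b) \<Rightarrow> bool" where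
  "smooth_map M N F \<longleftrightarrow> continuous_map (mtop M) (mtop N) F
     \<and> (\<forall>c\<in>atlas M. \<forall>c'\<in>atlas N.
          smooth_on (snd c ` {p \<in> fst c. F p \<in> fst c'}) (snd c' \<circ> F \<circ> cinv c))"

text \<open>The differential $F_*$ at \<open>p\<close>.\<close>

definition push :: "('b, 'f::euclidean_space) mfd \<Rightarrow> ('a \<Rightarrow> 'b) \<Rightarrow> 'a \<Rightarrow> 'a tvec \<Rightarrow> 'b tvec" where
  "push N F p v = (\<lambda>f. if smooth_near N (F p) f then v (f \<circ> F) else 0)"

definition smooth_embedding ::
  "('a, 'e::euclidean_space) mfd \<Rightarrow> ('b, 'f::euclidean_space) mfd \<Rightarrow> ('a \<Rightarrow> 'b) \<Rightarrow> bool" where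
  "smooth_embedding M N F \<longleftrightarrow> smooth_map M N F \<and> embedding_map (mtop M) (mtop N) F
     \<and> (\<forall>p\<in>points M. inj_on (push N F p) (tangent_space M p))"

definition euclid :: "'e::euclidean_space set \<Rightarrow> ('e, 'e) mfd" where
  "euclid O' = Mfd (top_of_set O') {(O', id)}"

text \<open>A subset \<open>S\<close> of \<open>M\<close> with the subspace topology and with all charts whose inverse is a smooth
  embedding into \<open>M\<close>. The set \<open>S\<close> is an embedded submanifold of dimension \<open>DIM('f)\<close> iff
  \<open>submanifold M S :: ('a, 'f) mfd\<close> is a smooth manifold (i.e. iff these charts cover \<open>S\<close>).\<close>

definition submanifold ::
  "('a, 'e::euclidean_space) mfd \<Rightarrow> 'a set \<Rightarrow> ('a, 'f::euclidean_space) mfd" where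
  "submanifold M S = Mfd (subtopology (mtop M) S)
     {c. openin (subtopology (mtop M) S) (fst c) \<and> inj_on (snd c) (fst c) \<and> open (snd c ` fst c)
         \<and> smooth_embedding (euclid (snd c ` fst c)) M (cinv c)}"

definition ray_times :: "('a, 'e::euclidean_space) mfd \<Rightarrow> (real \<times> 'a, real \<times> 'e) mfd" where
  "ray_times M = Mfd (prod_topology (top_of_set {0<..}) (mtop M))
     {({0<..} \<times> fst c, \<lambda>(s, p). (s, snd c p)) | c. c \<in> atlas M}"

text \<open>The value at \<open>p\<close> of the vector field generating a (multiplicative) action of the positive
  reals.\<close>

definition generator ::
  "('a, 'e::euclidean_space) mfd \<Rightarrow> (real \<Rightarrow> 'a \<Rightarrow> 'a) \<Rightarrow> 'a \<Rightarrow> 'a tvec" where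
  "generator M \<delta> p = (\<lambda>f. if smooth_near M p f then deriv (\<lambda>s. f (\<delta> s p)) 1 else 0)"

section \<open>Tensor fields\<close>

type_synonym 'a form2 = "'a tvec \<Rightarrow> 'a tvec \<Rightarrow> real"
type_synonym 'a metric = "'a \<Rightarrow> 'a form2"
type_synonym 'a form1 = "'a \<Rightarrow> 'a tvec \<Rightarrow> real"

definition mcoords ::
  "('a, 'e::euclidean_space) mfd \<Rightarrow> 'a metric \<Rightarrow> ('a, 'e) chart \<Rightarrow> 'e \<Rightarrow> 'e \<Rightarrow> 'e \<Rightarrow> real" where
  "mcoords M g c x v w = g (cinv c x) (tv M c (cinv c x) v) (tv M c (cinv c x) w)"

definition fcoords ::
  "('a, 'e::euclidean_space) mfd \<Rightarrow> 'a form1 \<Rightarrow> ('a, 'e) chart \<Rightarrow> 'e \<Rightarrow> 'e \<Rightarrow> real" where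
  "fcoords M \<alpha> c x v = \<alpha> (cinv c x) (tv M c (cinv c x) v)"

definition smooth_form :: "('a, 'e::euclidean_space) mfd \<Rightarrow> 'a form1 \<Rightarrow> bool" where
  "smooth_form M \<alpha> \<longleftrightarrow> (\<forall>c\<in>atlas M. (\<forall>x\<in>snd c ` fst c. linear (fcoords M \<alpha> c x))
      \<and> (\<forall>a\<in>Basis. smooth_on (snd c ` fst c) (\<lambda>x. fcoords M \<alpha> c x a)))"

text \<open>The first condition fixes the junk values, so that metrics that agree on tangent vectors are
  equal.\<close>

definition metric_sig :: "('a, 'e::euclidean_space) mfd \<Rightarrow> nat \<Rightarrow> nat \<Rightarrow> 'a metric \<Rightarrow> bool" where
  "metric_sig M p q g \<longleftrightarrow>
     (\<forall>x v w. \<not> (x \<in> points M \<and> v \<in> tangent_space M x \<and> w \<in> tangent_space M x) \<longrightarrow> g x v w = 0)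
     \<and> (\<forall>c\<in>atlas M. (\<forall>x\<in>snd c ` fst c.
            bilinear (mcoords M g c x) \<and> (\<forall>v w. mcoords M g c x v w = mcoords M g c x w v)
            \<and> has_signature (mcoords M g c x) p q)
          \<and> (\<forall>a\<in>Basis. \<forall>b\<in>Basis. smooth_on (snd c ` fst c) (\<lambda>x. mcoords M g c x a b)))"

abbreviation riemannian :: "('a, 'e::euclidean_space) mfd \<Rightarrow> 'a metric \<Rightarrow> bool" where
  "riemannian (M :: ('a, 'e) mfd) \<equiv> metric_sig M DIM('e) 0"

definition sharp :: "('a, 'e::euclidean_space) mfd \<Rightarrow> 'a metric \<Rightarrow> 'a \<Rightarrow> ('a tvec \<Rightarrow> real) \<Rightarrow> 'a tvec" where
  "sharp M g p \<alpha> =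
     (THE v. v \<in> tangent_space M p \<and> (\<forall>w\<in>tangent_space M p. g p v w = \<alpha> w))"

definition cometric ::
  "('a, 'e::euclidean_space) mfd \<Rightarrow> 'a metric \<Rightarrow> 'a \<Rightarrow> ('a tvec \<Rightarrow> real) \<Rightarrow> ('a tvec \<Rightarrow> real) \<Rightarrow> real" where
  "cometric M g p \<alpha> \<beta> = \<alpha> (sharp M g p \<beta>)"

text \<open>Pullback along \<open>F : N \<rightarrow> M\<close> of a bilinear form at \<open>F p\<close>, and of a metric.\<close>

definition pull_form ::
  "('b, 'f::euclidean_space) mfd \<Rightarrow> ('a, 'e::euclidean_space) mfd \<Rightarrow> ('b \<Rightarrow> 'a) \<Rightarrow> 'b
     \<Rightarrow> 'a form2 \<Rightarrow> 'b form2" where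
  "pull_form N M F p \<gamma> v w =
     (if p \<in> points N \<and> v \<in> tangent_space N p \<and> w \<in> tangent_space N p
      then \<gamma> (push M F p v) (push M F p w) else 0)"

definition pullback ::
  "('b, 'f::euclidean_space) mfd \<Rightarrow> ('a, 'e::euclidean_space) mfd \<Rightarrow> ('b \<Rightarrow> 'a)
     \<Rightarrow> 'a metric \<Rightarrow> 'b metric" where
  "pullback N M F g p = pull_form N M F p (g (F p))"

text \<open>Sections of $F^*TM$ for a map \<open>F : N \<rightarrow> M\<close>, and the \<open>k\<close>-th coordinate in the chart \<open>c\<close> of
  the derivative $\nabla_\xi U$ for the pullback of the Levi-Civita connection of \<open>h\<close>,
  where \<open>\<xi>\<close> is a tangent vector of \<open>N\<close> at \<open>u\<close>.\<close>

definition smooth_along ::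
  "('b, 'f::euclidean_space) mfd \<Rightarrow> ('a, 'e::euclidean_space) mfd \<Rightarrow> ('b \<Rightarrow> 'a)
     \<Rightarrow> ('b \<Rightarrow> 'a tvec) \<Rightarrow> bool" where
  "smooth_along N M F U \<longleftrightarrow> (\<forall>u\<in>points N. U u \<in> tangent_space M (F u))
     \<and> (\<forall>c\<in>atlas M. \<forall>k\<in>Basis.
          fun_smooth N {u \<in> points N. F u \<in> fst c} (\<lambda>u. U u (coordf c k)))"

abbreviation vector_field :: "('a, 'e::euclidean_space) mfd \<Rightarrow> ('a \<Rightarrow> 'a tvec) \<Rightarrow> bool" where
  "vector_field M \<equiv> smooth_along M M id"

definition nabla_along ::
  "('a, 'e::euclidean_space) mfd \<Rightarrow> 'a metric \<Rightarrow> ('b \<Rightarrow> 'a) \<Rightarrow> 'b \<Rightarrow> 'b tvec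
     \<Rightarrow> ('b \<Rightarrow> 'a tvec) \<Rightarrow> ('a, 'e) chart \<Rightarrow> 'e \<Rightarrow> real" where
  "nabla_along M h F u \<xi> U c k = \<xi> (\<lambda>u'. U u' (coordf c k))
     + (\<Sum>a\<in>Basis. \<Sum>b\<in>Basis. christoffel (mcoords M h c) (snd c (F u)) a b k
           * push M F u \<xi> (coordf c a) * U u (coordf c b))"

definition ricci_flat_along ::
  "('a, 'e::euclidean_space) mfd \<Rightarrow> 'a metric \<Rightarrow> 'a set \<Rightarrow> bool" where
  "ricci_flat_along M h Z \<longleftrightarrow> (\<forall>c\<in>atlas M. \<forall>p\<in>fst c \<inter> Z. \<forall>a\<in>Basis. \<forall>b\<in>Basis.
      vanishes_all_orders (\<lambda>x. ricci (mcoords M h c) x a b) (snd c p))"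

definition parallel_form_along ::
  "('a, 'e::euclidean_space) mfd \<Rightarrow> 'a metric \<Rightarrow> 'a form1 \<Rightarrow> 'a set \<Rightarrow> bool" where
  "parallel_form_along M h \<alpha> Z \<longleftrightarrow> (\<forall>c\<in>atlas M. \<forall>p\<in>fst c \<inter> Z. \<forall>a\<in>Basis. \<forall>b\<in>Basis.
      vanishes_all_orders (\<lambda>x. nabla_form (mcoords M h c) (fcoords M \<alpha> c) x a b) (snd c p))"

text \<open>For a submanifold \<open>N\<close> of \<open>(M, h)\<close>, with the induced metric, the second fundamental form is
  $II(V, W) = \nabla^M_V W - \nabla^N_V W$ (Gauss formula). Its \<open>k\<close>-th coordinate in the chart \<open>c\<close>
  of \<open>M\<close> is computed below on the coordinate fields of the chart \<open>b\<close> of \<open>N\<close>, where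
  \<open>snd c \<circ> cinv b\<close> is the inclusion in coordinates.\<close>

definition second_ff ::
  "('a, 'e::euclidean_space) mfd \<Rightarrow> 'a metric \<Rightarrow> ('a, 'f::euclidean_space) mfd
     \<Rightarrow> ('a, 'f) chart \<Rightarrow> ('a, 'e) chart \<Rightarrow> 'f \<Rightarrow> 'f \<Rightarrow> 'f \<Rightarrow> 'e \<Rightarrow> real" where
  "second_ff M h N b c y i j k =
     (let F = (\<lambda>l y. coordf c l (cinv b y)) in
      dpartial i (dpartial j (F k)) y
      + (\<Sum>l\<in>Basis. \<Sum>m\<in>Basis. christoffel (mcoords M h c) (snd c (cinv b y)) l m k
            * dpartial i (F l) y * dpartial j (F m) y)
      - (\<Sum>e\<in>Basis. christoffel (mcoords N (pullback N M id h) b) y i j e * dpartial e (F k) y))"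

definition totally_geodesic_along ::
  "('a, 'e::euclidean_space) mfd \<Rightarrow> 'a metric \<Rightarrow> ('a, 'f::euclidean_space) mfd \<Rightarrow> 'a set \<Rightarrow> bool" where
  "totally_geodesic_along M h N Z \<longleftrightarrow>
     (\<forall>b\<in>atlas N. \<forall>c\<in>atlas M. \<forall>p\<in>fst b \<inter> fst c \<inter> Z. \<forall>i\<in>Basis. \<forall>j\<in>Basis. \<forall>k\<in>Basis.
        vanishes_all_orders (\<lambda>y. second_ff M h N b c y i j k) (snd b p))"

section \<open>Conformal manifolds, the bundle of metrics, densities\<close>

definition conf_related ::
  "('a, 'e::euclidean_space) mfd \<Rightarrow> ('a \<Rightarrow> real) \<Rightarrow> 'a metric \<Rightarrow> 'a metric \<Rightarrow> bool" where
  "conf_related M \<omega> g g' \<longleftrightarrow> fun_smooth M (points M) \<omega> \<and>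
     (\<forall>x\<in>points M. \<forall>v\<in>tangent_space M x. \<forall>w\<in>tangent_space M x.
        g' x v w = exp (2 * \<omega> x) * g x v w)"

definition conformal_manifold :: "('a, 'e::euclidean_space) mfd \<Rightarrow> 'a metric set \<Rightarrow> bool" where
  "conformal_manifold M C \<longleftrightarrow> smooth_manifold M
     \<and> (\<exists>g. riemannian M g \<and> C = {g'. riemannian M g' \<and> (\<exists>\<omega>. conf_related M \<omega> g g')})"

text \<open>The conformal class containing the pullbacks to a submanifold \<open>N\<close> of the metrics in \<open>C\<close>.\<close>

definition induced_class ::
  "('a, 'f::euclidean_space) mfd \<Rightarrow> ('a, 'e::euclidean_space) mfd \<Rightarrow> 'a metric set \<Rightarrow> 'a metric set" where
  "induced_class N M C =
     {g'. riemannian N g' \<and> (\<exists>g\<in>C. \<exists>\<omega>. conf_related N \<omega> (pullback N M id g) g')}"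

type_synonym 'a bpt = "'a \<times> 'a form2"

definition metric_bundle :: "('a, 'e) mfd \<Rightarrow> 'a metric set \<Rightarrow> 'a bpt set" where
  "metric_bundle M C = {(x, g x) | x g. x \<in> points M \<and> g \<in> C}"

definition bscale :: "real \<Rightarrow> 'a bpt \<Rightarrow> 'a bpt" where
  "bscale s u = (fst u, \<lambda>v w. s\<^sup>2 * snd u v w)"

text \<open>The smooth structure of the bundle of metrics is the one for which
  $(s, x) \mapsto (x, s^2 g_x)$ is a diffeomorphism from $\mathbb{R}_+ \times M$ for every
  \<open>g\<close> in the conformal class.\<close>

definition blevel :: "'a metric \<Rightarrow> 'a bpt \<Rightarrow> real" where
  "blevel g u = (THE s. s > 0 \<and> u = bscale s (fst u, g (fst u)))"

definition bundle_open :: "('a, 'e) mfd \<Rightarrow> 'a metric set \<Rightarrow> 'a bpt set \<Rightarrow> bool" where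
  "bundle_open M C A \<longleftrightarrow> A \<subseteq> metric_bundle M C
     \<and> (\<forall>g\<in>C. openin (prod_topology (top_of_set {0<..}) (mtop M))
           {z \<in> {0<..} \<times> points M. bscale (fst z) (snd z, g (snd z)) \<in> A})"

lemma istopology_bundle_open: "istopology (bundle_open M C)"
proof -
  let ?T = "prod_topology (top_of_set {0<..}) (mtop M)"
  have int: "bundle_open M C (A \<inter> B)" if "bundle_open M C A" "bundle_open M C B" for A B
  proof -
    have "openin ?T {z \<in> {0<..} \<times> points M. bscale (fst z) (snd z, g (snd z)) \<in> A \<inter> B}" if "g \<in> C" for g
    proof -
      have eq: "{z \<in> {0<..} \<times> points M. bscale (fst z) (snd z, g (snd z)) \<in> A \<inter> B}
        = {z \<in> {0<..} \<times> points M. bscale (fst z) (snd z, g (snd z)) \<in> A}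
          \<inter> {z \<in> {0<..} \<times> points M. bscale (fst z) (snd z, g (snd z)) \<in> B}"
        by blast
      show ?thesis
        unfolding eq using that \<open>bundle_open M C A\<close> \<open>bundle_open M C B\<close>
        unfolding bundle_open_def by (intro openin_Int) blast+
    qed
    then show ?thesis using that unfolding bundle_open_def by blast
  qed
  have un: "bundle_open M C (\<Union>K)" if K: "\<forall>A\<in>K. bundle_open M C A" for K
  proof -
    have "openin ?T {z \<in> {0<..} \<times> points M. bscale (fst z) (snd z, g (snd z)) \<in> \<Union>K}" if "g \<in> C" for g
    proof -
      have eq: "{z \<in> {0<..} \<times> points M. bscale (fst z) (snd z, g (snd z)) \<in> \<Union>K}
        = (\<Union>A\<in>K. {z \<in> {0<..} \<times> points M. bscale (fst z) (snd z, g (snd z)) \<in> A})"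
        by blast
      show ?thesis
        unfolding eq using that K unfolding bundle_open_def by (intro openin_Union) blast
    qed
    then show ?thesis using K unfolding bundle_open_def by blast
  qed
  show ?thesis unfolding istopology_def using int un by blast
qed

definition bundle_mfd ::
  "('a, 'e::euclidean_space) mfd \<Rightarrow> 'a metric set \<Rightarrow> ('a bpt, real \<times> 'e) mfd" where
  "bundle_mfd M C = Mfd (topology (bundle_open M C))
     {({u \<in> metric_bundle M C. fst u \<in> fst c}, \<lambda>u. (blevel g u, snd c (fst u))) | g c.
        g \<in> C \<and> c \<in> atlas M}"

definition density ::
  "('a, 'e::euclidean_space) mfd \<Rightarrow> 'a metric set \<Rightarrow> real \<Rightarrow> ('a bpt \<Rightarrow> real) \<Rightarrow> bool" where
  "density M C w \<tau> \<longleftrightarrow> fun_smooth (bundle_mfd M C) (metric_bundle M C) \<tau>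
     \<and> (\<forall>u\<in>metric_bundle M C. \<forall>s>0. \<tau> (bscale s u) = s powr w * \<tau> u)"

section \<open>Tractors\<close>

text \<open>A section of the standard tractor bundle is given by its triples $(\sigma, \mu, \rho)$ for all
  metrics in the conformal class. Densities are represented by functions, and weighted 1-forms by
  1-forms, through the metric to which the triple belongs; this accounts for the powers of
  $e^\omega$ in the transformation law.\<close>

datatype 'a trac = Trac (tsig: "'a \<Rightarrow> real") (tmu: "'a form1") (trho: "'a \<Rightarrow> real")

type_synonym 'a tractor = "'a metric \<Rightarrow> 'a trac"

definition tractor_section ::
  "('a, 'e::euclidean_space) mfd \<Rightarrow> 'a metric set \<Rightarrow> 'a tractor \<Rightarrow> bool" where
  "tractor_section M C I \<longleftrightarrow>
     (\<forall>g\<in>C. fun_smooth M (points M) (tsig (I g)) \<and> smooth_form M (tmu (I g))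
          \<and> fun_smooth M (points M) (trho (I g)))
     \<and> (\<forall>g\<in>C. \<forall>g'\<in>C. \<forall>\<omega>. conf_related M \<omega> g g' \<longrightarrow> (\<forall>x\<in>points M.
          let \<sigma> = tsig (I g) x; \<mu> = tmu (I g) x; \<rho> = trho (I g) x; \<Upsilon> = (\<lambda>v. v \<omega>) in
          tsig (I g') x = exp (\<omega> x) * \<sigma>
          \<and> (\<forall>v\<in>tangent_space M x. tmu (I g') x v = exp (\<omega> x) * (\<mu> v + \<sigma> * \<Upsilon> v))
          \<and> trho (I g') x = exp (- \<omega> x) *
               (\<rho> - cometric M g x \<Upsilon> \<mu> - 1/2 * \<sigma> * cometric M g x \<Upsilon> \<Upsilon>)))"

text \<open>The value at \<open>x\<close> of the tractor metric, computed from triples belonging to \<open>g\<close>.\<close>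

definition tractor_h ::
  "('a, 'e::euclidean_space) mfd \<Rightarrow> 'a metric \<Rightarrow> 'a \<Rightarrow> 'a trac \<Rightarrow> 'a trac \<Rightarrow> real" where
  "tractor_h M g x A B =
     cometric M g x (tmu A x) (tmu B x) + tsig A x * trho B x + trho A x * tsig B x"

text \<open>The triple of the canonical section $X$ of weight 1, for every metric.\<close>

definition canonical_X :: "'a trac" where
  "canonical_X = Trac (\<lambda>_. 0) (\<lambda>_ _. 0) (\<lambda>_. 1)"

text \<open>The three slots of $\nabla_a(\sigma, \mu_b, \rho)$ at \<open>cinv c x\<close>, in the chart \<open>c\<close> and for
  the metric \<open>g\<close>.\<close>

definition tnabla1 ::
  "('a, 'e::euclidean_space) mfd \<Rightarrow> 'a metric \<Rightarrow> ('a, 'e) chart \<Rightarrow> 'a trac \<Rightarrow> 'e \<Rightarrow> 'e \<Rightarrow> real" where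
  "tnabla1 M g c A x a = dpartial a (tsig A \<circ> cinv c) x - fcoords M (tmu A) c x a"

definition tnabla2 ::
  "('a, 'e::euclidean_space) mfd \<Rightarrow> 'a metric \<Rightarrow> ('a, 'e) chart \<Rightarrow> 'a trac \<Rightarrow> 'e \<Rightarrow> 'e \<Rightarrow> 'e \<Rightarrow> real" where
  "tnabla2 M g c A x a b =
     (let G = mcoords M g c in
      nabla_form G (fcoords M (tmu A) c) x a b + G x a b * trho A (cinv c x)
      + schouten G x a b * tsig A (cinv c x))"

definition tnabla3 ::
  "('a, 'e::euclidean_space) mfd \<Rightarrow> 'a metric \<Rightarrow> ('a, 'e) chart \<Rightarrow> 'a trac \<Rightarrow> 'e \<Rightarrow> 'e \<Rightarrow> real" where
  "tnabla3 M g c A x a =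
     (let G = mcoords M g c in
      dpartial a (trho A \<circ> cinv c) x
      - (\<Sum>b\<in>Basis. \<Sum>e\<in>Basis. schouten G x a b * ginv (G x) b e * fcoords M (tmu A) c x e))"

text \<open>\<open>J\<close> is the covariant derivative of \<open>I\<close> along the vector field \<open>V\<close>.\<close>

definition is_tractor_nabla ::
  "('a, 'e::euclidean_space) mfd \<Rightarrow> 'a metric set \<Rightarrow> ('a \<Rightarrow> 'a tvec) \<Rightarrow> 'a tractor \<Rightarrow> 'a tractor \<Rightarrow> bool" where
  "is_tractor_nabla M C V I J \<longleftrightarrow> (\<forall>g\<in>C. \<forall>c\<in>atlas M. \<forall>p\<in>fst c.
     let x = snd c p in
     tsig (J g) p = (\<Sum>a\<in>Basis. V p (coordf c a) * tnabla1 M g c (I g) x a)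
     \<and> (\<forall>b\<in>Basis. tmu (J g) p (tv M c p b) =
            (\<Sum>a\<in>Basis. V p (coordf c a) * tnabla2 M g c (I g) x a b))
     \<and> trho (J g) p = (\<Sum>a\<in>Basis. V p (coordf c a) * tnabla3 M g c (I g) x a))"

definition parallel_tractor ::
  "('a, 'e::euclidean_space) mfd \<Rightarrow> 'a metric set \<Rightarrow> 'a tractor \<Rightarrow> bool" where
  "parallel_tractor M C I \<longleftrightarrow> (\<forall>g\<in>C. \<forall>c\<in>atlas M. \<forall>x\<in>snd c ` fst c. \<forall>a\<in>Basis.
     tnabla1 M g c (I g) x a = 0 \<and> (\<forall>b\<in>Basis. tnabla2 M g c (I g) x a b = 0)
     \<and> tnabla3 M g c (I g) x a = 0)"

definition tractor_eq ::
  "('a, 'e::euclidean_space) mfd \<Rightarrow> 'a metric set \<Rightarrow> 'a tractor \<Rightarrow> 'a tractor \<Rightarrow> bool" where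
  "tractor_eq M C I J \<longleftrightarrow> (\<forall>g\<in>C. \<forall>x\<in>points M. tsig (I g) x = tsig (J g) x
     \<and> (\<forall>v\<in>tangent_space M x. tmu (I g) x v = tmu (J g) x v) \<and> trho (I g) x = trho (J g) x)"

definition almost_einstein ::
  "('a, 'e::euclidean_space) mfd \<Rightarrow> 'a metric set \<Rightarrow> 'a tractor \<Rightarrow> bool" where
  "almost_einstein M C I \<longleftrightarrow> conformal_manifold M C \<and> connected_space (mtop M)
     \<and> tractor_section M C I \<and> parallel_tractor M C I
     \<and> \<not> tractor_eq M C I (\<lambda>_. Trac (\<lambda>_. 0) (\<lambda>_ _. 0) (\<lambda>_. 0))"

definition scalar_negative ::
  "('a, 'e::euclidean_space) mfd \<Rightarrow> 'a metric set \<Rightarrow> 'a tractor \<Rightarrow> bool" where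
  "scalar_negative M C I \<longleftrightarrow> (\<forall>g\<in>C. \<forall>x\<in>points M. - tractor_h M g x (I g) (I g) < 0)"

definition scale_singularity ::
  "('a, 'e::euclidean_space) mfd \<Rightarrow> 'a metric set \<Rightarrow> 'a tractor \<Rightarrow> 'a set" where
  "scale_singularity M C I = {x \<in> points M. \<exists>g\<in>C. tractor_h M g x canonical_X (I g) = 0}"

section \<open>Ambient metrics\<close>

definition ambient_manifold ::
  "('a, 'e::euclidean_space) mfd \<Rightarrow> 'a metric set \<Rightarrow> ('w, 'k::euclidean_space) mfd
     \<Rightarrow> (real \<Rightarrow> 'w \<Rightarrow> 'w) \<Rightarrow> ('a bpt \<Rightarrow> 'w) \<Rightarrow> bool" where
  "ambient_manifold M C Mt \<delta> i \<longleftrightarrow> smooth_manifold Mt \<and> DIM('k) = DIM('e) + 2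
     \<and> smooth_map (ray_times Mt) Mt (\<lambda>(s, p). \<delta> s p)
     \<and> (\<forall>p\<in>points Mt. \<delta> 1 p = p \<and> (\<forall>s>0. \<forall>t>0. \<delta> s (\<delta> t p) = \<delta> (s * t) p)
          \<and> (\<forall>s>0. \<delta> s p = p \<longrightarrow> s = 1))
     \<and> smooth_embedding (bundle_mfd M C) Mt i
     \<and> (\<forall>u\<in>metric_bundle M C. \<forall>s>0. i (bscale s u) = \<delta> s (i u))"

text \<open>The Lie derivative along the generator of the action is the derivative of the pullbacks by
  \<open>\<delta> s\<close> at \<open>s = 1\<close>, since $t \mapsto \delta_{e^t}$ is the flow of the generator.\<close>

definition ambient_metric ::
  "('a, 'e::euclidean_space) mfd \<Rightarrow> 'a metric set \<Rightarrow> ('w, 'k::euclidean_space) mfd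
     \<Rightarrow> (real \<Rightarrow> 'w \<Rightarrow> 'w) \<Rightarrow> ('a bpt \<Rightarrow> 'w) \<Rightarrow> 'w metric \<Rightarrow> bool" where
  "ambient_metric (M :: ('a, 'e) mfd) C Mt \<delta> i h \<longleftrightarrow> metric_sig Mt (DIM('e) + 1) 1 h
     \<and> (\<forall>p\<in>points Mt. \<forall>v\<in>tangent_space Mt p. \<forall>w\<in>tangent_space Mt p.
          ((\<lambda>s. pullback Mt Mt (\<delta> s) h p v w) has_real_derivative 2 * h p v w) (at 1))
     \<and> (\<forall>u\<in>metric_bundle M C. \<forall>\<xi>\<in>tangent_space (bundle_mfd M C) u.
          \<forall>\<eta>\<in>tangent_space (bundle_mfd M C) u.
          h (i u) (push Mt i u \<xi>) (push Mt i u \<eta>) = snd u (push M fst u \<xi>) (push M fst u \<eta>))"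

definition FG_metric_all_orders ::
  "('a, 'e::euclidean_space) mfd \<Rightarrow> 'a metric set \<Rightarrow> ('w, 'k::euclidean_space) mfd
     \<Rightarrow> (real \<Rightarrow> 'w \<Rightarrow> 'w) \<Rightarrow> ('a bpt \<Rightarrow> 'w) \<Rightarrow> 'w metric \<Rightarrow> bool" where
  "FG_metric_all_orders M C Mt \<delta> i h \<longleftrightarrow> conformal_manifold M C
     \<and> ambient_manifold M C Mt \<delta> i \<and> ambient_metric M C Mt \<delta> i h
     \<and> ricci_flat_along Mt h (i ` metric_bundle M C)"

text \<open>Sections of the ambient tangent bundle along the bundle of metrics that are parallel along the
  fibres.\<close>

definition fibre_parallel ::
  "('a, 'e::euclidean_space) mfd \<Rightarrow> 'a metric set \<Rightarrow> ('w, 'k::euclidean_space) mfd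
     \<Rightarrow> ('a bpt \<Rightarrow> 'w) \<Rightarrow> 'w metric \<Rightarrow> ('a bpt \<Rightarrow> 'w tvec) \<Rightarrow> bool" where
  "fibre_parallel M C Mt i h U \<longleftrightarrow> smooth_along (bundle_mfd M C) Mt i U
     \<and> (\<forall>u\<in>metric_bundle M C. \<forall>c\<in>atlas Mt. i u \<in> fst c \<longrightarrow> (\<forall>k\<in>Basis.
          nabla_along Mt h i u (generator (bundle_mfd M C) bscale u) U c k = 0))"

text \<open>\<open>\<Phi>\<close> is the identification of sections of the standard tractor bundle with fibre-parallel
  sections. The conditions are, in this order: it takes values in such sections; it is onto and
  one-to-one; it is linear over the smooth functions on \<open>M\<close>; $\tau X$ corresponds to
  $\tau\tilde X$ for every density $\tau$ of weight $-1$; the tractor metric corresponds to \<open>h\<close>;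
  and the tractor connection corresponds to the Levi-Civita connection of \<open>h\<close>.\<close>

definition tractor_correspondence ::
  "('a, 'e::euclidean_space) mfd \<Rightarrow> 'a metric set \<Rightarrow> ('w, 'k::euclidean_space) mfd
     \<Rightarrow> (real \<Rightarrow> 'w \<Rightarrow> 'w) \<Rightarrow> ('a bpt \<Rightarrow> 'w) \<Rightarrow> 'w metric
     \<Rightarrow> ('a tractor \<Rightarrow> 'a bpt \<Rightarrow> 'w tvec) \<Rightarrow> bool" where
  "tractor_correspondence M C Mt \<delta> i h \<Phi> \<longleftrightarrow>
     (\<forall>I. tractor_section M C I \<longrightarrow> fibre_parallel M C Mt i h (\<Phi> I))
     \<and> (\<forall>U. fibre_parallel M C Mt i h U \<longrightarrow>
          (\<exists>I. tractor_section M C I \<and> (\<forall>u\<in>metric_bundle M C. \<Phi> I u = U u)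
             \<and> (\<forall>J. tractor_section M C J \<and> (\<forall>u\<in>metric_bundle M C. \<Phi> J u = U u)
                  \<longrightarrow> tractor_eq M C I J)))
     \<and> (\<forall>I J K f. tractor_section M C I \<and> tractor_section M C J \<and> tractor_section M C K
          \<and> fun_smooth M (points M) f
          \<and> tractor_eq M C K (\<lambda>g. Trac (\<lambda>x. tsig (I g) x + f x * tsig (J g) x)
                                       (\<lambda>x v. tmu (I g) x v + f x * tmu (J g) x v)
                                       (\<lambda>x. trho (I g) x + f x * trho (J g) x))
          \<longrightarrow> (\<forall>u\<in>metric_bundle M C. \<forall>q. \<Phi> K u q = \<Phi> I u q + f (fst u) * \<Phi> J u q))
     \<and> (\<forall>K \<tau>. tractor_section M C K \<and> density M C (-1) \<tau>
          \<and> tractor_eq M C K (\<lambda>g. Trac (\<lambda>x. \<tau> (x, g x) * tsig canonical_X x)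
                                       (\<lambda>x v. \<tau> (x, g x) * tmu canonical_X x v)
                                       (\<lambda>x. \<tau> (x, g x) * trho canonical_X x))
          \<longrightarrow> (\<forall>u\<in>metric_bundle M C. \<forall>q. \<Phi> K u q = \<tau> u * generator Mt \<delta> (i u) q))
     \<and> (\<forall>I J. tractor_section M C I \<and> tractor_section M C J
          \<longrightarrow> (\<forall>u\<in>metric_bundle M C. \<forall>g\<in>C.
                h (i u) (\<Phi> I u) (\<Phi> J u) = tractor_h M g (fst u) (I g) (J g)))
     \<and> (\<forall>I J V. tractor_section M C I \<and> tractor_section M C J \<and> vector_field M V
          \<and> is_tractor_nabla M C V I J
          \<longrightarrow> (\<forall>u\<in>metric_bundle M C. \<forall>\<xi>\<in>tangent_space (bundle_mfd M C) u.
                push M fst u \<xi> = V (fst u) \<longrightarrow>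
                (\<forall>c\<in>atlas Mt. i u \<in> fst c \<longrightarrow> (\<forall>k\<in>Basis.
                   nabla_along Mt h i u \<xi> (\<Phi> I) c k = \<Phi> J u (coordf c k)))))"

definition ambient_scale ::
  "('w, 'k::euclidean_space) mfd \<Rightarrow> (real \<Rightarrow> 'w \<Rightarrow> 'w) \<Rightarrow> 'w metric \<Rightarrow> 'w form1 \<Rightarrow> 'w \<Rightarrow> real" where
  "ambient_scale Mt \<delta> h It p = h p (generator Mt \<delta> p) (sharp Mt h p (It p))"

text \<open>\<open>It\<close> is a 1-form on the ambient manifold that is parallel to all orders, restricts along the
  bundle of metrics to the section corresponding to \<open>I\<close>, and is the differential of its scale.\<close>

definition ambient_parallel_extension ::
  "('a, 'e::euclidean_space) mfd \<Rightarrow> 'a metric set \<Rightarrow> ('w, 'k::euclidean_space) mfd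
     \<Rightarrow> (real \<Rightarrow> 'w \<Rightarrow> 'w) \<Rightarrow> ('a bpt \<Rightarrow> 'w) \<Rightarrow> 'w metric
     \<Rightarrow> ('a tractor \<Rightarrow> 'a bpt \<Rightarrow> 'w tvec) \<Rightarrow> 'a tractor \<Rightarrow> 'w form1 \<Rightarrow> bool" where
  "ambient_parallel_extension M C Mt \<delta> i h \<Phi> I It \<longleftrightarrow> smooth_form Mt It
     \<and> parallel_form_along Mt h It (i ` metric_bundle M C)
     \<and> (\<forall>u\<in>metric_bundle M C. sharp Mt h (i u) (It (i u)) = \<Phi> I u)
     \<and> (\<forall>p\<in>points Mt. \<forall>s>0. ambient_scale Mt \<delta> h It (\<delta> s p) = s * ambient_scale Mt \<delta> h It p)
     \<and> (\<forall>p\<in>points Mt. \<forall>v\<in>tangent_space Mt p. It p v = v (ambient_scale Mt \<delta> h It))"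

text \<open>For a submanifold \<open>N\<close> of \<open>M\<close>, restriction of forms to tangent vectors of \<open>N\<close> identifies the
  part of the bundle of metrics of \<open>M\<close> over \<open>N\<close> with the bundle of metrics of \<open>N\<close>. Through this
  identification, a map on the former yields a map on the latter.\<close>

definition bundle_restrict ::
  "('a, 'f::euclidean_space) mfd \<Rightarrow> ('a, 'e::euclidean_space) mfd \<Rightarrow> 'a bpt \<Rightarrow> 'a bpt" where
  "bundle_restrict N M u = (fst u, pull_form N M id (fst u) (snd u))"

definition induced_bundle_map ::
  "('a, 'f::euclidean_space) mfd \<Rightarrow> ('a, 'e::euclidean_space) mfd \<Rightarrow> 'a metric set
     \<Rightarrow> ('a bpt \<Rightarrow> 'w) \<Rightarrow> 'a bpt \<Rightarrow> 'w" where
  "induced_bundle_map N M C i u =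
     i (inv_into {u \<in> metric_bundle M C. fst u \<in> points N} (bundle_restrict N M) u)"

end

theory Submission
  imports Defs
begin

text \<open>Since \<open>It\<close> is parallel to all orders along the bundle of metrics and annihilates the tangent
  spaces of the zero set of \<open>\<sigma> = h(X, It)\<close>, the second fundamental form of this zero set vanishes to
  all orders there. By the Gauss equation the curvature of the induced metric then agrees to all
  orders with the restriction of the ambient curvature; the normal term in the difference of the two
  Ricci tensors is the contraction of the ambient curvature with \<open>It\<close>, which vanishes to all orders by the
  Ricci identity. The sign of \<open>h(I, I)\<close> makes the conormal spacelike, so the induced metric is again
  Lorentzian by Sylvester's law of inertia. Homogeneity of \<open>h\<close> passes to the zero set because the latter
  is invariant under the action, and a metric in the conformal class is determined at a point of
  \<open>\<Sigma>\<close> by its restriction to \<open>\<Sigma>\<close>, which embeds the bundle of metrics of \<open>\<Sigma>\<close>.\<close>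

section \<open>Smooth functions on open sets\<close>

text \<open>The hypotheses on \<open>It\<close> and on the ambient Ricci tensor are infinite-order
  statements along the bundle of metrics. Off the bundle nothing prevents the zero set of \<sigma>
  from being singular or its induced metric from degenerating, so everything is cut down to the open
  set \<open>W\<close> where the gradient of \<sigma> is spacelike. It contains the bundle because
  h(I, I) > 0 there, and it is invariant because the homothety and the degree 1 of \<sigma> cancel
  in the norm of the gradient. Pointwise vanishing of the second fundamental form would say nothing
  about derivatives of curvature. Therefore the expression of this form by the covariant derivative
  of \<open>It\<close>, the Gauss equation and the Ricci identity are proved as exact identities on
  open sets. Vanishing enters only afterwards, through the ideal of functions that are flat at a
  point, which is closed under derivatives and carried along by smooth pullback. Smoothness of maps
  into the hypersurface and on the bundle of metrics is tested on plots, which reduces most of it to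
  calculus on open sets.\<close>

lemma dpartial_eqI: "(f has_derivative f') (at x) \<Longrightarrow> dpartial v f x = f' v"
  unfolding dpartial_def by (metis frechet_derivative_at)

lemma has_derivative_dpartial:
  "f differentiable (at x) \<Longrightarrow> (f has_derivative (\<lambda>v. dpartial v f x)) (at x)"
  unfolding dpartial_def by (metis frechet_derivative_works)

lemma linear_dpartial: "f differentiable (at x) \<Longrightarrow> linear (\<lambda>v. dpartial v f x)"
  using has_derivative_dpartial has_derivative_linear by blast

text \<open>\<open>frechet_derivative\<close> is a choice that depends on the function only through
  the predicate \<open>has_derivative\<close>, so agreement near \<open>x\<close> gives equal values
  even where neither function is differentiable.\<close>

lemma dpartial_cong:
  assumes "open S" "x \<in> S" "\<And>y. y \<in> S \<Longrightarrow> f y = g y"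
  shows "dpartial v f x = dpartial v g x"
proof -
  have "(f has_derivative f') (at x) = (g has_derivative f') (at x)" for f'
    using has_derivative_transform_within_open[of f f' x UNIV S g]
      has_derivative_transform_within_open[of g f' x UNIV S f] assms by auto
  then show ?thesis unfolding dpartial_def frechet_derivative_def by simp
qed

lemma dpartial_Basis:
  fixes f :: "'e::euclidean_space \<Rightarrow> 'b::real_normed_vector"
  assumes "f differentiable (at x)"
  shows "dpartial v f x = (\<Sum>k\<in>Basis. (v \<bullet> k) *\<^sub>R dpartial k f x)"
proof -
  have "dpartial v f x = dpartial (\<Sum>k\<in>Basis. (v \<bullet> k) *\<^sub>R k) f x" by (simp add: euclidean_representation)
  also have "\<dots> = (\<Sum>k\<in>Basis. (v \<bullet> k) *\<^sub>R dpartial k f x)"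
    using linear_dpartial[OF assms] by (simp add: linear_sum[of "\<lambda>v. dpartial v f x"] linear_scale[of "\<lambda>v. dpartial v f x"])
  finally show ?thesis .
qed

text \<open>A finite-order version of \<open>smooth_on\<close>, set up so that closure properties
  follow by induction on the order with the function generalized. Order 0 already means
  differentiable, so \<open>kdiff n\<close> is differentiability of order n + 1.\<close>

fun kdiff :: "nat \<Rightarrow> 'e::euclidean_space set \<Rightarrow> ('e \<Rightarrow> 'b::real_normed_vector) \<Rightarrow> bool" where
  "kdiff 0 S f \<longleftrightarrow> f differentiable_on S"
| "kdiff (Suc n) S f \<longleftrightarrow> f differentiable_on S \<and> (\<forall>b\<in>Basis. kdiff n S (dpartial b f))"

lemma kdiff_iff:
  "kdiff n S f \<longleftrightarrow> (\<forall>bs. set bs \<subseteq> Basis \<and> length bs \<le> n \<longrightarrow> iter_partial bs f differentiable_on S)"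
proof (induction n arbitrary: f)
  case (Suc n)
  show ?case
  proof
    assume L: "kdiff (Suc n) S f"
    show "\<forall>bs. set bs \<subseteq> Basis \<and> length bs \<le> Suc n \<longrightarrow> iter_partial bs f differentiable_on S"
    proof (intro allI impI)
      fix bs :: "'a list" assume "set bs \<subseteq> Basis \<and> length bs \<le> Suc n"
      then show "iter_partial bs f differentiable_on S"
        using L Suc.IH by (cases bs) auto
    qed
  next
    assume R: "\<forall>bs. set bs \<subseteq> Basis \<and> length bs \<le> Suc n \<longrightarrow> iter_partial bs f differentiable_on S"
    have "kdiff n S (dpartial b f)" if "b \<in> Basis" for b
      unfolding Suc.IH using R[rule_format, of "b # _"] that by auto
    then show "kdiff (Suc n) S f" using R[rule_format, of "[]"] by auto
  qed
qed auto

lemma smooth_on_iff: "smooth_on S f \<longleftrightarrow> (\<forall>n. kdiff n S f)"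
  unfolding kdiff_iff smooth_on_def by blast

lemma kdiff_imp: "kdiff n S f \<Longrightarrow> f differentiable_on S"
  by (cases n) auto

lemma kdiff_Suc_imp: "kdiff (Suc n) S f \<Longrightarrow> kdiff n S f"
  by (induction n arbitrary: f) auto

lemma kdiff_at: "kdiff n S f \<Longrightarrow> open S \<Longrightarrow> x \<in> S \<Longrightarrow> f differentiable (at x)"
  using kdiff_imp differentiable_on_eq_differentiable_at by blast

lemma smooth_on_at: "smooth_on S f \<Longrightarrow> open S \<Longrightarrow> x \<in> S \<Longrightarrow> f differentiable (at x)"
  using kdiff_at smooth_on_iff by blast

lemma smooth_on_continuous: "smooth_on S f \<Longrightarrow> continuous_on S f"
  by (metis differentiable_imp_continuous_on kdiff_imp smooth_on_iff)

lemma differentiable_on_cong: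
  assumes "\<And>y. y \<in> S \<Longrightarrow> f y = g y" "f differentiable_on S"
  shows "g differentiable_on S"
  unfolding differentiable_on_def
proof
  fix x assume "x \<in> S"
  then show "g differentiable (at x within S)"
    using assms differentiable_transform_within[of f x S 1 g] unfolding differentiable_on_def by auto
qed

lemma kdiff_cong:
  assumes "open S" "\<And>y. y \<in> S \<Longrightarrow> f y = g y" "kdiff n S f"
  shows "kdiff n S g"
  using assms
proof (induction n arbitrary: f g)
  case 0 then show ?case using differentiable_on_cong[of S f g] by auto
next
  case (Suc n)
  have "g differentiable_on S"
    using Suc.prems differentiable_on_cong kdiff_imp by blast
  moreover have "kdiff n S (dpartial b g)" if "b \<in> Basis" for b
    using Suc.IH[of "dpartial b f" "dpartial b g"] Suc.prems that dpartial_cong[of S _ f g b] by auto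
  ultimately show ?case by simp
qed

lemma smooth_on_cong:
  "open S \<Longrightarrow> (\<And>y. y \<in> S \<Longrightarrow> f y = g y) \<Longrightarrow> smooth_on S f \<Longrightarrow> smooth_on S g"
  unfolding smooth_on_iff using kdiff_cong by blast

lemma smooth_on_subset: "smooth_on S f \<Longrightarrow> T \<subseteq> S \<Longrightarrow> smooth_on T f"
  unfolding smooth_on_def using differentiable_on_subset by blast

lemma smooth_on_local:
  assumes "\<And>x. x \<in> S \<Longrightarrow> \<exists>T. open T \<and> x \<in> T \<and> smooth_on T f"
  shows "smooth_on S f"
proof -
  have "iter_partial bs f differentiable at x within S" if x: "x \<in> S" and bs: "set bs \<subseteq> Basis" for x bs
  proof -
    obtain T where "open T" "x \<in> T" "smooth_on T f" using assms x by blast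
    then have "iter_partial bs f differentiable at x"
      using bs differentiable_on_eq_differentiable_at unfolding smooth_on_def by blast
    then show ?thesis by (rule differentiable_at_withinI)
  qed
  then show ?thesis unfolding smooth_on_def differentiable_on_def by blast
qed

lemma smooth_on_localI:
  assumes "\<And>x. x \<in> S \<Longrightarrow> \<exists>T g. open T \<and> x \<in> T \<and> smooth_on T g \<and> (\<forall>y\<in>T. f y = g y)"
  shows "smooth_on S f"
proof (rule smooth_on_local)
  fix x assume "x \<in> S"
  then obtain T g where "open T" "x \<in> T" "smooth_on T g" "\<forall>y\<in>T. f y = g y" using assms by metis
  then show "\<exists>T. open T \<and> x \<in> T \<and> smooth_on T f" using smooth_on_cong[of T g f] by auto
qed

section \<open>Smoothness of constants, sums, products, linear images and composites\<close>

lemma kdiff_const: "kdiff n S (\<lambda>_. c)"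
proof (induction n arbitrary: c)
  case (Suc n)
  have "dpartial b (\<lambda>_. c) = (\<lambda>_. 0)" for b :: 'a by (simp add: dpartial_def fun_eq_iff)
  then show ?case using Suc by simp
qed simp

lemma smooth_on_const [simp]: "smooth_on S (\<lambda>_. c)"
  unfolding smooth_on_iff using kdiff_const by blast

lemma dpartial_const [simp]: "dpartial b (\<lambda>_. c) x = 0"
  by (simp add: dpartial_def)

lemma dpartial_bounded_linear: "bounded_linear f \<Longrightarrow> dpartial v f x = f v"
  by (simp add: bounded_linear_imp_has_derivative dpartial_eqI)

lemma kdiff_bounded_linear: "bounded_linear f \<Longrightarrow> kdiff n S f"
proof (cases n)
  case (Suc m)
  assume f: "bounded_linear f"
  then have "dpartial b f = (\<lambda>_. f b)" for b using dpartial_bounded_linear by blast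
  then show ?thesis using f Suc by (simp add: bounded_linear_imp_differentiable_on kdiff_const)
qed (simp add: bounded_linear_imp_differentiable_on)

lemma smooth_on_bounded_linear: "bounded_linear f \<Longrightarrow> smooth_on S f"
  unfolding smooth_on_iff using kdiff_bounded_linear by blast

lemma smooth_on_ident [simp]: "smooth_on S (\<lambda>x. x)"
  by (rule smooth_on_bounded_linear) simp

lemma dpartial_add:
  "f differentiable (at x) \<Longrightarrow> g differentiable (at x) \<Longrightarrow>
    dpartial v (\<lambda>x. f x + g x) x = dpartial v f x + dpartial v g x"
  by (rule dpartial_eqI) (auto intro!: has_derivative_add has_derivative_dpartial)

lemma dpartial_diff:
  "f differentiable (at x) \<Longrightarrow> g differentiable (at x) \<Longrightarrow>
    dpartial v (\<lambda>x. f x - g x) x = dpartial v f x - dpartial v g x"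
  by (rule dpartial_eqI) (auto intro!: has_derivative_diff has_derivative_dpartial)

lemma dpartial_bilinear:
  assumes "bounded_bilinear p" "f differentiable (at x)" "g differentiable (at x)"
  shows "dpartial v (\<lambda>x. p (f x) (g x)) x = p (f x) (dpartial v g x) + p (dpartial v f x) (g x)"
  by (rule dpartial_eqI)
    (intro bounded_bilinear.FDERIV[OF assms(1)] has_derivative_dpartial[OF assms(2)] has_derivative_dpartial[OF assms(3)])

lemma dpartial_linear:
  assumes "bounded_linear p" "f differentiable (at x)"
  shows "dpartial v (\<lambda>x. p (f x)) x = p (dpartial v f x)"
  by (rule dpartial_eqI) (intro bounded_linear.has_derivative[OF assms(1)] has_derivative_dpartial[OF assms(2)])

lemmas dpartial_mult = dpartial_bilinear[OF bounded_bilinear_mult]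
lemmas dpartial_inner_right = dpartial_linear[OF bounded_linear_inner_left]

lemma kdiff_add:
  assumes "open S" "kdiff n S f" "kdiff n S g"
  shows "kdiff n S (\<lambda>x. f x + g x)"
  using assms
proof (induction n arbitrary: f g)
  case (Suc n)
  have "kdiff n S (dpartial b (\<lambda>x. f x + g x))" if "b \<in> Basis" for b
    by (rule kdiff_cong[OF Suc.prems(1) _ Suc.IH[of "dpartial b f" "dpartial b g"]])
      (use Suc.prems that in \<open>auto intro!: dpartial_add[symmetric] kdiff_at[of "Suc n" S]\<close>)
  then show ?case using Suc.prems by simp
qed simp

text \<open>By the product rule each partial derivative is a sum of two terms of the same bilinear
  shape, to which the induction hypothesis applies. Products, scalar multiples and inner products
  are all instances.\<close>

lemma kdiff_bilinear:
  assumes "open S" "bounded_bilinear p" "kdiff n S f" "kdiff n S g"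
  shows "kdiff n S (\<lambda>x. p (f x) (g x))"
  using assms(1,3,4)
proof (induction n arbitrary: f g)
  case 0
  have "(\<lambda>x. p (f x) (g x)) differentiable (at x)" if "x \<in> S" for x
    using bounded_bilinear.FDERIV[OF assms(2) has_derivative_dpartial has_derivative_dpartial]
      kdiff_at[OF 0(2) 0(1) that] kdiff_at[OF 0(3) 0(1) that] unfolding differentiable_def by blast
  then show ?case by (simp add: differentiable_at_imp_differentiable_on)
next
  case (Suc n)
  have "kdiff n S (dpartial b (\<lambda>x. p (f x) (g x)))" if "b \<in> Basis" for b
  proof (rule kdiff_cong[OF Suc.prems(1)])
    show "kdiff n S (\<lambda>x. p (f x) (dpartial b g x) + p (dpartial b f x) (g x))"
      using Suc.prems that by (intro kdiff_add Suc.IH) (auto intro: kdiff_Suc_imp)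
    show "p (f y) (dpartial b g y) + p (dpartial b f y) (g y) = dpartial b (\<lambda>x. p (f x) (g x)) y" if "y \<in> S" for y
      using dpartial_bilinear[OF assms(2)] kdiff_at[of "Suc n" S] Suc.prems that by metis
  qed
  then show ?case
    using kdiff_imp[OF Suc.IH[OF Suc.prems(1) Suc.prems(2)[THEN kdiff_Suc_imp] Suc.prems(3)[THEN kdiff_Suc_imp]]] by simp
qed

lemma kdiff_sum:
  assumes "open S" "\<And>k. k \<in> A \<Longrightarrow> kdiff n S (f k)"
  shows "kdiff n S (\<lambda>x. \<Sum>k\<in>A. f k x)"
  using assms(2)
proof (induction A rule: infinite_finite_induct)
  case (insert x F) then show ?case using kdiff_add[OF assms(1)] by auto
qed (simp_all add: kdiff_const)

lemma kdiff_linear: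
  assumes "open S" "bounded_linear p" "kdiff n S f"
  shows "kdiff n S (\<lambda>x. p (f x))"
  using assms(1,3)
proof (induction n arbitrary: f)
  case 0
  have "(\<lambda>x. p (f x)) differentiable (at x)" if "x \<in> S" for x
    using bounded_linear.has_derivative[OF assms(2) has_derivative_dpartial]
      kdiff_at[OF 0(2) 0(1) that] unfolding differentiable_def by blast
  then show ?case by (simp add: differentiable_at_imp_differentiable_on)
next
  case (Suc n)
  have "kdiff n S (dpartial b (\<lambda>x. p (f x)))" if b: "b \<in> Basis" for b
  proof (rule kdiff_cong[OF Suc.prems(1)])
    show "kdiff n S (\<lambda>x. p (dpartial b f x))" using Suc b by simp
    show "p (dpartial b f x) = dpartial b (\<lambda>x. p (f x)) x" if "x \<in> S" for x
      using dpartial_linear[OF assms(2) kdiff_at[OF Suc.prems(2,1) that]] by simp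
  qed
  then show ?case
    using kdiff_imp[OF Suc.IH[OF Suc.prems(1) Suc.prems(2)[THEN kdiff_Suc_imp]]] by simp
qed

lemma dpartial_compose:
  fixes g :: "'a::euclidean_space \<Rightarrow> 'b::euclidean_space"
  assumes "f differentiable (at (g x))" "g differentiable (at x)"
  shows "dpartial v (\<lambda>x. f (g x)) x = dpartial (dpartial v g x) f (g x)"
proof (rule dpartial_eqI)
  show "((\<lambda>x. f (g x)) has_derivative (\<lambda>v. dpartial (dpartial v g x) f (g x))) (at x)"
    using has_derivative_compose[OF has_derivative_dpartial[OF assms(2)] has_derivative_dpartial[OF assms(1)]] .
qed

text \<open>The chain rule turns a partial derivative of the composite into a sum over
  \<open>Basis\<close> of \<open>dpartial k f\<close> at \<open>g x\<close>, weighted by components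
  of derivatives of \<open>g\<close>. The induction therefore generalizes \<open>f\<close> and keeps
  \<open>g\<close> fixed.\<close>

lemma kdiff_compose:
  fixes g :: "'a::euclidean_space \<Rightarrow> 'b::euclidean_space"
  assumes "open S" "open T" "kdiff n T f" "kdiff n S g" "g ` S \<subseteq> T"
  shows "kdiff n S (\<lambda>x. f (g x))"
  using assms(3,4)
proof (induction n arbitrary: f)
  case 0
  have "f differentiable (at (g x))" "g differentiable (at x)" if "x \<in> S" for x
    using 0 that assms kdiff_at by blast+
  then have "(\<lambda>x. f (g x)) differentiable (at x)" if "x \<in> S" for x
    using that has_derivative_compose[OF has_derivative_dpartial has_derivative_dpartial]
    unfolding differentiable_def by blast
  then show ?case by (simp add: differentiable_at_imp_differentiable_on)
next
  case (Suc n)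
  have d: "f differentiable (at (g x))" "g differentiable (at x)" if "x \<in> S" for x
    using Suc.prems that assms kdiff_at by blast+
  have "kdiff n S (dpartial b (\<lambda>x. f (g x)))" if "b \<in> Basis" for b
  proof (rule kdiff_cong[OF assms(1)])
    have "kdiff n S (\<lambda>x. dpartial k f (g x))" if "k \<in> Basis" for k
      using Suc.IH[of "dpartial k f"] Suc.prems kdiff_Suc_imp[OF Suc.prems(2)] that by simp
    moreover have "kdiff n S (\<lambda>x. dpartial b g x \<bullet> k)" for k
      using Suc.prems \<open>b \<in> Basis\<close> by (intro kdiff_linear[OF assms(1) bounded_linear_inner_left]) auto
    ultimately show "kdiff n S (\<lambda>x. \<Sum>k\<in>Basis. (dpartial b g x \<bullet> k) *\<^sub>R dpartial k f (g x))"
      by (intro kdiff_sum assms kdiff_bilinear[OF _ bounded_bilinear_scaleR]) auto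
    show "(\<Sum>k\<in>Basis. (dpartial b g x \<bullet> k) *\<^sub>R dpartial k f (g x)) = dpartial b (\<lambda>x. f (g x)) x" if "x \<in> S" for x
      using dpartial_Basis[OF d(1)[OF that]] dpartial_compose[OF d[OF that]] by metis
  qed
  moreover have "(\<lambda>x. f (g x)) differentiable (at x)" if "x \<in> S" for x
    using d[OF that] has_derivative_compose[OF has_derivative_dpartial has_derivative_dpartial]
    unfolding differentiable_def by blast
  then have "(\<lambda>x. f (g x)) differentiable_on S" by (simp add: differentiable_at_imp_differentiable_on)
  ultimately show ?case by simp
qed

lemma smooth_on_compose:
  fixes g :: "'a::euclidean_space \<Rightarrow> 'b::euclidean_space"
  shows "open S \<Longrightarrow> open T \<Longrightarrow> smooth_on T f \<Longrightarrow> smooth_on S g \<Longrightarrow> g ` S \<subseteq> T \<Longrightarrow> smooth_on S (\<lambda>x. f (g x))"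
  unfolding smooth_on_iff using kdiff_compose[of S T _ f g] by simp

lemma smooth_on_add: "open S \<Longrightarrow> smooth_on S f \<Longrightarrow> smooth_on S g \<Longrightarrow> smooth_on S (\<lambda>x. f x + g x)"
  unfolding smooth_on_iff using kdiff_add[of S _ f g] by simp

lemma smooth_on_linear: "bounded_linear p \<Longrightarrow> open S \<Longrightarrow> smooth_on S f \<Longrightarrow> smooth_on S (\<lambda>x. p (f x))"
  unfolding smooth_on_iff using kdiff_linear[of S p _ f] by simp

lemma smooth_on_bilinear:
  "bounded_bilinear p \<Longrightarrow> open S \<Longrightarrow> smooth_on S f \<Longrightarrow> smooth_on S g \<Longrightarrow> smooth_on S (\<lambda>x. p (f x) (g x))"
  unfolding smooth_on_iff using kdiff_bilinear[of S p _ f g] by simp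

lemmas smooth_on_mult = smooth_on_bilinear[OF bounded_bilinear_mult]
lemmas smooth_on_scaleR = smooth_on_bilinear[OF bounded_bilinear_scaleR]
lemmas smooth_on_inner = smooth_on_bilinear[OF bounded_bilinear_inner]
lemmas smooth_on_uminus = smooth_on_linear[OF bounded_linear_minus[OF bounded_linear_ident]]

lemma smooth_on_diff:
  "open S \<Longrightarrow> smooth_on S f \<Longrightarrow> smooth_on S g \<Longrightarrow> smooth_on S (\<lambda>x. f x - g x)"
  using smooth_on_add[of S f "\<lambda>x. - g x"] smooth_on_uminus[of S g] by simp

lemma smooth_on_sum:
  "open S \<Longrightarrow> (\<And>k. k \<in> A \<Longrightarrow> smooth_on S (f k)) \<Longrightarrow> smooth_on S (\<lambda>x. \<Sum>k\<in>A. f k x)"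
  unfolding smooth_on_iff by (intro allI kdiff_sum) auto

lemma smooth_on_component:
  "open S \<Longrightarrow> smooth_on S f \<Longrightarrow> smooth_on S (\<lambda>x. f x \<bullet> k)"
  by (rule smooth_on_linear[OF bounded_linear_inner_left])

lemma smooth_on_Pair:
  fixes f :: "'e::euclidean_space \<Rightarrow> 'b::euclidean_space" and g :: "'e \<Rightarrow> 'c::euclidean_space"
  assumes "open S" "smooth_on S f" "smooth_on S g"
  shows "smooth_on S (\<lambda>x. (f x, g x))"
proof -
  have "bounded_linear (\<lambda>a. (a, 0::'c))" "bounded_linear (\<lambda>a. (0::'b, a))"
    by (intro bounded_linear_Pair bounded_linear_ident bounded_linear_zero)+
  from smooth_on_add[OF assms(1) smooth_on_linear[OF this(1) assms(1,2)] smooth_on_linear[OF this(2) assms(1,3)]]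
  have "smooth_on S (\<lambda>x. (f x, 0::'c) + (0::'b, g x))" .
  then show ?thesis by simp
qed

lemmas smooth_on_fst = smooth_on_linear[OF bounded_linear_fst]
lemmas smooth_on_snd = smooth_on_linear[OF bounded_linear_snd]

lemma smooth_on_dpartial:
  assumes "open S" "smooth_on S f"
  shows "smooth_on S (dpartial v f)"
proof -
  have "smooth_on S (dpartial k f)" if "k \<in> Basis" for k
    using assms(2) that unfolding smooth_on_iff by (metis kdiff.simps(2))
  then have "smooth_on S (\<lambda>x. \<Sum>k\<in>Basis. (v \<bullet> k) *\<^sub>R dpartial k f x)"
    using assms(1) by (intro smooth_on_sum smooth_on_scaleR) auto
  then show ?thesis
    by (rule smooth_on_cong[OF assms(1), rotated]) (metis assms dpartial_Basis smooth_on_at)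
qed

text \<open>The direction varies with the point, as it does when the differential of the inclusion
  is applied to a Christoffel vector.\<close>

lemma smooth_on_dpartial_fun:
  fixes f :: "'e::euclidean_space \<Rightarrow> 'b::real_normed_vector"
  assumes "open S" "smooth_on S f" "smooth_on S g"
  shows "smooth_on S (\<lambda>x. dpartial (g x) f x)"
proof (rule smooth_on_cong[OF assms(1)])
  show "smooth_on S (\<lambda>x. \<Sum>k\<in>Basis. (g x \<bullet> k) *\<^sub>R dpartial k f x)"
    by (rule smooth_on_sum[OF assms(1)], rule smooth_on_scaleR[OF assms(1)])
      (rule smooth_on_component[OF assms(1,3)], rule smooth_on_dpartial[OF assms(1,2)])
qed (metis assms(1,2) dpartial_Basis smooth_on_at)

lemma smooth_on_exp: "smooth_on S (exp :: real \<Rightarrow> real)"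
proof -
  have d: "dpartial b exp = (\<lambda>x::real. b * exp x)" for b
    using dpartial_eqI[OF DERIV_exp[unfolded has_field_derivative_def]] by (auto simp: mult.commute)
  have "kdiff n UNIV (exp :: real \<Rightarrow> real)" for n
  proof (induction n)
    case (Suc n)
    then show ?case using kdiff_imp[OF Suc] by (simp add: d)
  qed (simp add: differentiable_on_def field_differentiable_imp_differentiable field_differentiable_within_exp)
  then show ?thesis using smooth_on_subset[of UNIV exp S] unfolding smooth_on_iff by simp
qed

lemma smooth_on_exp_comp:
  fixes f :: "'e::euclidean_space \<Rightarrow> real"
  shows "open S \<Longrightarrow> smooth_on S f \<Longrightarrow> smooth_on S (\<lambda>x. exp (f x))"
  by (rule smooth_on_compose[OF _ open_UNIV smooth_on_exp]) auto

text \<open>The derivative of 1/f is -f' (1/f)^2, which contains 1/f itself, so smoothness is gained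
  one order at a time.\<close>

lemma kdiff_inverse:
  fixes f :: "'e::euclidean_space \<Rightarrow> real"
  assumes "open S" "kdiff n S f" "\<And>x. x \<in> S \<Longrightarrow> f x \<noteq> 0"
  shows "kdiff n S (\<lambda>x. inverse (f x))"
  using assms(2)
proof (induction n)
  case (Suc n)
  have k: "kdiff n S (\<lambda>x. inverse (f x))" by (rule Suc.IH[OF kdiff_Suc_imp[OF Suc.prems]])
  have "kdiff n S (dpartial b (\<lambda>x. inverse (f x)))" if "b \<in> Basis" for b
  proof (rule kdiff_cong[OF assms(1)])
    show "kdiff n S (\<lambda>x. (- 1 * dpartial b f x) * (inverse (f x) * inverse (f x)))"
      using Suc.prems that k by (intro kdiff_bilinear[OF assms(1) bounded_bilinear_mult] kdiff_const) auto
    show "(- 1 * dpartial b f x) * (inverse (f x) * inverse (f x)) = dpartial b (\<lambda>x. inverse (f x)) x" if "x \<in> S" for x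
    proof (rule dpartial_eqI[symmetric])
      show "((\<lambda>x. inverse (f x)) has_derivative (\<lambda>b. (- 1 * dpartial b f x) * (inverse (f x) * inverse (f x)))) (at x)"
        using Suc.prems assms that kdiff_at[OF Suc.prems]
        by (auto intro!: derivative_eq_intros has_derivative_dpartial)
    qed
  qed
  then show ?case using k kdiff_imp by auto
qed (use assms(3) differentiable_on_inverse in auto)

lemma smooth_on_inverse:
  fixes f :: "'e::euclidean_space \<Rightarrow> real"
  shows "open S \<Longrightarrow> smooth_on S f \<Longrightarrow> (\<And>x. x \<in> S \<Longrightarrow> f x \<noteq> 0) \<Longrightarrow> smooth_on S (\<lambda>x. inverse (f x))"
  unfolding smooth_on_iff by (intro allI kdiff_inverse) auto


section \<open>Symmetry of second derivatives\<close>

lemma dpartial_mvt: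
  fixes f :: "'e::euclidean_space \<Rightarrow> real"
  assumes "h > 0" "\<And>s. 0 \<le> s \<Longrightarrow> s \<le> h \<Longrightarrow> f differentiable (at (x + s *\<^sub>R a))"
  shows "\<exists>s. 0 < s \<and> s < h \<and> f (x + h *\<^sub>R a) - f x = h * dpartial a f (x + s *\<^sub>R a)"
proof -
  have d: "((\<lambda>s. f (x + s *\<^sub>R a)) has_real_derivative dpartial a f (x + s *\<^sub>R a)) (at s)" if "0 \<le> s" "s \<le> h" for s
  proof -
    have "((\<lambda>s. f (x + s *\<^sub>R a)) has_derivative (\<lambda>t. dpartial (t *\<^sub>R a) f (x + s *\<^sub>R a))) (at s)"
      by (rule has_derivative_compose[where f = "\<lambda>s. x + s *\<^sub>R a" and g = f, OF _ has_derivative_dpartial[OF assms(2)[OF that]]])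
        (auto intro!: derivative_eq_intros)
    then show ?thesis
      unfolding has_field_derivative_def
      using linear_scale[OF linear_dpartial[OF assms(2)[OF that]]] by (simp add: mult_commute_abs)
  qed
  show ?thesis using MVT2[OF assms(1) d] by auto
qed

text \<open>The mean value theorem, applied in direction \<open>a\<close> to the increment of
  \<open>f\<close> along \<open>h *\<^sub>R b\<close> and then in direction \<open>b\<close> to
  \<open>dpartial a f\<close>, evaluates the second difference as a mixed derivative near
  \<open>x\<close>; continuity of that derivative gives the bound.\<close>

lemma second_difference:
  fixes f :: "'e::euclidean_space \<Rightarrow> real"
  assumes S: "open S" "smooth_on S f" "x \<in> S" and e: "e > 0"
  shows "\<exists>d>0. \<forall>h. 0 < h \<and> h < d \<longrightarrow>
    \<bar>(f (x + h *\<^sub>R a + h *\<^sub>R b) - f (x + h *\<^sub>R a) - f (x + h *\<^sub>R b) + f x) - h\<^sup>2 * dpartial b (dpartial a f) x\<bar> \<le> e * h\<^sup>2"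
proof -
  have sm: "smooth_on S (dpartial a f)" "smooth_on S (dpartial b (dpartial a f))"
    using S by (auto intro: smooth_on_dpartial)
  obtain r where r: "r > 0" "ball x r \<subseteq> S" using S openE by blast
  have "continuous_on S (dpartial b (dpartial a f))" using sm smooth_on_continuous by blast
  then have "continuous (at x) (dpartial b (dpartial a f))" using S continuous_on_eq_continuous_at by blast
  then obtain r' where r': "r' > 0" "\<And>y. dist y x < r' \<Longrightarrow> \<bar>dpartial b (dpartial a f) y - dpartial b (dpartial a f) x\<bar> < e"
    using e unfolding continuous_at_eps_delta dist_real_def by blast
  \<comment> \<open>Scaled so that the parallelogram spanned by \<open>h *\<^sub>R a\<close> and
    \<open>h *\<^sub>R b\<close> stays within distance \<open>min r r'\<close> of \<open>x\<close>;
    the summand 1 keeps the denominator positive.\<close>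
  define d where "d = min r r' / (norm a + norm b + 1)"
  have pos: "norm a + norm b + 1 > 0" using norm_ge_zero[of a] norm_ge_zero[of b] by linarith
  have d0: "d > 0" using r r' pos by (simp add: d_def)
  show ?thesis
  proof (intro exI[of _ d] conjI allI impI d0)
    fix h assume h: "0 < h \<and> h < d"
    have near: "dist (x + s *\<^sub>R a + t *\<^sub>R b) x < min r r'" if "0 \<le> s" "s \<le> h" "0 \<le> t" "t \<le> h" for s t
    proof -
      have "dist (x + s *\<^sub>R a + t *\<^sub>R b) x = norm (s *\<^sub>R a + t *\<^sub>R b)" by (simp add: dist_norm add.assoc)
      also have "\<dots> \<le> s * norm a + t * norm b" using norm_triangle_ineq[of "s *\<^sub>R a" "t *\<^sub>R b"] that by simp
      also have "\<dots> \<le> h * norm a + h * norm b" using that by (intro add_mono mult_right_mono) auto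
      also have "\<dots> \<le> h * (norm a + norm b + 1)" using h by (simp add: algebra_simps)
      also have "\<dots> < d * (norm a + norm b + 1)" using h pos by (intro mult_strict_right_mono) auto
      also have "\<dots> = min r r'" using pos by (simp add: d_def)
      finally show ?thesis .
    qed
    have inS: "x + s *\<^sub>R a + t *\<^sub>R b \<in> S" if "0 \<le> s" "s \<le> h" "0 \<le> t" "t \<le> h" for s t
      using near[OF that] r(2) by (auto simp: dist_commute)
    have inS0: "x + s *\<^sub>R a \<in> S" if "0 \<le> s" "s \<le> h" for s using inS[OF that, of 0] h by simp
    have df: "f differentiable (at y)" if "y \<in> S" for y using that S smooth_on_at by blast
    have sh: "(\<lambda>y. f (y + h *\<^sub>R b)) differentiable (at (x + s *\<^sub>R a))"
      "dpartial a (\<lambda>y. f (y + h *\<^sub>R b)) (x + s *\<^sub>R a) = dpartial a f (x + s *\<^sub>R a + h *\<^sub>R b)" if "0 \<le> s" "s \<le> h" for s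
    proof -
      have "((\<lambda>y. f (y + h *\<^sub>R b)) has_derivative (\<lambda>v. dpartial v f (x + s *\<^sub>R a + h *\<^sub>R b))) (at (x + s *\<^sub>R a))"
        using inS[OF that, of h] h
        by (intro has_derivative_compose[where f = "\<lambda>y. y + h *\<^sub>R b" and g = f, OF _ has_derivative_dpartial[OF df]]) (auto intro!: derivative_eq_intros)
      then show "(\<lambda>y. f (y + h *\<^sub>R b)) differentiable (at (x + s *\<^sub>R a))"
        "dpartial a (\<lambda>y. f (y + h *\<^sub>R b)) (x + s *\<^sub>R a) = dpartial a f (x + s *\<^sub>R a + h *\<^sub>R b)"
        by (auto simp: differentiable_def dpartial_eqI)
    qed
    let ?D = "\<lambda>y. f (y + h *\<^sub>R b) - f y"
    have "\<exists>s. 0 < s \<and> s < h \<and> ?D (x + h *\<^sub>R a) - ?D x = h * dpartial a ?D (x + s *\<^sub>R a)"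
      using h sh(1) df inS0 by (intro dpartial_mvt) (auto intro!: derivative_intros)
    then obtain s where s: "0 < s" "s < h" "?D (x + h *\<^sub>R a) - ?D x = h * dpartial a ?D (x + s *\<^sub>R a)" by blast
    have "dpartial a ?D (x + s *\<^sub>R a) = dpartial a f (x + s *\<^sub>R a + h *\<^sub>R b) - dpartial a f (x + s *\<^sub>R a)"
      using s sh[of s] df[OF inS0, of s] by (simp add: dpartial_diff)
    moreover have "\<exists>t. 0 < t \<and> t < h \<and> dpartial a f (x + s *\<^sub>R a + h *\<^sub>R b) - dpartial a f (x + s *\<^sub>R a)
        = h * dpartial b (dpartial a f) (x + s *\<^sub>R a + t *\<^sub>R b)"
      using h s inS[of s] sm(1) S(1) smooth_on_at by (intro dpartial_mvt) auto
    ultimately obtain t where t: "0 < t" "t < h"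
      "?D (x + h *\<^sub>R a) - ?D x = h * (h * dpartial b (dpartial a f) (x + s *\<^sub>R a + t *\<^sub>R b))" using s(3) by auto
    have "\<bar>dpartial b (dpartial a f) (x + s *\<^sub>R a + t *\<^sub>R b) - dpartial b (dpartial a f) x\<bar> < e"
      using near[of s t] s t by (intro r') auto
    then have "h\<^sup>2 * \<bar>dpartial b (dpartial a f) (x + s *\<^sub>R a + t *\<^sub>R b) - dpartial b (dpartial a f) x\<bar> \<le> e * h\<^sup>2"
      by (subst mult.commute) (intro mult_right_mono, auto)
    moreover have "(f (x + h *\<^sub>R a + h *\<^sub>R b) - f (x + h *\<^sub>R a) - f (x + h *\<^sub>R b) + f x) - h\<^sup>2 * dpartial b (dpartial a f) x
      = h\<^sup>2 * (dpartial b (dpartial a f) (x + s *\<^sub>R a + t *\<^sub>R b) - dpartial b (dpartial a f) x)"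
      using t(3) by (simp add: algebra_simps power2_eq_square)
    ultimately show "\<bar>(f (x + h *\<^sub>R a + h *\<^sub>R b) - f (x + h *\<^sub>R a) - f (x + h *\<^sub>R b) + f x) - h\<^sup>2 * dpartial b (dpartial a f) x\<bar> \<le> e * h\<^sup>2"
      by (simp add: abs_mult)
  qed
qed

text \<open>The second difference is symmetric in \<open>a\<close> and \<open>b\<close>, so both
  mixed derivatives are limits of the same quotient.\<close>

lemma dpartial_commute_real:
  fixes f :: "'e::euclidean_space \<Rightarrow> real"
  assumes "open S" "smooth_on S f" "x \<in> S"
  shows "dpartial a (dpartial b f) x = dpartial b (dpartial a f) x"
proof (rule ccontr)
  assume ne: "dpartial a (dpartial b f) x \<noteq> dpartial b (dpartial a f) x"
  \<comment> \<open>A third of the gap: two errors of at most \<open>e * h\<^sup>2\<close> cannot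
    fill a distance of \<open>3 * (e * h\<^sup>2)\<close>.\<close>
  define e where "e = \<bar>dpartial a (dpartial b f) x - dpartial b (dpartial a f) x\<bar> / 3"
  have e: "e > 0" using ne by (simp add: e_def)
  obtain d1 where d1: "d1 > 0" "\<And>h. 0 < h \<and> h < d1 \<Longrightarrow>
    \<bar>(f (x + h *\<^sub>R a + h *\<^sub>R b) - f (x + h *\<^sub>R a) - f (x + h *\<^sub>R b) + f x) - h\<^sup>2 * dpartial b (dpartial a f) x\<bar> \<le> e * h\<^sup>2"
    using second_difference[OF assms e] by blast
  obtain d2 where d2: "d2 > 0" "\<And>h. 0 < h \<and> h < d2 \<Longrightarrow>
    \<bar>(f (x + h *\<^sub>R b + h *\<^sub>R a) - f (x + h *\<^sub>R b) - f (x + h *\<^sub>R a) + f x) - h\<^sup>2 * dpartial a (dpartial b f) x\<bar> \<le> e * h\<^sup>2"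
    using second_difference[OF assms e, of b a] by blast
  define h where "h = min d1 d2 / 2"
  have h: "0 < h" "h < d1" "h < d2" using d1 d2 by (auto simp: h_def)
  have "\<bar>h\<^sup>2 * dpartial a (dpartial b f) x - h\<^sup>2 * dpartial b (dpartial a f) x\<bar> \<le> 2 * (e * h\<^sup>2)"
    using d1(2)[of h] d2(2)[of h] h by (simp add: add.commute add.left_commute)
  moreover have "\<bar>h\<^sup>2 * dpartial a (dpartial b f) x - h\<^sup>2 * dpartial b (dpartial a f) x\<bar> = 3 * (e * h\<^sup>2)"
    unfolding right_diff_distrib[symmetric] abs_mult e_def by simp
  ultimately have "e * h\<^sup>2 \<le> 0" by linarith
  moreover have "e * h\<^sup>2 > 0" using e h by simp
  ultimately show False by linarith
qed

lemma dpartial_commute: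
  fixes f :: "'e::euclidean_space \<Rightarrow> 'b::euclidean_space"
  assumes S: "open S" "smooth_on S f" "x \<in> S"
  shows "dpartial a (dpartial b f) x = dpartial b (dpartial a f) x"
proof (rule euclidean_eqI)
  fix k :: 'b
  have i: "dpartial u (dpartial v f) x \<bullet> k = dpartial u (dpartial v (\<lambda>y. f y \<bullet> k)) x" for u v
  proof -
    have "dpartial u (\<lambda>y. dpartial v f y \<bullet> k) x = dpartial u (dpartial v f) x \<bullet> k"
      by (rule dpartial_inner_right[OF smooth_on_at]) (use S smooth_on_dpartial in auto)
    moreover have "dpartial u (\<lambda>y. dpartial v f y \<bullet> k) x = dpartial u (dpartial v (\<lambda>y. f y \<bullet> k)) x"
      by (rule dpartial_cong[OF S(1,3)]) (use S smooth_on_at dpartial_inner_right in metis)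
    ultimately show ?thesis by simp
  qed
  show "dpartial a (dpartial b f) x \<bullet> k = dpartial b (dpartial a f) x \<bullet> k"
    unfolding i by (rule dpartial_commute_real[OF S(1) smooth_on_component[OF S(1,2)] S(3)])
qed

section \<open>Functions vanishing to all orders\<close>

text \<open>Vanishing of the n-jet at \<open>x\<close>, arranged as a recursion on the order for the
  same reason as \<open>kdiff\<close>.\<close>

fun vanish :: "nat \<Rightarrow> ('e::euclidean_space \<Rightarrow> real) \<Rightarrow> 'e \<Rightarrow> bool" where
  "vanish 0 f x \<longleftrightarrow> f x = 0"
| "vanish (Suc n) f x \<longleftrightarrow> f x = 0 \<and> (\<forall>b\<in>Basis. vanish n (dpartial b f) x)"

lemma vanish_iff:
  "vanish n f x \<longleftrightarrow> (\<forall>bs. set bs \<subseteq> Basis \<and> length bs \<le> n \<longrightarrow> iter_partial bs f x = 0)"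
proof (induction n arbitrary: f)
  case (Suc n)
  show ?case
  proof
    assume L: "vanish (Suc n) f x"
    show "\<forall>bs. set bs \<subseteq> Basis \<and> length bs \<le> Suc n \<longrightarrow> iter_partial bs f x = 0"
    proof (intro allI impI)
      fix bs :: "'a list" assume "set bs \<subseteq> Basis \<and> length bs \<le> Suc n"
      then show "iter_partial bs f x = 0" using L Suc.IH by (cases bs) auto
    qed
  next
    assume R: "\<forall>bs. set bs \<subseteq> Basis \<and> length bs \<le> Suc n \<longrightarrow> iter_partial bs f x = 0"
    have "vanish n (dpartial b f) x" if "b \<in> Basis" for b
      unfolding Suc.IH using R[rule_format, of "b # _"] that by auto
    then show "vanish (Suc n) f x" using R[rule_format, of "[]"] by auto
  qed
qed auto

lemma vanishes_iff: "vanishes_all_orders f x \<longleftrightarrow> (\<forall>n. vanish n f x)"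
  unfolding vanish_iff vanishes_all_orders_def by blast

lemma vanish_cong:
  assumes "open S" "x \<in> S" "\<And>y. y \<in> S \<Longrightarrow> f y = g y" "vanish n f x"
  shows "vanish n g x"
  using assms(3,4)
proof (induction n arbitrary: f g)
  case (Suc n)
  have "vanish n (dpartial b g) x" if b: "b \<in> Basis" for b
  proof (rule Suc.IH)
    show "vanish n (dpartial b f) x" using Suc.prems(2) b by simp
    show "\<And>y. y \<in> S \<Longrightarrow> dpartial b f y = dpartial b g y" using dpartial_cong[OF assms(1)] Suc.prems(1) by blast
  qed
  moreover have "g x = 0" using Suc.prems(1)[OF assms(2)] Suc.prems(2) by simp
  ultimately show ?case by simp
next
  case 0
  then show ?case using 0(1)[OF assms(2)] by simp
qed

lemma vanish_Suc_imp: "vanish (Suc n) f x \<Longrightarrow> vanish n f x"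
  by (induction n arbitrary: f) auto

text \<open>Smoothness around \<open>x\<close> is part of the notion because the sum and product
  rules need differentiable functions. Flat functions form an ideal in the smooth functions on
  \<open>S\<close> that is closed under derivatives; the later vanishing statements are memberships
  in it.\<close>

definition flat_on :: "'e::euclidean_space set \<Rightarrow> 'e \<Rightarrow> ('e \<Rightarrow> real) \<Rightarrow> bool" where
  "flat_on S x f \<longleftrightarrow> smooth_on S f \<and> vanishes_all_orders f x"

lemma vanishes_cong:
  "open S \<Longrightarrow> x \<in> S \<Longrightarrow> (\<And>y. y \<in> S \<Longrightarrow> f y = g y) \<Longrightarrow> vanishes_all_orders f x \<Longrightarrow> vanishes_all_orders g x"
  unfolding vanishes_iff using vanish_cong[of S x f g] by blast

lemma flat_on_cong:
  "open S \<Longrightarrow> x \<in> S \<Longrightarrow> (\<And>y. y \<in> S \<Longrightarrow> f y = g y) \<Longrightarrow> flat_on S x f \<Longrightarrow> flat_on S x g"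
  unfolding flat_on_def using smooth_on_cong[of S f g] vanishes_cong[of S x f g] by blast

lemma flat_on_0: "flat_on S x (\<lambda>_. 0)"
proof -
  have "vanish n (\<lambda>_. 0) x" for n
  proof (induction n)
    case (Suc n)
    have "dpartial b (\<lambda>_. 0::real) = (\<lambda>_. 0)" for b :: 'a by (simp add: fun_eq_iff)
    then show ?case using Suc by simp
  qed simp
  then show ?thesis by (simp add: flat_on_def vanishes_iff)
qed

lemma vanish_add:
  assumes S: "open S" "x \<in> S"
  shows "smooth_on S f \<Longrightarrow> smooth_on S g \<Longrightarrow> vanish n f x \<Longrightarrow> vanish n g x \<Longrightarrow> vanish n (\<lambda>y. f y + g y) x"
proof (induction n arbitrary: f g)
  case (Suc n)
  have "vanish n (dpartial b (\<lambda>y. f y + g y)) x" if "b \<in> Basis" for b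
  proof (rule vanish_cong[OF S])
    show "vanish n (\<lambda>y. dpartial b f y + dpartial b g y) x"
      using Suc.prems that S by (intro Suc.IH smooth_on_dpartial) auto
    show "dpartial b f y + dpartial b g y = dpartial b (\<lambda>y. f y + g y) y" if "y \<in> S" for y
      using dpartial_add[OF smooth_on_at[OF Suc.prems(1) S(1) that] smooth_on_at[OF Suc.prems(2) S(1) that]] by simp
  qed
  then show ?case using Suc.prems by simp
qed simp

lemma flat_on_add: "open S \<Longrightarrow> x \<in> S \<Longrightarrow> flat_on S x f \<Longrightarrow> flat_on S x g \<Longrightarrow> flat_on S x (\<lambda>y. f y + g y)"
  unfolding flat_on_def vanishes_iff using vanish_add[of S x f g] smooth_on_add[of S f g] by blast

lemma flat_on_sum:
  assumes "open S" "x \<in> S" "\<And>k. k \<in> A \<Longrightarrow> flat_on S x (f k)"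
  shows "flat_on S x (\<lambda>y. \<Sum>k\<in>A. f k y)"
  using assms(3)
proof (induction A rule: infinite_finite_induct)
  case (insert a F) then show ?case using flat_on_add[OF assms(1,2)] by auto
qed (simp_all add: flat_on_0)

text \<open>In the Leibniz rule the undifferentiated \<open>f\<close> vanishes to the lower order by
  \<open>vanish_Suc_imp\<close>, and its derivative does so by definition; the other factor
  contributes smooth coefficients.\<close>

lemma vanish_mult:
  assumes S: "open S" "x \<in> S"
  shows "smooth_on S f \<Longrightarrow> smooth_on S g \<Longrightarrow> vanish n f x \<Longrightarrow> vanish n (\<lambda>y. f y * g y) x"
proof (induction n arbitrary: f g)
  case (Suc n)
  have "vanish n (dpartial b (\<lambda>y. f y * g y)) x" if b: "b \<in> Basis" for b
  proof (rule vanish_cong[OF S])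
    have sm: "smooth_on S (dpartial b f)" "smooth_on S (dpartial b g)"
      using Suc.prems S by (auto intro: smooth_on_dpartial)
    show "vanish n (\<lambda>y. f y * dpartial b g y + dpartial b f y * g y) x"
    proof (rule vanish_add[OF S])
      show "vanish n (\<lambda>y. f y * dpartial b g y) x" "vanish n (\<lambda>y. dpartial b f y * g y) x"
        using Suc.prems b sm by (auto intro!: Suc.IH simp del: vanish.simps(2) dest: vanish_Suc_imp) (auto)
    qed (use Suc.prems S sm in \<open>auto intro!: smooth_on_mult\<close>)
    show "f y * dpartial b g y + dpartial b f y * g y = dpartial b (\<lambda>y. f y * g y) y" if "y \<in> S" for y
      using dpartial_mult[OF smooth_on_at[OF Suc.prems(1) S(1) that] smooth_on_at[OF Suc.prems(2) S(1) that]] by simp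
  qed
  then show ?case using Suc.prems by simp
qed simp

lemma flat_on_mult: "open S \<Longrightarrow> x \<in> S \<Longrightarrow> flat_on S x f \<Longrightarrow> smooth_on S g \<Longrightarrow> flat_on S x (\<lambda>y. f y * g y)"
  unfolding flat_on_def vanishes_iff using vanish_mult[of S x f g] smooth_on_mult[of S f g] by blast

lemma flat_on_mult2: "open S \<Longrightarrow> x \<in> S \<Longrightarrow> smooth_on S g \<Longrightarrow> flat_on S x f \<Longrightarrow> flat_on S x (\<lambda>y. g y * f y)"
  using flat_on_mult[of S x f g] by (simp add: mult.commute)

lemma flat_on_diff:
  assumes "open S" "x \<in> S" "flat_on S x f" "flat_on S x g"
  shows "flat_on S x (\<lambda>y. f y - g y)"
  using flat_on_add[OF assms(1-3) flat_on_mult[OF assms(1,2,4) smooth_on_const[of _ "-1"]]] by simp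

lemma flat_on_dpartial:
  assumes S: "open S" "x \<in> S" and f: "flat_on S x f"
  shows "flat_on S x (dpartial v f)"
proof (rule flat_on_cong[OF S])
  have "flat_on S x (dpartial k f)" if "k \<in> Basis" for k
    using f that S smooth_on_dpartial[of S f] unfolding flat_on_def vanishes_iff by (metis vanish.simps(2))
  then show "flat_on S x (\<lambda>y. \<Sum>k\<in>Basis. (v \<bullet> k) * dpartial k f y)"
    using S by (intro flat_on_sum flat_on_mult2) auto
  show "(\<Sum>k\<in>Basis. (v \<bullet> k) * dpartial k f y) = dpartial v f y" if "y \<in> S" for y
    using dpartial_Basis[of f y v] smooth_on_at[of S f y] f S that by (simp add: flat_on_def)
qed

text \<open>The chain rule writes derivatives of the composite as derivatives of \<open>f\<close>
  along \<open>g\<close> with smooth coefficients, so no order is lost. With \<open>g\<close> the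
  inclusion in coordinates, this carries ambient flatness to the hypersurface.\<close>

lemma vanish_compose:
  fixes g :: "'a::euclidean_space \<Rightarrow> 'b::euclidean_space"
  assumes S: "open S" "x \<in> S" and T: "open T" "g ` S \<subseteq> T" and g: "smooth_on S g"
  shows "smooth_on T f \<Longrightarrow> vanish n f (g x) \<Longrightarrow> vanish n (\<lambda>y. f (g y)) x"
proof (induction n arbitrary: f)
  case (Suc n)
  have gT: "g y \<in> T" if "y \<in> S" for y using that T by blast
  have "vanish n (dpartial b (\<lambda>y. f (g y))) x" if "b \<in> Basis" for b
  proof (rule vanish_cong[OF S])
    have sm: "smooth_on S (\<lambda>y. dpartial k f (g y))" "smooth_on S (\<lambda>y. dpartial b g y \<bullet> k)" for k
      using S T g Suc.prems by (auto intro!: smooth_on_compose[of S T] smooth_on_dpartial smooth_on_component)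
    \<comment> \<open>\<open>vanish_add\<close> asks for smooth summands, so the induction over
      subsets of \<open>Basis\<close> carries smoothness along.\<close>
    have "vanish n (\<lambda>y. \<Sum>k\<in>K. dpartial k f (g y) * (dpartial b g y \<bullet> k)) x \<and>
      smooth_on S (\<lambda>y. \<Sum>k\<in>K. dpartial k f (g y) * (dpartial b g y \<bullet> k))" if "K \<subseteq> Basis" "finite K" for K
      using that(2,1)
    proof (induction K rule: finite_induct)
      case empty
      then show ?case using flat_on_0[of S x] by (simp add: flat_on_def vanishes_iff)
    next
      case (insert k K)
      have "vanish n (\<lambda>y. dpartial k f (g y) * (dpartial b g y \<bullet> k)) x"
        using insert Suc.prems T by (intro vanish_mult[OF S] sm Suc.IH smooth_on_dpartial) auto
      then show ?case using insert sm S by (auto intro!: vanish_add[OF S] smooth_on_add smooth_on_mult)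
    qed
    then show "vanish n (\<lambda>y. \<Sum>k\<in>Basis. dpartial k f (g y) * (dpartial b g y \<bullet> k)) x" by auto
    show "(\<Sum>k\<in>Basis. dpartial k f (g y) * (dpartial b g y \<bullet> k)) = dpartial b (\<lambda>y. f (g y)) y" if y: "y \<in> S" for y
    proof -
      have "f differentiable (at (g y))" "g differentiable (at y)"
        using Suc.prems(1) T gT[OF y] g S y smooth_on_at by blast+
      then show ?thesis using dpartial_Basis[of f "g y" "dpartial b g y"] dpartial_compose[of f g y b] by (simp add: mult.commute)
    qed
  qed
  then show ?case using Suc.prems by simp
qed simp

lemma flat_on_compose:
  fixes g :: "'a::euclidean_space \<Rightarrow> 'b::euclidean_space"
  assumes "open S" "x \<in> S" "open T" "g ` S \<subseteq> T" "smooth_on S g" "flat_on T (g x) f"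
  shows "flat_on S x (\<lambda>y. f (g y))"
  using assms vanish_compose[OF assms(1-5), of f] smooth_on_compose[OF assms(1,3) _ assms(5,4), of f]
  unfolding flat_on_def vanishes_iff by blast

section \<open>Inverses of nondegenerate bilinear forms\<close>

definition nondegenerate :: "('e::euclidean_space \<Rightarrow> 'e \<Rightarrow> real) \<Rightarrow> bool" where
  "nondegenerate B \<longleftrightarrow> bilinear B \<and> (\<forall>v. (\<forall>w. B v w = 0) \<longrightarrow> v = 0)"

text \<open>The vector that represents the covector with coordinates \<open>j\<close>, that is, the
  inverse matrix of \<open>B\<close> applied to \<open>j\<close>. Treating it as the solution of an
  equation avoids determinants and cofactors.\<close>

definition bsolve :: "('e::euclidean_space \<Rightarrow> 'e \<Rightarrow> real) \<Rightarrow> 'e \<Rightarrow> 'e" where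
  "bsolve B j = (THE v. \<forall>w. B v w = j \<bullet> w)"

lemma ginv_bsolve: "ginv B i j = bsolve B j \<bullet> i"
  by (simp add: ginv_def bsolve_def)

lemma bilinear_sum_right:
  fixes B :: "'e::euclidean_space \<Rightarrow> 'f::euclidean_space \<Rightarrow> real"
  assumes "bilinear B" shows "B v w = (\<Sum>k\<in>Basis. B v k * (w \<bullet> k))"
proof -
  have l: "linear (B v)" using assms by (simp add: bilinear_def)
  have "B v w = B v (\<Sum>k\<in>Basis. (w \<bullet> k) *\<^sub>R k)" by (simp add: euclidean_representation)
  also have "\<dots> = (\<Sum>k\<in>Basis. B v k * (w \<bullet> k))"
    by (simp add: linear_sum[OF l] linear_scale[OF l] mult.commute)
  finally show ?thesis .
qed

lemma bilinear_swap: "bilinear B \<Longrightarrow> bilinear (\<lambda>v w. B w v)"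
  by (simp add: bilinear_def)

lemma bilinear_sum_both:
  fixes B :: "'e::euclidean_space \<Rightarrow> 'f::euclidean_space \<Rightarrow> real"
  assumes "bilinear B" shows "B v w = (\<Sum>k\<in>Basis. \<Sum>l\<in>Basis. B k l * (v \<bullet> k) * (w \<bullet> l))"
proof -
  have "B v w = (\<Sum>k\<in>Basis. B k w * (v \<bullet> k))" using bilinear_sum_right[OF bilinear_swap[OF assms]] .
  also have "\<dots> = (\<Sum>k\<in>Basis. \<Sum>l\<in>Basis. B k l * (v \<bullet> k) * (w \<bullet> l))"
    by (subst bilinear_sum_right[OF assms]) (simp add: sum_distrib_right sum_distrib_left mult_ac)
  finally show ?thesis .
qed

text \<open>The matrix of \<open>B\<close> is a linear map \<open>A\<close> that is injective by
  nondegeneracy, hence onto because the dimension is finite.\<close>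

lemma bsolve_unique_ex:
  assumes "nondegenerate B" shows "\<exists>!v. \<forall>w. B v w = j \<bullet> w"
proof -
  have b: "bilinear B" and nd: "\<And>v. (\<forall>w. B v w = 0) \<Longrightarrow> v = 0" using assms by (auto simp: nondegenerate_def)
  define A where "A v = (\<Sum>k\<in>Basis. B v k *\<^sub>R k)" for v
  have lA: "linear A" unfolding A_def
    by (rule linearI) (auto simp: bilinear_ladd[OF b] bilinear_lmul[OF b] scaleR_add_left sum.distrib scaleR_sum_right)
  have Aw: "A v \<bullet> w = B v w" for v w
  proof -
    have "A v \<bullet> w = (\<Sum>k\<in>Basis. B v k * (k \<bullet> w))" by (simp add: A_def inner_sum_left)
    also have "\<dots> = (\<Sum>k\<in>Basis. B v k * (w \<bullet> k))" by (simp add: inner_commute)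
    finally show ?thesis using bilinear_sum_right[OF b, of v w] by simp
  qed
  have "v = 0" if "A v = 0" for v
    using nd[of v] Aw[of v, symmetric] that by simp
  then have "inj A" using lA linear_injective_0 by blast
  then have "surj A" using lA linear_injective_imp_surjective by blast
  then obtain v where "A v = j" by (metis surjD)
  then have v: "\<forall>w. B v w = j \<bullet> w" using Aw[of v] by simp
  moreover have "v' = v" if v': "\<forall>w. B v' w = j \<bullet> w" for v'
  proof -
    have "v' - v = 0" using v v' by (intro nd) (simp add: bilinear_lsub[OF b])
    then show ?thesis by simp
  qed
  ultimately show ?thesis by blast
qed

lemma bsolve: "nondegenerate B \<Longrightarrow> B (bsolve B j) w = j \<bullet> w"
  using theI'[OF bsolve_unique_ex[of B j]] by (simp add: bsolve_def)

lemma bsolve_eqI: "nondegenerate B \<Longrightarrow> (\<And>w. B v w = j \<bullet> w) \<Longrightarrow> bsolve B j = v"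
  using bsolve_unique_ex[of B j] bsolve[of B j] by blast

text \<open>Index raising for a linear functional: both sides represent the covector
  \<open>?j\<close> built from the values of \<open>a\<close> on \<open>Basis\<close>.\<close>

lemma bsolve_form:
  assumes "nondegenerate B" "linear (a :: 'e::euclidean_space \<Rightarrow> real)" "\<And>w. B v w = a w"
  shows "v = (\<Sum>k\<in>Basis. a k *\<^sub>R bsolve B k)"
proof -
  have b: "bilinear B" using assms by (simp add: nondegenerate_def)
  have l: "linear (\<lambda>v. B v w)" for w using b by (simp add: bilinear_def)
  let ?j = "\<Sum>k\<in>Basis. a k *\<^sub>R k"
  have aw: "a w = (\<Sum>k\<in>Basis. a k * (k \<bullet> w))" for w
  proof -
    have "a w = a (\<Sum>k\<in>Basis. (w \<bullet> k) *\<^sub>R k)" by (simp add: euclidean_representation)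
    then show ?thesis by (simp add: linear_sum[OF assms(2)] linear_scale[OF assms(2)] inner_commute mult.commute)
  qed
  have "B v w = ?j \<bullet> w" for w
    unfolding inner_sum_left inner_scaleR_left by (rule trans[OF assms(3) aw])
  then have "bsolve B ?j = v" by (rule bsolve_eqI[OF assms(1)])
  moreover have "bsolve B ?j = (\<Sum>k\<in>Basis. a k *\<^sub>R bsolve B k)"
    using bsolve[OF assms(1)] by (intro bsolve_eqI[OF assms(1)]) (simp add: linear_sum[OF l] linear_scale[OF l] inner_sum_left)
  ultimately show ?thesis by simp
qed

text \<open>This is the formula d(B^-1) = - B^-1 dB B^-1. The inverse is not known to be continuous
  beforehand, so an exact identity for its increment takes the place of differentiating B B^-1 =
  1.\<close>

lemma bsolve_family_differentiable:
  fixes B :: "'a::euclidean_space \<Rightarrow> 'e::euclidean_space \<Rightarrow> 'e \<Rightarrow> real"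
  assumes S: "open S" "x \<in> S" and nd: "\<And>y. y \<in> S \<Longrightarrow> nondegenerate (B y)"
    and d: "\<And>k l. k \<in> Basis \<Longrightarrow> l \<in> Basis \<Longrightarrow> (\<lambda>y. B y k l) differentiable (at x)"
  shows "((\<lambda>y. bsolve (B y) j) has_derivative
    (\<lambda>v. - (\<Sum>k\<in>Basis. \<Sum>l\<in>Basis. ((bsolve (B x) j \<bullet> k) * dpartial v (\<lambda>y. B y k l) x) *\<^sub>R bsolve (B x) l))) (at x)"
proof -
  let ?v = "\<lambda>y. bsolve (B y) j" and ?s = "bsolve (B x)"
  define dd where "dd k l y = B y k l - B x k l" for k l y
  \<comment> \<open>Exact, not merely of first order: compare the two defining equations and solve
    with the inverse at \<open>x\<close>. The unknown \<open>?v y\<close> still occurs on the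
    right.\<close>
  have eq: "?v y = ?v x - (\<Sum>k\<in>Basis. \<Sum>l\<in>Basis. ((?v y \<bullet> k) * dd k l y) *\<^sub>R ?s l)" if y: "y \<in> S" for y
  proof -
    have b: "bilinear (B x)" "bilinear (B y)" using nd y S by (auto simp: nondegenerate_def)
    have lin: "linear (\<lambda>w. B x (?v y) w - B y (?v y) w)"
      using b unfolding bilinear_def by (intro linear_compose_sub) auto
    have "?v y - ?v x = (\<Sum>l\<in>Basis. (B x (?v y) l - B y (?v y) l) *\<^sub>R ?s l)"
      using bsolve[OF nd[OF y]] bsolve[OF nd[OF S(2)]]
      by (intro bsolve_form[OF nd[OF S(2)] lin]) (simp add: bilinear_lsub[OF b(1)])
    also have "\<dots> = (\<Sum>l\<in>Basis. (\<Sum>k\<in>Basis. - ((?v y \<bullet> k) * dd k l y)) *\<^sub>R ?s l)"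
    proof (intro sum.cong refl arg_cong2[where f = scaleR])
      fix l :: 'e
      show "B x (?v y) l - B y (?v y) l = (\<Sum>k\<in>Basis. - ((?v y \<bullet> k) * dd k l y))"
        using bilinear_sum_right[OF bilinear_swap[OF b(1)], where v = l and w = "?v y"]
          bilinear_sum_right[OF bilinear_swap[OF b(2)], where v = l and w = "?v y"]
        by (simp add: dd_def sum_subtractf sum_negf algebra_simps)
    qed
    also have "\<dots> = - (\<Sum>k\<in>Basis. \<Sum>l\<in>Basis. ((?v y \<bullet> k) * dd k l y) *\<^sub>R ?s l)"
      unfolding scaleR_sum_left by (subst sum.swap) (simp add: sum_negf)
    finally show ?thesis by (simp add: algebra_simps)
  qed
  have ddc: "dd k l \<midarrow>x\<rightarrow> 0" if "k \<in> Basis" "l \<in> Basis" for k l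
  proof -
    have "isCont (\<lambda>y. B y k l) x" using d[OF that] differentiable_imp_continuous_within by blast
    then have "(\<lambda>y. B y k l - B x k l) \<midarrow>x\<rightarrow> B x k l - B x k l" unfolding isCont_def by (intro tendsto_intros)
    then show ?thesis by (simp add: dd_def[abs_def])
  qed
  define eta where "eta y = (\<Sum>k\<in>Basis. \<Sum>l\<in>Basis. \<bar>dd k l y\<bar> * norm (?s l))" for y
  have eta0: "eta \<midarrow>x\<rightarrow> 0"
  proof -
    have "eta \<midarrow>x\<rightarrow> (\<Sum>k\<in>(Basis::'e set). \<Sum>l\<in>(Basis::'e set). \<bar>0\<bar> * norm (?s l))"
      unfolding eta_def by (intro tendsto_intros ddc)
    then show ?thesis by simp
  qed
  have bound: "norm (?v y - ?v x) \<le> eta y * norm (?v y)" if "y \<in> S" for y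
  proof -
    have "?v y - ?v x = - (\<Sum>k\<in>Basis. \<Sum>l\<in>Basis. ((?v y \<bullet> k) * dd k l y) *\<^sub>R ?s l)"
      by (subst eq[OF that]) simp
    then have "norm (?v y - ?v x) = norm (\<Sum>k\<in>Basis. \<Sum>l\<in>Basis. ((?v y \<bullet> k) * dd k l y) *\<^sub>R ?s l)"
      by (simp only: norm_minus_cancel)
    also have "\<dots> \<le> (\<Sum>k\<in>Basis. \<Sum>l\<in>Basis. norm (((?v y \<bullet> k) * dd k l y) *\<^sub>R ?s l))"
      by (rule order_trans[OF norm_sum]) (intro sum_mono norm_sum)
    also have "\<dots> \<le> (\<Sum>k\<in>Basis. \<Sum>l\<in>Basis. (\<bar>dd k l y\<bar> * norm (?s l)) * norm (?v y))"
    proof (intro sum_mono)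
      fix k l :: 'e assume "k \<in> Basis"
      then have "\<bar>?v y \<bullet> k\<bar> \<le> norm (?v y)" using Basis_le_norm by blast
      then have "\<bar>?v y \<bullet> k\<bar> * (\<bar>dd k l y\<bar> * norm (?s l)) \<le> norm (?v y) * (\<bar>dd k l y\<bar> * norm (?s l))"
        by (intro mult_right_mono) auto
      then show "norm (((?v y \<bullet> k) * dd k l y) *\<^sub>R ?s l) \<le> (\<bar>dd k l y\<bar> * norm (?s l)) * norm (?v y)"
        by (simp add: abs_mult mult_ac)
    qed
    finally show ?thesis by (simp add: eta_def sum_distrib_right)
  qed
  have evS: "eventually (\<lambda>y. y \<in> S) (at x)" using S eventually_at_topological by blast
  \<comment> \<open>Once \<open>eta\<close> is below 1/2, the term with \<open>norm (?v y)\<close>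
    can be absorbed; this bounds the solution near \<open>x\<close>, and then \<open>bound\<close>
    forces convergence.\<close>
  have cont: "?v \<midarrow>x\<rightarrow> ?v x"
  proof -
    have "eventually (\<lambda>y. \<bar>eta y\<bar> < 1/2) (at x)" using tendstoD[OF eta0, of "1/2"] by (simp add: dist_real_def)
    then have "eventually (\<lambda>y. norm (?v y - ?v x) \<le> \<bar>eta y\<bar> * (2 * norm (?v x))) (at x)"
      using evS
    proof eventually_elim
      case (elim y)
      have "norm (?v y) \<le> norm (?v x) + norm (?v y - ?v x)" by (rule norm_triangle_sub)
      also have "\<dots> \<le> norm (?v x) + \<bar>eta y\<bar> * norm (?v y)"
        using bound[OF elim(2)] mult_right_mono[OF abs_ge_self[of "eta y"] norm_ge_zero[of "?v y"]] by linarith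
      also have "\<dots> \<le> norm (?v x) + 1/2 * norm (?v y)" using elim by (intro add_left_mono mult_right_mono) auto
      finally have "norm (?v y) \<le> 2 * norm (?v x)" by simp
      then have "\<bar>eta y\<bar> * norm (?v y) \<le> \<bar>eta y\<bar> * (2 * norm (?v x))" by (intro mult_left_mono) auto
      then show ?case using bound[OF elim(2)] mult_right_mono[OF abs_ge_self[of "eta y"] norm_ge_zero[of "?v y"]] by linarith
    qed
    moreover have "(\<lambda>y. \<bar>eta y\<bar> * (2 * norm (?v x))) \<midarrow>x\<rightarrow> 0"
      using tendsto_mult_left_zero[OF tendsto_rabs_zero[OF eta0]] by simp
    ultimately have "(\<lambda>y. ?v y - ?v x) \<midarrow>x\<rightarrow> 0" by (rule Lim_null_comparison)
    then show ?thesis by (rule LIM_zero_cancel)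
  qed
  \<comment> \<open>\<open>dd k l\<close> vanishes at \<open>x\<close>, so a factor that is merely
    continuous there does not spoil differentiability of the product.\<close>
  have prod: "((\<lambda>y. (?v y \<bullet> k) * dd k l y) has_derivative (\<lambda>v. (?v x \<bullet> k) * dpartial v (\<lambda>y. B y k l) x)) (at x)"
    if kl: "k \<in> Basis" "l \<in> Basis" for k l
  proof -
    let ?D = "\<lambda>v. dpartial v (\<lambda>y. B y k l) x"
    have D: "((\<lambda>y. B y k l) has_derivative ?D) (at x)" using has_derivative_dpartial[OF d[OF kl]] .
    obtain K where K: "K > 0" "\<And>v. norm (?D v) \<le> norm v * K"
      using bounded_linear.pos_bounded[OF has_derivative_bounded_linear[OF D]] by blast
    have r: "(\<lambda>y. (dd k l y - ?D (y - x)) /\<^sub>R norm (y - x)) \<midarrow>x\<rightarrow> 0"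
      using D unfolding has_derivative_def dd_def by simp
    have c: "(\<lambda>y. ?v y \<bullet> k) \<midarrow>x\<rightarrow> ?v x \<bullet> k" using cont by (intro tendsto_intros)
    have 1: "(\<lambda>y. (?v y \<bullet> k) * ((dd k l y - ?D (y - x)) /\<^sub>R norm (y - x))) \<midarrow>x\<rightarrow> 0"
      using tendsto_mult[OF c r] by simp
    have 2: "(\<lambda>y. (?v y \<bullet> k - ?v x \<bullet> k) * (?D (y - x) /\<^sub>R norm (y - x))) \<midarrow>x\<rightarrow> 0"
    proof (rule Lim_null_comparison)
      show "eventually (\<lambda>y. norm ((?v y \<bullet> k - ?v x \<bullet> k) * (?D (y - x) /\<^sub>R norm (y - x))) \<le> \<bar>?v y \<bullet> k - ?v x \<bullet> k\<bar> * K) (at x)"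
        unfolding eventually_at_topological
      proof (intro exI[of _ UNIV] conjI ballI impI)
        fix y assume "y \<noteq> x"
        then have "norm (?D (y - x)) / norm (y - x) \<le> K" using K(2)[of "y - x"] by (simp add: divide_simps mult.commute)
        then have "\<bar>?v y \<bullet> k - ?v x \<bullet> k\<bar> * (norm (?D (y - x)) / norm (y - x)) \<le> \<bar>?v y \<bullet> k - ?v x \<bullet> k\<bar> * K"
          by (intro mult_left_mono) auto
        then show "norm ((?v y \<bullet> k - ?v x \<bullet> k) * (?D (y - x) /\<^sub>R norm (y - x))) \<le> \<bar>?v y \<bullet> k - ?v x \<bullet> k\<bar> * K"
          by (simp add: abs_mult divide_inverse mult_ac)
      qed auto
      show "(\<lambda>y. \<bar>?v y \<bullet> k - ?v x \<bullet> k\<bar> * K) \<midarrow>x\<rightarrow> 0"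
        using tendsto_mult_left_zero[OF tendsto_rabs_zero[OF LIM_zero[OF c]]] .
    qed
    have "(\<lambda>y. ((?v y \<bullet> k) * dd k l y - (?v x \<bullet> k) * dd k l x - (?v x \<bullet> k) * ?D (y - x)) /\<^sub>R norm (y - x)) \<midarrow>x\<rightarrow> 0"
      using tendsto_add[OF 1 2] by (simp add: dd_def algebra_simps)
    then show ?thesis unfolding has_derivative_def
      using bounded_linear_const_mult[OF has_derivative_bounded_linear[OF D]] by (simp add: dd_def)
  qed
  have "((\<lambda>y. ?v x - (\<Sum>k\<in>Basis. \<Sum>l\<in>Basis. ((?v y \<bullet> k) * dd k l y) *\<^sub>R ?s l)) has_derivative
    (\<lambda>v. 0 - (\<Sum>k\<in>Basis. \<Sum>l\<in>Basis. ((?v x \<bullet> k) * dpartial v (\<lambda>y. B y k l) x) *\<^sub>R ?s l))) (at x)"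
    by (intro has_derivative_diff has_derivative_const has_derivative_sum has_derivative_scaleR_left prod)
  from has_derivative_transform_within_open[OF this S, of ?v] show ?thesis using eq by simp
qed

text \<open>The derivative formula is polynomial in the solutions and in the derivatives of
  \<open>B\<close>, so each order of smoothness gives the next.\<close>

lemma smooth_on_bsolve:
  fixes B :: "'a::euclidean_space \<Rightarrow> 'e::euclidean_space \<Rightarrow> 'e \<Rightarrow> real"
  assumes S: "open S" and nd: "\<And>y. y \<in> S \<Longrightarrow> nondegenerate (B y)"
    and sm: "\<And>k l. k \<in> Basis \<Longrightarrow> l \<in> Basis \<Longrightarrow> smooth_on S (\<lambda>y. B y k l)"
  shows "smooth_on S (\<lambda>y. bsolve (B y) j)"
proof -
  note D = bsolve_family_differentiable[where B = B, OF S _ nd smooth_on_at[OF sm S]]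
  \<comment> \<open>All \<open>j\<close> at once: the derivative of the solution for
    \<open>j\<close> contains the solutions for every basis vector.\<close>
  have "\<forall>j. kdiff n S (\<lambda>y. bsolve (B y) j)" for n
  proof (induction n)
    case 0
    show ?case using D by (auto intro!: differentiable_at_imp_differentiable_on intro: differentiableI)
  next
    case (Suc n)
    have "kdiff n S (dpartial b (\<lambda>y. bsolve (B y) j))" if b: "b \<in> Basis" for b j
    proof (rule kdiff_cong[OF S])
      have "kdiff n S (dpartial b (\<lambda>y. B y k l))" if "k \<in> Basis" "l \<in> Basis" for k l
        using sm[OF that] b unfolding smooth_on_iff by (metis kdiff.simps(2))
      then show "kdiff n S (\<lambda>y. - 1 *\<^sub>R (\<Sum>k\<in>Basis. \<Sum>l\<in>Basis. ((bsolve (B y) j \<bullet> k) * dpartial b (\<lambda>y. B y k l) y) *\<^sub>R bsolve (B y) l))"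
        using S Suc by (intro kdiff_bilinear[OF _ bounded_bilinear_scaleR] kdiff_sum kdiff_bilinear[OF _ bounded_bilinear_mult]
            kdiff_linear[OF _ bounded_linear_inner_left] kdiff_const) auto
      show "- 1 *\<^sub>R (\<Sum>k\<in>Basis. \<Sum>l\<in>Basis. ((bsolve (B y) j \<bullet> k) * dpartial b (\<lambda>y. B y k l) y) *\<^sub>R bsolve (B y) l)
        = dpartial b (\<lambda>y. bsolve (B y) j) y" if "y \<in> S" for y
        using dpartial_eqI[OF D[OF that]] that by simp
    qed
    moreover have "(\<lambda>y. bsolve (B y) j) differentiable_on S" for j
      by (rule kdiff_imp[OF Suc[rule_format]])
    ultimately show ?case by simp
  qed
  then show ?thesis unfolding smooth_on_iff by blast
qed


section \<open>Lifting along immersions and the implicit function theorem\<close>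

text \<open>A continuous lift of a differentiable map through an immersion is differentiable: the
  left inverse \<open>L\<close> of \<open>P'\<close> solves for the increment of \<phi>, and the
  remainder of \<open>P\<close> is small compared with that same increment.\<close>

lemma has_derivative_lift:
  fixes P :: "'b::real_normed_vector \<Rightarrow> 'c::real_normed_vector" and \<phi> :: "'a::real_normed_vector \<Rightarrow> 'b"
  assumes P: "(P has_derivative P') (at (\<phi> y0))" and L: "bounded_linear L" and LP: "\<And>v. L (P' v) = v"
    and c: "isCont \<phi> y0" and U: "open U" "y0 \<in> U" and eq: "\<And>y. y \<in> U \<Longrightarrow> P (\<phi> y) = Q y"
    and Q: "(Q has_derivative Q') (at y0)"
  shows "(\<phi> has_derivative (\<lambda>v. L (Q' v))) (at y0)"
proof -
  obtain K where K: "K > 0" "\<And>v. norm (L v) \<le> norm v * K" using bounded_linear.pos_bounded[OF L] by blast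
  obtain q where q: "q > 0" "\<And>v. norm (Q' v) \<le> norm v * q"
    using bounded_linear.pos_bounded[OF has_derivative_bounded_linear[OF Q]] by blast
  have linL: "linear L" using L bounded_linear.linear by blast
  have small: "\<exists>d>0. \<forall>y. norm (y - y0) < d \<longrightarrow> y \<in> U \<and> norm (Q y - Q y0 - Q' (y - y0)) \<le> e * norm (y - y0)
      \<and> norm (P (\<phi> y) - P (\<phi> y0) - P' (\<phi> y - \<phi> y0)) \<le> e * norm (\<phi> y - \<phi> y0)" if e: "e > 0" for e
  proof -
    obtain d1 where d1: "d1 > 0" "\<And>y. norm (y - y0) < d1 \<Longrightarrow> norm (Q y - Q y0 - Q' (y - y0)) \<le> e * norm (y - y0)"
      using Q e unfolding has_derivative_at_alt by blast
    obtain d2 where d2: "d2 > 0" "\<And>z. norm (z - \<phi> y0) < d2 \<Longrightarrow> norm (P z - P (\<phi> y0) - P' (z - \<phi> y0)) \<le> e * norm (z - \<phi> y0)"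
      using P e unfolding has_derivative_at_alt by blast
    obtain d3 where d3: "d3 > 0" "\<And>y. dist y y0 < d3 \<Longrightarrow> dist (\<phi> y) (\<phi> y0) < d2"
      using c d2(1) unfolding continuous_at_eps_delta by blast
    obtain d4 where d4: "d4 > 0" "ball y0 d4 \<subseteq> U" using U openE by blast
    show ?thesis
      using d1 d2 d3 d4 by (intro exI[of _ "Min {d1, d3, d4}"]) (auto simp: dist_norm norm_minus_commute subset_iff)
  qed
  have rep: "\<phi> y - \<phi> y0 = L (Q y - Q y0) - L (P (\<phi> y) - P (\<phi> y0) - P' (\<phi> y - \<phi> y0))" if "y \<in> U" for y
    using eq[OF that] eq[OF U(2)] LP by (simp add: linear_diff[OF linL])
  show ?thesis unfolding has_derivative_at_alt
  proof (intro conjI allI impI)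
    show "bounded_linear (\<lambda>v. L (Q' v))"
      using bounded_linear_compose[OF L has_derivative_bounded_linear[OF Q]] .
    fix e :: real assume e: "e > 0"
    \<comment> \<open>A Lipschitz constant for \<phi> at \<open>y0\<close>. The factor 2 comes from
      absorbing half of the increment, which \<open>K * \<epsilon> \<le> 1/2\<close>
      permits.\<close>
    define C where "C = 2 * K * (q + 1)"
    have C: "C > 0" using K q by (simp add: C_def)
    \<comment> \<open>Three demands: the bound 1 keeps the Lipschitz estimate of \<open>Q\<close> at
      \<open>q + 1\<close>, the bound \<open>1 / (2 * K)\<close> allows the absorption, and the last
      bound produces the final \<open>e\<close>.\<close>
    define \<epsilon> where "\<epsilon> = min (min 1 (1 / (2 * K))) (e / (K * (1 + C)))"
    have \<epsilon>: "\<epsilon> > 0" "\<epsilon> \<le> 1" "K * \<epsilon> \<le> 1/2" "K * \<epsilon> * (1 + C) \<le> e"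
    proof -
      show "\<epsilon> > 0" "\<epsilon> \<le> 1" using e K C by (auto simp: \<epsilon>_def)
      have "\<epsilon> \<le> 1 / (2 * K)" by (simp add: \<epsilon>_def)
      then show "K * \<epsilon> \<le> 1/2" using K by (simp add: field_simps)
      have "\<epsilon> \<le> e / (K * (1 + C))" by (simp add: \<epsilon>_def)
      then show "K * \<epsilon> * (1 + C) \<le> e" using K C by (simp add: pos_le_divide_eq mult_ac)
    qed
    obtain d where d: "d > 0" "\<And>y. norm (y - y0) < d \<Longrightarrow> y \<in> U \<and> norm (Q y - Q y0 - Q' (y - y0)) \<le> \<epsilon> * norm (y - y0)
      \<and> norm (P (\<phi> y) - P (\<phi> y0) - P' (\<phi> y - \<phi> y0)) \<le> \<epsilon> * norm (\<phi> y - \<phi> y0)"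
      using small[OF \<epsilon>(1)] by blast
    show "\<exists>d>0. \<forall>y. norm (y - y0) < d \<longrightarrow> norm (\<phi> y - \<phi> y0 - L (Q' (y - y0))) \<le> e * norm (y - y0)"
    proof (intro exI[of _ d] conjI allI impI d(1))
      fix y assume y: "norm (y - y0) < d"
      let ?n = "norm (y - y0)" and ?m = "norm (\<phi> y - \<phi> y0)" and ?r = "P (\<phi> y) - P (\<phi> y0) - P' (\<phi> y - \<phi> y0)"
      have yU: "y \<in> U" and 1: "norm (Q y - Q y0 - Q' (y - y0)) \<le> \<epsilon> * ?n" and 2: "norm ?r \<le> \<epsilon> * ?m"
        using d(2)[OF y] by auto
      have Lr: "norm (L ?r) \<le> K * \<epsilon> * ?m"
        using order_trans[OF K(2)[of ?r] mult_right_mono[OF 2, of K]] K by (simp add: mult_ac)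
      have "norm (Q y - Q y0) \<le> norm (Q' (y - y0)) + norm (Q y - Q y0 - Q' (y - y0))" by (rule norm_triangle_sub)
      also have "\<dots> \<le> ?n * q + 1 * ?n" using q(2)[of "y - y0"] 1 \<epsilon>(2) mult_right_mono[OF \<epsilon>(2) norm_ge_zero[of "y - y0"]] by linarith
      finally have "norm (Q y - Q y0) \<le> (q + 1) * ?n" by (simp add: algebra_simps)
      from order_trans[OF K(2) mult_right_mono[OF this, of K]]
      have LQ: "norm (L (Q y - Q y0)) \<le> K * (q + 1) * ?n" using K(1) by (simp add: mult_ac)
      have "?m \<le> norm (L (Q y - Q y0)) + norm (L ?r)" using rep[OF yU] norm_triangle_ineq4 by metis
      also have "\<dots> \<le> K * (q + 1) * ?n + 1/2 * ?m"
        using LQ Lr mult_right_mono[OF \<epsilon>(3) norm_ge_zero[of "\<phi> y - \<phi> y0"]] by linarith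
      finally have m: "?m \<le> C * ?n" by (simp add: C_def algebra_simps)
      have "\<phi> y - \<phi> y0 - L (Q' (y - y0)) = L (Q y - Q y0 - Q' (y - y0)) - L ?r"
        using rep[OF yU] by (simp add: linear_diff[OF linL])
      then have "norm (\<phi> y - \<phi> y0 - L (Q' (y - y0))) \<le> norm (L (Q y - Q y0 - Q' (y - y0))) + norm (L ?r)"
        using norm_triangle_ineq4 by metis
      also have "\<dots> \<le> K * \<epsilon> * ?n + K * \<epsilon> * (C * ?n)"
      proof (rule add_mono)
        show "norm (L (Q y - Q y0 - Q' (y - y0))) \<le> K * \<epsilon> * ?n"
          using order_trans[OF K(2) mult_right_mono[OF 1, of K]] K by (simp add: mult_ac)
        show "norm (L ?r) \<le> K * \<epsilon> * (C * ?n)"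
          using order_trans[OF Lr mult_left_mono[OF m]] K(1) \<epsilon>(1) by simp
      qed
      also have "\<dots> = K * \<epsilon> * (1 + C) * ?n" by (simp add: algebra_simps)
      also have "\<dots> \<le> e * ?n" using \<epsilon>(4) by (intro mult_right_mono) auto
      finally show "norm (\<phi> y - \<phi> y0 - L (Q' (y - y0))) \<le> e * ?n" .
    qed
  qed
qed

lemma bilinear_gram:
  assumes "linear f" shows "bilinear (\<lambda>v w. f v \<bullet> f w)"
  unfolding bilinear_def using assms
  by (auto intro!: linearI simp: linear_add linear_scale inner_add_left inner_add_right)

text \<open>The derivative of the lift is the pseudo-inverse of the derivative of \<open>P\<close> applied to the
  derivative of \<open>P \<circ> \<phi>\<close>; this formula bootstraps continuity to smoothness.\<close>

lemma smooth_on_lift: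
  fixes P :: "'b::euclidean_space \<Rightarrow> 'c::euclidean_space" and \<phi> :: "'a::euclidean_space \<Rightarrow> 'b"
  assumes T: "open T" and P: "smooth_on T P" and inj: "\<And>z v. z \<in> T \<Longrightarrow> dpartial v P z = 0 \<Longrightarrow> v = 0"
    and S: "open S" and c: "continuous_on S \<phi>" and \<phi>: "\<phi> ` S \<subseteq> T" and Q: "smooth_on S (\<lambda>y. P (\<phi> y))"
  shows "smooth_on S \<phi>"
proof -
  let ?Q = "\<lambda>y. P (\<phi> y)"
  \<comment> \<open>The Gram form of the derivative. Injectivity makes it definite, so
    \<open>bsolve\<close> inverts it, and \<open>L\<close> below is (A^T A)^-1 A^T for the
    derivative A of \<open>P\<close>.\<close>
  define B where "B z v w = dpartial v P z \<bullet> dpartial w P z" for z v w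
  have lin: "linear (\<lambda>v. dpartial v P z)" if "z \<in> T" for z using P T that smooth_on_at linear_dpartial by blast
  have nd: "nondegenerate (B z)" if "z \<in> T" for z
    unfolding nondegenerate_def B_def using bilinear_gram[OF lin[OF that]] inj[OF that] by (metis inner_eq_zero_iff)
  define L where "L z w = (\<Sum>k\<in>Basis. (w \<bullet> dpartial k P z) *\<^sub>R bsolve (B z) k)" for z w
  have L: "bounded_linear (L z)" for z unfolding L_def
    by (intro bounded_linear_sum bounded_linear_scaleR_const bounded_linear_inner_left)
  have LP: "L z (dpartial v P z) = v" if z: "z \<in> T" for z v
  proof -
    have l: "linear (\<lambda>k. dpartial v P z \<bullet> dpartial k P z)"
      by (rule linearI) (simp_all add: linear_add[OF lin[OF z]] linear_scale[OF lin[OF z]] inner_add_right)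
    show ?thesis unfolding L_def using bsolve_form[OF nd[OF z] l, of v] by (simp add: B_def)
  qed
  have D: "(\<phi> has_derivative (\<lambda>v. L (\<phi> y) (dpartial v ?Q y))) (at y)" if y: "y \<in> S" for y
  proof (rule has_derivative_lift[OF _ L LP _ S y])
    have z: "\<phi> y \<in> T" using y \<phi> by blast
    show "(P has_derivative (\<lambda>v. dpartial v P (\<phi> y))) (at (\<phi> y))"
      using P T z smooth_on_at has_derivative_dpartial by blast
    show "\<phi> y \<in> T" by (rule z)
    show "isCont \<phi> y" using c S y continuous_on_eq_continuous_at by blast
    show "(?Q has_derivative (\<lambda>v. dpartial v ?Q y)) (at y)"
      using Q S y smooth_on_at has_derivative_dpartial by blast
  qed simp
  have smB: "smooth_on T (\<lambda>z. bsolve (B z) k)" for k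
    by (rule smooth_on_bsolve[OF T nd]) (auto simp: B_def intro!: smooth_on_inner T smooth_on_dpartial P)
  have "kdiff n S \<phi>" for n
  proof (induction n)
    case 0
    then show ?case using D by (auto intro!: differentiable_at_imp_differentiable_on intro: differentiableI)
  next
    case (Suc n)
    have "kdiff n S (dpartial b \<phi>)" if b: "b \<in> Basis" for b
    proof (rule kdiff_cong[OF S])
      have 1: "kdiff n S (dpartial b ?Q)" using Q b unfolding smooth_on_iff by (metis kdiff.simps(2))
      have 2: "kdiff n S (\<lambda>y. dpartial k P (\<phi> y))" for k
        by (rule kdiff_compose[OF S T _ Suc \<phi>]) (use smooth_on_dpartial[OF T P] in \<open>simp add: smooth_on_iff\<close>)
      have 3: "kdiff n S (\<lambda>y. bsolve (B (\<phi> y)) k)" for k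
        by (rule kdiff_compose[OF S T _ Suc \<phi>]) (use smB in \<open>simp add: smooth_on_iff\<close>)
      show "kdiff n S (\<lambda>y. L (\<phi> y) (dpartial b ?Q y))"
        unfolding L_def using S 1 2 3
        by (intro kdiff_sum kdiff_bilinear[OF _ bounded_bilinear_scaleR] kdiff_bilinear[OF _ bounded_bilinear_inner])
      show "L (\<phi> y) (dpartial b ?Q y) = dpartial b \<phi> y" if "y \<in> S" for y
        using dpartial_eqI[OF D[OF that]] by simp
    qed
    then show ?case using kdiff_imp[OF Suc] by simp
  qed
  then show ?thesis unfolding smooth_on_iff by blast
qed

text \<open>The level set is straightened by the local diffeomorphism \<Theta>, which sends it into
  the hyperplane orthogonal to the gradient \<open>a\<close>. \<open>F\<close> is the inverse of
  \<Theta> on that hyperplane, and \<pi> recovers the parameter.\<close>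

lemma local_parametrization:
  fixes f :: "'e::euclidean_space \<Rightarrow> real"
  assumes O: "open O'" "smooth_on O' f" "x0 \<in> O'" and f0: "f x0 = 0" and nz: "dpartial w f x0 \<noteq> 0"
    and dim: "DIM('f::euclidean_space) + 1 = DIM('e)"
  obtains U and V :: "'f::euclidean_space set" and F :: "'f \<Rightarrow> 'e" and \<pi> :: "'e \<Rightarrow> 'f"
  where "open U" "x0 \<in> U" "U \<subseteq> O'" "open V" "smooth_on V F" "linear \<pi>" "\<And>y. y \<in> V \<Longrightarrow> \<pi> (F y) = y"
    "F ` V = {x \<in> U. f x = 0}"
proof -
  have df: "f differentiable (at x)" if "x \<in> O'" for x using O that smooth_on_at by blast
  have lin0: "linear (\<lambda>v. dpartial v f x0)" using df O linear_dpartial by blast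
  define a where "a = (\<Sum>k\<in>Basis. dpartial k f x0 *\<^sub>R k)"
  have a: "dpartial v f x0 = a \<bullet> v" for v
    unfolding a_def by (subst dpartial_Basis[OF df[OF O(3)]]) (simp add: inner_sum_left inner_commute[of v] mult.commute)
  have a0: "a \<noteq> 0" using nz a by auto
  have "dim (UNIV :: 'f set) = dim {v. a \<bullet> v = 0}" using dim_hyperplane[OF a0] dim by simp
  then obtain A :: "'f \<Rightarrow> 'e" and \<pi> where A: "linear A" "linear \<pi>" "A ` UNIV = {v. a \<bullet> v = 0}"
    "\<And>y. \<pi> (A y) = y"
    using isometries_subspaces[OF subspace_UNIV subspace_hyperplane, of a] by (metis UNIV_I)
  \<comment> \<open>A vector transversal to the hyperplane and in the kernel of \<pi>, so that the
    components of \<pi> together with \<open>f\<close> are independent coordinates.\<close>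
  define n where "n = w - A (\<pi> w)"
  have An: "a \<bullet> A y = 0" for y using A(3) by blast
  have n: "\<pi> n = 0" "a \<bullet> n \<noteq> 0"
    using A(4) nz a An by (simp_all add: n_def linear_diff[OF A(2)] inner_diff_right)
  then have n0: "n \<noteq> 0" by auto
  define \<Theta> where "\<Theta> x = A (\<pi> x) + f x *\<^sub>R n" for x
  have bA: "bounded_linear (\<lambda>x. A (\<pi> x))"
    using A linear_compose[OF A(2,1)] by (simp add: linear_conv_bounded_linear o_def)
  have sm: "smooth_on O' \<Theta>" unfolding \<Theta>_def
    by (rule smooth_on_add[OF O(1) smooth_on_bounded_linear[OF bA] smooth_on_scaleR[OF O(1,2) smooth_on_const]])
  have D: "(\<Theta> has_derivative (\<lambda>v. dpartial v \<Theta> x)) (at x)" if "x \<in> O'" for x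
    using sm O that smooth_on_at has_derivative_dpartial by blast
  have D\<Theta>: "dpartial v \<Theta> x = A (\<pi> v) + dpartial v f x *\<^sub>R n" if "x \<in> O'" for x v
  proof (rule dpartial_eqI)
    show "(\<Theta> has_derivative (\<lambda>v. A (\<pi> v) + dpartial v f x *\<^sub>R n)) (at x)"
      unfolding \<Theta>_def
      using bA df[OF that] by (intro has_derivative_add bounded_linear_imp_has_derivative has_derivative_scaleR_left has_derivative_dpartial)
  qed
  define f' where "f' x = Blinfun (\<lambda>v. dpartial v \<Theta> x)" for x
  have f': "blinfun_apply (f' x) = (\<lambda>v. dpartial v \<Theta> x)" if "x \<in> O'" for x
    unfolding f'_def using has_derivative_bounded_linear[OF D[OF that]] bounded_linear_Blinfun_apply by blast
  have contf: "continuous_on O' f'"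
  proof (rule continuous_on_blinfun_componentwise)
    fix i :: 'e
    have "continuous_on O' (dpartial i \<Theta>)" using sm O smooth_on_dpartial smooth_on_continuous by blast
    then show "continuous_on O' (\<lambda>x. blinfun_apply (f' x) i)"
      by (rule continuous_on_eq) (simp add: f')
  qed
  have inj0: "v = 0" if "dpartial v \<Theta> x0 = 0" for v
  proof -
    have e: "A (\<pi> v) + (a \<bullet> v) *\<^sub>R n = 0" using that D\<Theta>[OF O(3)] a by simp
    then have "\<pi> (A (\<pi> v) + (a \<bullet> v) *\<^sub>R n) = \<pi> 0" by simp
    then have pv: "\<pi> v = 0" using A n by (simp add: linear_add[OF A(2)] linear_scale[OF A(2)] linear_0[OF A(2)])
    then have "a \<bullet> v = 0" using e n0 by (simp add: linear_0[OF A(1)])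
    then obtain y where "v = A y" using A(3) by blast
    then show "v = 0" using pv A(4) linear_0[OF A(1)] by simp
  qed
  have lin: "linear (\<lambda>v. dpartial v \<Theta> x0)" using sm O smooth_on_at linear_dpartial by blast
  then have "inj (\<lambda>v. dpartial v \<Theta> x0)" using inj0 linear_injective_0 by blast
  then obtain g where g: "linear g" "g \<circ> (\<lambda>v. dpartial v \<Theta> x0) = id" using linear_injective_left_inverse[OF lin] by blast
  have "Blinfun g o\<^sub>L f' x0 = id_blinfun"
    using g f'[OF O(3)] by (intro blinfun_eqI) (simp add: bounded_linear_Blinfun_apply linear_conv_bounded_linear[symmetric] fun_eq_iff)
  then obtain U V' G G' where UV: "open U" "U \<subseteq> O'" "x0 \<in> U" "open V'" "\<Theta> x0 \<in> V'" "homeomorphism U V' \<Theta> G"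
    "\<And>y. y \<in> V' \<Longrightarrow> bij (blinfun_apply (f' (G y)))"
    using inverse_function_theorem[OF O(1) _ contf O(3), of \<Theta>] D f' by (smt (verit, best))
  have inj\<Theta>: "v = 0" if x: "x \<in> U" and v: "dpartial v \<Theta> x = 0" for x v
  proof -
    have "G (\<Theta> x) = x" "\<Theta> x \<in> V'" using UV(6) x by (auto simp: homeomorphism_def)
    then have "bij (\<lambda>v. dpartial v \<Theta> x)" using UV(7)[of "\<Theta> x"] f'[of x] x UV(2) by auto
    moreover have "dpartial 0 \<Theta> x = 0"
      using linear_0[OF linear_dpartial[of \<Theta> x]] sm O x UV smooth_on_at by blast
    ultimately show "v = 0" using v by (metis (mono_tags, lifting) bij_betw_def injD)
  qed
  define V where "V = A -` V'"
  define F where "F y = G (A y)" for y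
  have contA: "continuous_on UNIV A" using A(1) linear_continuous_on linear_conv_bounded_linear by blast
  have oV: "open V" unfolding V_def using contA UV(4) continuous_open_vimage by (metis continuous_on_eq_continuous_within UNIV_I)
  have FU: "F y \<in> U" "\<Theta> (F y) = A y" if "y \<in> V" for y
    using that UV(6) by (auto simp: V_def F_def homeomorphism_def)
  have p\<Theta>: "\<pi> (\<Theta> x) = \<pi> x" for x using A n by (simp add: \<Theta>_def linear_add[OF A(2)] linear_scale[OF A(2)])
  have \<pi>F: "\<pi> (F y) = y" if "y \<in> V" for y using p\<Theta>[of "F y"] FU(2)[OF that] A(4) by simp
  \<comment> \<open>The inverse function theorem is used for a continuous inverse and for invertible
    derivatives on all of \<open>U\<close>; smoothness of \<open>F\<close> is then a case of lifting
    through \<Theta>.\<close>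
  have "smooth_on V F"
  proof (rule smooth_on_lift[OF UV(1) smooth_on_subset[OF sm UV(2)] inj\<Theta> oV])
    have "continuous_on V' G" using UV(6) by (simp add: homeomorphism_def)
    then show "continuous_on V F" unfolding F_def
      using continuous_on_compose2[of V' G V A] contA continuous_on_subset by (auto simp: V_def)
    show "F ` V \<subseteq> U" using FU by blast
    have "smooth_on V A" using A(1) by (intro smooth_on_bounded_linear) (simp add: linear_conv_bounded_linear)
    then show "smooth_on V (\<lambda>y. \<Theta> (F y))" by (rule smooth_on_cong[OF oV, rotated]) (simp add: FU)
  qed
  moreover have "F ` V = {x \<in> U. f x = 0}"
  proof (intro equalityI subsetI)
    fix x assume "x \<in> F ` V"
    then obtain y where y: "y \<in> V" "x = F y" by blast
    have "A y + f x *\<^sub>R n = A y" using FU(2)[OF y(1)] \<pi>F[OF y(1)] y(2) by (simp add: \<Theta>_def)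
    then show "x \<in> {x \<in> U. f x = 0}" using FU(1) y n0 by simp
  next
    fix x assume x: "x \<in> {x \<in> U. f x = 0}"
    then have "\<Theta> x = A (\<pi> x)" by (simp add: \<Theta>_def)
    moreover have "\<Theta> x \<in> V'" "G (\<Theta> x) = x" using UV(6) x by (auto simp: homeomorphism_def)
    ultimately show "x \<in> F ` V" by (intro image_eqI[of _ _ "\<pi> x"]) (auto simp: F_def V_def)
  qed
  ultimately show thesis using that UV(1,2,3) oV A(2) \<pi>F by blast
qed


section \<open>Charts, tangent vectors and smooth maps\<close>

text \<open>The part of \<open>smooth_manifold\<close> that concerns charts. It is what plots,
  tangent vectors and pullbacks rest on, and the form in which the products with the ray and the
  bundle of metrics are given their smooth structure.\<close>

definition smooth_charts :: "('a, 'e::euclidean_space) mfd \<Rightarrow> bool" where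
  "smooth_charts M \<longleftrightarrow> (\<Union>c\<in>atlas M. fst c) = points M
     \<and> (\<forall>c\<in>atlas M. openin (mtop M) (fst c) \<and> open (snd c ` fst c)
          \<and> homeomorphic_map (subtopology (mtop M) (fst c)) (top_of_set (snd c ` fst c)) (snd c))
     \<and> (\<forall>c\<in>atlas M. \<forall>c'\<in>atlas M. smooth_on (snd c ` (fst c \<inter> fst c')) (snd c' \<circ> cinv c))"

lemma smooth_manifold_iff:
  "smooth_manifold M \<longleftrightarrow> Hausdorff_space (mtop M) \<and> second_countable (mtop M) \<and> smooth_charts M"
  by (simp add: smooth_manifold_def smooth_charts_def)

lemma cinv_chart: "inj_on (snd c) (fst c) \<Longrightarrow> p \<in> fst c \<Longrightarrow> cinv c (snd c p) = p"
  by (simp add: cinv_def)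

lemma chart_cinv: "x \<in> snd c ` fst c \<Longrightarrow> snd c (cinv c x) = x"
  by (simp add: cinv_def f_inv_into_f)

lemma cinv_in: "x \<in> snd c ` fst c \<Longrightarrow> cinv c x \<in> fst c"
  by (simp add: cinv_def inv_into_into)

lemma cinv_eqI: "inj_on (snd c) (fst c) \<Longrightarrow> p \<in> fst c \<Longrightarrow> snd c p = x \<Longrightarrow> cinv c x = p"
  by (auto simp: cinv_chart)

context
  fixes M :: "('a, 'e::euclidean_space) mfd" assumes M: "smooth_charts M"
begin

lemma chart_exists: "p \<in> points M \<Longrightarrow> \<exists>c\<in>atlas M. p \<in> fst c"
  using M unfolding smooth_charts_def by blast

lemma chart_openin: "c \<in> atlas M \<Longrightarrow> openin (mtop M) (fst c)"
  using M unfolding smooth_charts_def by blast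

lemma chart_subset: "c \<in> atlas M \<Longrightarrow> fst c \<subseteq> points M"
  using chart_openin openin_subset by blast

lemma chart_homeo:
  "c \<in> atlas M \<Longrightarrow> homeomorphic_map (subtopology (mtop M) (fst c)) (top_of_set (snd c ` fst c)) (snd c)"
  using M unfolding smooth_charts_def by blast

lemma chart_open: "c \<in> atlas M \<Longrightarrow> open (snd c ` fst c)"
  using M unfolding smooth_charts_def by blast

lemma chart_inj: "c \<in> atlas M \<Longrightarrow> inj_on (snd c) (fst c)"
  using homeomorphic_imp_injective_map[OF chart_homeo] chart_subset
  by (simp add: Int_absorb1)

lemma chart_open_image:
  assumes c: "c \<in> atlas M" and W: "openin (mtop M) W"
  shows "open (snd c ` (fst c \<inter> W))"
proof -
  have "openin (subtopology (mtop M) (fst c)) (fst c \<inter> W)"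
    using W by (simp add: Int_commute openin_subtopology_Int)
  then have "openin (top_of_set (snd c ` fst c)) (snd c ` (fst c \<inter> W))"
    using homeomorphic_imp_open_map[OF chart_homeo[OF c]] unfolding open_map_def by blast
  then show ?thesis using chart_open[OF c] openin_open_trans by blast
qed

lemma chart_vimage_open:
  assumes c: "c \<in> atlas M" and V: "open V"
  shows "openin (mtop M) {p \<in> fst c. snd c p \<in> V}"
proof -
  have "continuous_map (subtopology (mtop M) (fst c)) (top_of_set (snd c ` fst c)) (snd c)"
    using chart_homeo[OF c] homeomorphic_imp_continuous_map by blast
  then have "continuous_map (subtopology (mtop M) (fst c)) euclidean (snd c)"
    using continuous_map_in_subtopology by blast
  then have "openin (subtopology (mtop M) (fst c)) {p \<in> topspace (subtopology (mtop M) (fst c)). snd c p \<in> V}"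
    by (rule openin_continuous_map_preimage) (use V in simp)
  then have "openin (mtop M) {p \<in> topspace (subtopology (mtop M) (fst c)). snd c p \<in> V}"
    using chart_openin[OF c] openin_trans_full by blast
  moreover have "topspace (subtopology (mtop M) (fst c)) = fst c" using chart_subset[OF c] by auto
  ultimately show ?thesis by (simp only:)
qed

lemma transition_smooth:
  "c \<in> atlas M \<Longrightarrow> c' \<in> atlas M \<Longrightarrow> smooth_on (snd c ` (fst c \<inter> fst c')) (snd c' \<circ> cinv c)"
  using M unfolding smooth_charts_def by blast

end

text \<open>These maps are the plots of \<open>M\<close> as a diffeological space: a map between manifolds is smooth
  if and only if it preserves plots.\<close>

definition smooth_into ::
  "('a, 'e::euclidean_space) mfd \<Rightarrow> 'g::euclidean_space set \<Rightarrow> ('g \<Rightarrow> 'a) \<Rightarrow> bool" where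
  "smooth_into M V G \<longleftrightarrow> (\<forall>y\<in>V. \<exists>c\<in>atlas M. \<exists>O'. open O' \<and> y \<in> O' \<and> O' \<subseteq> V \<and> G ` O' \<subseteq> fst c
     \<and> smooth_on O' (\<lambda>z. snd c (G z)))"

context
  fixes M :: "('a, 'e::euclidean_space) mfd" assumes M: "smooth_charts M"
begin

lemma smooth_into_points: "smooth_into M V G \<Longrightarrow> y \<in> V \<Longrightarrow> G y \<in> points M"
  unfolding smooth_into_def using chart_subset[OF M] by (metis image_subset_iff subsetD)

text \<open>The neighbourhoods in the definition of a plot are open and lie inside \<open>V\<close>.
  In a chart the claim is continuity of the coordinate expression, and injectivity of the chart
  leads back to \<open>W\<close>.\<close>

lemma smooth_into_preimage:
  assumes G: "smooth_into M V G" and W: "openin (mtop M) W"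
  shows "open {y \<in> V. G y \<in> W}"
  unfolding open_subopen[of "{y \<in> V. G y \<in> W}"]
proof
  fix y assume "y \<in> {y \<in> V. G y \<in> W}"
  then have y: "y \<in> V" "G y \<in> W" by auto
  obtain c O' where c: "c \<in> atlas M" "open O'" "y \<in> O'" "O' \<subseteq> V" "G ` O' \<subseteq> fst c" "smooth_on O' (\<lambda>z. snd c (G z))"
    using G y unfolding smooth_into_def by blast
  let ?T = "O' \<inter> (\<lambda>z. snd c (G z)) -` (snd c ` (fst c \<inter> W))"
  have "open ?T" using continuous_open_preimage[OF smooth_on_continuous[OF c(6)] c(2) chart_open_image[OF M c(1) W]] .
  moreover have "y \<in> ?T" using y c by auto
  moreover have "?T \<subseteq> {y \<in> V. G y \<in> W}"
  proof
    fix z assume z: "z \<in> ?T"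
    then obtain q where q: "q \<in> fst c" "q \<in> W" "snd c (G z) = snd c q" by blast
    moreover have "G z \<in> fst c" using z c(5) by blast
    ultimately have "G z = q" using chart_inj[OF M c(1)] by (meson inj_onD)
    then show "z \<in> {y \<in> V. G y \<in> W}" using q z c by auto
  qed
  ultimately show "\<exists>T. open T \<and> y \<in> T \<and> T \<subseteq> {y \<in> V. G y \<in> W}" by blast
qed

lemma smooth_into_continuous_map:
  assumes "smooth_into M V G" "open V" shows "continuous_map (top_of_set V) (mtop M) G"
  unfolding continuous_map_def
  using smooth_into_points[OF assms(1)] smooth_into_preimage[OF assms(1)] assms(2) by (auto simp: openin_open_eq)

text \<open>The definition provides some chart at \<open>G y\<close>; a transition map replaces it
  by any prescribed one.\<close>

lemma smooth_into_chart:
  assumes G: "smooth_into M V G" and y: "y \<in> V" and c: "c \<in> atlas M" "G y \<in> fst c"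
  obtains O' where "open O'" "y \<in> O'" "O' \<subseteq> V" "G ` O' \<subseteq> fst c" "smooth_on O' (\<lambda>z. snd c (G z))"
proof -
  obtain c1 O1 where c1: "c1 \<in> atlas M" "open O1" "y \<in> O1" "O1 \<subseteq> V" "G ` O1 \<subseteq> fst c1" "smooth_on O1 (\<lambda>z. snd c1 (G z))"
    using G y unfolding smooth_into_def by blast
  let ?O = "O1 \<inter> {y \<in> V. G y \<in> fst c}"
  have oO: "open ?O" using c1(2) smooth_into_preimage[OF G chart_openin[OF M c(1)]] by blast
  have "smooth_on ?O (\<lambda>z. (snd c \<circ> cinv c1) (snd c1 (G z)))"
  proof (rule smooth_on_compose[OF oO _ transition_smooth[OF M c1(1) c(1)]])
    show "open (snd c1 ` (fst c1 \<inter> fst c))" using chart_open_image[OF M c1(1) chart_openin[OF M c(1)]] .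
    show "smooth_on ?O (\<lambda>z. snd c1 (G z))" using smooth_on_subset[OF c1(6)] by blast
    show "(\<lambda>z. snd c1 (G z)) ` ?O \<subseteq> snd c1 ` (fst c1 \<inter> fst c)" using c1(5) by blast
  qed
  moreover have "(snd c \<circ> cinv c1) (snd c1 (G z)) = snd c (G z)" if "z \<in> ?O" for z
    using that c1(5) cinv_chart[OF chart_inj[OF M c1(1)]] by auto
  ultimately have "smooth_on ?O (\<lambda>z. snd c (G z))" by (rule smooth_on_cong[OF oO, rotated])
  then show thesis using that[of ?O] oO c1 c y by blast
qed

lemma smooth_into_smooth_on:
  assumes "smooth_into M V G" "c \<in> atlas M" "G ` V \<subseteq> fst c"
  shows "smooth_on V (\<lambda>z. snd c (G z))"
proof (rule smooth_on_local)
  fix y assume y: "y \<in> V"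
  have "G y \<in> fst c" using assms(3) y by blast
  then show "\<exists>T. open T \<and> y \<in> T \<and> smooth_on T (\<lambda>z. snd c (G z))"
    using smooth_into_chart[OF assms(1) y assms(2)] by metis
qed

lemma smooth_intoI_chart:
  assumes "open V" "c \<in> atlas M" "G ` V \<subseteq> fst c" "smooth_on V (\<lambda>z. snd c (G z))"
  shows "smooth_into M V G"
  unfolding smooth_into_def using assms by blast

lemma smooth_into_cinv: "c \<in> atlas M \<Longrightarrow> smooth_into M (snd c ` fst c) (cinv c)"
proof (rule smooth_intoI_chart)
  assume c: "c \<in> atlas M"
  show o: "open (snd c ` fst c)" using chart_open[OF M c] .
  show "cinv c ` (snd c ` fst c) \<subseteq> fst c" by (rule image_subsetI, rule cinv_in)
  show "smooth_on (snd c ` fst c) (\<lambda>z. snd c (cinv c z))"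
    by (rule smooth_on_cong[OF o _ smooth_on_ident]) (rule chart_cinv[symmetric])
qed

end

lemma smooth_into_local:
  assumes "\<And>y. y \<in> V \<Longrightarrow> \<exists>O'. open O' \<and> y \<in> O' \<and> O' \<subseteq> V \<and> smooth_into M O' G"
  shows "smooth_into M V G"
  unfolding smooth_into_def
proof
  fix y assume "y \<in> V"
  then obtain O1 where 1: "y \<in> O1" "O1 \<subseteq> V" "smooth_into M O1 G" using assms by blast
  then show "\<exists>c\<in>atlas M. \<exists>O'. open O' \<and> y \<in> O' \<and> O' \<subseteq> V \<and> G ` O' \<subseteq> fst c \<and> smooth_on O' (\<lambda>z. snd c (G z))"
    unfolding smooth_into_def by (meson subset_trans)
qed

lemma smooth_into_subset:
  assumes "smooth_into M V G" "open V'" "V' \<subseteq> V" shows "smooth_into M V' G"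
  unfolding smooth_into_def
proof
  fix y assume y: "y \<in> V'"
  then obtain c O' where c: "c \<in> atlas M" "open O'" "y \<in> O'" "G ` O' \<subseteq> fst c" "smooth_on O' (\<lambda>z. snd c (G z))"
    using assms unfolding smooth_into_def by (meson subsetD)
  then show "\<exists>c\<in>atlas M. \<exists>O'. open O' \<and> y \<in> O' \<and> O' \<subseteq> V' \<and> G ` O' \<subseteq> fst c \<and> smooth_on O' (\<lambda>z. snd c (G z))"
    using y assms(2) smooth_on_subset[OF c(5), of "O' \<inter> V'"] by (intro bexI[OF _ c(1)] exI[of _ "O' \<inter> V'"]) auto
qed

lemma smooth_into_cong:
  assumes "smooth_into M V G" "\<And>y. y \<in> V \<Longrightarrow> G y = G' y" shows "smooth_into M V G'"
  unfolding smooth_into_def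
proof
  fix y assume y: "y \<in> V"
  then obtain c O' where c: "c \<in> atlas M" "open O'" "y \<in> O'" "O' \<subseteq> V" "G ` O' \<subseteq> fst c" "smooth_on O' (\<lambda>z. snd c (G z))"
    using assms unfolding smooth_into_def by meson
  have "smooth_on O' (\<lambda>z. snd c (G' z))" using smooth_on_cong[OF c(2) _ c(6)] c(4) assms(2) by (metis subsetD)
  then show "\<exists>c\<in>atlas M. \<exists>O'. open O' \<and> y \<in> O' \<and> O' \<subseteq> V \<and> G' ` O' \<subseteq> fst c \<and> smooth_on O' (\<lambda>z. snd c (G' z))"
    using c assms(2) by (intro bexI[OF _ c(1)] exI[of _ O']) (auto simp: subset_iff)
qed

lemma smooth_into_compose:
  fixes \<phi> :: "'b::euclidean_space \<Rightarrow> 'g::euclidean_space"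
  assumes G: "smooth_into M V G" and \<phi>: "open U" "smooth_on U \<phi>" "\<phi> ` U \<subseteq> V"
  shows "smooth_into M U (\<lambda>y. G (\<phi> y))"
  unfolding smooth_into_def
proof
  fix y assume y: "y \<in> U"
  then obtain c O' where c: "c \<in> atlas M" "open O'" "\<phi> y \<in> O'" "O' \<subseteq> V" "G ` O' \<subseteq> fst c" "smooth_on O' (\<lambda>z. snd c (G z))"
    using G \<phi>(3) unfolding smooth_into_def by blast
  let ?T = "U \<inter> \<phi> -` O'"
  have T: "open ?T" using continuous_open_preimage[OF smooth_on_continuous[OF \<phi>(2)] \<phi>(1) c(2)] .
  have "smooth_on ?T (\<lambda>z. snd c (G (\<phi> z)))"
    by (rule smooth_on_compose[OF T c(2) c(6) smooth_on_subset[OF \<phi>(2)]]) auto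
  then show "\<exists>c\<in>atlas M. \<exists>O'. open O' \<and> y \<in> O' \<and> O' \<subseteq> U \<and> (\<lambda>y. G (\<phi> y)) ` O' \<subseteq> fst c \<and> smooth_on O' (\<lambda>z. snd c (G (\<phi> z)))"
    using T y c by (intro bexI[OF _ c(1)] exI[of _ ?T]) auto
qed

lemma smooth_map_imp_into:
  assumes M: "smooth_charts M" and N: "smooth_charts N" and F: "smooth_map M N F" and G: "smooth_into M V G"
  shows "smooth_into N V (\<lambda>y. F (G y))"
  unfolding smooth_into_def
proof
  fix y assume y: "y \<in> V"
  obtain c O1 where c: "c \<in> atlas M" "open O1" "y \<in> O1" "O1 \<subseteq> V" "G ` O1 \<subseteq> fst c" "smooth_on O1 (\<lambda>z. snd c (G z))"
    using G y unfolding smooth_into_def by blast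
  have cont: "continuous_map (mtop M) (mtop N) F" using F by (simp add: smooth_map_def)
  have "F (G y) \<in> points N"
    using continuous_map_image_subset_topspace[OF cont] smooth_into_points[OF M G y] by blast
  then obtain c' where c': "c' \<in> atlas N" "F (G y) \<in> fst c'" using chart_exists[OF N] by blast
  let ?W = "{p \<in> points M. F p \<in> fst c'}"
  have W: "openin (mtop M) ?W" using openin_continuous_map_preimage[OF cont chart_openin[OF N c'(1)]] .
  have eqW: "{p \<in> fst c. F p \<in> fst c'} = fst c \<inter> ?W" using chart_subset[OF M c(1)] by blast
  have oA: "open (snd c ` {p \<in> fst c. F p \<in> fst c'})" unfolding eqW by (rule chart_open_image[OF M c(1) W])
  let ?T = "O1 \<inter> {y \<in> V. G y \<in> ?W}"
  have T: "open ?T" using c(2) smooth_into_preimage[OF M G W] by blast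
  have "smooth_on ?T (\<lambda>z. (snd c' \<circ> F \<circ> cinv c) (snd c (G z)))"
  proof (rule smooth_on_compose[OF T oA])
    show "smooth_on (snd c ` {p \<in> fst c. F p \<in> fst c'}) (snd c' \<circ> F \<circ> cinv c)"
      using F c c' by (simp add: smooth_map_def)
    show "smooth_on ?T (\<lambda>z. snd c (G z))" using smooth_on_subset[OF c(6)] by blast
    show "(\<lambda>z. snd c (G z)) ` ?T \<subseteq> snd c ` {p \<in> fst c. F p \<in> fst c'}" using c(5) by blast
  qed
  moreover have "(snd c' \<circ> F \<circ> cinv c) (snd c (G z)) = snd c' (F (G z))" if "z \<in> ?T" for z
    using that c(5) cinv_chart[OF chart_inj[OF M c(1)]] by auto
  ultimately have "smooth_on ?T (\<lambda>z. snd c' (F (G z)))" by (rule smooth_on_cong[OF T, rotated])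
  then show "\<exists>c\<in>atlas N. \<exists>O'. open O' \<and> y \<in> O' \<and> O' \<subseteq> V \<and> (\<lambda>y. F (G y)) ` O' \<subseteq> fst c \<and> smooth_on O' (\<lambda>z. snd c (F (G z)))"
    using T c y c' smooth_into_points[OF M G y] by (intro bexI[OF _ c'(1)] exI[of _ ?T]) auto
qed

text \<open>\<open>smooth_map\<close> demands continuity and all pairs of charts. One chart at each
  point of the source suffices: plots have open preimages, and the remaining charts differ by
  transition maps.\<close>

lemma smooth_mapI:
  assumes M: "smooth_charts M" and N: "smooth_charts N"
    and F: "\<And>p. p \<in> points M \<Longrightarrow> \<exists>c\<in>atlas M. p \<in> fst c \<and> smooth_into N (snd c ` fst c) (\<lambda>y. F (cinv c y))"
  shows "smooth_map M N F"
proof -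
  have pts: "F p \<in> points N" if p: "p \<in> points M" for p
  proof -
    obtain c where c: "c \<in> atlas M" "p \<in> fst c" "smooth_into N (snd c ` fst c) (\<lambda>y. F (cinv c y))" using F[OF p] by blast
    then show ?thesis using smooth_into_points[OF N c(3), of "snd c p"] cinv_chart[OF chart_inj[OF M c(1)] c(2)] by simp
  qed
  have op: "openin (mtop M) {p \<in> points M. F p \<in> W}" if W: "openin (mtop N) W" for W
  proof (subst openin_subopen, intro ballI)
    fix p assume p: "p \<in> {p \<in> points M. F p \<in> W}"
    then obtain c where c: "c \<in> atlas M" "p \<in> fst c" "smooth_into N (snd c ` fst c) (\<lambda>y. F (cinv c y))" using F by blast
    let ?V = "{y \<in> snd c ` fst c. F (cinv c y) \<in> W}"
    have "openin (mtop M) {q \<in> fst c. snd c q \<in> ?V}"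
      by (rule chart_vimage_open[OF M c(1) smooth_into_preimage[OF N c(3) W]])
    moreover have "{q \<in> fst c. snd c q \<in> ?V} \<subseteq> {p \<in> points M. F p \<in> W}"
    proof
      fix q assume "q \<in> {q \<in> fst c. snd c q \<in> ?V}"
      then have "q \<in> fst c" "F (cinv c (snd c q)) \<in> W" by auto
      then show "q \<in> {p \<in> points M. F p \<in> W}"
        using cinv_chart[OF chart_inj[OF M c(1)]] chart_subset[OF M c(1)] by auto
    qed
    moreover have "p \<in> {q \<in> fst c. snd c q \<in> ?V}" using c(2) p cinv_chart[OF chart_inj[OF M c(1)] c(2)] by auto
    ultimately show "\<exists>T. openin (mtop M) T \<and> p \<in> T \<and> T \<subseteq> {p \<in> points M. F p \<in> W}" by blast
  qed
  have cont: "continuous_map (mtop M) (mtop N) F" unfolding continuous_map_def using pts op by auto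
  have "smooth_on (snd c ` {p \<in> fst c. F p \<in> fst c'}) (snd c' \<circ> F \<circ> cinv c)"
    if c: "c \<in> atlas M" and c': "c' \<in> atlas N" for c c'
  proof (rule smooth_on_local)
    fix x assume "x \<in> snd c ` {p \<in> fst c. F p \<in> fst c'}"
    then obtain p where p: "p \<in> fst c" "F p \<in> fst c'" "x = snd c p" by blast
    have px: "cinv c x = p" using cinv_chart[OF chart_inj[OF M c] p(1)] p(3) by simp
    have pM: "p \<in> points M" using p(1) chart_subset[OF M c] by blast
    obtain c1 where c1: "c1 \<in> atlas M" "p \<in> fst c1" "smooth_into N (snd c1 ` fst c1) (\<lambda>y. F (cinv c1 y))" using F[OF pM] by blast
    let ?A = "snd c ` (fst c \<inter> fst c1)"
    have A: "open ?A" by (rule chart_open_image[OF M c chart_openin[OF M c1(1)]])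
    have "smooth_into N ?A (\<lambda>z. F (cinv c1 ((snd c1 \<circ> cinv c) z)))"
      by (rule smooth_into_compose[OF c1(3) A transition_smooth[OF M c c1(1)]])
        (auto simp: cinv_chart[OF chart_inj[OF M c]])
    then have "smooth_into N ?A (\<lambda>z. F (cinv c z))"
      by (rule smooth_into_cong)
        (auto simp: cinv_chart[OF chart_inj[OF M c]] cinv_chart[OF chart_inj[OF M c1(1)]])
    note into = this
    have x: "x \<in> ?A" unfolding p(3) using p(1) c1(2) by (intro imageI IntI)
    have "F (cinv c x) \<in> fst c'" using px p(2) by simp
    from smooth_into_chart[OF N into x c' this]
    obtain O' where "open O'" "x \<in> O'" "smooth_on O' (\<lambda>z. snd c' (F (cinv c z)))" by metis
    then show "\<exists>T. open T \<and> x \<in> T \<and> smooth_on T (snd c' \<circ> F \<circ> cinv c)" unfolding comp_def by blast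
  qed
  then show ?thesis using cont by (simp add: smooth_map_def)
qed

text \<open>An assumption cannot quantify over the type of the plot domain, so only plots on open
  subsets of the model space are tested. The inverse charts are among them.\<close>

lemma smooth_mapI_into:
  fixes M :: "('a, 'e::euclidean_space) mfd"
  assumes M: "smooth_charts M" and N: "smooth_charts N"
    and F: "\<And>(V::'e set) G. open V \<Longrightarrow> smooth_into M V G \<Longrightarrow> smooth_into N V (\<lambda>y. F (G y))"
  shows "smooth_map M N F"
  using smooth_mapI[OF M N] F chart_open[OF M] smooth_into_cinv[OF M] chart_exists[OF M] by meson

lemma smooth_map_compose:
  assumes "smooth_charts M" "smooth_charts N" "smooth_charts P" "smooth_map M N F" "smooth_map N P G"
  shows "smooth_map M P (G \<circ> F)"
proof (rule smooth_mapI_into[OF assms(1,3)])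
  show "smooth_into P V (\<lambda>y. (G \<circ> F) (K y))" if "smooth_into M V K" for V K
    using smooth_map_imp_into[OF assms(2,3,5) smooth_map_imp_into[OF assms(1,2,4) that]] by simp
qed

lemma smooth_map_points: "smooth_map M N F \<Longrightarrow> p \<in> points M \<Longrightarrow> F p \<in> points N"
  unfolding smooth_map_def using continuous_map_image_subset_topspace by blast

section \<open>Tangent vectors\<close>

context
  fixes M :: "('a, 'e::euclidean_space) mfd" assumes M: "smooth_charts M"
begin

text \<open>\<open>smooth_near\<close> refers to all charts on a neighbourhood; transition maps
  spread smoothness from the single chart \<open>c\<close> to the others.\<close>

lemma smooth_near_chart:
  assumes c: "c \<in> atlas M" "p \<in> fst c"
  shows "smooth_near M p f \<longleftrightarrow> (\<exists>O'. open O' \<and> snd c p \<in> O' \<and> O' \<subseteq> snd c ` fst c \<and> smooth_on O' (\<lambda>x. f (cinv c x)))"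
proof
  assume "smooth_near M p f"
  then obtain W where W: "openin (mtop M) W" "p \<in> W" "fun_smooth M W f" unfolding smooth_near_def by blast
  then show "\<exists>O'. open O' \<and> snd c p \<in> O' \<and> O' \<subseteq> snd c ` fst c \<and> smooth_on O' (\<lambda>x. f (cinv c x))"
    using chart_open_image[OF M c(1) W(1)] c
    by (intro exI[of _ "snd c ` (fst c \<inter> W)"]) (auto simp: fun_smooth_def o_def)
next
  assume "\<exists>O'. open O' \<and> snd c p \<in> O' \<and> O' \<subseteq> snd c ` fst c \<and> smooth_on O' (\<lambda>x. f (cinv c x))"
  then obtain O' where O': "open O'" "snd c p \<in> O'" "smooth_on O' (\<lambda>x. f (cinv c x))" by blast
  let ?W = "{q \<in> fst c. snd c q \<in> O'}"
  have W: "openin (mtop M) ?W" by (rule chart_vimage_open[OF M c(1) O'(1)])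
  have "smooth_on (snd c' ` (fst c' \<inter> ?W)) (f \<circ> cinv c')" if c': "c' \<in> atlas M" for c'
  proof -
    have o: "open (snd c' ` (fst c' \<inter> ?W))" by (rule chart_open_image[OF M c' W])
    have "smooth_on (snd c' ` (fst c' \<inter> ?W)) (\<lambda>x. f (cinv c ((snd c \<circ> cinv c') x)))"
      by (rule smooth_on_compose[OF o O'(1,3) smooth_on_subset[OF transition_smooth[OF M c' c(1)]]])
        (auto simp: cinv_chart[OF chart_inj[OF M c']])
    then show ?thesis
      by (rule smooth_on_cong[OF o, rotated])
        (auto simp: cinv_chart[OF chart_inj[OF M c']] cinv_chart[OF chart_inj[OF M c(1)]])
  qed
  then show "smooth_near M p f" unfolding smooth_near_def fun_smooth_def using W O'(2) c(2) by blast
qed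

lemma fun_smooth_iff:
  assumes W: "openin (mtop M) W" shows "fun_smooth M W f \<longleftrightarrow> (\<forall>p\<in>W. smooth_near M p f)"
proof
  show "fun_smooth M W f \<Longrightarrow> \<forall>p\<in>W. smooth_near M p f" unfolding smooth_near_def using W by blast
next
  assume R: "\<forall>p\<in>W. smooth_near M p f"
  show "fun_smooth M W f" unfolding fun_smooth_def
  proof (intro ballI smooth_on_local)
    fix c x assume c: "c \<in> atlas M" and "x \<in> snd c ` (fst c \<inter> W)"
    then obtain p where p: "p \<in> fst c" "p \<in> W" "x = snd c p" by blast
    show "\<exists>T. open T \<and> x \<in> T \<and> smooth_on T (f \<circ> cinv c)"
      using smooth_near_chart[OF c p(1), of f] R p by (auto simp: o_def)
  qed
qed

lemma smooth_near_into:
  assumes f: "smooth_near M (G y) f" and G: "smooth_into M V G" and y: "y \<in> V"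
  obtains O' where "open O'" "y \<in> O'" "O' \<subseteq> V" "smooth_on O' (\<lambda>z. f (G z))"
proof -
  obtain c O1 where c: "c \<in> atlas M" "open O1" "y \<in> O1" "O1 \<subseteq> V" "G ` O1 \<subseteq> fst c" "smooth_on O1 (\<lambda>z. snd c (G z))"
    using G y unfolding smooth_into_def by blast
  have Gy: "G y \<in> fst c" using c by blast
  obtain O2 where O2: "open O2" "snd c (G y) \<in> O2" "smooth_on O2 (\<lambda>x. f (cinv c x))"
    using f unfolding smooth_near_chart[OF c(1) Gy] by blast
  let ?T = "O1 \<inter> (\<lambda>z. snd c (G z)) -` O2"
  have T: "open ?T" using continuous_open_preimage[OF smooth_on_continuous[OF c(6)] c(2) O2(1)] .
  have "smooth_on ?T (\<lambda>z. f (cinv c (snd c (G z))))"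
    by (rule smooth_on_compose[OF T O2(1,3) smooth_on_subset[OF c(6)]]) auto
  moreover have "f (cinv c (snd c (G z))) = f (G z)" if "z \<in> ?T" for z
    using that c(5) cinv_chart[OF chart_inj[OF M c(1)]] by auto
  ultimately have "smooth_on ?T (\<lambda>z. f (G z))" by (rule smooth_on_cong[OF T, rotated])
  then show thesis using that[of ?T] T c O2 by blast
qed

lemma smooth_near_differentiable:
  assumes "smooth_near M p f" "c \<in> atlas M" "p \<in> fst c"
  shows "(\<lambda>x. f (cinv c x)) differentiable (at (snd c p))"
  using assms smooth_near_chart smooth_on_at by blast

lemma tv_apply:
  "tv M c p v f = (if smooth_near M p f then dpartial v (\<lambda>x. f (cinv c x)) (snd c p) else 0)"
  by (simp add: tv_def o_def)

lemma tv_linear: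
  assumes "c \<in> atlas M" "p \<in> fst c" shows "linear (\<lambda>v. tv M c p v f)"
proof (cases "smooth_near M p f")
  case True
  then show ?thesis using linear_dpartial[OF smooth_near_differentiable[OF True assms]] by (simp add: tv_apply)
qed (simp add: tv_apply linear_zero)

text \<open>The chain rule on functions that are smooth near \<open>p\<close>; on all other
  functions both sides take the default value 0.\<close>

lemma tv_change:
  assumes c: "c \<in> atlas M" "p \<in> fst c" and c': "c' \<in> atlas M" "p \<in> fst c'"
  shows "tv M c p v = tv M c' p (dpartial v (\<lambda>x. snd c' (cinv c x)) (snd c p))"
proof
  fix f
  show "tv M c p v f = tv M c' p (dpartial v (\<lambda>x. snd c' (cinv c x)) (snd c p)) f"
  proof (cases "smooth_near M p f")
    case True
    let ?A = "snd c ` (fst c \<inter> fst c')"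
    have A: "open ?A" "snd c p \<in> ?A" using chart_open_image[OF M c(1) chart_openin[OF M c'(1)]] c c' by auto
    have cp: "cinv c (snd c p) = p" using cinv_chart[OF chart_inj[OF M c(1)] c(2)] .
    have 1: "(\<lambda>x. snd c' (cinv c x)) differentiable (at (snd c p))"
      using smooth_on_at[OF transition_smooth[OF M c(1) c'(1)] A] by (simp add: o_def)
    have 2: "(\<lambda>x. f (cinv c' x)) differentiable (at (snd c' (cinv c (snd c p))))"
      using smooth_near_differentiable[OF True c'] by (simp add: cp)
    have "dpartial v (\<lambda>x. f (cinv c x)) (snd c p) = dpartial v (\<lambda>x. f (cinv c' (snd c' (cinv c x)))) (snd c p)"
      by (rule dpartial_cong[OF A])
        (auto simp: cinv_chart[OF chart_inj[OF M c(1)]] cinv_chart[OF chart_inj[OF M c'(1)]])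
    also have "\<dots> = dpartial (dpartial v (\<lambda>x. snd c' (cinv c x)) (snd c p)) (\<lambda>x. f (cinv c' x)) (snd c' p)"
      using dpartial_compose[OF 2 1, of v] by (simp add: cp)
    finally show ?thesis using True by (simp add: tv_apply)
  qed (simp add: tv_apply)
qed

lemma tangent_space_chart:
  assumes "c \<in> atlas M" "p \<in> fst c" shows "tangent_space M p = range (tv M c p)"
proof
  show "range (tv M c p) \<subseteq> tangent_space M p" unfolding tangent_space_def using assms by blast
  show "tangent_space M p \<subseteq> range (tv M c p)"
    unfolding tangent_space_def using tv_change[OF _ _ assms] by blast
qed

lemma smooth_near_coordf:
  assumes "c \<in> atlas M" "p \<in> fst c" shows "smooth_near M p (coordf c k)"
  unfolding smooth_near_chart[OF assms]
proof (intro exI[of _ "snd c ` fst c"] conjI subset_refl)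
  show o: "open (snd c ` fst c)" by (rule chart_open[OF M assms(1)])
  have "smooth_on (snd c ` fst c) (\<lambda>x. x \<bullet> k)" by (rule smooth_on_component[OF o smooth_on_ident])
  then show "smooth_on (snd c ` fst c) (\<lambda>x. coordf c k (cinv c x))"
    by (rule smooth_on_cong[OF o, rotated]) (simp add: coordf_def chart_cinv)
qed (use assms in auto)

lemma tv_coordf:
  assumes "c \<in> atlas M" "p \<in> fst c" shows "tv M c p v (coordf c k) = v \<bullet> k"
proof -
  have "dpartial v (\<lambda>x. coordf c k (cinv c x)) (snd c p) = dpartial v (\<lambda>x. x \<bullet> k) (snd c p)"
    by (rule dpartial_cong[OF chart_open[OF M assms(1)]]) (use assms in \<open>auto simp: coordf_def chart_cinv\<close>)
  also have "\<dots> = v \<bullet> k" by (rule dpartial_bounded_linear[OF bounded_linear_inner_left])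
  finally show ?thesis using smooth_near_coordf[OF assms] by (simp add: tv_apply)
qed

lemma tv_inject:
  assumes "c \<in> atlas M" "p \<in> fst c" shows "tv M c p v = tv M c p w \<longleftrightarrow> v = w"
  using tv_coordf[OF assms] by (metis euclidean_eqI)

end

lemma smooth_map_near:
  assumes M: "smooth_charts M" and N: "smooth_charts N" and F: "smooth_map M N F" and p: "p \<in> points M"
    and f: "smooth_near N (F p) f"
  shows "smooth_near M p (\<lambda>q. f (F q))"
proof -
  obtain c where c: "c \<in> atlas M" "p \<in> fst c" using chart_exists[OF M p] by blast
  have cp: "cinv c (snd c p) = p" using cinv_chart[OF chart_inj[OF M c(1)] c(2)] .
  have "smooth_into N (snd c ` fst c) (\<lambda>y. F (cinv c y))"
    by (rule smooth_map_imp_into[OF M N F smooth_into_cinv[OF M c(1)]])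
  then obtain O' where "open O'" "snd c p \<in> O'" "O' \<subseteq> snd c ` fst c" "smooth_on O' (\<lambda>z. f (F (cinv c z)))"
    using smooth_near_into[OF N, of "\<lambda>y. F (cinv c y)" "snd c p" f] f c by (metis cp imageI)
  then show ?thesis using smooth_near_chart[OF M c] by blast
qed

lemma chart_rep_differentiable:
  assumes M: "smooth_charts M" and N: "smooth_charts N" and F: "smooth_map M N F"
    and c: "c \<in> atlas M" "p \<in> fst c" and c': "c' \<in> atlas N" "F p \<in> fst c'"
  obtains O' where "open O'" "snd c p \<in> O'" "O' \<subseteq> snd c ` fst c" "\<And>y. y \<in> O' \<Longrightarrow> F (cinv c y) \<in> fst c'"
    "smooth_on O' (\<lambda>x. snd c' (F (cinv c x)))"
proof -
  have cp: "cinv c (snd c p) = p" using cinv_chart[OF chart_inj[OF M c(1)] c(2)] .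
  have "smooth_into N (snd c ` fst c) (\<lambda>y. F (cinv c y))"
    by (rule smooth_map_imp_into[OF M N F smooth_into_cinv[OF M c(1)]])
  then obtain O' where O': "open O'" "snd c p \<in> O'" "O' \<subseteq> snd c ` fst c" "(\<lambda>y. F (cinv c y)) ` O' \<subseteq> fst c'"
    "smooth_on O' (\<lambda>z. snd c' (F (cinv c z)))"
    using smooth_into_chart[OF N _ _ c'(1), of _ "\<lambda>y. F (cinv c y)" "snd c p"] c c'(2) cp by (metis imageI)
  then show thesis by (intro that[of O']) auto
qed

text \<open>The differential is the Jacobian of the coordinate expression. The guard in
  \<open>push\<close> matters for functions that are not smooth near \<open>F p\<close> but become
  smooth after composition with \<open>F\<close>: both sides are 0 on them.\<close>

lemma push_tv:
  assumes M: "smooth_charts M" and N: "smooth_charts N" and F: "smooth_map M N F"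
    and c: "c \<in> atlas M" "p \<in> fst c" and c': "c' \<in> atlas N" "F p \<in> fst c'"
  shows "push N F p (tv M c p v) = tv N c' (F p) (dpartial v (\<lambda>x. snd c' (F (cinv c x))) (snd c p))"
proof (rule ext)
  fix f
  have cp: "cinv c (snd c p) = p" using cinv_chart[OF chart_inj[OF M c(1)] c(2)] .
  show "push N F p (tv M c p v) f = tv N c' (F p) (dpartial v (\<lambda>x. snd c' (F (cinv c x))) (snd c p)) f"
  proof (cases "smooth_near N (F p) f")
    case True
    have pM: "p \<in> points M" using c chart_subset[OF M] by blast
    have nr: "smooth_near M p (f \<circ> F)" using smooth_map_near[OF M N F pM True] by (simp add: o_def)
    obtain O' where O': "open O'" "snd c p \<in> O'" "\<And>y. y \<in> O' \<Longrightarrow> F (cinv c y) \<in> fst c'"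
      "smooth_on O' (\<lambda>x. snd c' (F (cinv c x)))"
      using chart_rep_differentiable[OF M N F c c'] by metis
    have 1: "(\<lambda>x. snd c' (F (cinv c x))) differentiable (at (snd c p))" using smooth_on_at[OF O'(4,1,2)] .
    have 2: "(\<lambda>x. f (cinv c' x)) differentiable (at (snd c' (F (cinv c (snd c p)))))"
      using smooth_near_differentiable[OF N True c'] by (simp add: cp)
    have "dpartial v (\<lambda>x. f (F (cinv c x))) (snd c p) = dpartial v (\<lambda>x. f (cinv c' (snd c' (F (cinv c x))))) (snd c p)"
      by (rule dpartial_cong[OF O'(1,2)]) (simp add: cinv_chart[OF chart_inj[OF N c'(1)]] O'(3))
    also have "\<dots> = dpartial (dpartial v (\<lambda>x. snd c' (F (cinv c x))) (snd c p)) (\<lambda>x. f (cinv c' x)) (snd c' (F p))"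
      using dpartial_compose[OF 2 1, of v] by (simp add: cp)
    finally show ?thesis using True nr by (simp add: push_def tv_apply[OF M] tv_apply[OF N])
  qed (simp add: push_def tv_apply[OF N])
qed


lemma push_in_tangent_space:
  assumes M: "smooth_charts M" and N: "smooth_charts N" and F: "smooth_map M N F"
    and p: "p \<in> points M" and v: "v \<in> tangent_space M p"
  shows "push N F p v \<in> tangent_space N (F p)"
proof -
  obtain c where c: "c \<in> atlas M" "p \<in> fst c" using chart_exists[OF M p] by blast
  obtain c' where c': "c' \<in> atlas N" "F p \<in> fst c'" using chart_exists[OF N smooth_map_points[OF F p]] by blast
  show ?thesis
    using v push_tv[OF M N F c c'] unfolding tangent_space_chart[OF M c] tangent_space_chart[OF N c'] by auto
qed

text \<open>Functoriality survives the default values because composition with \<open>G\<close>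
  preserves smoothness, so the inner guard is passed whenever the outer one is.\<close>

lemma push_push:
  assumes M: "smooth_charts M" and N: "smooth_charts N" and P: "smooth_charts P"
    and F: "smooth_map M N F" and G: "smooth_map N P G" and p: "p \<in> points M"
  shows "push P G (F p) (push N F p v) = push P (G \<circ> F) p v"
proof
  fix f
  show "push P G (F p) (push N F p v) f = push P (G \<circ> F) p v f"
    using smooth_map_near[OF N P G smooth_map_points[OF F p], of f] by (auto simp: push_def o_def)
qed

lemma push_inj_iff:
  assumes M: "smooth_charts M" and N: "smooth_charts N" and F: "smooth_map M N F"
    and c: "c \<in> atlas M" "p \<in> fst c" and c': "c' \<in> atlas N" "F p \<in> fst c'"
  shows "inj_on (push N F p) (tangent_space M p) \<longleftrightarrow>
    (\<forall>v. dpartial v (\<lambda>x. snd c' (F (cinv c x))) (snd c p) = 0 \<longrightarrow> v = 0)"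
proof -
  let ?D = "\<lambda>v. dpartial v (\<lambda>x. snd c' (F (cinv c x))) (snd c p)"
  obtain O' where "open O'" "snd c p \<in> O'" "smooth_on O' (\<lambda>x. snd c' (F (cinv c x)))"
    using chart_rep_differentiable[OF M N F c c'] by metis
  then have lin: "linear ?D" using smooth_on_at linear_dpartial by blast
  have "inj_on (push N F p) (tangent_space M p) \<longleftrightarrow> inj ?D"
    unfolding tangent_space_chart[OF M c] inj_on_def
    using push_tv[OF M N F c c'] tv_inject[OF M c] tv_inject[OF N c'] by auto
  also have "\<dots> \<longleftrightarrow> (\<forall>v. ?D v = 0 \<longrightarrow> v = 0)" using linear_injective_0[OF lin] .
  finally show ?thesis .
qed

lemma push_id:
  assumes M: "smooth_charts M" and p: "p \<in> points M" and v: "v \<in> tangent_space M p"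
  shows "push M id p v = v"
proof -
  obtain c where c: "c \<in> atlas M" "p \<in> fst c" using chart_exists[OF M p] by blast
  then show ?thesis using v unfolding tangent_space_chart[OF M c] by (auto simp: push_def fun_eq_iff tv_apply[OF M])
qed

section \<open>Open subsets of Euclidean spaces\<close>

lemma euclid_simps [simp]:
  "mtop (euclid V) = top_of_set V" "atlas (euclid V) = {(V, id)}" "points (euclid V) = V"
  by (simp_all add: euclid_def)

lemma cinv_euclid: "x \<in> V \<Longrightarrow> cinv (V, id) x = x"
  by (rule cinv_eqI) auto

lemma smooth_charts_euclid:
  assumes V: "open V" shows "smooth_charts (euclid V)"
proof -
  have "smooth_on V (id \<circ> cinv (V, id))"
    by (rule smooth_on_cong[OF V _ smooth_on_ident]) (simp add: cinv_euclid)
  moreover have "homeomorphic_map (top_of_set V) (top_of_set V) id" by (simp add: homeomorphic_map_id)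
  ultimately show ?thesis using V by (simp add: smooth_charts_def subtopology_subtopology)
qed

lemma smooth_into_euclid_id: "open V \<Longrightarrow> smooth_into (euclid V) V (\<lambda>y. y)"
  by (rule smooth_intoI_chart[OF smooth_charts_euclid, of V V "(V, id)"]) auto

lemma smooth_into_euclid:
  assumes V: "open V" and U: "smooth_into (euclid V) U K"
  shows "smooth_on U K" "K ` U \<subseteq> V"
proof -
  show K: "K ` U \<subseteq> V" using smooth_into_points[OF smooth_charts_euclid[OF V] U] by auto
  show "smooth_on U K" using smooth_into_smooth_on[OF smooth_charts_euclid[OF V] U, of "(V, id)"] K by simp
qed

lemma smooth_map_euclid:
  fixes V :: "'g::euclidean_space set"
  assumes M: "smooth_charts M" and V: "open V"
  shows "smooth_map (euclid V) M G \<longleftrightarrow> smooth_into M V G"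
proof
  assume "smooth_map (euclid V) M G"
  then show "smooth_into M V G"
    using smooth_map_imp_into[OF smooth_charts_euclid[OF V] M _ smooth_into_euclid_id[OF V]] by blast
next
  assume G: "smooth_into M V G"
  show "smooth_map (euclid V) M G"
  proof (rule smooth_mapI_into[OF smooth_charts_euclid[OF V] M])
    fix U and K :: "'g \<Rightarrow> 'g" assume "open U" "smooth_into (euclid V) U K"
    then show "smooth_into M U (\<lambda>y. G (K y))"
      by (intro smooth_into_compose[OF G] smooth_into_euclid[OF V])
  qed
qed

section \<open>Submanifolds\<close>

lemma submanifold_simps:
  "mtop (submanifold M S) = subtopology (mtop M) S" "points (submanifold M S) = points M \<inter> S"
  by (simp_all add: submanifold_def)

context
  fixes M :: "('a, 'e::euclidean_space) mfd" assumes M: "smooth_charts M"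
begin

text \<open>The atlas of a submanifold is specified through inverse charts. The homeomorphism and
  immersion properties in terms of the charts themselves are recovered here from
  \<open>smooth_embedding\<close>.\<close>

lemma submanifold_chart:
  fixes S :: "'a set"
  assumes b: "b \<in> atlas (submanifold M S :: ('a, 'f::euclidean_space) mfd)"
  shows "fst b \<subseteq> points M \<inter> S" "openin (subtopology (mtop M) S) (fst b)" "open (snd b ` fst b)" "inj_on (snd b) (fst b)"
    "smooth_into M (snd b ` fst b) (cinv b)"
    "homeomorphic_map (subtopology (mtop M) (fst b)) (top_of_set (snd b ` fst b)) (snd b)"
    "\<And>c y v. c \<in> atlas M \<Longrightarrow> y \<in> snd b ` fst b \<Longrightarrow> cinv b y \<in> fst c \<Longrightarrow> dpartial v (\<lambda>x. snd c (cinv b x)) y = 0 \<Longrightarrow> v = 0"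
proof -
  have b': "openin (subtopology (mtop M) S) (fst b)" "inj_on (snd b) (fst b)" "open (snd b ` fst b)"
    "smooth_embedding (euclid (snd b ` fst b)) M (cinv b)"
    using b by (auto simp: submanifold_def)
  show "openin (subtopology (mtop M) S) (fst b)" "inj_on (snd b) (fst b)" and o: "open (snd b ` fst b)" using b' by auto
  show sub: "fst b \<subseteq> points M \<inter> S" using openin_subset[OF b'(1)] by simp
  have sm: "smooth_map (euclid (snd b ` fst b)) M (cinv b)" using b'(4) by (simp add: smooth_embedding_def)
  then show "smooth_into M (snd b ` fst b) (cinv b)" using smooth_map_euclid[OF M o] by blast
  have im: "cinv b ` (snd b ` fst b) = fst b" using cinv_chart[OF b'(2)] by (force simp: image_iff)
  have "embedding_map (top_of_set (snd b ` fst b)) (mtop M) (cinv b)" using b'(4) by (simp add: smooth_embedding_def)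
  then have hm: "homeomorphic_map (top_of_set (snd b ` fst b)) (subtopology (mtop M) (fst b)) (cinv b)"
    by (simp add: embedding_map_def im)
  then obtain k where k: "homeomorphic_maps (top_of_set (snd b ` fst b)) (subtopology (mtop M) (fst b)) (cinv b) k"
    using homeomorphic_map_maps by blast
  then have k2: "homeomorphic_map (subtopology (mtop M) (fst b)) (top_of_set (snd b ` fst b)) k"
    using homeomorphic_maps_map by blast
  have "k p = snd b p" if "p \<in> fst b" for p
  proof -
    have "k (cinv b (snd b p)) = snd b p" using k that by (auto simp: homeomorphic_maps_def)
    then show ?thesis using cinv_chart[OF b'(2) that] by simp
  qed
  then show "homeomorphic_map (subtopology (mtop M) (fst b)) (top_of_set (snd b ` fst b)) (snd b)"
    using homeomorphic_map_eq[OF k2] sub by simp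
  show "v = 0" if c: "c \<in> atlas M" and y: "y \<in> snd b ` fst b" "cinv b y \<in> fst c"
    and v: "dpartial v (\<lambda>x. snd c (cinv b x)) y = 0" for c y v
  proof -
    have "\<forall>p\<in>points (euclid (snd b ` fst b)). inj_on (push M (cinv b) p) (tangent_space (euclid (snd b ` fst b)) p)"
      using b'(4) unfolding smooth_embedding_def by (elim conjE)
    then have "inj_on (push M (cinv b) y) (tangent_space (euclid (snd b ` fst b)) y)"
      by (rule bspec) (simp only: euclid_simps topspace_euclidean_subtopology y)
    moreover have "dpartial v (\<lambda>x. snd c (cinv b (cinv (snd b ` fst b, id) x))) y = dpartial v (\<lambda>x. snd c (cinv b x)) y"
      by (rule dpartial_cong[OF o y(1)]) (simp add: cinv_euclid)
    ultimately show "v = 0"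
      using push_inj_iff[OF smooth_charts_euclid[OF o] M sm, of "(snd b ` fst b, id)" y c] c y v by simp
  qed
qed

text \<open>The expression in the chart is continuous because the chart is a homeomorphism for the
  topology of \<open>M\<close>, and it lifts the plot \<open>G\<close> through the immersion
  \<open>cinv b\<close>; a continuous lift through an immersion is smooth.\<close>

lemma submanifold_chart_smooth:
  fixes S :: "'a set" and G :: "'g::euclidean_space \<Rightarrow> 'a"
  assumes b: "b \<in> atlas (submanifold M S :: ('a, 'f::euclidean_space) mfd)"
    and G: "smooth_into M V G" "open V" "G ` V \<subseteq> fst b"
  shows "smooth_on V (\<lambda>y. snd b (G y))"
proof (rule smooth_on_local)
  note b' = submanifold_chart[OF b]
  fix y assume y: "y \<in> V"
  then have Gy: "G y \<in> fst b" using G by blast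
  then obtain c where c: "c \<in> atlas M" "G y \<in> fst c" using b'(1) chart_exists[OF M] by blast
  have bG: "cinv b (snd b (G z)) = G z" if "z \<in> V" for z using that G(3) cinv_chart[OF b'(4)] by blast
  obtain T where T: "open T" "snd b (G y) \<in> T" "T \<subseteq> snd b ` fst b" "cinv b ` T \<subseteq> fst c"
    "smooth_on T (\<lambda>z. snd c (cinv b z))"
    by (rule smooth_into_chart[OF M b'(5) _ c(1), of "snd b (G y)"]) (use Gy c bG[OF y] in auto)
  obtain O1 where O1: "open O1" "y \<in> O1" "O1 \<subseteq> V" "G ` O1 \<subseteq> fst c" "smooth_on O1 (\<lambda>z. snd c (G z))"
    by (rule smooth_into_chart[OF M G(1) y c])
  have "continuous_map (top_of_set V) (subtopology (mtop M) (fst b)) G"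
    using smooth_into_continuous_map[OF M G(1,2)] G(3) by (auto simp: continuous_map_in_subtopology)
  then have "continuous_map (top_of_set V) (top_of_set (snd b ` fst b)) (snd b \<circ> G)"
    using continuous_map_compose homeomorphic_imp_continuous_map[OF b'(6)] by blast
  then have cont: "continuous_on V (\<lambda>y. snd b (G y))"
    by (simp add: continuous_map_in_subtopology o_def)
  let ?O = "O1 \<inter> (V \<inter> (\<lambda>y. snd b (G y)) -` T)"
  have oO: "open ?O" using O1(1) continuous_open_preimage[OF cont G(2) T(1)] by blast
  have "smooth_on ?O (\<lambda>y. snd b (G y))"
  proof (rule smooth_on_lift[OF T(1,5) _ oO])
    show "v = 0" if "z \<in> T" "dpartial v (\<lambda>z. snd c (cinv b z)) z = 0" for z v
      using b'(7)[OF c(1), of z v] that T by blast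
    show "continuous_on ?O (\<lambda>y. snd b (G y))" by (rule continuous_on_subset[OF cont]) auto
    show "(\<lambda>y. snd b (G y)) ` ?O \<subseteq> T" by blast
    show "smooth_on ?O (\<lambda>y. snd c (cinv b (snd b (G y))))"
      by (rule smooth_on_cong[OF oO _ smooth_on_subset[OF O1(5)]]) (use bG in auto)
  qed
  then show "\<exists>T. open T \<and> y \<in> T \<and> smooth_on T (\<lambda>y. snd b (G y))" using oO O1 y T(2) by blast
qed

text \<open>Once the charts cover, compatibility is automatic: a transition map is a chart applied
  to another inverse chart, which is a plot of \<open>M\<close>.\<close>

lemma smooth_charts_submanifold:
  assumes S: "S \<subseteq> points M"
    and cov: "\<And>p. p \<in> S \<Longrightarrow> \<exists>b\<in>atlas (submanifold M S :: ('a, 'f::euclidean_space) mfd). p \<in> fst b"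
  shows "smooth_charts (submanifold M S :: ('a, 'f) mfd)"
proof -
  let ?N = "submanifold M S :: ('a, 'f) mfd"
  have "(\<Union>b\<in>atlas ?N. fst b) = points ?N"
    using cov submanifold_chart(1) S by (fastforce simp: submanifold_simps)
  moreover have "homeomorphic_map (subtopology (mtop ?N) (fst b)) (top_of_set (snd b ` fst b)) (snd b)" if "b \<in> atlas ?N" for b
  proof -
    have "S \<inter> fst b = fst b" using submanifold_chart(1)[OF that] by blast
    then show ?thesis using submanifold_chart(6)[OF that] by (simp add: submanifold_simps subtopology_subtopology)
  qed
  moreover have "smooth_on (snd b ` (fst b \<inter> fst b')) (snd b' \<circ> cinv b)" if b: "b \<in> atlas ?N" and b': "b' \<in> atlas ?N" for b b'
  proof -
    note f = submanifold_chart[OF b]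
    have "openin (subtopology (mtop M) S) (fst b \<inter> fst b')"
      using f(2) submanifold_chart(2)[OF b'] by blast
    then obtain W where W: "openin (mtop M) W" "fst b \<inter> fst b' = W \<inter> S" unfolding openin_subtopology by blast
    then have "fst b \<inter> fst b' = W \<inter> fst b" using f(1) by blast
    then have "openin (subtopology (mtop M) (fst b)) (fst b \<inter> fst b')" unfolding openin_subtopology using W(1) by blast
    then have "openin (top_of_set (snd b ` fst b)) (snd b ` (fst b \<inter> fst b'))"
      using homeomorphic_imp_open_map[OF f(6)] unfolding open_map_def by blast
    then have o: "open (snd b ` (fst b \<inter> fst b'))" using f(3) openin_open_trans by blast
    have "smooth_on (snd b ` (fst b \<inter> fst b')) (\<lambda>y. snd b' (cinv b y))"
      by (rule submanifold_chart_smooth[OF b' smooth_into_subset[OF f(5) o]]) (use o cinv_chart[OF f(4)] in auto)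
    then show ?thesis by (simp add: o_def)
  qed
  ultimately show ?thesis
    unfolding smooth_charts_def using submanifold_chart(2,3) by (auto simp: submanifold_simps)
qed

context
  fixes S :: "'a set" and N :: "('a, 'f::euclidean_space) mfd"
  assumes N_def: "N = submanifold M S" and N: "smooth_charts N"
begin

text \<open>The smooth structure of a submanifold is the one induced by \<open>M\<close> on plots;
  smoothness of the inclusion and of maps with restricted target follows at once.\<close>

lemma smooth_into_submanifold:
  assumes V: "open V" shows "smooth_into N V G \<longleftrightarrow> smooth_into M V G \<and> G ` V \<subseteq> S"
proof
  assume G: "smooth_into N V G"
  have "smooth_into M V G"
  proof (rule smooth_into_local)
    fix y assume y: "y \<in> V"
    then obtain b O' where b: "b \<in> atlas N" "open O'" "y \<in> O'" "O' \<subseteq> V" "G ` O' \<subseteq> fst b" "smooth_on O' (\<lambda>z. snd b (G z))"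
      using G unfolding smooth_into_def by blast
    note f = submanifold_chart[OF b(1)[unfolded N_def]]
    have "smooth_into M O' (\<lambda>z. cinv b (snd b (G z)))"
      by (rule smooth_into_compose[OF f(5) b(2,6)]) (use b in auto)
    then have "smooth_into M O' G" by (rule smooth_into_cong) (use b cinv_chart[OF f(4)] in auto)
    then show "\<exists>O'. open O' \<and> y \<in> O' \<and> O' \<subseteq> V \<and> smooth_into M O' G" using b by blast
  qed
  moreover have "G ` V \<subseteq> S" using smooth_into_points[OF N G] by (auto simp: N_def submanifold_simps)
  ultimately show "smooth_into M V G \<and> G ` V \<subseteq> S" by blast
next
  assume G: "smooth_into M V G \<and> G ` V \<subseteq> S"
  show "smooth_into N V G"
  proof (rule smooth_into_local)
    fix y assume y: "y \<in> V"
    then have "G y \<in> points N" using G smooth_into_points[OF M] by (auto simp: N_def submanifold_simps)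
    then obtain b where b: "b \<in> atlas N" "G y \<in> fst b" using chart_exists[OF N] by blast
    note f = submanifold_chart[OF b(1)[unfolded N_def]]
    obtain W where W: "openin (mtop M) W" "fst b = W \<inter> S" using f(2) unfolding openin_subtopology by blast
    let ?O = "{z \<in> V. G z \<in> W}"
    have o: "open ?O" using smooth_into_preimage[OF M] G W by blast
    have sub: "G ` ?O \<subseteq> fst b" using G W by blast
    have "smooth_into N ?O G"
    proof (rule smooth_intoI_chart[OF N o b(1) sub])
      show "smooth_on ?O (\<lambda>z. snd b (G z))"
        by (rule submanifold_chart_smooth[OF b(1)[unfolded N_def] smooth_into_subset[OF _ o] o sub]) (use G in auto)
    qed
    then show "\<exists>O'. open O' \<and> y \<in> O' \<and> O' \<subseteq> V \<and> smooth_into N O' G" using o y b(2) W by blast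
  qed
qed

lemma smooth_map_inclusion: "smooth_map N M id"
  by (rule smooth_mapI_into[OF N M]) (simp add: smooth_into_submanifold)

lemma smooth_map_into_submanifold:
  assumes P: "smooth_charts P" and F: "smooth_map P M F" "F ` points P \<subseteq> S" shows "smooth_map P N F"
proof (rule smooth_mapI_into[OF P N])
  fix V and G :: "'c \<Rightarrow> 'b" assume V: "open V" "smooth_into P V G"
  then show "smooth_into N V (\<lambda>y. F (G y))"
    using smooth_map_imp_into[OF P M F(1) V(2)] smooth_into_points[OF P V(2)] F(2) smooth_into_submanifold by blast
qed

lemma inclusion_immersion:
  assumes p: "p \<in> points N" shows "inj_on (push M id p) (tangent_space N p)"
proof -
  obtain b where b: "b \<in> atlas N" "p \<in> fst b" using chart_exists[OF N p] by blast
  note f = submanifold_chart[OF b(1)[unfolded N_def]]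
  obtain c where c: "c \<in> atlas M" "p \<in> fst c" using f(1) b chart_exists[OF M] by blast
  show ?thesis
    using push_inj_iff[OF N M smooth_map_inclusion b c(1)] c(2) f(7)[OF c(1), of "snd b p"] b(2)
    by (simp add: cinv_chart[OF f(4) b(2)])
qed

end

text \<open>The chart at \<open>p\<close> is \<open>\<pi> \<circ> snd c\<close>, with inverse \<open>cinv c \<circ> F\<close>, where \<open>F\<close> is the local
  parametrization of the zero set.\<close>

lemma hypersurface_chart:
  assumes W: "openin (mtop M) W" "p \<in> W" and S: "S \<inter> W = {q \<in> W. f q = 0}" and p: "p \<in> S"
    and f: "fun_smooth M W f" and c: "c \<in> atlas M" "p \<in> fst c" and nz: "tv M c p w f \<noteq> 0"
    and dim: "DIM('f::euclidean_space) + 1 = DIM('e)"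
  shows "\<exists>b\<in>atlas (submanifold M S :: ('a, 'f) mfd). p \<in> fst b"
proof -
  let ?O = "snd c ` (fst c \<inter> W)"
  have cp: "cinv c (snd c p) = p" using cinv_chart[OF chart_inj[OF M c(1)] c(2)] .
  have O: "open ?O" "smooth_on ?O (\<lambda>x. f (cinv c x))" "snd c p \<in> ?O"
    using chart_open_image[OF M c(1) W(1)] f c W by (auto simp: fun_smooth_def o_def)
  have "f p = 0" using p W S by blast
  then have f0: "f (cinv c (snd c p)) = 0" by (simp add: cp)
  have "dpartial w (\<lambda>x. f (cinv c x)) (snd c p) \<noteq> 0" using nz by (auto simp: tv_apply[OF M] split: if_splits)
  from local_parametrization[OF O f0 this dim]
  obtain U and V :: "'f set" and F \<pi> where UV: "open U" "snd c p \<in> U" "U \<subseteq> ?O" "open V" "smooth_on V F" "linear \<pi>"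
    "\<And>y. y \<in> V \<Longrightarrow> \<pi> (F y) = y" "F ` V = {x \<in> U. f (cinv c x) = 0}" by blast
  define G where "G y = cinv c (F y)" for y
  define b where "b = (G ` V, \<lambda>q. \<pi> (snd c q))"
  have UO: "U \<subseteq> snd c ` fst c" using UV(3) by blast
  have FU: "F y \<in> U" "f (cinv c (F y)) = 0" if "y \<in> V" for y using UV(8) that by auto
  have Gc: "G y \<in> fst c" "snd c (G y) = F y" if "y \<in> V" for y
    unfolding G_def using subsetD[OF UO FU(1)[OF that]] by (rule cinv_in, rule chart_cinv)
  have bG: "snd b (G y) = y" if "y \<in> V" for y using that UV(7) Gc by (simp add: b_def)
  have fb: "fst b = G ` V" and sb: "snd b ` fst b = V" using bG by (force simp: b_def image_iff)+
  have inj: "inj_on (snd b) (fst b)" using bG by (auto simp: fb intro!: inj_onI)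
  have cb: "cinv b y = G y" if "y \<in> V" for y by (rule cinv_eqI[OF inj]) (use that bG fb in auto)
  \<comment> \<open>This shows that the chart domain is open in \<open>S\<close>, as membership in
    the atlas of \<open>submanifold\<close> requires.\<close>
  have GV: "G ` V = {q \<in> fst c. snd c q \<in> U} \<inter> S"
  proof (intro equalityI subsetI)
    fix q assume "q \<in> G ` V"
    then obtain y where y: "y \<in> V" "q = G y" by blast
    obtain r where r: "r \<in> fst c" "r \<in> W" "snd c r = F y" using FU[OF y(1)] UV(3) by fastforce
    then have "G y = r" unfolding G_def using cinv_eqI[OF chart_inj[OF M c(1)]] by blast
    moreover have "f (G y) = 0" using FU(2)[OF y(1)] by (simp add: G_def)
    ultimately show "q \<in> {q \<in> fst c. snd c q \<in> U} \<inter> S" using r y FU[OF y(1)] S by auto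
  next
    fix q assume q: "q \<in> {q \<in> fst c. snd c q \<in> U} \<inter> S"
    then obtain r where r: "r \<in> fst c" "r \<in> W" "snd c r = snd c q" using UV(3) by fastforce
    then have "r = q" using chart_inj[OF M c(1)] q by (auto dest: inj_onD)
    then have qW: "q \<in> W" using r by simp
    have cq: "cinv c (snd c q) = q" using q cinv_chart[OF chart_inj[OF M c(1)]] by blast
    have "snd c q \<in> F ` V" unfolding UV(8) using q qW S by (auto simp: cq)
    then obtain y where "y \<in> V" "F y = snd c q" by (metis imageE)
    then show "q \<in> G ` V" using cq unfolding G_def by (metis imageI)
  qed
  have oV: "openin (mtop M) {q \<in> fst c. snd c q \<in> U}" by (rule chart_vimage_open[OF M c(1) UV(1)])
  have sG: "smooth_into M V G" unfolding G_def
    by (rule smooth_into_compose[OF smooth_into_cinv[OF M c(1)] UV(4,5)]) (use FU UO in auto)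
  have sb': "smooth_into M V (cinv b)" by (rule smooth_into_cong[OF sG]) (simp add: cb)
  have "smooth_embedding (euclid V) M (cinv b)" unfolding smooth_embedding_def
  proof (intro conjI ballI)
    show sm: "smooth_map (euclid V) M (cinv b)" using smooth_map_euclid[OF M UV(4)] sb' by blast
    have im: "cinv b ` V = G ` V" using cb by auto
    have "continuous_map (subtopology (mtop M) (fst c)) (top_of_set (snd c ` fst c)) (snd c)"
      by (rule homeomorphic_imp_continuous_map[OF chart_homeo[OF M c(1)]])
    then have "continuous_map (subtopology (mtop M) (fst c)) euclidean (snd c)"
      by (simp add: continuous_map_in_subtopology)
    moreover have "continuous_map euclidean euclidean \<pi>"
      using UV(6) linear_continuous_on linear_conv_bounded_linear by (metis continuous_map_iff_continuous2)
    ultimately have "continuous_map (subtopology (mtop M) (fst c)) euclidean (\<lambda>q. \<pi> (snd c q))"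
      using continuous_map_compose unfolding o_def by blast
    moreover have "G ` V \<subseteq> fst c" using Gc(1) by blast
    ultimately have "continuous_map (subtopology (mtop M) (G ` V)) euclidean (\<lambda>q. \<pi> (snd c q))"
      by (rule continuous_map_from_subtopology_mono)
    then have "continuous_map (subtopology (mtop M) (G ` V)) euclidean (snd b)" by (simp add: b_def)
    then have "continuous_map (subtopology (mtop M) (G ` V)) (top_of_set V) (snd b)"
      using bG by (auto simp: continuous_map_in_subtopology)
    moreover have "continuous_map (top_of_set V) (subtopology (mtop M) (G ` V)) (cinv b)"
      using smooth_into_continuous_map[OF M sb' UV(4)] im by (auto simp: continuous_map_in_subtopology)
    ultimately have "homeomorphic_maps (top_of_set V) (subtopology (mtop M) (G ` V)) (cinv b) (snd b)"
      using cb bG by (auto simp: homeomorphic_maps_def)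
    then have "homeomorphic_map (top_of_set V) (subtopology (mtop M) (G ` V)) (cinv b)"
      using homeomorphic_map_maps by blast
    then show "embedding_map (mtop (euclid V)) (mtop M) (cinv b)" by (simp add: embedding_map_def im)
    fix y assume y: "y \<in> points (euclid V)"
    \<comment> \<open>\<pi> is a linear left inverse of \<open>F\<close>, so the derivative of
      \<open>F\<close> is injective.\<close>
    have "v = 0" if v: "dpartial v (\<lambda>x. snd c (cinv b (cinv (V, id) x))) y = 0" for v
    proof -
      have yV: "y \<in> V" using y by simp
      have F: "F differentiable (at y)" using smooth_on_at[OF UV(5,4) yV] .
      have b\<pi>: "bounded_linear \<pi>" using UV(6) by (simp add: linear_conv_bounded_linear)
      have "dpartial v (\<lambda>x. snd c (cinv b (cinv (V, id) x))) y = dpartial v F y"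
        by (rule dpartial_cong[OF UV(4) yV]) (simp add: cinv_euclid cb Gc)
      then have "dpartial v F y = 0" using v by simp
      then have "dpartial v (\<lambda>x. \<pi> (F x)) y = 0" using dpartial_linear[OF b\<pi> F] UV(6) by (simp add: linear_0)
      moreover have "dpartial v (\<lambda>x. \<pi> (F x)) y = dpartial v (\<lambda>x. x) y"
        by (rule dpartial_cong[OF UV(4) yV]) (simp add: UV(7))
      moreover have "dpartial v (\<lambda>x. x) y = v" by (rule dpartial_bounded_linear) simp
      ultimately show ?thesis by simp
    qed
    then show "inj_on (push M (cinv b) y) (tangent_space (euclid V) y)"
      using push_inj_iff[OF smooth_charts_euclid[OF UV(4)] M sm, of "(V, id)" y c] c(1) y cb Gc by simp
  qed
  then have "b \<in> atlas (submanifold M S)"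
    using UV(4) inj oV unfolding submanifold_def by (auto simp: sb openin_subtopology) (metis fb GV)
  moreover have "p \<in> fst b" using fb GV p c UV(2) by blast
  ultimately show ?thesis by blast
qed

end


section \<open>Families of linear and bilinear maps\<close>

lemma linear_Basis_sum:
  fixes A :: "'k::euclidean_space \<Rightarrow> 'c::real_normed_vector"
  assumes "linear A" shows "A v = (\<Sum>k\<in>Basis. (v \<bullet> k) *\<^sub>R A k)"
proof -
  have "A v = A (\<Sum>k\<in>Basis. (v \<bullet> k) *\<^sub>R k)" by (simp add: euclidean_representation)
  also have "\<dots> = (\<Sum>k\<in>Basis. (v \<bullet> k) *\<^sub>R A k)" by (simp add: linear_sum[OF assms] linear_scale[OF assms])
  finally show ?thesis .
qed

lemma bilinearD:
  assumes "bilinear B" shows "linear (B v)" "linear (\<lambda>v. B v w)"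
  using assms by (auto simp: bilinear_def)

text \<open>The product rule for a point-dependent linear map applied to a varying vector. Expansion
  in \<open>Basis\<close> reduces it to scalar coefficients; in the first summand the vector is
  frozen at \<open>y\<close>.\<close>

lemma dpartial_linear_family:
  fixes A :: "'a::euclidean_space \<Rightarrow> 'k::euclidean_space \<Rightarrow> 'c::real_normed_vector"
  assumes S: "open S" "y \<in> S" and lin: "\<And>z. z \<in> S \<Longrightarrow> linear (A z)"
    and dA: "\<And>k. k \<in> Basis \<Longrightarrow> (\<lambda>z. A z k) differentiable (at y)" and dV: "V differentiable (at y)"
  shows "(\<lambda>z. A z (V z)) differentiable (at y)"
    and "dpartial u (\<lambda>z. A z (V z)) y = dpartial u (\<lambda>z. A z (V y)) y + A y (dpartial u V y)"
proof -
  have D: "((\<lambda>z. A z (V z)) has_derivative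
      (\<lambda>u. \<Sum>k\<in>Basis. (V y \<bullet> k) *\<^sub>R dpartial u (\<lambda>z. A z k) y + (dpartial u V y \<bullet> k) *\<^sub>R A y k)) (at y)"
    if dV: "V differentiable (at y)" for V
  proof (rule has_derivative_transform_within_open[OF _ S])
    show "((\<lambda>z. \<Sum>k\<in>Basis. (V z \<bullet> k) *\<^sub>R A z k) has_derivative
      (\<lambda>u. \<Sum>k\<in>Basis. (V y \<bullet> k) *\<^sub>R dpartial u (\<lambda>z. A z k) y + (dpartial u V y \<bullet> k) *\<^sub>R A y k)) (at y)"
      by (intro has_derivative_sum has_derivative_scaleR has_derivative_inner_left has_derivative_dpartial dA dV)
    show "(\<Sum>k\<in>Basis. (V z \<bullet> k) *\<^sub>R A z k) = A z (V z)" if "z \<in> S" for z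
      by (rule linear_Basis_sum[OF lin[OF that], symmetric])
  qed
  show "(\<lambda>z. A z (V z)) differentiable (at y)" using D[OF dV] by (rule differentiableI)
  have "dpartial u (\<lambda>z. A z (V z)) y = (\<Sum>k\<in>Basis. (V y \<bullet> k) *\<^sub>R dpartial u (\<lambda>z. A z k) y) + A y (dpartial u V y)"
    unfolding dpartial_eqI[OF D[OF dV]] linear_Basis_sum[OF lin[OF S(2)], of "dpartial u V y"] by (rule sum.distrib)
  moreover have "dpartial u (\<lambda>z. A z (V y)) y = (\<Sum>k\<in>Basis. (V y \<bullet> k) *\<^sub>R dpartial u (\<lambda>z. A z k) y)"
    using dpartial_eqI[OF D[of "\<lambda>_. V y"], of u] by simp
  ultimately show "dpartial u (\<lambda>z. A z (V z)) y = dpartial u (\<lambda>z. A z (V y)) y + A y (dpartial u V y)" by simp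
qed

lemma smooth_on_linear_family:
  fixes A :: "'a::euclidean_space \<Rightarrow> 'k::euclidean_space \<Rightarrow> 'c::real_normed_vector"
  assumes S: "open S" and lin: "\<And>z. z \<in> S \<Longrightarrow> linear (A z)"
    and A: "\<And>k. k \<in> Basis \<Longrightarrow> smooth_on S (\<lambda>z. A z k)" and V: "smooth_on S V"
  shows "smooth_on S (\<lambda>z. A z (V z))"
proof (rule smooth_on_cong[OF S])
  show "smooth_on S (\<lambda>z. \<Sum>k\<in>Basis. (V z \<bullet> k) *\<^sub>R A z k)"
    by (intro smooth_on_sum smooth_on_scaleR smooth_on_component S V A)
  show "(\<Sum>k\<in>Basis. (V z \<bullet> k) *\<^sub>R A z k) = A z (V z)" if "z \<in> S" for z
    by (rule linear_Basis_sum[OF lin[OF that], symmetric])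
qed

lemma smooth_on_bilinear_family:
  fixes B :: "'a::euclidean_space \<Rightarrow> 'k::euclidean_space \<Rightarrow> 'm::euclidean_space \<Rightarrow> 'c::real_normed_vector"
  assumes S: "open S" and bil: "\<And>z. z \<in> S \<Longrightarrow> bilinear (B z)"
    and B: "\<And>k l. k \<in> Basis \<Longrightarrow> l \<in> Basis \<Longrightarrow> smooth_on S (\<lambda>z. B z k l)" and V: "smooth_on S V" "smooth_on S W"
  shows "smooth_on S (\<lambda>z. B z (V z) (W z))"
  by (rule smooth_on_linear_family[where A = "\<lambda>z v. B z v (W z)", OF S bilinearD(2)[OF bil] _ V(1)])
    (auto intro: smooth_on_linear_family[OF S bilinearD(1)[OF bil] B V(2)])

lemma dpartial_bilinear_family:
  fixes B :: "'a::euclidean_space \<Rightarrow> 'k::euclidean_space \<Rightarrow> 'm::euclidean_space \<Rightarrow> 'c::real_normed_vector"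
  assumes S: "open S" "y \<in> S" and bil: "\<And>z. z \<in> S \<Longrightarrow> bilinear (B z)"
    and dB: "\<And>k l. k \<in> Basis \<Longrightarrow> l \<in> Basis \<Longrightarrow> (\<lambda>z. B z k l) differentiable (at y)"
    and dV: "V differentiable (at y)" "W differentiable (at y)"
  shows "dpartial u (\<lambda>z. B z (V z) (W z)) y =
    dpartial u (\<lambda>z. B z (V y) (W y)) y + B y (dpartial u V y) (W y) + B y (V y) (dpartial u W y)"
proof -
  note lin = bilinearD[OF bil]
  have 1: "(\<lambda>z. B z k (W z)) differentiable (at y)" if "k \<in> Basis" for k
    by (rule dpartial_linear_family(1)[OF S lin(1) dB[OF that] dV(2)])
  have 2: "(\<lambda>z. B z (V y) l) differentiable (at y)" if "l \<in> Basis" for l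
    by (rule dpartial_linear_family(1)[where A = "\<lambda>z v. B z v l", OF S lin(2) dB[OF _ that]]) auto
  have "dpartial u (\<lambda>z. B z (V z) (W z)) y = dpartial u (\<lambda>z. B z (V y) (W z)) y + B y (dpartial u V y) (W y)"
    by (rule dpartial_linear_family(2)[where A = "\<lambda>z v. B z v (W z)", OF S lin(2) 1 dV(1)])
  also have "dpartial u (\<lambda>z. B z (V y) (W z)) y = dpartial u (\<lambda>z. B z (V y) (W y)) y + B y (V y) (dpartial u W y)"
    by (rule dpartial_linear_family(2)[OF S lin(1) 2 dV(2)])
  finally show ?thesis by simp
qed

text \<open>tr(AB) = tr(BA) for maps between possibly different spaces. It turns the trace that
  defines the Ricci tensor of the hypersurface into an ambient trace.\<close>

lemma trace_commute:
  fixes A :: "'k::euclidean_space \<Rightarrow> 'l::euclidean_space" and B :: "'l \<Rightarrow> 'k"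
  assumes "linear A" "linear B"
  shows "(\<Sum>i\<in>Basis. A (B i) \<bullet> i) = (\<Sum>k\<in>Basis. B (A k) \<bullet> k)"
proof -
  have "(\<Sum>i\<in>Basis. A (B i) \<bullet> i) = (\<Sum>i\<in>Basis. \<Sum>k\<in>Basis. (B i \<bullet> k) * (A k \<bullet> i))"
    by (subst linear_Basis_sum[OF assms(1)]) (simp add: inner_sum_left)
  also have "\<dots> = (\<Sum>k\<in>Basis. \<Sum>i\<in>Basis. (A k \<bullet> i) * (B i \<bullet> k))" by (subst sum.swap) (simp add: mult.commute)
  also have "\<dots> = (\<Sum>k\<in>Basis. B (A k) \<bullet> k)"
    by (subst linear_Basis_sum[OF assms(2)]) (simp add: inner_sum_left)
  finally show ?thesis .
qed

section \<open>The Levi-Civita connection in coordinates\<close>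

locale pseudo_metric =
  fixes G :: "'k::euclidean_space \<Rightarrow> 'k \<Rightarrow> 'k \<Rightarrow> real" and T
  assumes T: "open T" and nd: "x \<in> T \<Longrightarrow> nondegenerate (G x)" and sym: "x \<in> T \<Longrightarrow> G x v w = G x w v"
    and sm: "k \<in> Basis \<Longrightarrow> l \<in> Basis \<Longrightarrow> smooth_on T (\<lambda>x. G x k l)"
begin

text \<open>The Christoffel symbols as a vector-valued bilinear map, i.e. the covariant derivative
  of one constant field along another. Multilinear algebra then replaces most index sums.\<close>

definition gam :: "'k \<Rightarrow> 'k \<Rightarrow> 'k \<Rightarrow> 'k" where
  "gam x v w = (\<Sum>k\<in>Basis. christoffel G x v w k *\<^sub>R k)"

lemma bil: "x \<in> T \<Longrightarrow> bilinear (G x)"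
  using nd by (simp add: nondegenerate_def)

lemma smG: "smooth_on T (\<lambda>x. G x v w)"
  by (rule smooth_on_bilinear_family[OF T bil sm]) auto

lemma diffG: "x \<in> T \<Longrightarrow> (\<lambda>x. G x v w) differentiable (at x)"
  using smooth_on_at[OF smG T] .

lemma dG_linear:
  assumes x: "x \<in> T"
  shows "linear (\<lambda>u. dpartial u (\<lambda>y. G y v w) x)" "linear (\<lambda>v. dpartial u (\<lambda>y. G y v w) x)"
    "linear (\<lambda>w. dpartial u (\<lambda>y. G y v w) x)"
proof -
  show "linear (\<lambda>u. dpartial u (\<lambda>y. G y v w) x)" by (rule linear_dpartial[OF diffG[OF x]])
  have add: "dpartial u (\<lambda>y. G y (a + b) w) x = dpartial u (\<lambda>y. G y a w) x + dpartial u (\<lambda>y. G y b w) x" for a b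
  proof -
    have "dpartial u (\<lambda>y. G y (a + b) w) x = dpartial u (\<lambda>y. G y a w + G y b w) x"
      by (rule dpartial_cong[OF T x]) (simp add: bilinear_ladd[OF bil])
    then show ?thesis by (simp add: dpartial_add[OF diffG[OF x] diffG[OF x]])
  qed
  have scale: "dpartial u (\<lambda>y. G y (r *\<^sub>R a) w) x = r *\<^sub>R dpartial u (\<lambda>y. G y a w) x" for r a
  proof -
    have "dpartial u (\<lambda>y. G y (r *\<^sub>R a) w) x = dpartial u (\<lambda>y. r * G y a w) x"
      by (rule dpartial_cong[OF T x]) (simp add: bilinear_lmul[OF bil])
    then show ?thesis using dpartial_linear[OF bounded_linear_mult_right diffG[OF x]] by simp
  qed
  show l: "linear (\<lambda>v. dpartial u (\<lambda>y. G y v w) x)" by (rule linearI) (rule add, rule scale)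
  have "dpartial u (\<lambda>y. G y v w) x = dpartial u (\<lambda>y. G y w v) x" for v w
    by (rule dpartial_cong[OF T x]) (rule sym)
  note swap = this
  show "linear (\<lambda>w. dpartial u (\<lambda>y. G y v w) x)"
  proof (rule linearI)
    show "dpartial u (\<lambda>y. G y v (a + b)) x = dpartial u (\<lambda>y. G y v a) x + dpartial u (\<lambda>y. G y v b) x" for a b
    proof -
      have "dpartial u (\<lambda>y. G y v (a + b)) x = dpartial u (\<lambda>y. G y v a + G y v b) x"
        by (rule dpartial_cong[OF T x]) (simp add: bilinear_radd[OF bil])
      then show ?thesis by (simp add: dpartial_add[OF diffG[OF x] diffG[OF x]])
    qed
    show "dpartial u (\<lambda>y. G y v (r *\<^sub>R a)) x = r *\<^sub>R dpartial u (\<lambda>y. G y v a) x" for r a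
    proof -
      have "dpartial u (\<lambda>y. G y v (r *\<^sub>R a)) x = dpartial u (\<lambda>y. r * G y v a) x"
        by (rule dpartial_cong[OF T x]) (simp add: bilinear_rmul[OF bil])
      then show ?thesis using dpartial_linear[OF bounded_linear_mult_right diffG[OF x]] by simp
    qed
  qed
qed

definition koszul :: "'k \<Rightarrow> 'k \<Rightarrow> 'k \<Rightarrow> 'k \<Rightarrow> real" where
  "koszul x v w u = dpartial v (\<lambda>y. G y w u) x + dpartial w (\<lambda>y. G y v u) x - dpartial u (\<lambda>y. G y v w) x"

lemma koszul_linear:
  assumes x: "x \<in> T" shows "linear (koszul x v w)" "linear (\<lambda>w. koszul x v w u)" "linear (\<lambda>v. koszul x v w u)"
  unfolding koszul_def
  by (intro linear_compose_add linear_compose_sub dG_linear[OF x])+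

lemma gam_bsolve: "gam x v w = (\<Sum>l\<in>Basis. (koszul x v w l / 2) *\<^sub>R bsolve (G x) l)"
proof -
  have "gam x v w = (\<Sum>k\<in>Basis. ((\<Sum>l\<in>Basis. (koszul x v w l / 2) *\<^sub>R bsolve (G x) l) \<bullet> k) *\<^sub>R k)"
    unfolding gam_def christoffel_def koszul_def ginv_bsolve
    by (intro sum.cong refl) (simp add: inner_sum_left sum_distrib_left sum_distrib_right field_simps)
  then show ?thesis by (simp only: euclidean_representation)
qed

text \<open>The Koszul formula for constant fields, whose brackets vanish. It determines
  \<open>gam\<close> without mention of the inverse matrix, which makes it comparable with its
  counterpart for an induced metric.\<close>

lemma koszul_eq:
  assumes x: "x \<in> T" shows "2 * G x (gam x v w) u = koszul x v w u"
proof -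
  have "G x (gam x v w) u = (\<Sum>l\<in>Basis. (koszul x v w l / 2) * (l \<bullet> u))"
    unfolding gam_bsolve
    by (simp add: linear_sum[OF bilinearD(2)[OF bil[OF x]]] linear_scale[OF bilinearD(2)[OF bil[OF x]]] bsolve[OF nd[OF x]])
  also have "\<dots> = (\<Sum>l\<in>Basis. (u \<bullet> l) *\<^sub>R koszul x v w l) / 2"
    by (simp add: sum_divide_distrib inner_commute mult.commute)
  also have "\<dots> = koszul x v w u / 2" by (simp only: linear_Basis_sum[OF koszul_linear(1)[OF x], symmetric])
  finally show ?thesis by simp
qed

lemma gam_inner: "k \<in> Basis \<Longrightarrow> gam x v w \<bullet> k = christoffel G x v w k"
  by (simp add: gam_def inner_sum_left_Basis inner_sum_left inner_Basis if_distrib cong: if_cong)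

lemma gam_bilinear:
  assumes x: "x \<in> T" shows "bilinear (gam x)"
  unfolding bilinear_def gam_bsolve
  by (intro conjI allI linearI)
    (simp_all add: linear_add[OF koszul_linear(2)[OF x]] linear_scale[OF koszul_linear(2)[OF x]]
      linear_add[OF koszul_linear(3)[OF x]] linear_scale[OF koszul_linear(3)[OF x]]
      scaleR_add_left sum.distrib add_divide_distrib scaleR_sum_right)

lemma gam_sym:
  assumes x: "x \<in> T" shows "gam x v w = gam x w v"
proof -
  have "koszul x v w u = koszul x w v u" for u
    using dpartial_cong[OF T x, of "\<lambda>y. G y v w" "\<lambda>y. G y w v" u] sym by (simp add: koszul_def)
  then show ?thesis by (simp add: gam_bsolve)
qed

lemma smooth_gam: "smooth_on T (\<lambda>x. gam x v w)"
  unfolding gam_bsolve koszul_def divide_inverse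
  by (intro smooth_on_sum smooth_on_scaleR smooth_on_mult smooth_on_add smooth_on_diff T smooth_on_dpartial[OF T smG]
      smooth_on_bsolve[OF T nd sm]) auto

text \<open>The curvature operator R(u, v) w, with the convention R(u, v) = [D_u, D_v] on constant
  fields.\<close>

definition curv :: "'k \<Rightarrow> 'k \<Rightarrow> 'k \<Rightarrow> 'k \<Rightarrow> 'k" where
  "curv x u v w = dpartial u (\<lambda>y. gam y v w) x - dpartial v (\<lambda>y. gam y u w) x
     + gam x u (gam x v w) - gam x v (gam x u w)"

lemma diff_gam: "x \<in> T \<Longrightarrow> (\<lambda>x. gam x v w) differentiable (at x)"
  using smooth_on_at[OF smooth_gam T] .

lemma dgam_linear:
  assumes x: "x \<in> T"
  shows "linear (\<lambda>u. dpartial u (\<lambda>y. gam y v w) x)" "linear (\<lambda>v. dpartial u (\<lambda>y. gam y v w) x)"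
    "linear (\<lambda>w. dpartial u (\<lambda>y. gam y v w) x)"
proof -
  show "linear (\<lambda>u. dpartial u (\<lambda>y. gam y v w) x)" by (rule linear_dpartial[OF diff_gam[OF x]])
  show l: "linear (\<lambda>v. dpartial u (\<lambda>y. gam y v w) x)" for w
  proof (rule linearI)
    show "dpartial u (\<lambda>y. gam y (a + b) w) x = dpartial u (\<lambda>y. gam y a w) x + dpartial u (\<lambda>y. gam y b w) x" for a b
    proof -
      have "dpartial u (\<lambda>y. gam y (a + b) w) x = dpartial u (\<lambda>y. gam y a w + gam y b w) x"
        by (rule dpartial_cong[OF T x]) (simp add: bilinear_ladd[OF gam_bilinear])
      then show ?thesis by (simp add: dpartial_add[OF diff_gam[OF x] diff_gam[OF x]])
    qed
    show "dpartial u (\<lambda>y. gam y (r *\<^sub>R a) w) x = r *\<^sub>R dpartial u (\<lambda>y. gam y a w) x" for r a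
    proof -
      have "dpartial u (\<lambda>y. gam y (r *\<^sub>R a) w) x = dpartial u (\<lambda>y. r *\<^sub>R gam y a w) x"
        by (rule dpartial_cong[OF T x]) (simp add: bilinear_lmul[OF gam_bilinear])
      then show ?thesis using dpartial_linear[OF bounded_linear_scaleR_right diff_gam[OF x]] by simp
    qed
  qed
  have "dpartial u (\<lambda>y. gam y v w) x = dpartial u (\<lambda>y. gam y w v) x" for w
    by (rule dpartial_cong[OF T x]) (rule gam_sym)
  then show "linear (\<lambda>w. dpartial u (\<lambda>y. gam y v w) x)" using l by simp
qed

lemma curv_linear:
  assumes x: "x \<in> T"
  shows "linear (\<lambda>u. curv x u v w)" "linear (\<lambda>v. curv x u v w)" "linear (\<lambda>w. curv x u v w)"
  unfolding curv_def
  by (intro linear_compose_add linear_compose_sub dgam_linear[OF x] bilinearD[OF gam_bilinear[OF x]]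
      linear_compose[OF bilinearD(1)[OF gam_bilinear[OF x]] bilinearD(1)[OF gam_bilinear[OF x]], unfolded o_def]
      linear_compose[OF bilinearD(2)[OF gam_bilinear[OF x]] bilinearD(1)[OF gam_bilinear[OF x]], unfolded o_def])+

text \<open>The coordinate formula is the trace of z \<mapsto> R(z, k) j; after using the symmetry
  of \<open>gam\<close> the summands agree one by one.\<close>

lemma ricci_curv:
  assumes x: "x \<in> T" shows "ricci G x j k = (\<Sum>i\<in>Basis. curv x i k j \<bullet> i)"
  unfolding ricci_def
proof (intro sum.cong refl)
  fix i :: 'k assume i: "i \<in> Basis"
  have d: "dpartial u (\<lambda>y. christoffel G y v w i) x = dpartial u (\<lambda>y. gam y v w) x \<bullet> i" for u v w
    using dpartial_inner_right[OF diff_gam[OF x], of u v w i] by (simp add: gam_inner[OF i])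
  have 1: "(\<Sum>l\<in>Basis. christoffel G x a l i * christoffel G x b c l) = gam x a (gam x b c) \<bullet> i" for a b c
    using linear_Basis_sum[OF bilinearD(1)[OF gam_bilinear[OF x], of a], of "gam x b c"]
    by (simp add: inner_sum_left gam_inner i mult.commute)
  have 2: "dpartial u (\<lambda>y. gam y j k) x = dpartial u (\<lambda>y. gam y k j) x" for u
    by (rule dpartial_cong[OF T x]) (rule gam_sym)
  show "dpartial i (\<lambda>y. christoffel G y j k i) x - dpartial k (\<lambda>y. christoffel G y i j i) x
      + (\<Sum>l\<in>Basis. christoffel G x i l i * christoffel G x j k l - christoffel G x k l i * christoffel G x i j l)
    = curv x i k j \<bullet> i"
    unfolding sum_subtractf 1 d curv_def by (simp add: inner_add_left inner_diff_left 2 gam_sym[OF x, of j k])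
qed

lemma smooth_curv: "smooth_on T (\<lambda>x. curv x u v w)"
  unfolding curv_def
  by (intro smooth_on_add smooth_on_diff T smooth_on_dpartial smooth_gam
      smooth_on_linear_family[where A = "\<lambda>x. gam x u" for u] bilinearD(1)[OF gam_bilinear])

lemma ricci_smooth: "smooth_on T (\<lambda>x. ricci G x j k)"
  by (rule smooth_on_cong[OF T, where f = "\<lambda>x. \<Sum>i\<in>Basis. curv x i k j \<bullet> i"])
    (auto simp: ricci_curv intro!: smooth_on_sum smooth_on_component T smooth_curv)

end

locale form_on_metric = pseudo_metric +
  fixes \<alpha> :: "'a \<Rightarrow> 'a \<Rightarrow> real"
  assumes lin\<alpha>: "x \<in> T \<Longrightarrow> linear (\<alpha> x)" and sm\<alpha>: "k \<in> Basis \<Longrightarrow> smooth_on T (\<lambda>x. \<alpha> x k)"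
begin

text \<open>The covariant derivative of the 1-form \<alpha> as a bilinear form; for the differential
  of a function it is the Hessian.\<close>

definition hess :: "'a \<Rightarrow> 'a \<Rightarrow> 'a \<Rightarrow> real" where
  "hess x u w = dpartial u (\<lambda>y. \<alpha> y w) x - \<alpha> x (gam x u w)"

lemma smooth_\<alpha>: "smooth_on T (\<lambda>x. \<alpha> x w)"
  by (rule smooth_on_linear_family[OF T lin\<alpha> sm\<alpha>]) auto

lemma diff_\<alpha>: "x \<in> T \<Longrightarrow> (\<lambda>x. \<alpha> x w) differentiable (at x)"
  using smooth_on_at[OF smooth_\<alpha> T] .

lemma smooth_\<alpha>_gam: "smooth_on T (\<lambda>y. \<alpha> y (gam y u w))"
  by (rule smooth_on_linear_family[OF T lin\<alpha> sm\<alpha> smooth_gam])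

lemma smooth_hess: "smooth_on T (\<lambda>x. hess x u w)"
  unfolding hess_def by (intro smooth_on_diff T smooth_on_dpartial smooth_\<alpha> smooth_\<alpha>_gam)

lemma d\<alpha>_linear:
  assumes x: "x \<in> T" shows "linear (\<lambda>w. dpartial u (\<lambda>y. \<alpha> y w) x)"
proof (rule linearI)
  show "dpartial u (\<lambda>y. \<alpha> y (a + b)) x = dpartial u (\<lambda>y. \<alpha> y a) x + dpartial u (\<lambda>y. \<alpha> y b) x" for a b
  proof -
    have "dpartial u (\<lambda>y. \<alpha> y (a + b)) x = dpartial u (\<lambda>y. \<alpha> y a + \<alpha> y b) x"
      by (rule dpartial_cong[OF T x]) (simp add: linear_add[OF lin\<alpha>])
    then show ?thesis by (simp add: dpartial_add[OF diff_\<alpha>[OF x] diff_\<alpha>[OF x]])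
  qed
  show "dpartial u (\<lambda>y. \<alpha> y (r *\<^sub>R a)) x = r *\<^sub>R dpartial u (\<lambda>y. \<alpha> y a) x" for r a
  proof -
    have "dpartial u (\<lambda>y. \<alpha> y (r *\<^sub>R a)) x = dpartial u (\<lambda>y. r * \<alpha> y a) x"
      by (rule dpartial_cong[OF T x]) (simp add: linear_scale[OF lin\<alpha>])
    then show ?thesis using dpartial_linear[OF bounded_linear_mult_right diff_\<alpha>[OF x]] by simp
  qed
qed

lemma hess_bilinear:
  assumes x: "x \<in> T" shows "bilinear (hess x)"
  unfolding bilinear_def hess_def
  by (intro conjI allI linear_compose_sub d\<alpha>_linear[OF x] linear_dpartial[OF diff_\<alpha>[OF x]]
      linear_compose[OF bilinearD(1)[OF gam_bilinear[OF x]] lin\<alpha>[OF x], unfolded o_def]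
      linear_compose[OF bilinearD(2)[OF gam_bilinear[OF x]] lin\<alpha>[OF x], unfolded o_def])

lemma hess_nabla_form:
  assumes x: "x \<in> T" shows "nabla_form G \<alpha> x a b = hess x a b"
  unfolding nabla_form_def hess_def
  by (subst linear_Basis_sum[OF lin\<alpha>[OF x], of "gam x a b"]) (simp add: gam_inner)

text \<open>Second partial derivatives of \<alpha> cancel under antisymmetrization, and curvature is
  what remains. The right-hand side contains only \<open>hess\<close> and its first derivatives, so
  it inherits flatness from \<open>hess\<close>.\<close>

lemma ricci_identity:
  assumes x: "x \<in> T"
  shows "\<alpha> x (curv x v u w) = dpartial u (\<lambda>y. hess y v w) x - dpartial v (\<lambda>y. hess y u w) x
    - hess x v (gam x u w) + hess x u (gam x v w)"
proof -
  have d: "dpartial v (\<lambda>y. hess y u w) x = dpartial v (dpartial u (\<lambda>y. \<alpha> y w)) x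
      - (hess x v (gam x u w) + \<alpha> x (gam x v (gam x u w)) + \<alpha> x (dpartial v (\<lambda>y. gam y u w) x))" for u v
  proof -
    have "dpartial v (\<lambda>y. hess y u w) x = dpartial v (dpartial u (\<lambda>y. \<alpha> y w)) x - dpartial v (\<lambda>y. \<alpha> y (gam y u w)) x"
      unfolding hess_def
      by (rule dpartial_diff) (rule smooth_on_at[OF _ T x], intro smooth_on_dpartial T smooth_\<alpha> smooth_\<alpha>_gam)+
    also have "dpartial v (\<lambda>y. \<alpha> y (gam y u w)) x = dpartial v (\<lambda>y. \<alpha> y (gam x u w)) x + \<alpha> x (dpartial v (\<lambda>y. gam y u w) x)"
      by (rule dpartial_linear_family(2)[OF T x lin\<alpha> diff_\<alpha>[OF x] diff_gam[OF x]])
    finally show ?thesis by (simp add: hess_def)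
  qed
  have "dpartial v (dpartial u (\<lambda>y. \<alpha> y w)) x = dpartial u (dpartial v (\<lambda>y. \<alpha> y w)) x"
    by (rule dpartial_commute[OF T smooth_\<alpha> x])
  then show ?thesis unfolding curv_def d
    by (simp add: linear_add[OF lin\<alpha>[OF x]] linear_diff[OF lin\<alpha>[OF x]])
qed

lemma curv_flat:
  assumes x: "x \<in> T" and h: "\<And>a b. a \<in> Basis \<Longrightarrow> b \<in> Basis \<Longrightarrow> flat_on T x (\<lambda>y. hess y a b)"
    and b: "u \<in> Basis" "v \<in> Basis" "w \<in> Basis"
  shows "flat_on T x (\<lambda>y. \<alpha> y (curv y v u w))"
proof (rule flat_on_cong[OF T x ricci_identity[symmetric]])
  have "flat_on T x (\<lambda>y. hess y a (gam y c d))" if a: "a \<in> Basis" for a c d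
  proof (rule flat_on_cong[OF T x])
    show "flat_on T x (\<lambda>y. \<Sum>k\<in>Basis. (gam y c d \<bullet> k) * hess y a k)"
      by (intro flat_on_sum flat_on_mult2 T x smooth_on_component smooth_gam h a)
    show "(\<Sum>k\<in>Basis. (gam y c d \<bullet> k) * hess y a k) = hess y a (gam y c d)" if "y \<in> T" for y
      using linear_Basis_sum[OF bilinearD(1)[OF hess_bilinear[OF that]], of a "gam y c d"] by simp
  qed
  then show "flat_on T x (\<lambda>y. dpartial u (\<lambda>y. hess y v w) y - dpartial v (\<lambda>y. hess y u w) y
      - hess y v (gam y u w) + hess y u (gam y v w))"
    using b by (intro flat_on_add flat_on_diff T x flat_on_dpartial h)
qed

end


section \<open>Hypersurfaces with flat second fundamental form\<close>

text \<open>One chart of the hypersurface inside one ambient chart: \<open>F\<close> is the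
  inclusion in coordinates and \<alpha> is a conormal. The assumption \<open>positive\<close> says
  that the vector dual to \<alpha> is not null, so that tangent and normal directions split.\<close>

locale coordinate_hypersurface =
  amb: form_on_metric G T \<alpha> + sub: pseudo_metric g S
  for G :: "'k::euclidean_space \<Rightarrow> 'k \<Rightarrow> 'k \<Rightarrow> real" and T and \<alpha> :: "'k \<Rightarrow> 'k \<Rightarrow> real"
    and g :: "'l::euclidean_space \<Rightarrow> 'l \<Rightarrow> 'l \<Rightarrow> real" and S +
  fixes F :: "'l \<Rightarrow> 'k"
  assumes F: "smooth_on S F" and FT: "F ` S \<subseteq> T"
    and g_eq: "y \<in> S \<Longrightarrow> g y v w = G (F y) (dpartial v F y) (dpartial w F y)"
    and tangent: "y \<in> S \<Longrightarrow> \<alpha> (F y) (dpartial v F y) = 0"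
    and positive: "y \<in> S \<Longrightarrow> \<alpha> (F y) (\<Sum>k\<in>Basis. \<alpha> (F y) k *\<^sub>R bsolve (G (F y)) k) \<noteq> 0"
    and codim: "DIM('l) + 1 = DIM('k)"
begin

abbreviation "DF y v \<equiv> dpartial v F y"

definition nv :: "'k \<Rightarrow> 'k" where "nv x = (\<Sum>k\<in>Basis. \<alpha> x k *\<^sub>R bsolve (G x) k)"

definition II :: "'l \<Rightarrow> 'l \<Rightarrow> 'l \<Rightarrow> 'k" where
  "II y v w = dpartial v (dpartial w F) y + amb.gam (F y) (DF y v) (DF y w) - DF y (sub.gam y v w)"

lemma Fy: "y \<in> S \<Longrightarrow> F y \<in> T" using FT by blast

lemma DF_lin: "y \<in> S \<Longrightarrow> linear (DF y)"
  using linear_dpartial[OF smooth_on_at[OF F sub.T]] .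

lemma smDF: "smooth_on S (dpartial v F)" using smooth_on_dpartial[OF sub.T F] .

lemma diffDF: "y \<in> S \<Longrightarrow> (dpartial v F) differentiable (at y)" using smooth_on_at[OF smDF sub.T] .

lemma diffF: "y \<in> S \<Longrightarrow> F differentiable (at y)" using smooth_on_at[OF F sub.T] .

lemma smooth_pull: "smooth_on T f \<Longrightarrow> smooth_on S (\<lambda>y. f (F y))"
  by (rule smooth_on_compose[OF sub.T amb.T _ F FT])

lemma nv:
  assumes x: "x \<in> T" shows "G x (nv x) w = \<alpha> x w"
proof -
  have l: "linear (\<lambda>v. G x v w)" using bilinearD(2)[OF amb.bil[OF x]] .
  have "G x (nv x) w = (\<Sum>k\<in>Basis. (w \<bullet> k) *\<^sub>R \<alpha> x k)"
    unfolding nv_def by (simp add: linear_sum[OF l] linear_scale[OF l] bsolve[OF amb.nd[OF x]] inner_commute mult.commute)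
  then show ?thesis using linear_Basis_sum[OF amb.lin\<alpha>[OF x], of w] by simp
qed

lemma smooth_nv: "smooth_on T nv"
  unfolding nv_def[abs_def]
  by (intro smooth_on_sum smooth_on_scaleR amb.T amb.smooth_\<alpha> smooth_on_bsolve[OF amb.T amb.nd amb.sm])

lemma \<alpha>nv: "y \<in> S \<Longrightarrow> \<alpha> (F y) (nv (F y)) \<noteq> 0"
  using positive by (simp add: nv_def)

text \<open>The Koszul expression of the induced metric, expanded by the chain rule, is twice the
  pairing with the second derivative of \<open>F\<close> plus the ambient Koszul expression on
  pushed vectors. So the difference in the Gauss formula is orthogonal to tangent vectors.\<close>

lemma II_inner:
  assumes y: "y \<in> S" shows "G (F y) (II y v w) (DF y u) = 0"
proof -
  note x = Fy[OF y] and l = bilinearD(2)[OF amb.bil[OF Fy[OF y]]]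
  define D where "D a b = dpartial a (dpartial b F) y" for a b
  have Dsym: "D a b = D b a" for a b unfolding D_def by (rule dpartial_commute[OF sub.T F y])
  define K where "K a b c = dpartial (DF y a) (\<lambda>x. G x (DF y b) (DF y c)) (F y)" for a b c
  have dg: "dpartial a (\<lambda>z. g z b c) y = K a b c + G (F y) (D a b) (DF y c) + G (F y) (DF y b) (D a c)" for a b c
  proof -
    have "dpartial a (\<lambda>z. g z b c) y = dpartial a (\<lambda>z. G (F z) (dpartial b F z) (dpartial c F z)) y"
      by (rule dpartial_cong[OF sub.T y]) (rule g_eq)
    also have "\<dots> = dpartial a (\<lambda>z. G (F z) (DF y b) (DF y c)) y + G (F y) (D a b) (DF y c) + G (F y) (DF y b) (D a c)"
      unfolding D_def
      by (rule dpartial_bilinear_family[OF sub.T y amb.bil[OF Fy] _ diffDF[OF y] diffDF[OF y]])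
        (auto intro!: smooth_on_at[OF smooth_pull[OF amb.smG] sub.T y])
    also have "dpartial a (\<lambda>z. G (F z) (DF y b) (DF y c)) y = K a b c"
      unfolding K_def by (rule dpartial_compose[OF amb.diffG[OF x] diffF[OF y]])
    finally show ?thesis .
  qed
  have "2 * g y (sub.gam y v w) u = sub.koszul y v w u" by (rule sub.koszul_eq[OF y])
  \<comment> \<open>Of the six terms with second derivatives of \<open>F\<close>, four cancel by
    symmetry and the other two coincide, which gives the factor 2.\<close>
  moreover have "sub.koszul y v w u = 2 * G (F y) (D v w) (DF y u) + (K v w u + K w v u - K u v w)"
    unfolding sub.koszul_def dg using amb.sym[OF x] Dsym by simp
  moreover have "2 * G (F y) (amb.gam (F y) (DF y v) (DF y w)) (DF y u) = K v w u + K w v u - K u v w"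
    unfolding amb.koszul_eq[OF x] amb.koszul_def K_def ..
  ultimately have "G (F y) (DF y (sub.gam y v w)) (DF y u)
      = G (F y) (D v w) (DF y u) + G (F y) (amb.gam (F y) (DF y v) (DF y w)) (DF y u)"
    unfolding g_eq[OF y] by simp
  then show ?thesis unfolding II_def D_def[symmetric] by (simp add: linear_add[OF l] linear_diff[OF l])
qed

text \<open>Differentiate the identity that \<alpha> annihilates tangent vectors.\<close>

lemma II_\<alpha>:
  assumes y: "y \<in> S" shows "\<alpha> (F y) (II y v w) = - amb.hess (F y) (DF y v) (DF y w)"
proof -
  note x = Fy[OF y]
  have "dpartial v (\<lambda>z. \<alpha> (F z) (dpartial w F z)) y = dpartial v (\<lambda>z. \<alpha> (F z) (DF y w)) y + \<alpha> (F y) (dpartial v (dpartial w F) y)"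
    by (rule dpartial_linear_family(2)[OF sub.T y amb.lin\<alpha>[OF Fy] _ diffDF[OF y]])
      (auto intro!: smooth_on_at[OF smooth_pull[OF amb.smooth_\<alpha>] sub.T y])
  moreover have "dpartial v (\<lambda>z. \<alpha> (F z) (DF y w)) y = dpartial (DF y v) (\<lambda>x. \<alpha> x (DF y w)) (F y)"
    by (rule dpartial_compose[OF amb.diff_\<alpha>[OF x] diffF[OF y]])
  moreover have "dpartial v (\<lambda>z. \<alpha> (F z) (dpartial w F z)) y = dpartial v (\<lambda>_. 0) y"
    by (rule dpartial_cong[OF sub.T y]) (rule tangent)
  ultimately show ?thesis unfolding II_def amb.hess_def
    by (simp add: linear_add[OF amb.lin\<alpha>[OF x]] linear_diff[OF amb.lin\<alpha>[OF x]] tangent[OF y])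
qed

lemma DF_inj: "y \<in> S \<Longrightarrow> DF y v = 0 \<Longrightarrow> v = 0"
proof -
  assume y: "y \<in> S" and v: "DF y v = 0"
  have "g y v w = 0" for w using g_eq[OF y, of v w] v linear_0[OF bilinearD(2)[OF amb.bil[OF Fy[OF y]]]] by simp
  then show "v = 0" using sub.nd[OF y] unfolding nondegenerate_def by blast
qed

text \<open>The range of \<open>DF y\<close> lies in the kernel of \<alpha>, and both have dimension
  one less than the ambient space. Subtracting the right multiple of the normal vector brings
  \<open>z\<close> into this kernel.\<close>

lemma tangent_normal_split:
  assumes y: "y \<in> S"
  obtains a where "z = DF y a + (\<alpha> (F y) z / \<alpha> (F y) (nv (F y))) *\<^sub>R nv (F y)"
proof -
  note x = Fy[OF y] and la = amb.lin\<alpha>[OF Fy[OF y]]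
  have "range (DF y) = {z. \<alpha> (F y) z = 0}"
  proof (rule subspace_dim_equal)
    show "subspace (range (DF y))" using DF_lin[OF y] linear_subspace_image subspace_UNIV by blast
    show "subspace {z. \<alpha> (F y) z = 0}" using la linear_subspace_kernel by blast
    show "range (DF y) \<subseteq> {z. \<alpha> (F y) z = 0}" using tangent[OF y] by auto
    have "inj (DF y)" using linear_injective_0[OF DF_lin[OF y]] DF_inj[OF y] by blast
    then have 1: "dim (range (DF y)) = DIM('l)" using dim_image_eq[OF DF_lin[OF y]] by simp
    define a where "a = (\<Sum>k\<in>Basis. \<alpha> (F y) k *\<^sub>R k)"
    have a: "\<alpha> (F y) v = a \<bullet> v" for v
      unfolding a_def by (subst linear_Basis_sum[OF la]) (simp add: inner_sum_left inner_commute[of v] mult.commute)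
    have "a \<noteq> 0" using \<alpha>nv[OF y] a by auto
    then have "dim {z. \<alpha> (F y) z = 0} = DIM('k) - 1" using dim_hyperplane unfolding a by blast
    then show "dim {z. \<alpha> (F y) z = 0} \<le> dim (range (DF y))" using 1 codim by simp
  qed
  moreover have "\<alpha> (F y) (z - (\<alpha> (F y) z / \<alpha> (F y) (nv (F y))) *\<^sub>R nv (F y)) = 0"
    using \<alpha>nv[OF y] by (simp add: linear_diff[OF la] linear_scale[OF la])
  ultimately obtain a where "DF y a = z - (\<alpha> (F y) z / \<alpha> (F y) (nv (F y))) *\<^sub>R nv (F y)" by (metis (mono_tags, lifting) mem_Collect_eq rangeE)
  then show thesis by (intro that[of a]) simp
qed

text \<open>The orthogonal projection to the hypersurface, in its own coordinates: it inverts
  \<open>DF y\<close> on tangent vectors and kills \<open>nv\<close>.\<close>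

definition L :: "'l \<Rightarrow> 'k \<Rightarrow> 'l" where
  "L y z = (\<Sum>e\<in>Basis. G (F y) z (DF y e) *\<^sub>R bsolve (g y) e)"

lemma L_lin:
  assumes y: "y \<in> S" shows "linear (L y)"
  unfolding L_def using bilinear_ladd[OF amb.bil[OF Fy[OF y]]] bilinear_lmul[OF amb.bil[OF Fy[OF y]]]
  by (auto intro!: linearI simp: scaleR_add_left sum.distrib scaleR_sum_right)

lemma L_DF:
  assumes y: "y \<in> S" shows "L y (DF y v) = v"
proof -
  have "linear (\<lambda>e. g y v e)" using bilinearD(1)[OF sub.bil[OF y]] .
  from bsolve_form[OF sub.nd[OF y] this, of v] show ?thesis unfolding L_def g_eq[OF y, symmetric] by simp
qed

lemma L_nv:
  assumes y: "y \<in> S" shows "L y (nv (F y)) = 0"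
  unfolding L_def nv[OF Fy[OF y]] tangent[OF y] by simp

lemma DF_L:
  assumes y: "y \<in> S" shows "DF y (L y z) = z - (\<alpha> (F y) z / \<alpha> (F y) (nv (F y))) *\<^sub>R nv (F y)"
proof -
  obtain a where a: "z = DF y a + (\<alpha> (F y) z / \<alpha> (F y) (nv (F y))) *\<^sub>R nv (F y)" using tangent_normal_split[OF y] .
  have "L y z = L y (DF y a + (\<alpha> (F y) z / \<alpha> (F y) (nv (F y))) *\<^sub>R nv (F y))" using a by simp
  also have "\<dots> = a" using L_lin[OF y] by (simp only: linear_add linear_scale L_DF[OF y] L_nv[OF y] scaleR_zero_right add_0_right)
  finally have "L y z = a" .
  then show ?thesis using a by (metis add_diff_cancel_right')
qed

text \<open>The tangential part is 0 by \<open>II_inner\<close>, and the normal part is read off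
  from \<open>II_\<alpha>\<close>. As an identity on all of \<open>S\<close>, it transfers flatness
  of \<open>hess\<close> to \<open>II\<close> with every derivative.\<close>

lemma II_eq:
  assumes y: "y \<in> S"
  shows "II y v w = - (amb.hess (F y) (DF y v) (DF y w) / \<alpha> (F y) (nv (F y))) *\<^sub>R nv (F y)"
proof -
  have "L y (II y v w) = 0" unfolding L_def II_inner[OF y] by simp
  then have "DF y (L y (II y v w)) = 0" using linear_0[OF DF_lin[OF y]] by simp
  then show ?thesis unfolding DF_L[OF y] II_\<alpha>[OF y] by (simp add: eq_neg_iff_add_eq_0)
qed

lemma smooth_II: "smooth_on S (\<lambda>y. II y v w)"
  unfolding II_def
  by (intro smooth_on_add smooth_on_diff sub.T smooth_on_dpartial smDF
      smooth_on_bilinear_family[OF sub.T amb.gam_bilinear[OF Fy] smooth_pull[OF amb.smooth_gam]]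
      smooth_on_dpartial_fun[OF sub.T F] sub.smooth_gam)

text \<open>The terms of the Gauss equation that contain the second fundamental form.\<close>

definition gauss_rest :: "'l \<Rightarrow> 'l \<Rightarrow> 'l \<Rightarrow> 'l \<Rightarrow> 'k" where
  "gauss_rest y u v w = II y u (sub.gam y v w) + dpartial u (\<lambda>z. II z v w) y - amb.gam (F y) (DF y v) (II y u w)"

text \<open>Antisymmetrize the derivative of the Gauss formula; third derivatives of \<open>F\<close> cancel.\<close>

lemma gauss:
  assumes y: "y \<in> S"
  shows "DF y (sub.curv y u v w) = amb.curv (F y) (DF y u) (DF y v) (DF y w) - (gauss_rest y u v w - gauss_rest y v u w)"
proof -
  note x = Fy[OF y] and b1 = bilinearD(1)[OF amb.gam_bilinear[OF Fy[OF y]]] and b2 = bilinearD(2)[OF amb.gam_bilinear[OF Fy[OF y]]]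
  have D2: "dpartial a (dpartial b F) z = DF z (sub.gam z a b) - amb.gam (F z) (DF z a) (DF z b) + II z a b" if "z \<in> S" for a b z
    by (simp add: II_def)
  have D3: "dpartial u (dpartial v (dpartial w F)) y
    = dpartial u (dpartial (sub.gam y v w) F) y + DF y (dpartial u (\<lambda>z. sub.gam z v w) y)
      - (dpartial (DF y u) (\<lambda>x. amb.gam x (DF y v) (DF y w)) (F y)
         + amb.gam (F y) (dpartial u (dpartial v F) y) (DF y w) + amb.gam (F y) (DF y v) (dpartial u (dpartial w F) y))
      + dpartial u (\<lambda>z. II z v w) y" for u v
  proof -
    have s1: "smooth_on S (\<lambda>z. DF z (sub.gam z v w))"
      by (rule smooth_on_dpartial_fun[OF sub.T F sub.smooth_gam])
    have s2: "smooth_on S (\<lambda>z. amb.gam (F z) (DF z v) (DF z w))"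
      by (rule smooth_on_bilinear_family[OF sub.T amb.gam_bilinear[OF Fy] smooth_pull[OF amb.smooth_gam] smDF smDF])
    have "dpartial u (dpartial v (dpartial w F)) y
      = dpartial u (\<lambda>z. DF z (sub.gam z v w) - amb.gam (F z) (DF z v) (DF z w) + II z v w) y"
      by (rule dpartial_cong[OF sub.T y]) (rule D2)
    also have "\<dots> = dpartial u (\<lambda>z. DF z (sub.gam z v w)) y - dpartial u (\<lambda>z. amb.gam (F z) (DF z v) (DF z w)) y
        + dpartial u (\<lambda>z. II z v w) y"
      using dpartial_add[OF smooth_on_at[OF smooth_on_diff[OF sub.T s1 s2] sub.T y] smooth_on_at[OF smooth_II sub.T y], of u v w]
        dpartial_diff[OF smooth_on_at[OF s1 sub.T y] smooth_on_at[OF s2 sub.T y], of u] by simp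
    also have "dpartial u (\<lambda>z. DF z (sub.gam z v w)) y
        = dpartial u (dpartial (sub.gam y v w) F) y + DF y (dpartial u (\<lambda>z. sub.gam z v w) y)"
      by (rule dpartial_linear_family(2)[where A = "\<lambda>z a. DF z a", OF sub.T y DF_lin diffDF[OF y] sub.diff_gam[OF y]])
    also have "dpartial u (\<lambda>z. amb.gam (F z) (DF z v) (DF z w)) y
        = dpartial u (\<lambda>z. amb.gam (F z) (DF y v) (DF y w)) y
         + amb.gam (F y) (dpartial u (dpartial v F) y) (DF y w) + amb.gam (F y) (DF y v) (dpartial u (dpartial w F) y)"
      by (rule dpartial_bilinear_family[OF sub.T y amb.gam_bilinear[OF Fy] _ diffDF[OF y] diffDF[OF y]])
        (auto intro!: smooth_on_at[OF smooth_pull[OF amb.smooth_gam] sub.T y])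
    also have "dpartial u (\<lambda>z. amb.gam (F z) (DF y v) (DF y w)) y = dpartial (DF y u) (\<lambda>x. amb.gam x (DF y v) (DF y w)) (F y)"
      by (rule dpartial_compose[OF amb.diff_gam[OF x] diffF[OF y]])
    finally show ?thesis .
  qed
  define Q where "Q u v = amb.gam (F y) (dpartial u (dpartial v F) y) (DF y w)" for u v
  have D4: "dpartial u (dpartial v (dpartial w F)) y
    = DF y (sub.gam y u (sub.gam y v w)) - amb.gam (F y) (DF y u) (DF y (sub.gam y v w)) + II y u (sub.gam y v w)
      + DF y (dpartial u (\<lambda>z. sub.gam z v w) y)
      - (dpartial (DF y u) (\<lambda>x. amb.gam x (DF y v) (DF y w)) (F y) + Q u v
         + (amb.gam (F y) (DF y v) (DF y (sub.gam y u w)) - amb.gam (F y) (DF y v) (amb.gam (F y) (DF y u) (DF y w))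
            + amb.gam (F y) (DF y v) (II y u w)))
      + dpartial u (\<lambda>z. II z v w) y" for u v
    unfolding D3 Q_def D2[OF y, of u w] D2[OF y, of u "sub.gam y v w"] by (simp add: linear_add[OF b1] linear_diff[OF b1])
  have "dpartial u (dpartial v (dpartial w F)) y = dpartial v (dpartial u (dpartial w F)) y"
    by (rule dpartial_commute[OF sub.T smDF y])
  moreover have "Q u v = Q v u" unfolding Q_def using dpartial_commute[OF sub.T F y, of u v] by simp
  ultimately show ?thesis
    unfolding D4 sub.curv_def amb.curv_def gauss_rest_def
    by (simp add: linear_add[OF DF_lin[OF y]] linear_diff[OF DF_lin[OF y]] algebra_simps)
qed

text \<open>The traced Gauss equation. Cyclicity replaces the trace over the hypersurface by an
  ambient one with the projection \<open>DF y (L y k)\<close> inserted; that projection is the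
  identity minus a multiple of \<open>nv\<close>, which accounts for the normal term.\<close>

lemma ricci_sub:
  assumes y: "y \<in> S"
  shows "ricci g y j m = (\<Sum>k\<in>Basis. amb.curv (F y) k (DF y m) (DF y j) \<bullet> k)
    - \<alpha> (F y) (amb.curv (F y) (nv (F y)) (DF y m) (DF y j)) / \<alpha> (F y) (nv (F y))
    - (\<Sum>i\<in>Basis. L y (gauss_rest y i m j - gauss_rest y m i j) \<bullet> i)"
proof -
  note x = Fy[OF y] and lL = L_lin[OF y] and la = amb.lin\<alpha>[OF Fy[OF y]]
  define R where "R z = amb.curv (F y) z (DF y m) (DF y j)" for z
  have lR: "linear R" unfolding R_def by (rule amb.curv_linear(1)[OF x])
  have lRD: "linear (\<lambda>i. R (DF y i))" using linear_compose[OF DF_lin[OF y] lR] by (simp add: o_def)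
  have "ricci g y j m = (\<Sum>i\<in>Basis. L y (DF y (sub.curv y i m j)) \<bullet> i)"
    unfolding sub.ricci_curv[OF y] L_DF[OF y] ..
  also have "\<dots> = (\<Sum>i\<in>Basis. L y (R (DF y i)) \<bullet> i) - (\<Sum>i\<in>Basis. L y (gauss_rest y i m j - gauss_rest y m i j) \<bullet> i)"
    unfolding gauss[OF y] R_def linear_diff[OF lL] inner_diff_left sum_subtractf ..
  also have "(\<Sum>i\<in>Basis. L y (R (DF y i)) \<bullet> i) = (\<Sum>k\<in>Basis. R (DF y (L y k)) \<bullet> k)"
    by (rule trace_commute[OF lL lRD])
  also have "\<dots> = (\<Sum>k\<in>Basis. R k \<bullet> k) - (\<Sum>k\<in>Basis. (R (nv (F y)) \<bullet> k) *\<^sub>R \<alpha> (F y) k) / \<alpha> (F y) (nv (F y))"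
    unfolding DF_L[OF y] linear_diff[OF lR] linear_scale[OF lR]
    by (simp add: inner_diff_left sum_subtractf sum_divide_distrib mult.commute)
  also have "(\<Sum>k\<in>Basis. (R (nv (F y)) \<bullet> k) *\<^sub>R \<alpha> (F y) k) = \<alpha> (F y) (R (nv (F y)))"
    by (rule linear_Basis_sum[OF la, symmetric])
  finally show ?thesis by (simp add: R_def)
qed

section \<open>Transfer of infinite-order vanishing to the hypersurface\<close>

context
  fixes y0 assumes y0: "y0 \<in> S"
    and hess_flat: "\<And>a b. a \<in> Basis \<Longrightarrow> b \<in> Basis \<Longrightarrow> flat_on T (F y0) (\<lambda>x. amb.hess x a b)"
begin

lemma flat_pull: "flat_on T (F y0) f \<Longrightarrow> flat_on S y0 (\<lambda>y. f (F y))"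
  by (rule flat_on_compose[OF sub.T y0 amb.T FT F])

lemma II_flat: "flat_on S y0 (\<lambda>y. II y v w \<bullet> k)"
proof (rule flat_on_cong[OF sub.T y0])
  have "flat_on S y0 (\<lambda>y. \<Sum>a\<in>Basis. \<Sum>b\<in>Basis. (DF y v \<bullet> a) * ((DF y w \<bullet> b) * amb.hess (F y) a b))"
    by (intro flat_on_sum flat_on_mult2 sub.T y0 smooth_on_component smDF flat_pull hess_flat)
  then show "flat_on S y0 (\<lambda>y. (\<Sum>a\<in>Basis. \<Sum>b\<in>Basis. (DF y v \<bullet> a) * ((DF y w \<bullet> b) * amb.hess (F y) a b))
      * (- 1 * (inverse (\<alpha> (F y) (nv (F y))) * (nv (F y) \<bullet> k))))"
    by (intro flat_on_mult smooth_on_mult sub.T y0 smooth_on_const smooth_on_inverse smooth_on_component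
        smooth_pull[OF smooth_nv] \<alpha>nv smooth_pull[where f = "\<lambda>x. \<alpha> x (nv x)"]
        smooth_on_linear_family[OF amb.T amb.lin\<alpha> amb.sm\<alpha> smooth_nv])
  show "(\<Sum>a\<in>Basis. \<Sum>b\<in>Basis. (DF y v \<bullet> a) * ((DF y w \<bullet> b) * amb.hess (F y) a b))
      * (- 1 * (inverse (\<alpha> (F y) (nv (F y))) * (nv (F y) \<bullet> k))) = II y v w \<bullet> k" if y: "y \<in> S" for y
  proof -
    have "amb.hess (F y) (DF y v) (DF y w) = (\<Sum>a\<in>Basis. \<Sum>b\<in>Basis. (DF y v \<bullet> a) * ((DF y w \<bullet> b) * amb.hess (F y) a b))"
      by (subst bilinear_sum_both[OF amb.hess_bilinear[OF Fy[OF y]]]) (simp add: mult_ac)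
    then show ?thesis unfolding II_eq[OF y] by (simp add: divide_inverse)
  qed
qed

lemma linear_flat:
  fixes A :: "'l \<Rightarrow> 'p::euclidean_space \<Rightarrow> real"
  assumes "\<And>y. y \<in> S \<Longrightarrow> linear (A y)" "\<And>k. k \<in> Basis \<Longrightarrow> smooth_on S (\<lambda>y. A y k)"
    and V: "\<And>k. k \<in> Basis \<Longrightarrow> flat_on S y0 (\<lambda>y. V y \<bullet> k)"
  shows "flat_on S y0 (\<lambda>y. A y (V y))"
proof (rule flat_on_cong[OF sub.T y0])
  show "flat_on S y0 (\<lambda>y. \<Sum>k\<in>Basis. (V y \<bullet> k) * A y k)"
    by (intro flat_on_sum flat_on_mult sub.T y0 V assms)
  show "(\<Sum>k\<in>Basis. (V y \<bullet> k) * A y k) = A y (V y)" if "y \<in> S" for y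
    using linear_Basis_sum[OF assms(1)[OF that], of "V y"] by simp
qed

text \<open>Read off from \<open>II_eq\<close>, where linearity in the last slot is that of
  \<open>hess\<close>; it permits expanding \<open>II\<close> on a Christoffel vector in a
  basis.\<close>

lemma II_lin2: "y \<in> S \<Longrightarrow> linear (II y v)"
proof -
  assume y: "y \<in> S"
  have "linear (\<lambda>w. amb.hess (F y) (DF y v) (DF y w))"
    using linear_compose[OF DF_lin[OF y] bilinearD(1)[OF amb.hess_bilinear[OF Fy[OF y]]]] by (simp add: o_def)
  note l = this
  show ?thesis unfolding II_eq[OF y]
    by (rule linearI) (simp_all add: linear_add[OF l] linear_scale[OF l] add_divide_distrib scaleR_add_left scaleR_diff_left)
qed

text \<open>Every term is linear in \<open>II\<close> or in a first derivative of it, with smooth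
  coefficients.\<close>

lemma gauss_rest_flat: "flat_on S y0 (\<lambda>y. gauss_rest y u v w \<bullet> k)"
proof -
  have 1: "flat_on S y0 (\<lambda>y. II y u (sub.gam y v w) \<bullet> k)"
  proof (rule flat_on_cong[OF sub.T y0])
    show "flat_on S y0 (\<lambda>y. \<Sum>e\<in>Basis. (sub.gam y v w \<bullet> e) * (II y u e \<bullet> k))"
      by (intro flat_on_sum flat_on_mult2 sub.T y0 smooth_on_component sub.smooth_gam II_flat)
    show "(\<Sum>e\<in>Basis. (sub.gam y v w \<bullet> e) * (II y u e \<bullet> k)) = II y u (sub.gam y v w) \<bullet> k" if "y \<in> S" for y
      using linear_Basis_sum[OF II_lin2[OF that, of u], of "sub.gam y v w"] by (simp add: inner_sum_left)
  qed
  have 2: "flat_on S y0 (\<lambda>y. dpartial u (\<lambda>z. II z v w) y \<bullet> k)"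
  proof (rule flat_on_cong[OF sub.T y0])
    show "flat_on S y0 (dpartial u (\<lambda>y. II y v w \<bullet> k))" by (rule flat_on_dpartial[OF sub.T y0 II_flat])
    show "dpartial u (\<lambda>y. II y v w \<bullet> k) y = dpartial u (\<lambda>z. II z v w) y \<bullet> k" if "y \<in> S" for y
      by (rule dpartial_inner_right[OF smooth_on_at[OF smooth_II sub.T that]])
  qed
  have 3: "flat_on S y0 (\<lambda>y. amb.gam (F y) (DF y v) (II y u w) \<bullet> k)"
  proof (rule linear_flat[where A = "\<lambda>y z. amb.gam (F y) (DF y v) z \<bullet> k"])
    show "linear (\<lambda>z. amb.gam (F y) (DF y v) z \<bullet> k)" if "y \<in> S" for y
      by (rule linearI) (simp_all add: bilinear_radd[OF amb.gam_bilinear[OF Fy[OF that]]] bilinear_rmul[OF amb.gam_bilinear[OF Fy[OF that]]] inner_add_left)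
    show "smooth_on S (\<lambda>y. amb.gam (F y) (DF y v) e \<bullet> k)" for e
      by (intro smooth_on_component sub.T smooth_on_const smDF
          smooth_on_bilinear_family[OF sub.T amb.gam_bilinear[OF Fy] smooth_pull[OF amb.smooth_gam]])
  qed (rule II_flat)
  show ?thesis unfolding gauss_rest_def inner_diff_left inner_add_left by (intro flat_on_add flat_on_diff sub.T y0 1 2 3)
qed

theorem ricci_flat:
  assumes ric: "\<And>a b. a \<in> Basis \<Longrightarrow> b \<in> Basis \<Longrightarrow> flat_on T (F y0) (\<lambda>x. ricci G x a b)"
  shows "flat_on S y0 (\<lambda>y. ricci g y j m)"
proof (rule flat_on_cong[OF sub.T y0 ricci_sub[symmetric]])
  have 1: "flat_on S y0 (\<lambda>y. \<Sum>k\<in>Basis. amb.curv (F y) k (DF y m) (DF y j) \<bullet> k)"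
  proof (rule flat_on_cong[OF sub.T y0])
    \<comment> \<open>The arguments of \<open>ricci\<close> appear as \<open>b a\<close> because
      \<open>ricci_curv\<close> puts the second argument of \<open>ricci\<close> into the second
      slot of \<open>curv\<close> and the first into the third.\<close>
    show "flat_on S y0 (\<lambda>y. \<Sum>a\<in>Basis. \<Sum>b\<in>Basis. (DF y m \<bullet> a) * ((DF y j \<bullet> b) * ricci G (F y) b a))"
      by (intro flat_on_sum flat_on_mult2 sub.T y0 smooth_on_component smDF flat_pull ric)
    show "(\<Sum>a\<in>Basis. \<Sum>b\<in>Basis. (DF y m \<bullet> a) * ((DF y j \<bullet> b) * ricci G (F y) b a))
      = (\<Sum>k\<in>Basis. amb.curv (F y) k (DF y m) (DF y j) \<bullet> k)" if y: "y \<in> S" for y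
    proof -
      define B where "B a b = (\<Sum>k\<in>Basis. amb.curv (F y) k a b \<bullet> k)" for a b
      note c = amb.curv_linear[OF Fy[OF y]]
      have "bilinear B" unfolding B_def bilinear_def
        by (intro conjI allI linearI) (simp_all add: linear_add[OF c(2)] linear_add[OF c(3)] linear_scale[OF c(2)]
            linear_scale[OF c(3)] inner_add_left sum.distrib sum_distrib_left)
      from bilinear_sum_both[OF this, of "DF y m" "DF y j"] show ?thesis
        by (simp add: B_def amb.ricci_curv[OF Fy[OF y]] mult_ac)
    qed
  qed
  have 2: "flat_on S y0 (\<lambda>y. \<alpha> (F y) (amb.curv (F y) (nv (F y)) (DF y m) (DF y j)) / \<alpha> (F y) (nv (F y)))"
  proof (rule flat_on_cong[OF sub.T y0])
    show "flat_on S y0 (\<lambda>y. (\<Sum>a\<in>Basis. (nv (F y) \<bullet> a) * (\<Sum>b\<in>Basis. \<Sum>c\<in>Basis. (DF y m \<bullet> b) * ((DF y j \<bullet> c) * \<alpha> (F y) (amb.curv (F y) a b c))))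
        * inverse (\<alpha> (F y) (nv (F y))))"
      by (intro flat_on_mult flat_on_sum flat_on_mult2 sub.T y0 smooth_on_component smDF smooth_pull[OF smooth_nv]
          flat_pull[where f = "\<lambda>x. \<alpha> x (amb.curv x a b c)" for a b c] amb.curv_flat Fy hess_flat smooth_on_inverse \<alpha>nv
          smooth_pull[where f = "\<lambda>x. \<alpha> x (nv x)"] smooth_on_linear_family[OF amb.T amb.lin\<alpha> amb.sm\<alpha> smooth_nv])
    show "(\<Sum>a\<in>Basis. (nv (F y) \<bullet> a) * (\<Sum>b\<in>Basis. \<Sum>c\<in>Basis. (DF y m \<bullet> b) * ((DF y j \<bullet> c) * \<alpha> (F y) (amb.curv (F y) a b c))))
        * inverse (\<alpha> (F y) (nv (F y))) = \<alpha> (F y) (amb.curv (F y) (nv (F y)) (DF y m) (DF y j)) / \<alpha> (F y) (nv (F y))"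
      if y: "y \<in> S" for y
    proof -
      note c = amb.curv_linear[OF Fy[OF y]] and la = amb.lin\<alpha>[OF Fy[OF y]]
      have "linear (\<lambda>a. \<alpha> (F y) (amb.curv (F y) a (DF y m) (DF y j)))"
        by (rule linearI) (simp_all add: linear_add[OF c(1)] linear_scale[OF c(1)] linear_add[OF la] linear_scale[OF la])
      note 1 = linear_Basis_sum[OF this, of "nv (F y)"]
      have "bilinear (\<lambda>b c. \<alpha> (F y) (amb.curv (F y) a b c))" for a
        unfolding bilinear_def by (intro conjI allI linearI) (simp_all add: linear_add[OF c(2)] linear_add[OF c(3)]
            linear_scale[OF c(2)] linear_scale[OF c(3)] linear_add[OF la] linear_scale[OF la])
      note 2 = bilinear_sum_both[OF this, of _ "DF y m" "DF y j"]
      show ?thesis unfolding 1 unfolding 2 by (simp add: divide_inverse mult_ac)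
    qed
  qed
  have 3: "flat_on S y0 (\<lambda>y. \<Sum>i\<in>Basis. L y (gauss_rest y i m j - gauss_rest y m i j) \<bullet> i)"
  proof (intro flat_on_sum sub.T y0)
    fix i :: 'l
    show "flat_on S y0 (\<lambda>y. L y (gauss_rest y i m j - gauss_rest y m i j) \<bullet> i)"
    proof (rule linear_flat[where A = "\<lambda>y z. L y z \<bullet> i"])
      show "linear (\<lambda>z. L y z \<bullet> i)" if "y \<in> S" for y
        by (rule linearI) (simp_all add: linear_add[OF L_lin[OF that]] linear_scale[OF L_lin[OF that]] inner_add_left)
      show "smooth_on S (\<lambda>y. L y k \<bullet> i)" for k
        unfolding L_def
        by (intro smooth_on_component smooth_on_sum smooth_on_scaleR sub.T smooth_on_bsolve[OF sub.T sub.nd sub.sm]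
            smooth_on_bilinear_family[OF sub.T amb.bil[OF Fy] smooth_pull[OF amb.smG]] smooth_on_const smDF)
      show "flat_on S y0 (\<lambda>y. (gauss_rest y i m j - gauss_rest y m i j) \<bullet> k)" for k
        unfolding inner_diff_left by (intro flat_on_diff sub.T y0 gauss_rest_flat)
    qed
  qed
  show "flat_on S y0 (\<lambda>y. (\<Sum>k\<in>Basis. amb.curv (F y) k (DF y m) (DF y j) \<bullet> k)
    - \<alpha> (F y) (amb.curv (F y) (nv (F y)) (DF y m) (DF y j)) / \<alpha> (F y) (nv (F y))
    - (\<Sum>i\<in>Basis. L y (gauss_rest y i m j - gauss_rest y m i j) \<bullet> i))"
    by (intro flat_on_diff sub.T y0 1 2 3)
qed

end

lemma II_component:
  assumes y: "y \<in> S" and k: "k \<in> Basis"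
  shows "II y i j \<bullet> k = dpartial i (dpartial j (\<lambda>y. F y \<bullet> k)) y
      + (\<Sum>l\<in>Basis. \<Sum>m\<in>Basis. christoffel G (F y) l m k * dpartial i (\<lambda>y. F y \<bullet> l) y * dpartial j (\<lambda>y. F y \<bullet> m) y)
      - (\<Sum>e\<in>Basis. christoffel g y i j e * dpartial e (\<lambda>y. F y \<bullet> k) y)"
proof -
  have d: "dpartial v (\<lambda>y. F y \<bullet> l) z = DF z v \<bullet> l" if "z \<in> S" for v l z
    by (rule dpartial_inner_right[OF diffF[OF that]])
  have "dpartial i (dpartial j (\<lambda>y. F y \<bullet> k)) y = dpartial i (\<lambda>y. dpartial j F y \<bullet> k) y"
    by (rule dpartial_cong[OF sub.T y]) (rule d)
  also have "\<dots> = dpartial i (dpartial j F) y \<bullet> k" by (rule dpartial_inner_right[OF diffDF[OF y]])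
  finally have 1: "dpartial i (dpartial j (\<lambda>y. F y \<bullet> k)) y = dpartial i (dpartial j F) y \<bullet> k" .
  have "bilinear (\<lambda>v w. amb.gam (F y) v w \<bullet> k)" unfolding bilinear_def
    by (intro conjI allI linearI) (simp_all add: bilinear_ladd[OF amb.gam_bilinear[OF Fy[OF y]]] bilinear_radd[OF amb.gam_bilinear[OF Fy[OF y]]]
        bilinear_lmul[OF amb.gam_bilinear[OF Fy[OF y]]] bilinear_rmul[OF amb.gam_bilinear[OF Fy[OF y]]] inner_add_left)
  from bilinear_sum_both[OF this, of "DF y i" "DF y j"]
  have 2: "amb.gam (F y) (DF y i) (DF y j) \<bullet> k
      = (\<Sum>l\<in>Basis. \<Sum>m\<in>Basis. christoffel G (F y) l m k * (DF y i \<bullet> l) * (DF y j \<bullet> m))"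
    by (simp add: amb.gam_inner[OF k])
  have 3: "DF y (sub.gam y i j) \<bullet> k = (\<Sum>e\<in>Basis. christoffel g y i j e * (DF y e \<bullet> k))"
    by (subst linear_Basis_sum[OF DF_lin[OF y]]) (simp add: inner_sum_left sub.gam_inner)
  show ?thesis unfolding II_def inner_diff_left inner_add_left 1 2 3 d[OF y] ..
qed

end


section \<open>Signatures of symmetric bilinear forms\<close>

text \<open>Excluding vectors of zero square lets coefficients be recovered by pairing, so such a
  family is independent.\<close>

definition orthogonal_family :: "('e::euclidean_space \<Rightarrow> 'e \<Rightarrow> real) \<Rightarrow> 'e set \<Rightarrow> bool" where
  "orthogonal_family B S \<longleftrightarrow> finite S \<and> (\<forall>v\<in>S. B v v \<noteq> 0) \<and> (\<forall>v\<in>S. \<forall>w\<in>S. v \<noteq> w \<longrightarrow> B v w = 0)"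

lemma orthogonal_family_coeff:
  assumes B: "bilinear B" and S: "orthogonal_family B S" and w: "w \<in> S"
  shows "B (\<Sum>v\<in>S. c v *\<^sub>R v) w = c w * B w w"
proof -
  note l = bilinearD(2)[OF B]
  have f: "finite S" using S by (simp add: orthogonal_family_def)
  have "B (\<Sum>v\<in>S. c v *\<^sub>R v) w = (\<Sum>v\<in>S. c v * B v w)"
    by (simp add: linear_sum[OF l] linear_scale[OF l])
  also have "\<dots> = (\<Sum>v\<in>S. if v = w then c w * B w w else 0)"
    using S w by (intro sum.cong) (auto simp: orthogonal_family_def)
  also have "\<dots> = c w * B w w" using f w by simp
  finally show ?thesis .
qed

lemma orthogonal_family_independent:
  assumes B: "bilinear B" and S: "orthogonal_family B S" shows "independent S"
proof -
  have f: "finite S" using S by (simp add: orthogonal_family_def)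
  show ?thesis
  proof (rule independent_if_scalars_zero[OF f])
    fix c w assume z: "(\<Sum>v\<in>S. c v *\<^sub>R v) = 0" and w: "w \<in> S"
    have "c w * B w w = 0"
      using orthogonal_family_coeff[OF B S w, of c] z linear_0[OF bilinearD(2)[OF B]] by simp
    then show "c w = 0" using S w by (auto simp: orthogonal_family_def)
  qed
qed

lemma orthogonal_family_split:
  assumes B: "bilinear B" and S: "orthogonal_family B S" and w: "w \<in> S"
  shows "B (x - (\<Sum>v\<in>S. (B x v / B v v) *\<^sub>R v)) w = 0"
  using orthogonal_family_coeff[OF B S w, of "\<lambda>v. B x v / B v v"] S w
  by (simp add: bilinear_lsub[OF B] orthogonal_family_def)

lemma orthogonal_family_sum_split:
  assumes B: "bilinear B" and PN: "orthogonal_family B S" "x \<in> span S"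
  shows "\<exists>c. x = (\<Sum>v\<in>S. c v *\<^sub>R v) \<and> B x x = (\<Sum>v\<in>S. (c v)\<^sup>2 * B v v)"
proof -
  have f: "finite S" using PN by (simp add: orthogonal_family_def)
  obtain c where c: "x = (\<Sum>v\<in>S. c v *\<^sub>R v)" using PN(2) span_finite[OF f] by auto
  have l: "linear (B x)" using bilinearD(1)[OF B] .
  have "B x x = (\<Sum>w\<in>S. c w * B x w)" by (subst (2) c) (simp add: linear_sum[OF l] linear_scale[OF l])
  also have "\<dots> = (\<Sum>w\<in>S. c w * (c w * B w w))"
    by (rule sum.cong[OF refl]) (simp add: c orthogonal_family_coeff[OF B PN(1)])
  finally show ?thesis using c by (auto simp: power2_eq_square mult.assoc)
qed

lemma has_signature_orthogonal:
  assumes "has_signature B p q"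
  obtains P N where "finite P" "finite N" "P \<inter> N = {}" "card P = p" "card N = q" "orthogonal_family B (P \<union> N)"
    "span (P \<union> N) = UNIV" "\<forall>v\<in>P. B v v > 0" "\<forall>v\<in>N. B v v < 0" "independent (P \<union> N)"
proof -
  obtain P N where 1: "finite P" "finite N" "P \<inter> N = {}" "card P = p" "card N = q" "independent (P \<union> N)"
    "span (P \<union> N) = UNIV" "\<forall>v\<in>P. B v v > 0" "\<forall>v\<in>N. B v v < 0" "\<forall>v\<in>P \<union> N. \<forall>w\<in>P \<union> N. v \<noteq> w \<longrightarrow> B v w = 0"
    using assms unfolding has_signature_def by blast
  then have "orthogonal_family B (P \<union> N)" unfolding orthogonal_family_def by fastforce
  then show thesis using that 1 by blast
qed

lemma has_signature_dim:
  assumes "has_signature (B :: 'e::euclidean_space \<Rightarrow> _) p q" shows "p + q = DIM('e)"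
proof -
  obtain P N where 1: "finite P" "finite N" "P \<inter> N = {}" "card P = p" "card N = q" "orthogonal_family B (P \<union> N)"
    "span (P \<union> N) = UNIV" "\<forall>v\<in>P. B v v > 0" "\<forall>v\<in>N. B v v < 0" "independent (P \<union> N)"
    by (rule has_signature_orthogonal[OF assms])
  have "card (P \<union> N) = DIM('e)" using dim_eq_card[of "P \<union> N" UNIV] 1 by simp
  then show ?thesis using 1 by (simp add: card_Un_disjoint)
qed

lemma has_signatureI:
  fixes B :: "'e::euclidean_space \<Rightarrow> 'e \<Rightarrow> real"
  assumes B: "bilinear B" and f: "finite P" "finite N" "card P = p" "card N = q" "p + q = DIM('e)"
    and s: "\<And>v. v \<in> P \<Longrightarrow> B v v > 0" "\<And>v. v \<in> N \<Longrightarrow> B v v < 0"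
    and o: "\<And>v w. v \<in> P \<union> N \<Longrightarrow> w \<in> P \<union> N \<Longrightarrow> v \<noteq> w \<Longrightarrow> B v w = 0"
  shows "has_signature B p q"
proof -
  have disj: "P \<inter> N = {}" using s by (metis disjoint_iff less_asym)
  have "B v v \<noteq> 0" if "v \<in> P \<union> N" for v using s that by (metis Un_iff less_irrefl)
  then have "orthogonal_family B (P \<union> N)" using f o by (simp add: orthogonal_family_def)
  then have i: "independent (P \<union> N)" using orthogonal_family_independent[OF B] by blast
  have "card (P \<union> N) = DIM('e)" using f disj by (simp add: card_Un_disjoint)
  then have "UNIV \<subseteq> span (P \<union> N)" by (intro card_ge_dim_independent i) simp_all
  then have "span (P \<union> N) = UNIV" by blast
  then show ?thesis unfolding has_signature_def using f disj i s o
    by (intro exI[of _ P] exI[of _ N] conjI ballI impI) simp_all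
qed

lemma has_signature_nondegenerate:
  fixes B :: "'e::euclidean_space \<Rightarrow> 'e \<Rightarrow> real"
  assumes B: "bilinear B" and s: "has_signature B p q" shows "nondegenerate B"
  unfolding nondegenerate_def
proof (intro conjI allI impI B)
  fix x assume x: "\<forall>w. B x w = 0"
  obtain P N where 1: "orthogonal_family B (P \<union> N)" "span (P \<union> N) = UNIV"
    by (rule has_signature_orthogonal[OF s]) blast
  then obtain c where c: "x = (\<Sum>v\<in>P \<union> N. c v *\<^sub>R v)" using orthogonal_family_sum_split[OF B 1(1), of x] by blast
  have "c w = 0" if w: "w \<in> P \<union> N" for w
    using orthogonal_family_coeff[OF B 1(1) w, of c] c x 1(1) w by (auto simp: orthogonal_family_def)
  then show "x = 0" using c by simp
qed

text \<open>Sizes of orthogonal families are bounded by the dimension, so a largest one exists. By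
  maximality its complement consists of vectors of square 0; polarization makes the form vanish on
  the complement, and nondegeneracy makes the complement trivial.\<close>

lemma diagonalize:
  fixes B :: "'e::euclidean_space \<Rightarrow> 'e \<Rightarrow> real"
  assumes nd: "nondegenerate B" and sym: "\<And>v w. B v w = B w v"
  shows "\<exists>p q. has_signature B p q"
proof -
  have B: "bilinear B" using nd by (simp add: nondegenerate_def)
  have bound: "card S \<le> DIM('e)" if "orthogonal_family B S" for S
    using independent_bound[OF orthogonal_family_independent[OF B that]] by simp
  have "orthogonal_family B {}" by (simp add: orthogonal_family_def)
  then obtain S where S: "orthogonal_family B S" and mx: "\<And>S'. orthogonal_family B S' \<Longrightarrow> card S' \<le> card S"
    using ex_has_greatest_nat[of "orthogonal_family B" "{}" card "Suc DIM('e)"] bound by (metis le_imp_less_Suc)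
  have fS: "finite S" using S by (simp add: orthogonal_family_def)
  have iso: "B w w = 0" if w: "\<forall>v\<in>S. B w v = 0" for w
  proof (rule ccontr)
    assume nz: "B w w \<noteq> 0"
    then have "w \<notin> S" using w by blast
    have "orthogonal_family B (insert w S)" using S nz w sym unfolding orthogonal_family_def by (metis finite_insert insert_iff)
    from mx[OF this] show False using \<open>w \<notin> S\<close> fS by simp
  qed
  have zero: "w = 0" if w: "\<forall>v\<in>S. B w v = 0" for w
  proof -
    have "B w x = 0" for x
    proof -
      define x1 where "x1 = x - (\<Sum>v\<in>S. (B x v / B v v) *\<^sub>R v)"
      have x1: "\<forall>v\<in>S. B x1 v = 0" using orthogonal_family_split[OF B S] by (simp add: x1_def)
      have "B (w + x1) (w + x1) = 0" by (rule iso) (simp add: bilinear_ladd[OF B] w x1)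
      then have "B w x1 = 0" using iso[OF w] iso[OF x1] sym[of x1 w]
        by (simp add: bilinear_ladd[OF B] bilinear_radd[OF B])
      moreover have "B w (\<Sum>v\<in>S. (B x v / B v v) *\<^sub>R v) = 0"
        using w by (simp add: linear_sum[OF bilinearD(1)[OF B]] linear_scale[OF bilinearD(1)[OF B]])
      ultimately show ?thesis by (simp add: x1_def bilinear_rsub[OF B])
    qed
    then show "w = 0" using nd by (simp add: nondegenerate_def)
  qed
  have span: "x \<in> span S" for x
  proof -
    have "x - (\<Sum>v\<in>S. (B x v / B v v) *\<^sub>R v) = 0"
      by (rule zero) (simp add: orthogonal_family_split[OF B S])
    then have "x = (\<Sum>v\<in>S. (B x v / B v v) *\<^sub>R v)" by simp
    also have "\<dots> \<in> span S" by (intro span_sum span_scale span_base)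
    finally show ?thesis .
  qed
  then have "span S = UNIV" by blast
  let ?P = "{v \<in> S. B v v > 0}" and ?N = "{v \<in> S. B v v < 0}"
  have un: "?P \<union> ?N = S" using S by (auto simp: orthogonal_family_def)
  have "card S = DIM('e)"
    using dim_eq_card[of S UNIV] orthogonal_family_independent[OF B S] \<open>span S = UNIV\<close> by simp
  moreover have "card ?P + card ?N = card (?P \<union> ?N)" using fS by (intro card_Un_disjoint[symmetric]) auto
  ultimately have "card ?P + card ?N = DIM('e)" unfolding un by simp
  then have "has_signature B (card ?P) (card ?N)"
    using S fS by (intro has_signatureI[OF B _ _ refl refl]) (auto simp: orthogonal_family_def)
  then show ?thesis by blast
qed

text \<open>A positive definite and a negative definite subspace meet only in 0, so p + q' is at
  most the dimension p' + q'.\<close>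

lemma inertia_le:
  fixes B :: "'e::euclidean_space \<Rightarrow> 'e \<Rightarrow> real"
  assumes B: "bilinear B" and s: "has_signature B p q" "has_signature B p' q'" shows "p \<le> p'"
proof -
  obtain P N where 1: "finite P" "card P = p" "orthogonal_family B (P \<union> N)" "\<forall>v\<in>P. B v v > 0"
    by (rule has_signature_orthogonal[OF s(1)]) blast
  obtain P' N' where 2: "finite N'" "card N' = q'" "orthogonal_family B (P' \<union> N')" "\<forall>v\<in>N'. B v v < 0"
    by (rule has_signature_orthogonal[OF s(2)]) blast
  have oP: "orthogonal_family B P" and oN: "orthogonal_family B N'" using 1 2 by (auto simp: orthogonal_family_def)
  have "x = 0" if x: "x \<in> span P \<inter> span N'" for x
  proof -
    obtain c where c: "x = (\<Sum>v\<in>P. c v *\<^sub>R v)" "B x x = (\<Sum>v\<in>P. (c v)\<^sup>2 * B v v)"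
      using orthogonal_family_sum_split[OF B oP] x by blast
    obtain d where d: "B x x = (\<Sum>v\<in>N'. (d v)\<^sup>2 * B v v)"
      using orthogonal_family_sum_split[OF B oN] x by blast
    have nn: "(c v)\<^sup>2 * B v v \<ge> 0" if "v \<in> P" for v using 1(4) that by (simp add: less_imp_le)
    have "B x x \<le> 0" unfolding d using 2(4) by (intro sum_nonpos mult_nonneg_nonpos) (auto simp: less_imp_le)
    then have "(\<Sum>v\<in>P. (c v)\<^sup>2 * B v v) = 0" using sum_nonneg[of P "\<lambda>v. (c v)\<^sup>2 * B v v"] nn c(2) by simp
    then have "\<forall>v\<in>P. (c v)\<^sup>2 * B v v = 0" using sum_nonneg_eq_0_iff[OF 1(1), of "\<lambda>v. (c v)\<^sup>2 * B v v"] nn by blast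
    then have "\<forall>v\<in>P. c v = 0" using 1(4) by fastforce
    then show "x = 0" using c(1) by simp
  qed
  then have "span P \<inter> span N' = {0}" using span_0 by blast
  then have "dim {x + y | x y. x \<in> span P \<and> y \<in> span N'} = dim (span P) + dim (span N')"
    using dim_sums_Int[of "span P" "span N'"] by simp
  moreover have "dim {x + y | x y. x \<in> span P \<and> y \<in> span N'} \<le> DIM('e)" by (rule dim_subset_UNIV)
  moreover have "dim (span P) = p" "dim (span N') = q'"
    using orthogonal_family_independent[OF B oP] orthogonal_family_independent[OF B oN] 1 2
    by (simp_all add: dim_eq_card_independent)
  ultimately show ?thesis using has_signature_dim[OF s(2)] by linarith
qed

lemma inertia:
  fixes B :: "'e::euclidean_space \<Rightarrow> 'e \<Rightarrow> real"
  assumes B: "bilinear B" and s: "has_signature B p q" "has_signature B p' q'" shows "p = p'" "q = q'"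
  using inertia_le[OF B s] inertia_le[OF B s(2,1)] has_signature_dim[OF s(1)] has_signature_dim[OF s(2)] by auto

lemma bilinear_pull:
  assumes "bilinear B" "linear F" shows "bilinear (\<lambda>v w. B (F v) (F w))"
  unfolding bilinear_def
  using linear_compose[OF assms(2) bilinearD(1)[OF assms(1)]] linear_compose[OF assms(2) bilinearD(2)[OF assms(1)]]
  by (auto simp: o_def)

text \<open>An orthogonal basis for the restricted form together with \<open>n\<close> diagonalizes
  the whole form with one more positive vector; inertia compares this with the known signature. Such
  a basis exists because \<open>n\<close> and the image of \<open>F\<close> span, which makes the
  restriction nondegenerate.\<close>

lemma has_signature_orthogonal_complement:
  fixes B :: "'k::euclidean_space \<Rightarrow> 'k \<Rightarrow> real" and F :: "'l::euclidean_space \<Rightarrow> 'k"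
  assumes B: "bilinear B" and sym: "\<And>v w. B v w = B w v" and s: "has_signature B (Suc p) q"
    and n: "B n n > 0" and F: "linear F" "inj F" and Fn: "\<And>v. B (F v) n = 0" and dim: "DIM('l) + 1 = DIM('k)"
  shows "has_signature (\<lambda>v w. B (F v) (F w)) p q"
proof -
  let ?B = "\<lambda>v w. B (F v) (F w)"
  note b = bilinear_pull[OF B F(1)]
  have nF: "n \<notin> span (range F)"
  proof
    assume "n \<in> span (range F)"
    then have "n \<in> range F" using F(1) linear_subspace_image[OF F(1) subspace_UNIV] by (metis span_eq_iff)
    then show False using Fn n by fastforce
  qed
  have "dim (insert n (range F)) = DIM('k)"
    using nF dim dim_image_eq[OF F(1), of UNIV] F(2) by (simp add: dim_insert inj_on_def)
  then have sp: "span (insert n (range F)) = UNIV" using dim_eq_full by blast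
  have "nondegenerate ?B" unfolding nondegenerate_def
  proof (intro conjI allI impI b)
    fix v assume v: "\<forall>w. ?B v w = 0"
    have "B (F v) w = 0" for w
    proof -
      have "subspace {w. B (F v) w = 0}" using linear_subspace_kernel[OF bilinearD(1)[OF B]] .
      moreover have "insert n (range F) \<subseteq> {w. B (F v) w = 0}" using v Fn by auto
      ultimately have "span (insert n (range F)) \<subseteq> {w. B (F v) w = 0}" by (rule span_minimal[rotated])
      then show ?thesis using sp by blast
    qed
    then have "F v = 0" using has_signature_nondegenerate[OF B s] by (simp add: nondegenerate_def)
    then show "v = 0" using F linear_injective_0 by blast
  qed
  then obtain p' q' where s': "has_signature ?B p' q'" using diagonalize[of ?B] sym by blast
  obtain P N where 1: "finite P" "finite N" "P \<inter> N = {}" "card P = p'" "card N = q'" "orthogonal_family ?B (P \<union> N)"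
    "span (P \<union> N) = UNIV" "\<forall>v\<in>P. ?B v v > 0" "\<forall>v\<in>N. ?B v v < 0" "independent (P \<union> N)"
    by (rule has_signature_orthogonal[OF s'])
  have "has_signature B (Suc p') q'"
  proof (rule has_signatureI[OF B])
    show "finite (insert n (F ` P))" "finite (F ` N)" using 1 by auto
    have inj: "inj_on F X" for X using F(2) inj_on_subset by blast
    have "n \<notin> F ` P" using Fn n by fastforce
    then show "card (insert n (F ` P)) = Suc p'" using 1 by (simp add: card_image inj)
    show "card (F ` N) = q'" using 1 by (simp add: card_image inj)
    show "Suc p' + q' = DIM('k)" using has_signature_dim[OF s'] dim by simp
    show "B v v > 0" if "v \<in> insert n (F ` P)" for v using that n 1 by auto
    show "B v v < 0" if "v \<in> F ` N" for v using that 1 by auto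
    show "B v w = 0" if "v \<in> insert n (F ` P) \<union> F ` N" "w \<in> insert n (F ` P) \<union> F ` N" "v \<noteq> w" for v w
    proof -
      have "B (F v) (F w) = 0" if "v \<in> P \<union> N" "w \<in> P \<union> N" "F v \<noteq> F w" for v w
        using 1(6) that unfolding orthogonal_family_def by metis
      then show ?thesis using that Fn sym[of n] by auto
    qed
  qed
  then show ?thesis using inertia[OF B s] s' by auto
qed

lemma has_signature_pos:
  fixes B :: "'e::euclidean_space \<Rightarrow> 'e \<Rightarrow> real"
  assumes B: "bilinear B" and s: "has_signature B p 0" and x: "x \<noteq> 0" shows "B x x > 0"
proof -
  obtain P and N :: "'e set" where 1: "finite P" "card N = 0" "finite N" "orthogonal_family B (P \<union> N)" "span (P \<union> N) = UNIV" "\<forall>v\<in>P. B v v > 0"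
    by (rule has_signature_orthogonal[OF s]) blast
  then have N: "N = {}" by simp
  obtain c where c: "x = (\<Sum>v\<in>P. c v *\<^sub>R v)" "B x x = (\<Sum>v\<in>P. (c v)\<^sup>2 * B v v)"
    using orthogonal_family_sum_split[OF B, of P x] 1 N by auto
  have "\<exists>v\<in>P. c v \<noteq> 0" using c(1) x by (metis (no_types, lifting) scaleR_zero_left sum.neutral)
  then obtain v where v: "v \<in> P" "c v \<noteq> 0" by blast
  show ?thesis unfolding c(2) using 1 v by (intro sum_pos2[OF 1(1) v(1)]) (auto simp: less_imp_le)
qed

lemma has_signature_posI:
  fixes B :: "'e::euclidean_space \<Rightarrow> 'e \<Rightarrow> real"
  assumes B: "bilinear B" and sym: "\<And>v w. B v w = B w v" and pos: "\<And>x. x \<noteq> 0 \<Longrightarrow> B x x > 0"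
  shows "has_signature B DIM('e) 0"
proof -
  have "v = 0" if "\<forall>w. B v w = 0" for v using pos[of v] that by (metis less_irrefl)
  then have "nondegenerate B" using B by (simp add: nondegenerate_def)
  then obtain p q where s: "has_signature B p q" using diagonalize[of B] sym by blast
  obtain N where N: "card N = q" "finite N" "\<forall>v\<in>N. B v v < 0" by (rule has_signature_orthogonal[OF s]) blast
  have "N = {}"
  proof (rule ccontr)
    assume "N \<noteq> {}"
    then obtain v where v: "B v v < 0" using N(3) by blast
    then have "v \<noteq> 0" using linear_0[OF bilinearD(1)[OF B, of v]] by auto
    then show False using pos[of v] v by simp
  qed
  then have "q = 0" using N by simp
  then show ?thesis using s has_signature_dim[OF s] by simp
qed


section \<open>Operations on smooth functions and tangent vectors\<close>

context
  fixes M :: "('a, 'e::euclidean_space) mfd" assumes M: "smooth_charts M"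
begin

lemma smooth_near_points: "smooth_near M p f \<Longrightarrow> p \<in> points M"
  unfolding smooth_near_def using openin_subset by blast

lemma germ_chart:
  assumes W: "openin (mtop M) W" "p \<in> W" "c \<in> atlas M" "p \<in> fst c"
  shows "open (snd c ` (fst c \<inter> W))" "snd c p \<in> snd c ` (fst c \<inter> W)"
    "\<And>x. x \<in> snd c ` (fst c \<inter> W) \<Longrightarrow> cinv c x \<in> W"
  using chart_open_image[OF M W(3,1)] W cinv_chart[OF chart_inj[OF M W(3)]] by auto

lemma smooth_near_cong:
  assumes W: "openin (mtop M) W" "p \<in> W" and eq: "\<And>q. q \<in> W \<Longrightarrow> f q = f' q" and f: "smooth_near M p f"
  shows "smooth_near M p f'"
proof -
  obtain c where c: "c \<in> atlas M" "p \<in> fst c" using chart_exists[OF M smooth_near_points[OF f]] by blast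
  note o = germ_chart[OF W c]
  obtain O' where O': "open O'" "snd c p \<in> O'" "O' \<subseteq> snd c ` fst c" "smooth_on O' (\<lambda>x. f (cinv c x))"
    using f unfolding smooth_near_chart[OF M c] by blast
  let ?O = "O' \<inter> snd c ` (fst c \<inter> W)"
  have oO: "open ?O" using O'(1) o(1) by blast
  have "smooth_on ?O (\<lambda>x. f' (cinv c x))"
    by (rule smooth_on_cong[OF oO _ smooth_on_subset[OF O'(4)]]) (use o(3) eq in auto)
  then show ?thesis unfolding smooth_near_chart[OF M c] using oO O' o(2) by blast
qed

text \<open>Functions are total on the type of points, while a derivation sees only the germ at
  \<open>p\<close>; the default value is respected because smoothness near \<open>p\<close> is
  itself a property of the germ.\<close>

lemma tangent_cong:
  assumes W: "openin (mtop M) W" "p \<in> W" and eq: "\<And>q. q \<in> W \<Longrightarrow> f q = f' q" and v: "v \<in> tangent_space M p"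
  shows "v f = v f'"
proof -
  obtain c u where c: "c \<in> atlas M" "p \<in> fst c" "v = tv M c p u" using v by (auto simp: tangent_space_def)
  note o = germ_chart[OF W c(1,2)]
  have "smooth_near M p f = smooth_near M p f'"
    using smooth_near_cong[OF W, of f f'] smooth_near_cong[OF W, of f' f] eq by auto
  moreover have "dpartial u (\<lambda>x. f (cinv c x)) (snd c p) = dpartial u (\<lambda>x. f' (cinv c x)) (snd c p)"
    by (rule dpartial_cong[OF o(1,2)]) (rule eq[OF o(3)])
  ultimately show ?thesis using c(3) by (simp add: tv_apply[OF M])
qed

lemma smooth_near_compose2:
  fixes \<phi> :: "real \<times> real \<Rightarrow> real"
  assumes \<phi>: "smooth_on UNIV \<phi>" and f: "smooth_near M p f" and g: "smooth_near M p g"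
  shows "smooth_near M p (\<lambda>q. \<phi> (f q, g q))"
proof -
  obtain c where c: "c \<in> atlas M" "p \<in> fst c" using chart_exists[OF M smooth_near_points[OF f]] by blast
  obtain O1 where 1: "open O1" "snd c p \<in> O1" "O1 \<subseteq> snd c ` fst c" "smooth_on O1 (\<lambda>x. f (cinv c x))"
    using f unfolding smooth_near_chart[OF M c] by blast
  obtain O2 where 2: "open O2" "snd c p \<in> O2" "smooth_on O2 (\<lambda>x. g (cinv c x))"
    using g unfolding smooth_near_chart[OF M c] by blast
  have o: "open (O1 \<inter> O2)" using 1 2 by blast
  have "smooth_on (O1 \<inter> O2) (\<lambda>x. \<phi> (f (cinv c x), g (cinv c x)))"
    by (rule smooth_on_compose[OF o open_UNIV \<phi>])
      (auto intro!: smooth_on_Pair o smooth_on_subset[OF 1(4)] smooth_on_subset[OF 2(3)])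
  then show ?thesis unfolding smooth_near_chart[OF M c] using o 1 2 by blast
qed

lemma smooth_near_const: "p \<in> points M \<Longrightarrow> smooth_near M p (\<lambda>_. r)"
  unfolding smooth_near_def fun_smooth_def
  using smooth_on_const by (intro exI[of _ "points M"]) (auto simp: o_def)

lemma smooth_near_add: "smooth_near M p f \<Longrightarrow> smooth_near M p g \<Longrightarrow> smooth_near M p (\<lambda>q. f q + g q)"
  using smooth_near_compose2[where \<phi> = "\<lambda>z. fst z + snd z"] by (simp add: smooth_on_add smooth_on_fst smooth_on_snd)

lemma smooth_near_mult: "smooth_near M p f \<Longrightarrow> smooth_near M p g \<Longrightarrow> smooth_near M p (\<lambda>q. f q * g q)"
  using smooth_near_compose2[where \<phi> = "\<lambda>z. fst z * snd z"] by (simp add: smooth_on_mult smooth_on_fst smooth_on_snd)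

lemma smooth_near_diff: "smooth_near M p f \<Longrightarrow> smooth_near M p g \<Longrightarrow> smooth_near M p (\<lambda>q. f q - g q)"
  using smooth_near_compose2[where \<phi> = "\<lambda>z. fst z - snd z"] by (simp add: smooth_on_diff smooth_on_fst smooth_on_snd)

lemma tangent_scale_fun:
  assumes v: "v \<in> tangent_space M p" and p: "p \<in> points M" and r: "r \<noteq> 0"
  shows "v (\<lambda>q. r * f q) = r * v f"
proof -
  obtain c u where c: "c \<in> atlas M" "p \<in> fst c" "v = tv M c p u" using v by (auto simp: tangent_space_def)
  have sn: "smooth_near M p f" if "smooth_near M p (\<lambda>q. r * f q)"
    using smooth_near_mult[OF smooth_near_const[OF p, of "1/r"] that] r by (simp add: mult.assoc[symmetric])
  show ?thesis
  proof (cases "smooth_near M p f")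
    case True
    then show ?thesis
      using c smooth_near_mult[OF smooth_near_const[OF p, of r] True]
        dpartial_linear[OF bounded_linear_mult_right smooth_near_differentiable[OF M True c(1,2)], of u r]
      by (simp add: tv_apply[OF M])
  next
    case False
    then have "\<not> smooth_near M p (\<lambda>q. r * f q)" using sn by blast
    then show ?thesis using False c(3) by (simp add: tv_apply[OF M])
  qed
qed

lemma tangent_scale:
  assumes v: "v \<in> tangent_space M p" shows "(\<lambda>f. r * v f) \<in> tangent_space M p"
proof -
  obtain c u where c: "c \<in> atlas M" "p \<in> fst c" "v = tv M c p u" using v by (auto simp: tangent_space_def)
  have "(\<lambda>f. r * v f) = tv M c p (r *\<^sub>R u)" using linear_scale[OF tv_linear[OF M c(1,2)], of r u] c(3) by auto
  then show ?thesis using c unfolding tangent_space_def by blast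
qed

section \<open>Metrics in charts\<close>

context
  fixes p q and h :: "'a metric" assumes h: "metric_sig M p q h"
begin

lemma metric_form:
  assumes c: "c \<in> atlas M" "x \<in> fst c"
  shows "bilinear (\<lambda>v w. h x (tv M c x v) (tv M c x w))" "h x (tv M c x v) (tv M c x w) = h x (tv M c x w) (tv M c x v)"
    "has_signature (\<lambda>v w. h x (tv M c x v) (tv M c x w)) p q" "nondegenerate (\<lambda>v w. h x (tv M c x v) (tv M c x w))"
proof -
  have "mcoords M h c (snd c x) = (\<lambda>v w. h x (tv M c x v) (tv M c x w))"
    by (intro ext) (simp add: mcoords_def cinv_chart[OF chart_inj[OF M c(1)] c(2)])
  moreover have "bilinear (mcoords M h c (snd c x)) \<and> (\<forall>v w. mcoords M h c (snd c x) v w = mcoords M h c (snd c x) w v)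
      \<and> has_signature (mcoords M h c (snd c x)) p q"
    using h c unfolding metric_sig_def by blast
  ultimately show 1: "bilinear (\<lambda>v w. h x (tv M c x v) (tv M c x w))" "h x (tv M c x v) (tv M c x w) = h x (tv M c x w) (tv M c x v)"
    "has_signature (\<lambda>v w. h x (tv M c x v) (tv M c x w)) p q" by metis+
  show "nondegenerate (\<lambda>v w. h x (tv M c x v) (tv M c x w))" using has_signature_nondegenerate[OF 1(1,3)] .
qed

lemma metric_pseudo_metric: "c \<in> atlas M \<Longrightarrow> pseudo_metric (mcoords M h c) (snd c ` fst c)"
proof
  assume c: "c \<in> atlas M"
  show "open (snd c ` fst c)" by (rule chart_open[OF M c])
  fix x assume x: "x \<in> snd c ` fst c"
  show "nondegenerate (mcoords M h c x)" "mcoords M h c x v w = mcoords M h c x w v" for v w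
    using metric_form(4,2)[OF c cinv_in[OF x]] by (auto simp: mcoords_def[abs_def])
next
  assume c: "c \<in> atlas M"
  show "smooth_on (snd c ` fst c) (\<lambda>x. mcoords M h c x k l)" if "k \<in> Basis" "l \<in> Basis" for k l
    using h c that unfolding metric_sig_def by blast
qed

lemma metric_outside: "\<not> (x \<in> points M \<and> v \<in> tangent_space M x \<and> w \<in> tangent_space M x) \<Longrightarrow> h x v w = 0"
  using h unfolding metric_sig_def by blast

lemma metric_scale:
  assumes x: "v \<in> tangent_space M x" "w \<in> tangent_space M x" "x \<in> points M"
  shows "h x (\<lambda>f. r * v f) w = r * h x v w" "h x w (\<lambda>f. r * v f) = r * h x w v"
proof -
  obtain c where c: "c \<in> atlas M" "x \<in> fst c" using chart_exists[OF M x(3)] by blast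
  obtain a b where ab: "v = tv M c x a" "w = tv M c x b" using x unfolding tangent_space_chart[OF M c] by blast
  have "(\<lambda>f. r * v f) = tv M c x (r *\<^sub>R a)" using linear_scale[OF tv_linear[OF M c], of r a] ab by auto
  then show "h x (\<lambda>f. r * v f) w = r * h x v w" "h x w (\<lambda>f. r * v f) = r * h x w v"
    using bilinear_lmul[OF metric_form(1)[OF c]] bilinear_rmul[OF metric_form(1)[OF c]] ab by auto
qed

text \<open>Nondegeneracy gives existence and uniqueness for the description in
  \<open>sharp\<close>. The explicit solution by \<open>bsolve\<close> links dual vectors to the
  coordinate formulas.\<close>

lemma sharp_chart:
  assumes c: "c \<in> atlas M" "x \<in> fst c" and a: "linear (\<lambda>v. \<alpha> (tv M c x v))"
  shows "sharp M h x \<alpha> = tv M c x (\<Sum>k\<in>Basis. \<alpha> (tv M c x k) *\<^sub>R bsolve (\<lambda>v w. h x (tv M c x v) (tv M c x w)) k)"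
    "\<And>w. w \<in> tangent_space M x \<Longrightarrow> h x (sharp M h x \<alpha>) w = \<alpha> w"
    "\<And>v. v \<in> tangent_space M x \<Longrightarrow> (\<And>w. w \<in> tangent_space M x \<Longrightarrow> h x v w = \<alpha> w) \<Longrightarrow> sharp M h x \<alpha> = v"
proof -
  let ?B = "\<lambda>v w. h x (tv M c x v) (tv M c x w)"
  let ?s = "\<Sum>k\<in>Basis. \<alpha> (tv M c x k) *\<^sub>R bsolve ?B k"
  note nd = metric_form(4)[OF c] and l = bilinearD(2)[OF metric_form(1)[OF c]]
  have s: "?B ?s w = \<alpha> (tv M c x w)" for w
  proof -
    have "?B ?s w = (\<Sum>k\<in>Basis. \<alpha> (tv M c x k) * ?B (bsolve ?B k) w)"
      by (simp add: linear_sum[OF l] linear_scale[OF l])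
    also have "\<dots> = (\<Sum>k\<in>Basis. (w \<bullet> k) *\<^sub>R \<alpha> (tv M c x k))"
      using bsolve[OF nd] by (simp add: inner_commute mult.commute)
    finally show ?thesis using linear_Basis_sum[OF a, of w] by simp
  qed
  have u: "v = tv M c x ?s" if v: "v \<in> tangent_space M x" "\<And>w. w \<in> tangent_space M x \<Longrightarrow> h x v w = \<alpha> w" for v
  proof -
    obtain b where b: "v = tv M c x b" using v(1) unfolding tangent_space_chart[OF M c] by blast
    have "?B b w = \<alpha> (tv M c x w)" for w using v(2) b unfolding tangent_space_chart[OF M c] by blast
    from bsolve_form[OF nd a this] show ?thesis using b by simp
  qed
  have ex: "tv M c x ?s \<in> tangent_space M x" "\<And>w. w \<in> tangent_space M x \<Longrightarrow> h x (tv M c x ?s) w = \<alpha> w"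
    using s unfolding tangent_space_chart[OF M c] by auto
  show 1: "sharp M h x \<alpha> = tv M c x ?s" unfolding sharp_def
    by (rule the_equality) (use ex u in blast)+
  show "\<And>w. w \<in> tangent_space M x \<Longrightarrow> h x (sharp M h x \<alpha>) w = \<alpha> w" unfolding 1 by (rule ex(2))
  show "\<And>v. v \<in> tangent_space M x \<Longrightarrow> (\<And>w. w \<in> tangent_space M x \<Longrightarrow> h x v w = \<alpha> w) \<Longrightarrow> sharp M h x \<alpha> = v"
    unfolding 1 using u by blast
qed

end

lemma metric_sigI:
  assumes out: "\<And>x v w. \<not> (x \<in> points M \<and> v \<in> tangent_space M x \<and> w \<in> tangent_space M x) \<Longrightarrow> g x v w = 0"
    and form: "\<And>c x. c \<in> atlas M \<Longrightarrow> x \<in> fst c \<Longrightarrow> bilinear (\<lambda>v w. g x (tv M c x v) (tv M c x w))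
      \<and> (\<forall>v w. g x (tv M c x v) (tv M c x w) = g x (tv M c x w) (tv M c x v))
      \<and> has_signature (\<lambda>v w. g x (tv M c x v) (tv M c x w)) p q"
    and sm: "\<And>c k l. c \<in> atlas M \<Longrightarrow> k \<in> Basis \<Longrightarrow> l \<in> Basis \<Longrightarrow> smooth_on (snd c ` fst c) (\<lambda>y. mcoords M g c y k l)"
  shows "metric_sig M p q g"
  unfolding metric_sig_def
proof (intro conjI allI ballI impI)
  fix c y assume c: "c \<in> atlas M" "y \<in> snd c ` fst c"
  note f = form[OF c(1) cinv_in[OF c(2)]]
  show "bilinear (mcoords M g c y)" "has_signature (mcoords M g c y) p q" using f by (simp_all add: mcoords_def[abs_def])
  show "mcoords M g c y v w = mcoords M g c y w v" for v w using f by (simp add: mcoords_def)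
qed (use out sm in auto)

end

section \<open>Pullbacks\<close>

context
  fixes N :: "('b, 'f::euclidean_space) mfd" and M :: "('a, 'e::euclidean_space) mfd" and F
  assumes N: "smooth_charts N" and M: "smooth_charts M" and F: "smooth_map N M F"
begin

lemma pullback_apply:
  assumes "x \<in> points N" "v \<in> tangent_space N x" "w \<in> tangent_space N x"
  shows "pullback N M F g x v w = g (F x) (push M F x v) (push M F x w)"
  using assms by (simp add: pullback_def pull_form_def)

lemma pullback_coords:
  assumes b: "b \<in> atlas N" "x \<in> fst b" and c: "c \<in> atlas M" "F x \<in> fst c"
  shows "pullback N M F g x (tv N b x v) (tv N b x w)
    = g (F x) (tv M c (F x) (dpartial v (\<lambda>y. snd c (F (cinv b y))) (snd b x)))
              (tv M c (F x) (dpartial w (\<lambda>y. snd c (F (cinv b y))) (snd b x)))"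
  using pullback_apply[of x "tv N b x v" "tv N b x w" g] b chart_subset[OF N b(1)] tangent_space_chart[OF N b]
    push_tv[OF N M F b c] by auto

text \<open>In indefinite signature a pullback along an immersion may degenerate, so the pointwise
  signature enters as a hypothesis. It is supplied separately for the Riemannian restriction and for
  the Lorentzian hypersurface.\<close>

lemma pullback_metric:
  assumes g: "metric_sig M p q g"
    and s: "\<And>x b c. b \<in> atlas N \<Longrightarrow> x \<in> fst b \<Longrightarrow> c \<in> atlas M \<Longrightarrow> F x \<in> fst c \<Longrightarrow>
      linear (\<lambda>v. dpartial v (\<lambda>y. snd c (F (cinv b y))) (snd b x)) \<Longrightarrow>
      has_signature (\<lambda>v w. g (F x) (tv M c (F x) (dpartial v (\<lambda>y. snd c (F (cinv b y))) (snd b x)))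
              (tv M c (F x) (dpartial w (\<lambda>y. snd c (F (cinv b y))) (snd b x)))) p' q'"
  shows "metric_sig N p' q' (pullback N M F g)"
proof (rule metric_sigI[OF N])
  show "pullback N M F g x v w = 0" if "\<not> (x \<in> points N \<and> v \<in> tangent_space N x \<and> w \<in> tangent_space N x)" for x v w
    using that by (auto simp: pullback_def pull_form_def)
  fix b x assume b: "b \<in> atlas N" "x \<in> fst b"
  then have "F x \<in> points M" using smooth_map_points[OF F] chart_subset[OF N] by blast
  then obtain c where c: "c \<in> atlas M" "F x \<in> fst c" using chart_exists[OF M] by blast
  obtain O' where "open O'" "snd b x \<in> O'" "smooth_on O' (\<lambda>y. snd c (F (cinv b y)))"
    using chart_rep_differentiable[OF N M F b c] by metis
  then have l: "linear (\<lambda>v. dpartial v (\<lambda>y. snd c (F (cinv b y))) (snd b x))"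
    using smooth_on_at linear_dpartial by blast
  show "bilinear (\<lambda>v w. pullback N M F g x (tv N b x v) (tv N b x w)) \<and>
    (\<forall>v w. pullback N M F g x (tv N b x v) (tv N b x w) = pullback N M F g x (tv N b x w) (tv N b x v)) \<and>
    has_signature (\<lambda>v w. pullback N M F g x (tv N b x v) (tv N b x w)) p' q'"
    unfolding pullback_coords[OF b c]
    using s[OF b c l] bilinear_pull[OF metric_form(1)[OF M g c] l] metric_form(2)[OF M g c] by blast
next
  fix b and k l :: 'f assume b: "b \<in> atlas N" "k \<in> Basis" "l \<in> Basis"
  show "smooth_on (snd b ` fst b) (\<lambda>y. mcoords N (pullback N M F g) b y k l)"
  proof (rule smooth_on_localI)
    fix y assume "y \<in> snd b ` fst b"
    then obtain x where x: "x \<in> fst b" "y = snd b x" by blast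
    then have "F x \<in> points M" using smooth_map_points[OF F] chart_subset[OF N] b by blast
    then obtain c where c: "c \<in> atlas M" "F x \<in> fst c" using chart_exists[OF M] by blast
    obtain O' where O': "open O'" "snd b x \<in> O'" "O' \<subseteq> snd b ` fst b" "\<And>y. y \<in> O' \<Longrightarrow> F (cinv b y) \<in> fst c"
      "smooth_on O' (\<lambda>y. snd c (F (cinv b y)))"
      using chart_rep_differentiable[OF N M F b(1) x(1) c] by metis
    let ?F = "\<lambda>y. snd c (F (cinv b y))"
    interpret pseudo_metric "mcoords M g c" "snd c ` fst c" by (rule metric_pseudo_metric[OF M g c(1)])
    have FT: "?F ` O' \<subseteq> snd c ` fst c" using O'(4) by blast
    have "smooth_on O' (\<lambda>y. mcoords M g c (?F y) (dpartial k ?F y) (dpartial l ?F y))"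
    proof (rule smooth_on_bilinear_family[where B = "\<lambda>y. mcoords M g c (?F y)" and V = "dpartial k ?F" and W = "dpartial l ?F", OF O'(1)])
      show "bilinear (mcoords M g c (?F z))" if "z \<in> O'" for z using bil FT that by blast
      show "smooth_on O' (\<lambda>y. mcoords M g c (?F y) a e)" for a e
        by (rule smooth_on_compose[OF O'(1) T smG O'(5) FT])
    qed (rule smooth_on_dpartial[OF O'(1,5)])+
    moreover have "mcoords N (pullback N M F g) b z k l = mcoords M g c (?F z) (dpartial k ?F z) (dpartial l ?F z)" if z: "z \<in> O'" for z
    proof -
      have zb: "z \<in> snd b ` fst b" using z O' by blast
      show ?thesis
        using pullback_coords[OF b(1) cinv_in[OF zb] c(1) O'(4)[OF z], of g k l]
        by (simp add: mcoords_def chart_cinv[OF zb] cinv_chart[OF chart_inj[OF M c(1)] O'(4)[OF z]])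
    qed
    ultimately show "\<exists>T g'. open T \<and> y \<in> T \<and> smooth_on T g' \<and> (\<forall>y\<in>T. mcoords N (pullback N M F g) b y k l = g' y)"
      using O'(1,2) x(2) by blast
  qed
qed

end

lemma pullback_pullback:
  assumes N: "smooth_charts N" and M: "smooth_charts M" and P: "smooth_charts P"
    and F: "smooth_map N M F" and G: "smooth_map M P G"
    and x: "x \<in> points N" "v \<in> tangent_space N x" "w \<in> tangent_space N x"
  shows "pullback N M F (pullback M P G g) x v w = pullback N P (G \<circ> F) g x v w"
proof -
  note t = push_in_tangent_space[OF N M F x(1)]
  show ?thesis
    unfolding pullback_apply[OF N M F x] pullback_apply[OF M P G smooth_map_points[OF F x(1)] t[OF x(2)] t[OF x(3)]]
      pullback_apply[OF N P smooth_map_compose[OF N M P F G] x] push_push[OF N M P F G x(1)]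
    by simp
qed


section \<open>Smooth functions tested on plots\<close>

lemma fun_smooth_plot:
  assumes M: "smooth_charts M" and f: "fun_smooth M (points M) f" and G: "smooth_into M V G"
  shows "smooth_on V (\<lambda>y. f (G y))"
proof (rule smooth_on_local)
  fix y assume y: "y \<in> V"
  have "smooth_near M (G y) f"
    using f smooth_into_points[OF M G y] fun_smooth_iff[OF M openin_topspace] by blast
  from smooth_near_into[OF M this G y]
  show "\<exists>T. open T \<and> y \<in> T \<and> smooth_on T (\<lambda>y. f (G y))" by metis
qed

lemma fun_smoothI_plot:
  fixes M :: "('a, 'e::euclidean_space) mfd"
  assumes M: "smooth_charts M"
    and f: "\<And>(V::'e set) G. open V \<Longrightarrow> smooth_into M V G \<Longrightarrow> smooth_on V (\<lambda>y. f (G y))"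
  shows "fun_smooth M (points M) f"
proof -
  have "smooth_on (snd c ` (fst c \<inter> points M)) (f \<circ> cinv c)" if c: "c \<in> atlas M" for c
  proof -
    have "fst c \<inter> points M = fst c" using chart_subset[OF M c] by blast
    then show ?thesis using f[OF chart_open[OF M c] smooth_into_cinv[OF M c]] by (simp add: o_def)
  qed
  then show ?thesis by (simp add: fun_smooth_def)
qed

lemma fun_smooth_restrict:
  fixes N :: "('b, 'f::euclidean_space) mfd"
  assumes "smooth_charts N" "smooth_charts M" "smooth_map N M F" "fun_smooth M (points M) f"
  shows "fun_smooth N (points N) (\<lambda>x. f (F x))"
proof (rule fun_smoothI_plot[OF assms(1)])
  fix V and G :: "'f \<Rightarrow> 'b" assume "smooth_into N V G"
  then show "smooth_on V (\<lambda>y. f (F (G y)))"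
    using fun_smooth_plot[OF assms(2,4) smooth_map_imp_into[OF assms(1-3)]] by blast
qed

section \<open>Products with the positive ray\<close>

context
  fixes M :: "('a, 'e::euclidean_space) mfd" assumes M: "smooth_charts M"
begin

lemma ray_points: "points (ray_times M) = {0::real<..} \<times> points M"
  by (simp add: ray_times_def)

lemma ray_chart_image: "(\<lambda>(s, p). (s, snd c p)) ` ({0::real<..} \<times> X) = {0::real<..} \<times> snd c ` X"
  by force

lemma ray_cinv:
  assumes "c \<in> atlas M" "s > 0" "y \<in> snd c ` fst c"
  shows "cinv ({0::real<..} \<times> fst c, \<lambda>(s, p). (s, snd c p)) (s, y) = (s, cinv c y)"
proof (rule cinv_eqI)
  show "inj_on (snd ({0::real<..} \<times> fst c, \<lambda>(s, p). (s, snd c p))) (fst ({0::real<..} \<times> fst c, \<lambda>(s, p). (s, snd c p)))"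
    using chart_inj[OF M assms(1)] by (auto simp: inj_on_def)
qed (use assms(2) cinv_in[OF assms(3)] chart_cinv[OF assms(3)] in auto)

lemma smooth_charts_ray: "smooth_charts (ray_times M)"
  unfolding smooth_charts_def
proof (intro conjI ballI)
  have at: "\<exists>c\<in>atlas M. cc = ({0::real<..} \<times> fst c, \<lambda>(s, p). (s, snd c p))" if "cc \<in> atlas (ray_times M)" for cc
    using that unfolding ray_times_def mfd.sel by blast
  have ta: "({0::real<..} \<times> fst c, \<lambda>(s, p). (s, snd c p)) \<in> atlas (ray_times M)" if "c \<in> atlas M" for c
    using that unfolding ray_times_def mfd.sel by blast
  show "(\<Union>c\<in>atlas (ray_times M). fst c) = points (ray_times M)"
  proof (intro equalityI subsetI)
    fix z assume "z \<in> (\<Union>c\<in>atlas (ray_times M). fst c)"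
    then show "z \<in> points (ray_times M)" using at chart_subset[OF M] by (fastforce simp: ray_points)
  next
    fix z assume z: "z \<in> points (ray_times M)"
    then have "snd z \<in> points M" by (auto simp: ray_points)
    then obtain c where c: "c \<in> atlas M" "snd z \<in> fst c" using chart_exists[OF M] by blast
    then show "z \<in> (\<Union>c\<in>atlas (ray_times M). fst c)" using ta[OF c(1)] z by (force simp: ray_points mem_Times_iff)
  qed
  fix cc assume "cc \<in> atlas (ray_times M)"
  then obtain c where c: "c \<in> atlas M" and cc: "cc = ({0::real<..} \<times> fst c, \<lambda>(s, p). (s, snd c p))" using at by blast
  have im: "snd cc ` fst cc = {0::real<..} \<times> snd c ` fst c" unfolding cc snd_conv fst_conv by (rule ray_chart_image)
  show "openin (mtop (ray_times M)) (fst cc)"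
    using chart_openin[OF M c] by (simp add: cc ray_times_def openin_prod_Times_iff)
  show "open (snd cc ` fst cc)" unfolding im using chart_open[OF M c] by (intro open_Times) auto
  obtain k where k: "homeomorphic_maps (subtopology (mtop M) (fst c)) (top_of_set (snd c ` fst c)) (snd c) k"
    using chart_homeo[OF M c] homeomorphic_map_maps by blast
  have "homeomorphic_maps (prod_topology (top_of_set {0::real<..}) (subtopology (mtop M) (fst c)))
      (prod_topology (top_of_set {0::real<..}) (top_of_set (snd c ` fst c))) (\<lambda>(s::real, p). (s, snd c p)) (\<lambda>(s, p). (s, k p))"
    using homeomorphic_maps_prod[of "top_of_set {0::real<..}" "subtopology (mtop M) (fst c)" "top_of_set {0::real<..}" "top_of_set (snd c ` fst c)"
        "\<lambda>s::real. s" "snd c" "\<lambda>s. s" k] k by (simp add: homeomorphic_maps_def)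
  then have "homeomorphic_map (prod_topology (top_of_set {0::real<..}) (subtopology (mtop M) (fst c)))
      (prod_topology (top_of_set {0::real<..}) (top_of_set (snd c ` fst c))) (\<lambda>(s::real, p). (s, snd c p))"
    using homeomorphic_map_maps by blast
  moreover have "subtopology (mtop (ray_times M)) ({0::real<..} \<times> fst c) = prod_topology (top_of_set {0::real<..}) (subtopology (mtop M) (fst c))"
    by (simp add: ray_times_def subtopology_Times[symmetric] subtopology_subtopology prod_topology_subtopology)
  ultimately show "homeomorphic_map (subtopology (mtop (ray_times M)) (fst cc)) (top_of_set (snd cc ` fst cc)) (snd cc)"
    unfolding im by (simp add: cc)
  fix cc' assume "cc' \<in> atlas (ray_times M)"
  then obtain c' where c': "c' \<in> atlas M" and cc': "cc' = ({0::real<..} \<times> fst c', \<lambda>(s, p). (s, snd c' p))" using at by blast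
  have im2: "snd cc ` (fst cc \<inter> fst cc') = {0::real<..} \<times> snd c ` (fst c \<inter> fst c')"
    unfolding cc cc' snd_conv fst_conv Times_Int_Times using ray_chart_image[of c "fst c \<inter> fst c'"] by simp
  have o: "open (snd c ` (fst c \<inter> fst c'))" by (rule chart_open_image[OF M c chart_openin[OF M c']])
  have o2: "open ({0::real<..} \<times> snd c ` (fst c \<inter> fst c'))" by (intro open_Times o) auto
  show "smooth_on (snd cc ` (fst cc \<inter> fst cc')) (snd cc' \<circ> cinv cc)"
    unfolding im2
  proof (rule smooth_on_cong[OF o2])
    show "smooth_on ({0::real<..} \<times> snd c ` (fst c \<inter> fst c')) (\<lambda>z. (fst z, (snd c' \<circ> cinv c) (snd z)))"
      by (intro smooth_on_Pair o2 smooth_on_fst smooth_on_ident smooth_on_compose[OF o2 o transition_smooth[OF M c c'] smooth_on_snd[OF o2]]) auto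
    show "(fst z, (snd c' \<circ> cinv c) (snd z)) = (snd cc' \<circ> cinv cc) z" if "z \<in> {0::real<..} \<times> snd c ` (fst c \<inter> fst c')" for z
      using that ray_cinv[OF c] by (auto simp: cc cc')
  qed
qed

lemma smooth_into_ray:
  assumes V: "open V"
  shows "smooth_into (ray_times M) V K \<longleftrightarrow>
    smooth_on V (\<lambda>y. fst (K y)) \<and> (\<forall>y\<in>V. fst (K y) > 0) \<and> smooth_into M V (\<lambda>y. snd (K y))"
proof
  assume K: "smooth_into (ray_times M) V K"
  have pos: "fst (K y) > 0" "snd (K y) \<in> points M" if "y \<in> V" for y
    using smooth_into_points[OF smooth_charts_ray K that] by (auto simp: ray_points mem_Times_iff)
  have loc: "\<exists>O'. open O' \<and> y \<in> O' \<and> O' \<subseteq> V \<and> smooth_on O' (\<lambda>z. fst (K z)) \<and> smooth_into M O' (\<lambda>z. snd (K z))" if y: "y \<in> V" for y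
  proof -
    obtain c where c: "c \<in> atlas M" "snd (K y) \<in> fst c" using chart_exists[OF M pos(2)[OF y]] by blast
    let ?cc = "({0::real<..} \<times> fst c, \<lambda>(s::real, p). (s, snd c p))"
    have 1: "?cc \<in> atlas (ray_times M)" using c unfolding ray_times_def mfd.sel by blast
    have 2: "K y \<in> fst ?cc" using c pos[OF y] by (auto simp: mem_Times_iff)
    obtain O' where O': "open O'" "y \<in> O'" "O' \<subseteq> V" "K ` O' \<subseteq> fst ?cc" "smooth_on O' (\<lambda>z. snd ?cc (K z))"
      by (rule smooth_into_chart[OF smooth_charts_ray K y 1 2], rule that)
    have "smooth_on O' (\<lambda>z. fst (K z))" "smooth_on O' (\<lambda>z. snd c (snd (K z)))"
      using smooth_on_fst[OF O'(1,5)] smooth_on_snd[OF O'(1,5)] by (simp_all add: case_prod_unfold)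
    moreover have "(\<lambda>z. snd (K z)) ` O' \<subseteq> fst c" using O'(4) by auto
    ultimately show ?thesis using O' smooth_intoI_chart[OF M O'(1) c(1)] by blast
  qed
  have "smooth_on V (\<lambda>y. fst (K y))" by (rule smooth_on_local) (drule loc, elim exE conjE, intro exI conjI)
  moreover have "smooth_into M V (\<lambda>y. snd (K y))" by (rule smooth_into_local) (drule loc, elim exE conjE, intro exI conjI)
  ultimately show "smooth_on V (\<lambda>y. fst (K y)) \<and> (\<forall>y\<in>V. fst (K y) > 0) \<and> smooth_into M V (\<lambda>y. snd (K y))"
    using pos by blast
next
  assume R: "smooth_on V (\<lambda>y. fst (K y)) \<and> (\<forall>y\<in>V. fst (K y) > 0) \<and> smooth_into M V (\<lambda>y. snd (K y))"
  show "smooth_into (ray_times M) V K"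
  proof (rule smooth_into_local)
    fix y assume y: "y \<in> V"
    then obtain c O' where c: "c \<in> atlas M" "open O'" "y \<in> O'" "O' \<subseteq> V" "(\<lambda>y. snd (K y)) ` O' \<subseteq> fst c" "smooth_on O' (\<lambda>z. snd c (snd (K z)))"
      using R unfolding smooth_into_def by blast
    have "smooth_into (ray_times M) O' K"
    proof (rule smooth_intoI_chart[OF smooth_charts_ray c(2), of "({0::real<..} \<times> fst c, \<lambda>(s::real, p). (s, snd c p))"])
      show "smooth_on O' (\<lambda>z. snd ({0::real<..} \<times> fst c, \<lambda>(s::real, p). (s, snd c p)) (K z))"
        using smooth_on_Pair[OF c(2) smooth_on_subset[OF conjunct1[OF R] c(4)] c(6)] by (simp add: case_prod_unfold)
      show "K ` O' \<subseteq> fst ({0::real<..} \<times> fst c, \<lambda>(s::real, p). (s, snd c p))"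
      proof (rule image_subsetI)
        fix x assume "x \<in> O'"
        then have "fst (K x) > 0" "snd (K x) \<in> fst c" using R c(4,5) by auto
        then show "K x \<in> fst ({0::real<..} \<times> fst c, \<lambda>(s::real, p). (s, snd c p))" by (simp add: mem_Times_iff)
      qed
      show "({0::real<..} \<times> fst c, \<lambda>(s::real, p). (s, snd c p)) \<in> atlas (ray_times M)"
        using c unfolding ray_times_def mfd.sel by blast
    qed
    then show "\<exists>O'. open O' \<and> y \<in> O' \<and> O' \<subseteq> V \<and> smooth_into (ray_times M) O' K" using c by blast
  qed
qed

end

section \<open>The bundle of metrics\<close>

lemma bscale_bscale: "bscale s (bscale t u) = bscale (s * t) u"
  by (simp add: bscale_def power_mult_distrib mult.assoc)

lemma fst_bscale [simp]: "fst (bscale s u) = fst u"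
  by (simp add: bscale_def)

lemma riemannian_pos:
  assumes M: "smooth_charts (M :: ('a, 'e::euclidean_space) mfd)" and g: "riemannian M g"
    and x: "x \<in> points M" "c \<in> atlas M" "x \<in> fst c" and v: "v \<noteq> 0"
  shows "g x (tv M c x v) (tv M c x v) > 0"
  using has_signature_pos[OF metric_form(1,3)[OF M g x(2,3)] v] .

context
  fixes M :: "('a, 'e::euclidean_space) mfd" assumes M: "smooth_charts M"
begin

lemma conf_related_refl: "conf_related M (\<lambda>_. 0) g g"
  using smooth_near_const[OF M] by (simp add: conf_related_def fun_smooth_iff[OF M openin_topspace])

lemma conf_related_sym: "conf_related M \<omega> g g' \<Longrightarrow> conf_related M (\<lambda>x. - \<omega> x) g' g"
  using smooth_near_diff[OF M smooth_near_const[OF M, of _ 0]]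
  by (auto simp: conf_related_def fun_smooth_iff[OF M openin_topspace] exp_minus field_simps)

lemma conf_related_trans:
  "conf_related M \<omega> g g' \<Longrightarrow> conf_related M \<omega>' g' g'' \<Longrightarrow> conf_related M (\<lambda>x. \<omega> x + \<omega>' x) g g''"
  using smooth_near_add[OF M]
  by (auto simp: conf_related_def fun_smooth_iff[OF M openin_topspace] distrib_left exp_add)

end

locale conformal =
  fixes M :: "('a, 'e::euclidean_space) mfd" and C
  assumes conformal: "conformal_manifold M C"
begin

lemma M: "smooth_charts M"
  using conformal by (simp add: conformal_manifold_def smooth_manifold_iff)

lemmas fs_iff = fun_smooth_iff[OF M openin_topspace]
lemmas conf_refl = conf_related_refl[OF M]
lemmas conf_sym = conf_related_sym[OF M]
lemmas conf_trans = conf_related_trans[OF M]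

lemma C_ex: "\<exists>g. g \<in> C"
  using conformal conf_refl unfolding conformal_manifold_def by blast

lemma riem: "g \<in> C \<Longrightarrow> riemannian M g"
  using conformal unfolding conformal_manifold_def by blast

lemma rel: "g \<in> C \<Longrightarrow> g' \<in> C \<Longrightarrow> \<exists>\<omega>. conf_related M \<omega> g g'"
  using conformal conf_sym conf_trans unfolding conformal_manifold_def by blast

lemma C_closed: "g \<in> C \<Longrightarrow> riemannian M g' \<Longrightarrow> conf_related M \<omega> g g' \<Longrightarrow> g' \<in> C"
  using conformal conf_trans unfolding conformal_manifold_def by blast

text \<open>A point of the bundle contains a form on the whole type of derivations; equality extends
  to arguments that are not tangent vectors because metrics are 0 on them.\<close>

lemma conf_eq:
  assumes "g \<in> C" "g' \<in> C" "conf_related M \<omega> g g'" "x \<in> points M"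
  shows "(x, g' x) = bscale (exp (\<omega> x)) (x, g x)"
proof -
  have "g' x v w = exp (2 * \<omega> x) * g x v w" for v w
    using assms(3,4) metric_outside[OF M riem[OF assms(1)], of x v w] metric_outside[OF M riem[OF assms(2)], of x v w]
    by (cases "v \<in> tangent_space M x \<and> w \<in> tangent_space M x") (auto simp: conf_related_def)
  moreover have "exp (2 * \<omega> x) = (exp (\<omega> x))\<^sup>2" by (simp add: exp_double)
  ultimately show ?thesis by (simp add: bscale_def fun_eq_iff)
qed

text \<open>Constant rescalings stay in the class, with conformal factor \<open>ln s\<close>; hence
  the whole ray through a point of the bundle lies in the bundle.\<close>

lemma C_scale:
  assumes g: "g \<in> C" and s: "s > 0" shows "(\<lambda>x v w. s\<^sup>2 * g x v w) \<in> C"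
proof (rule C_closed[OF g])
  note r = riem[OF g]
  show "riemannian M (\<lambda>x v w. s\<^sup>2 * g x v w)"
  proof (rule metric_sigI[OF M])
    fix c x assume c: "c \<in> atlas M" "x \<in> fst c"
    let ?B = "\<lambda>v w. s\<^sup>2 * g x (tv M c x v) (tv M c x w)"
    note f = metric_form[OF M r c]
    have b: "bilinear ?B" unfolding bilinear_def
      by (intro conjI allI linearI) (simp_all add: bilinear_ladd[OF f(1)] bilinear_radd[OF f(1)] bilinear_lmul[OF f(1)] bilinear_rmul[OF f(1)] algebra_simps)
    moreover have sy: "?B v w = ?B w v" for v w using f(2)[of v w] by simp
    moreover have "has_signature ?B DIM('e) 0"
      by (rule has_signature_posI[OF b sy]) (use has_signature_pos[OF f(1,3)] s in auto)
    ultimately show "bilinear ?B \<and> (\<forall>v w. ?B v w = ?B w v) \<and> has_signature ?B DIM('e) 0" by blast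
  next
    fix c and k l :: 'e assume c: "c \<in> atlas M" and kl: "k \<in> Basis" "l \<in> Basis"
    interpret pseudo_metric "mcoords M g c" "snd c ` fst c" by (rule metric_pseudo_metric[OF M r c])
    show "smooth_on (snd c ` fst c) (\<lambda>y. mcoords M (\<lambda>x v w. s\<^sup>2 * g x v w) c y k l)"
      using smooth_on_mult[OF T smooth_on_const sm[OF kl]] by (simp add: mcoords_def)
  qed (simp add: metric_outside[OF M r])
  show "conf_related M (\<lambda>_. ln s) g (\<lambda>x v w. s\<^sup>2 * g x v w)"
    using s smooth_near_const[OF M] by (simp add: conf_related_def fs_iff exp_double)
qed

text \<open>Metrics of the class differ by positive functions, so a single \<open>g\<close>
  parametrizes the bundle by base point and positive scale.\<close>

lemma metric_bundle_iff:
  assumes g: "g \<in> C"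
  shows "u \<in> metric_bundle M C \<longleftrightarrow> (\<exists>x\<in>points M. \<exists>s>0. u = bscale s (x, g x))"
proof
  assume "u \<in> metric_bundle M C"
  then obtain x g' where x: "x \<in> points M" "g' \<in> C" "u = (x, g' x)" by (auto simp: metric_bundle_def)
  then obtain \<omega> where "conf_related M \<omega> g g'" using rel[OF g] by blast
  then have "u = bscale (exp (\<omega> x)) (x, g x)" using conf_eq[OF g x(2) _ x(1)] x(3) by simp
  then show "\<exists>x\<in>points M. \<exists>s>0. u = bscale s (x, g x)" using x(1) by (intro bexI[of _ x] exI[of _ "exp (\<omega> x)"] conjI) auto
next
  assume "\<exists>x\<in>points M. \<exists>s>0. u = bscale s (x, g x)"
  then obtain x s where x: "x \<in> points M" "s > 0" "u = bscale s (x, g x)" by blast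
  have "u = (x, (\<lambda>x v w. s\<^sup>2 * g x v w) x)" using x(3) by (simp add: bscale_def)
  then show "u \<in> metric_bundle M C" unfolding metric_bundle_def mem_Collect_eq using x(1) C_scale[OF g x(2)]
    by (intro exI[of _ x] exI[of _ "\<lambda>x v w. s\<^sup>2 * g x v w"] conjI)
qed

lemma bscale_inj:
  assumes g: "g \<in> C" and x: "x \<in> points M" and s: "s > 0" "t > 0" "bscale s (x, g x) = bscale t (x, g x)"
  shows "s = t"
proof -
  obtain c where c: "c \<in> atlas M" "x \<in> fst c" using chart_exists[OF M x] by blast
  obtain b :: 'e where b: "b \<in> Basis" using nonempty_Basis by blast
  then have "g x (tv M c x b) (tv M c x b) > 0" using riemannian_pos[OF M riem[OF g] x c] nonzero_Basis by blast
  moreover have "s\<^sup>2 * g x (tv M c x b) (tv M c x b) = t\<^sup>2 * g x (tv M c x b) (tv M c x b)"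
    using arg_cong[OF s(3), of "\<lambda>u. snd u (tv M c x b) (tv M c x b)"] by (simp add: bscale_def)
  ultimately have "s\<^sup>2 = t\<^sup>2" by simp
  then show ?thesis using s by simp
qed

lemma blevel_bscale:
  assumes "g \<in> C" "x \<in> points M" "s > 0" shows "blevel g (bscale s (x, g x)) = s"
  unfolding blevel_def using assms bscale_inj[OF assms(1,2)] by (intro the_equality) auto

lemma blevel:
  assumes g: "g \<in> C" and u: "u \<in> metric_bundle M C"
  shows "blevel g u > 0" "bscale (blevel g u) (fst u, g (fst u)) = u" "fst u \<in> points M"
proof -
  obtain x s where x: "x \<in> points M" "s > 0" "u = bscale s (x, g x)" using u unfolding metric_bundle_iff[OF g] by blast
  then show "blevel g u > 0" "bscale (blevel g u) (fst u, g (fst u)) = u" "fst u \<in> points M"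
    using blevel_bscale[OF g x(1,2)] by simp_all
qed

lemma blevel_scale:
  assumes g: "g \<in> C" and u: "u \<in> metric_bundle M C" and s: "s > 0"
  shows "blevel g (bscale s u) = s * blevel g u"
  using blevel[OF g u] blevel_bscale[OF g blevel(3)[OF g u], of "s * blevel g u"] s bscale_bscale by (metis mult_pos_pos)

lemma blevel_change:
  assumes g: "g \<in> C" "g' \<in> C" "conf_related M \<omega> g g'" and x: "x \<in> points M" and s: "s > 0"
  shows "blevel g (bscale s (x, g' x)) = s * exp (\<omega> x)"
  unfolding conf_eq[OF g x] bscale_bscale using blevel_bscale[OF g(1) x] s by simp

section \<open>Trivializations, topology and charts of the bundle of metrics\<close>

definition triv :: "'a metric \<Rightarrow> real \<times> 'a \<Rightarrow> 'a bpt" where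
  "triv g z = bscale (fst z) (snd z, g (snd z))"

definition triv_inv :: "'a metric \<Rightarrow> 'a bpt \<Rightarrow> real \<times> 'a" where
  "triv_inv g u = (blevel g u, fst u)"

lemma triv:
  assumes g: "g \<in> C"
  shows "z \<in> {0::real<..} \<times> points M \<Longrightarrow> triv g z \<in> metric_bundle M C" "z \<in> {0::real<..} \<times> points M \<Longrightarrow> triv_inv g (triv g z) = z"
    "u \<in> metric_bundle M C \<Longrightarrow> triv g (triv_inv g u) = u" "u \<in> metric_bundle M C \<Longrightarrow> triv_inv g u \<in> {0::real<..} \<times> points M"
proof -
  show "triv g z \<in> metric_bundle M C" "triv_inv g (triv g z) = z" if "z \<in> {0::real<..} \<times> points M"
    using that blevel_bscale[OF g, of "snd z" "fst z"] unfolding metric_bundle_iff[OF g]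
    by (auto simp: triv_def triv_inv_def mem_Times_iff)
  show "triv g (triv_inv g u) = u" "triv_inv g u \<in> {0::real<..} \<times> points M" if "u \<in> metric_bundle M C"
    using blevel[OF g that] by (auto simp: triv_def triv_inv_def)
qed

lemma openin_bundle: "openin (mtop (bundle_mfd M C)) A \<longleftrightarrow> bundle_open M C A"
  by (simp add: bundle_mfd_def topology_inverse'[OF istopology_bundle_open])

text \<open>Openness is defined through all metrics of the class. Two trivializations differ by the
  smooth map \<theta>, which multiplies the fibre coordinate by \<open>exp (\<omega> x)\<close>, so
  one metric decides.\<close>

lemma bundle_open_iff:
  assumes g: "g \<in> C"
  shows "bundle_open M C A \<longleftrightarrow> A \<subseteq> metric_bundle M C \<and> openin (mtop (ray_times M)) {z \<in> {0::real<..} \<times> points M. triv g z \<in> A}"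
proof
  show "bundle_open M C A \<Longrightarrow> A \<subseteq> metric_bundle M C \<and> openin (mtop (ray_times M)) {z \<in> {0::real<..} \<times> points M. triv g z \<in> A}"
    using g unfolding bundle_open_def triv_def by (simp add: ray_times_def)
next
  assume A: "A \<subseteq> metric_bundle M C \<and> openin (mtop (ray_times M)) {z \<in> {0::real<..} \<times> points M. triv g z \<in> A}"
  have "openin (mtop (ray_times M)) {z \<in> {0::real<..} \<times> points M. triv g' z \<in> A}" if g': "g' \<in> C" for g'
  proof -
    obtain \<omega> where \<omega>: "conf_related M \<omega> g g'" using rel[OF g g'] by blast
    define \<theta> where "\<theta> z = (fst z * exp (\<omega> (snd z)), snd z)" for z :: "real \<times> 'a"
    have fs: "fun_smooth M (points M) \<omega>" using \<omega> by (simp add: conf_related_def)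
    have "smooth_map (ray_times M) (ray_times M) \<theta>"
    proof (rule smooth_mapI_into[OF smooth_charts_ray[OF M] smooth_charts_ray[OF M]])
      fix V and G :: "real \<times> 'e \<Rightarrow> real \<times> 'a" assume V: "open V" and G: "smooth_into (ray_times M) V G"
      note G' = G[unfolded smooth_into_ray[OF M V]]
      show "smooth_into (ray_times M) V (\<lambda>y. \<theta> (G y))"
        unfolding smooth_into_ray[OF M V] \<theta>_def
        using G' smooth_on_mult[OF V _ smooth_on_exp_comp[OF V fun_smooth_plot[OF M fs]]] by simp
    qed
    then have "continuous_map (mtop (ray_times M)) (mtop (ray_times M)) \<theta>" by (simp add: smooth_map_def)
    from openin_continuous_map_preimage[OF this] A
    have op: "openin (mtop (ray_times M)) {z \<in> points (ray_times M). \<theta> z \<in> {z \<in> {0::real<..} \<times> points M. triv g z \<in> A}}" by blast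
    have tr: "triv g (\<theta> z) = triv g' z" if "z \<in> {0::real<..} \<times> points M" for z
      unfolding triv_def \<theta>_def using conf_eq[OF g g' \<omega>, of "snd z"] that by (auto simp: bscale_bscale)
    have pt: "\<theta> z \<in> {0::real<..} \<times> points M" if "z \<in> {0::real<..} \<times> points M" for z using that by (auto simp: \<theta>_def)
    have "{z \<in> points (ray_times M). \<theta> z \<in> {z \<in> {0::real<..} \<times> points M. triv g z \<in> A}} = {z \<in> {0::real<..} \<times> points M. triv g' z \<in> A}"
      unfolding ray_points[OF M] mem_Collect_eq using tr pt by (intro Collect_cong) metis
    then show ?thesis using op by simp
  qed
  then show "bundle_open M C A" using A unfolding bundle_open_def triv_def by (simp add: ray_times_def)
qed

lemma bundle_points: "points (bundle_mfd M C) = metric_bundle M C"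
proof -
  obtain g where g: "g \<in> C" using C_ex by blast
  have "{z \<in> {0::real<..} \<times> points M. triv g z \<in> metric_bundle M C} = points (ray_times M)"
    using triv(1)[OF g] by (auto simp: ray_points[OF M])
  then have "openin (mtop (bundle_mfd M C)) (metric_bundle M C)"
    unfolding openin_bundle bundle_open_iff[OF g] by simp
  moreover have "A \<subseteq> metric_bundle M C" if "openin (mtop (bundle_mfd M C)) A" for A
    using that unfolding openin_bundle bundle_open_def by blast
  ultimately show ?thesis by (meson openin_subset openin_topspace subset_antisym)
qed

lemma triv_inv_homeo:
  assumes g: "g \<in> C"
  shows "homeomorphic_maps (mtop (bundle_mfd M C)) (mtop (ray_times M)) (triv_inv g) (triv g)"
  unfolding homeomorphic_maps_def continuous_map_def bundle_points ray_points[OF M]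
proof (intro conjI allI impI ballI Pi_I)
  fix U assume U: "openin (mtop (ray_times M)) U"
  have "{z \<in> {0::real<..} \<times> points M. triv g z \<in> {u \<in> metric_bundle M C. triv_inv g u \<in> U}} = U"
    using triv(1,2)[OF g] openin_subset[OF U] unfolding ray_points[OF M] by auto
  then show "openin (mtop (bundle_mfd M C)) {u \<in> metric_bundle M C. triv_inv g u \<in> U}"
    unfolding openin_bundle bundle_open_iff[OF g] using U by simp
next
  fix U assume "openin (mtop (bundle_mfd M C)) U"
  then show "openin (mtop (ray_times M)) {z \<in> {0::real<..} \<times> points M. triv g z \<in> U}"
    unfolding openin_bundle bundle_open_iff[OF g] by blast
qed (use triv[OF g] in auto)

definition bchart :: "'a metric \<Rightarrow> ('a, 'e) chart \<Rightarrow> ('a bpt, real \<times> 'e) chart" where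
  "bchart g c = ({u \<in> metric_bundle M C. fst u \<in> fst c}, \<lambda>u. (blevel g u, snd c (fst u)))"

lemma bchart_simps: "fst (bchart g c) = {u \<in> metric_bundle M C. fst u \<in> fst c}"
  "snd (bchart g c) u = (blevel g u, snd c (fst u))"
  by (simp_all add: bchart_def)

lemma bundle_atlas: "atlas (bundle_mfd M C) = {bchart g c | g c. g \<in> C \<and> c \<in> atlas M}"
  by (simp add: bundle_mfd_def bchart_def)

lemma bchart_image:
  assumes g: "g \<in> C" and X: "X \<subseteq> points M"
  shows "snd (bchart g c) ` {u \<in> metric_bundle M C. fst u \<in> X} = {0::real<..} \<times> snd c ` X"
proof (intro equalityI subsetI)
  fix z :: "real \<times> 'e" assume "z \<in> snd (bchart g c) ` {u \<in> metric_bundle M C. fst u \<in> X}"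
  then show "z \<in> {0::real<..} \<times> snd c ` X" using blevel(1)[OF g] by (auto simp: bchart_simps)
next
  fix z :: "real \<times> 'e" assume "z \<in> {0::real<..} \<times> snd c ` X"
  then obtain s x where z: "s > 0" "x \<in> X" "z = (s, snd c x)" by auto
  then have "x \<in> points M" using X by blast
  then show "z \<in> snd (bchart g c) ` {u \<in> metric_bundle M C. fst u \<in> X}"
    using z blevel_bscale[OF g, of x s] metric_bundle_iff[OF g]
    by (intro image_eqI[of _ _ "bscale s (x, g x)"]) (auto simp: bchart_simps)
qed

lemma bchart_inj:
  assumes g: "g \<in> C" and c: "c \<in> atlas M" shows "inj_on (snd (bchart g c)) (fst (bchart g c))"
proof (rule inj_onI)
  fix u u' assume u: "u \<in> fst (bchart g c)" "u' \<in> fst (bchart g c)" and e: "snd (bchart g c) u = snd (bchart g c) u'"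
  then have "fst u = fst u'" using chart_inj[OF M c] by (auto simp: bchart_simps dest: inj_onD)
  then show "u = u'" using e u blevel(2)[OF g] unfolding bchart_simps by (metis (mono_tags, lifting) Pair_inject mem_Collect_eq)
qed

lemma bchart_cinv:
  assumes g: "g \<in> C" and c: "c \<in> atlas M" and s: "s > 0" and y: "y \<in> snd c ` fst c"
  shows "cinv (bchart g c) (s, y) = bscale s (cinv c y, g (cinv c y))"
proof (rule cinv_eqI[OF bchart_inj[OF g c]])
  have p: "cinv c y \<in> points M" using cinv_in[OF y] chart_subset[OF M c] by blast
  show "bscale s (cinv c y, g (cinv c y)) \<in> fst (bchart g c)"
    using cinv_in[OF y] p s metric_bundle_iff[OF g] by (auto simp: bchart_simps)
  show "snd (bchart g c) (bscale s (cinv c y, g (cinv c y))) = (s, y)"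
    using blevel_bscale[OF g p s] chart_cinv[OF y] by (simp add: bchart_simps)
qed

text \<open>The topological conditions are transported by \<open>triv_inv\<close> from the product
  with the ray. Transition maps multiply the fibre coordinate by the exponential of a conformal
  factor.\<close>

lemma smooth_charts_bundle: "smooth_charts (bundle_mfd M C)"
  unfolding smooth_charts_def
proof (intro conjI ballI)
  show "(\<Union>c\<in>atlas (bundle_mfd M C). fst c) = points (bundle_mfd M C)"
  proof (intro equalityI subsetI)
    fix u assume "u \<in> (\<Union>c\<in>atlas (bundle_mfd M C). fst c)"
    then obtain g c where "u \<in> fst (bchart g c)" unfolding bundle_atlas by blast
    then show "u \<in> points (bundle_mfd M C)" by (simp add: bchart_simps bundle_points)
  next
    fix u assume u: "u \<in> points (bundle_mfd M C)"
    obtain g where g: "g \<in> C" using C_ex by blast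
    then obtain c where c: "c \<in> atlas M" "fst u \<in> fst c" using u blevel(3)[OF g] chart_exists[OF M] unfolding bundle_points by blast
    then have "u \<in> fst (bchart g c)" using u by (simp add: bchart_simps bundle_points)
    then show "u \<in> (\<Union>c\<in>atlas (bundle_mfd M C). fst c)" using c g unfolding bundle_atlas by blast
  qed
  fix cc assume "cc \<in> atlas (bundle_mfd M C)"
  then obtain g c where c: "g \<in> C" "c \<in> atlas M" and cc: "cc = bchart g c" unfolding bundle_atlas by blast
  have im: "snd cc ` fst cc = {0::real<..} \<times> snd c ` fst c"
    unfolding cc bchart_simps(1) by (rule bchart_image[OF c(1) chart_subset[OF M c(2)]])
  let ?rc = "({0::real<..} \<times> fst c, \<lambda>(s::real, p). (s, snd c p))"
  have rc: "?rc \<in> atlas (ray_times M)" using c unfolding ray_times_def mfd.sel by blast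
  note hm = triv_inv_homeo[OF c(1)]
  have f: "fst cc = {u \<in> points (bundle_mfd M C). triv_inv g u \<in> {0::real<..} \<times> fst c}"
    unfolding cc bchart_simps bundle_points using blevel(1)[OF c(1)] by (auto simp: triv_inv_def)
  have "continuous_map (mtop (bundle_mfd M C)) (mtop (ray_times M)) (triv_inv g)" using hm by (simp add: homeomorphic_maps_def)
  then show "openin (mtop (bundle_mfd M C)) (fst cc)" unfolding f
    by (rule openin_continuous_map_preimage[OF _ chart_openin[OF smooth_charts_ray[OF M] rc, unfolded fst_conv]])
  show "open (snd cc ` fst cc)" unfolding im using chart_open[OF M c(2)] by (intro open_Times) auto
  have "homeomorphic_map (mtop (bundle_mfd M C)) (mtop (ray_times M)) (triv_inv g)"
    using hm homeomorphic_map_maps by blast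
  moreover have "triv_inv g ` (points (bundle_mfd M C) \<inter> fst cc) = points (ray_times M) \<inter> ({0::real<..} \<times> fst c)"
  proof (intro equalityI subsetI)
    fix z assume "z \<in> triv_inv g ` (points (bundle_mfd M C) \<inter> fst cc)"
    then show "z \<in> points (ray_times M) \<inter> ({0::real<..} \<times> fst c)"
      using f triv(4)[OF c(1)] unfolding ray_points[OF M] bundle_points by auto
  next
    fix z assume z: "z \<in> points (ray_times M) \<inter> ({0::real<..} \<times> fst c)"
    then have "triv g z \<in> points (bundle_mfd M C) \<inter> fst cc" "triv_inv g (triv g z) = z"
      using triv(1,2)[OF c(1)] unfolding f ray_points[OF M] bundle_points by auto
    then show "z \<in> triv_inv g ` (points (bundle_mfd M C) \<inter> fst cc)" by (metis imageI)
  qed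
  ultimately have "homeomorphic_map (subtopology (mtop (bundle_mfd M C)) (fst cc)) (subtopology (mtop (ray_times M)) ({0::real<..} \<times> fst c)) (triv_inv g)"
    by (rule homeomorphic_map_subtopologies)
  from homeomorphic_map_compose[OF this, OF chart_homeo[OF smooth_charts_ray[OF M] rc, unfolded fst_conv]]
  have "homeomorphic_map (subtopology (mtop (bundle_mfd M C)) (fst cc)) (top_of_set (snd cc ` fst cc)) (snd ?rc \<circ> triv_inv g)"
    unfolding im by (simp add: ray_chart_image[OF M])
  moreover have "snd ?rc \<circ> triv_inv g = snd cc" by (auto simp: cc bchart_def triv_inv_def)
  ultimately show "homeomorphic_map (subtopology (mtop (bundle_mfd M C)) (fst cc)) (top_of_set (snd cc ` fst cc)) (snd cc)" by simp
  fix cc' assume "cc' \<in> atlas (bundle_mfd M C)"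
  then obtain g' c' where c': "g' \<in> C" "c' \<in> atlas M" and cc': "cc' = bchart g' c'" unfolding bundle_atlas by blast
  obtain \<omega> where \<omega>: "conf_related M \<omega> g' g" using rel[OF c'(1) c(1)] by blast
  let ?X = "fst c \<inter> fst c'"
  have "fst cc \<inter> fst cc' = {u \<in> metric_bundle M C. fst u \<in> ?X}" by (auto simp: cc cc' bchart_simps)
  then have im2: "snd cc ` (fst cc \<inter> fst cc') = {0::real<..} \<times> snd c ` ?X"
    using bchart_image[OF c(1), of ?X c] chart_subset[OF M c(2)] by (simp add: cc le_infI1)
  have o: "open (snd c ` ?X)" by (rule chart_open_image[OF M c(2) chart_openin[OF M c'(2)]])
  have o2: "open ({0::real<..} \<times> snd c ` ?X)" by (intro open_Times o) auto
  have fs: "fun_smooth M (points M) \<omega>" using \<omega> by (simp add: conf_related_def)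
  have pl: "smooth_on (snd c ` ?X) (\<lambda>y. \<omega> (cinv c y))"
    by (rule smooth_on_subset[OF fun_smooth_plot[OF M fs smooth_into_cinv[OF M c(2)]]]) auto
  show "smooth_on (snd cc ` (fst cc \<inter> fst cc')) (snd cc' \<circ> cinv cc)" unfolding im2
  proof (rule smooth_on_cong[OF o2])
    show "smooth_on ({0::real<..} \<times> snd c ` ?X) (\<lambda>z. (fst z * exp (\<omega> (cinv c (snd z))), (snd c' \<circ> cinv c) (snd z)))"
      by (intro smooth_on_Pair o2 smooth_on_mult smooth_on_exp_comp smooth_on_fst smooth_on_ident
          smooth_on_compose[OF o2 o pl smooth_on_snd[OF o2]]
          smooth_on_compose[OF o2 o transition_smooth[OF M c(2) c'(2)] smooth_on_snd[OF o2]]) auto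
    fix z assume "z \<in> {0::real<..} \<times> snd c ` ?X"
    then have z: "fst z > 0" "snd z \<in> snd c ` fst c" by auto
    have "cinv c (snd z) \<in> points M" using cinv_in[OF z(2)] chart_subset[OF M c(2)] by blast
    then show "(fst z * exp (\<omega> (cinv c (snd z))), (snd c' \<circ> cinv c) (snd z)) = (snd cc' \<circ> cinv cc) z"
      using bchart_cinv[OF c z] blevel_change[OF c'(1) c(1) \<omega> _ z(1)] by (simp add: cc cc' bchart_simps)
  qed
qed

lemma bundle_plotI:
  assumes g: "g \<in> C" and V: "open V" and s: "smooth_on V s" "\<And>y. y \<in> V \<Longrightarrow> s y > 0" and x: "smooth_into M V x"
  shows "smooth_into (bundle_mfd M C) V (\<lambda>y. bscale (s y) (x y, g (x y)))"
proof (rule smooth_into_local)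
  fix y assume y: "y \<in> V"
  then obtain c O' where c: "c \<in> atlas M" "open O'" "y \<in> O'" "O' \<subseteq> V" "x ` O' \<subseteq> fst c" "smooth_on O' (\<lambda>z. snd c (x z))"
    using x unfolding smooth_into_def by blast
  have "smooth_into (bundle_mfd M C) O' (\<lambda>y. bscale (s y) (x y, g (x y)))"
  proof (rule smooth_intoI_chart[OF smooth_charts_bundle c(2), of "bchart g c"])
    show "bchart g c \<in> atlas (bundle_mfd M C)" using g c(1) unfolding bundle_atlas by blast
    have pts: "x z \<in> points M" "s z > 0" if "z \<in> O'" for z
      using that c(4) s(2) smooth_into_points[OF M x] by auto
    show "(\<lambda>y. bscale (s y) (x y, g (x y))) ` O' \<subseteq> fst (bchart g c)"
      using pts c(5) metric_bundle_iff[OF g] by (auto simp: bchart_simps)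
    show "smooth_on O' (\<lambda>z. snd (bchart g c) (bscale (s z) (x z, g (x z))))"
      by (rule smooth_on_cong[OF c(2) _ smooth_on_Pair[OF c(2) smooth_on_subset[OF s(1) c(4)] c(6)]])
        (simp add: bchart_simps blevel_bscale[OF g pts])
  qed
  then show "\<exists>O'. open O' \<and> y \<in> O' \<and> O' \<subseteq> V \<and> smooth_into (bundle_mfd M C) O' (\<lambda>y. bscale (s y) (x y, g (x y)))"
    using c by blast
qed

lemma bundle_plotD:
  assumes g: "g \<in> C" and K: "smooth_into (bundle_mfd M C) V K"
  shows "smooth_on V (\<lambda>y. blevel g (K y))" "smooth_into M V (\<lambda>y. fst (K y))" "\<And>y. y \<in> V \<Longrightarrow> K y \<in> metric_bundle M C"
proof -
  show Q: "K y \<in> metric_bundle M C" if "y \<in> V" for y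
    using smooth_into_points[OF smooth_charts_bundle K that] by (simp add: bundle_points)
  have loc: "\<exists>O'. open O' \<and> y \<in> O' \<and> O' \<subseteq> V \<and> smooth_on O' (\<lambda>z. blevel g (K z)) \<and> smooth_into M O' (\<lambda>z. fst (K z))" if y: "y \<in> V" for y
  proof -
    obtain c where c: "c \<in> atlas M" "fst (K y) \<in> fst c" using chart_exists[OF M blevel(3)[OF g Q[OF y]]] by blast
    have 1: "bchart g c \<in> atlas (bundle_mfd M C)" unfolding bundle_atlas using g c(1) by blast
    have 2: "K y \<in> fst (bchart g c)" using c Q[OF y] by (simp add: bchart_simps)
    obtain O' where O': "open O'" "y \<in> O'" "O' \<subseteq> V" "K ` O' \<subseteq> fst (bchart g c)" "smooth_on O' (\<lambda>z. snd (bchart g c) (K z))"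
      by (rule smooth_into_chart[OF smooth_charts_bundle K y 1 2], rule that)
    note O'(5)[unfolded bchart_simps(2)]
    note O' = O'(1-4) this
    have "(\<lambda>z. fst (K z)) ` O' \<subseteq> fst c" using O'(4) by (auto simp: bchart_simps)
    moreover have "smooth_on O' (\<lambda>z. blevel g (K z))" "smooth_on O' (\<lambda>z. snd c (fst (K z)))"
      using smooth_on_fst[OF O'(1,5)] smooth_on_snd[OF O'(1,5)] by simp_all
    ultimately show ?thesis using O' smooth_intoI_chart[OF M O'(1) c(1)] by blast
  qed
  show "smooth_on V (\<lambda>y. blevel g (K y))" by (rule smooth_on_local) (drule loc, elim exE conjE, intro exI conjI)
  show "smooth_into M V (\<lambda>y. fst (K y))" by (rule smooth_into_local) (drule loc, elim exE conjE, intro exI conjI)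
qed

lemma smooth_map_fst: "smooth_map (bundle_mfd M C) M fst"
proof (rule smooth_mapI_into[OF smooth_charts_bundle M])
  fix V and G :: "real \<times> 'e \<Rightarrow> 'a bpt" assume G: "smooth_into (bundle_mfd M C) V G"
  obtain g where "g \<in> C" using C_ex by blast
  then show "smooth_into M V (\<lambda>y. fst (G y))" using bundle_plotD(2) G by blast
qed

end


lemma push_cong:
  assumes N: "smooth_charts N" and x: "x \<in> points N" "v \<in> tangent_space N x"
    and eq: "\<And>y. y \<in> points N \<Longrightarrow> F y = G y"
  shows "push M F x v = push M G x v"
proof
  fix f
  have "v (f \<circ> F) = v (f \<circ> G)"
    by (rule tangent_cong[OF N openin_topspace x(1) _ x(2)]) (simp add: eq)
  then show "push M F x v f = push M G x v f" using eq[OF x(1)] by (simp add: push_def)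
qed

section \<open>The bundle of metrics of a submanifold\<close>

locale conformal_submanifold = conformal M C for M :: "('a, 'e::euclidean_space) mfd" and C +
  fixes S :: "'a set" and N :: "('a, 'f::euclidean_space) mfd"
  assumes N_def: "N = submanifold M S" and N_manifold: "smooth_manifold N"
begin

lemma N: "smooth_charts N"
  using N_manifold by (simp add: smooth_manifold_iff)

lemmas inclusion = smooth_map_inclusion[OF M N_def N]

lemma N_points: "x \<in> points N \<Longrightarrow> x \<in> points M" "x \<in> points N \<Longrightarrow> x \<in> S"
  by (auto simp: N_def submanifold_simps)

abbreviation "res g \<equiv> pullback N M id g"
abbreviation "C' \<equiv> induced_class N M C"

lemma riem_res:
  assumes g: "g \<in> C" shows "riemannian N (res g)"
proof (rule pullback_metric[OF N M inclusion riem[OF g]])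
  fix x b c assume b: "b \<in> atlas N" "x \<in> fst b" and c: "c \<in> atlas M" "id x \<in> fst c"
  let ?D = "\<lambda>v. dpartial v (\<lambda>y. snd c (id (cinv b y))) (snd b x)"
  assume l: "linear ?D"
  note f = metric_form[OF M riem[OF g] c]
  have x: "x \<in> points N" using b chart_subset[OF N] by blast
  have inj: "?D v \<noteq> 0" if "v \<noteq> 0" for v
    using push_inj_iff[OF N M inclusion b c] inclusion_immersion[OF M N_def N x] that by blast
  show "has_signature (\<lambda>v w. g (id x) (tv M c (id x) (?D v)) (tv M c (id x) (?D w))) DIM('f) 0"
  proof (rule has_signature_posI[OF bilinear_pull[OF f(1) l]])
    show "g (id x) (tv M c (id x) (?D v)) (tv M c (id x) (?D w)) = g (id x) (tv M c (id x) (?D w)) (tv M c (id x) (?D v))" for v w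
      by (rule f(2))
    show "0 < g (id x) (tv M c (id x) (?D v)) (tv M c (id x) (?D v))" if "v \<noteq> 0" for v
      by (rule has_signature_pos[OF f(1,3) inj[OF that]])
  qed
qed

lemma conf_res:
  assumes "conf_related M \<omega> g g'" shows "conf_related N \<omega> (res g) (res g')"
  unfolding conf_related_def
proof (intro conjI ballI)
  show "fun_smooth N (points N) \<omega>"
    using fun_smooth_restrict[OF N M inclusion, of \<omega>] assms by (simp add: conf_related_def)
  fix x v w assume x: "x \<in> points N" "v \<in> tangent_space N x" "w \<in> tangent_space N x"
  show "res g' x v w = exp (2 * \<omega> x) * res g x v w"
    unfolding pullback_apply[OF N M inclusion x]
    using assms push_in_tangent_space[OF N M inclusion x(1) x(2)] push_in_tangent_space[OF N M inclusion x(1) x(3)] N_points(1)[OF x(1)]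
    by (simp add: conf_related_def)
qed

text \<open>Restriction to \<open>N\<close> respects conformal factors, so the restriction of any
  one metric of \<open>C\<close> already generates the induced class.\<close>

lemma conformal_N: "conformal_manifold N C'"
proof -
  obtain g0 where g0: "g0 \<in> C" using C_ex by blast
  have "C' = {g'. riemannian N g' \<and> (\<exists>\<omega>. conf_related N \<omega> (res g0) g')}"
  proof (intro equalityI subsetI)
    fix g' assume "g' \<in> C'"
    then obtain g \<omega> where g: "riemannian N g'" "g \<in> C" "conf_related N \<omega> (res g) g'" unfolding induced_class_def by blast
    obtain \<omega>0 where "conf_related M \<omega>0 g0 g" using rel[OF g0 g(2)] by blast
    from conf_related_trans[OF N conf_res[OF this] g(3)] g(1)
    show "g' \<in> {g'. riemannian N g' \<and> (\<exists>\<omega>. conf_related N \<omega> (res g0) g')}" by blast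
  qed (use g0 in \<open>auto simp: induced_class_def\<close>)
  then show ?thesis unfolding conformal_manifold_def using N_manifold riem_res[OF g0] by blast
qed

sublocale sub: conformal N C'
  by unfold_locales (rule conformal_N)

lemma res_in: "g \<in> C \<Longrightarrow> res g \<in> C'"
  unfolding induced_class_def using riem_res conf_related_refl[OF N] by blast

definition QS :: "'a bpt set" where "QS = {u \<in> metric_bundle M C. fst u \<in> points N}"

text \<open>Lifts a form on a tangent space of \<open>N\<close> to the unique point of the bundle
  over \<open>M\<close> that restricts to it; \<open>induced_bundle_map\<close> is
  \<open>i \<circ> beta\<close>.\<close>

definition beta :: "'a bpt \<Rightarrow> 'a bpt" where "beta = inv_into QS (bundle_restrict N M)"

lemma restrict_bscale: "bundle_restrict N M (bscale s (x, g x)) = bscale s (x, res g x)"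
  by (simp add: bundle_restrict_def bscale_def pullback_def pull_form_def fun_eq_iff)

lemma QS_iff: "g \<in> C \<Longrightarrow> u \<in> QS \<longleftrightarrow> (\<exists>x\<in>points N. \<exists>s>0. u = bscale s (x, g x))"
  unfolding QS_def mem_Collect_eq metric_bundle_iff using N_points(1) by fastforce

text \<open>The restriction to \<open>N\<close> determines the conformal factor because \<open>N\<close> has positive dimension.\<close>

lemma restrict_inj: "inj_on (bundle_restrict N M) QS"
proof (rule inj_onI)
  fix u u' assume u: "u \<in> QS" "u' \<in> QS" and e: "bundle_restrict N M u = bundle_restrict N M u'"
  obtain g where g: "g \<in> C" using C_ex by blast
  obtain x s where x: "x \<in> points N" "s > 0" "u = bscale s (x, g x)" using u(1) unfolding QS_iff[OF g] by blast
  obtain x' s' where x': "x' \<in> points N" "s' > 0" "u' = bscale s' (x', g x')" using u(2) unfolding QS_iff[OF g] by blast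
  have e': "bscale s (x, res g x) = bscale s' (x', res g x')" using e unfolding x(3) x'(3) restrict_bscale .
  then have "x = x'" using fst_bscale by (metis fst_conv)
  then have "s = s'" using sub.bscale_inj[OF res_in[OF g] x(1,2) x'(2)] e' by simp
  then show "u = u'" using x x' \<open>x = x'\<close> by simp
qed

lemma beta_eq:
  assumes g: "g \<in> C" and x: "x \<in> points N" and s: "s > 0"
  shows "beta (bscale s (x, res g x)) = bscale s (x, g x)"
proof -
  have "bscale s (x, g x) \<in> QS" unfolding QS_iff[OF g] using x s by blast
  from inv_into_f_f[OF restrict_inj this] show ?thesis by (simp add: beta_def restrict_bscale)
qed

lemma beta:
  assumes u: "u \<in> metric_bundle N C'"
  shows "beta u \<in> QS" "bundle_restrict N M (beta u) = u" "fst (beta u) = fst u"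
proof -
  obtain g where g: "g \<in> C" using C_ex by blast
  obtain x s where x: "x \<in> points N" "s > 0" "u = bscale s (x, res g x)"
    using u unfolding sub.metric_bundle_iff[OF res_in[OF g]] by blast
  show "beta u \<in> QS" "bundle_restrict N M (beta u) = u" "fst (beta u) = fst u"
    unfolding x(3) beta_eq[OF g x(1,2)] restrict_bscale QS_iff[OF g] using x by auto
qed

lemma beta_bscale:
  assumes u: "u \<in> metric_bundle N C'" and t: "t > 0"
  shows "beta (bscale t u) = bscale t (beta u)"
proof -
  obtain g where g: "g \<in> C" using C_ex by blast
  obtain x s where x: "x \<in> points N" "s > 0" "u = bscale s (x, res g x)"
    using u unfolding sub.metric_bundle_iff[OF res_in[OF g]] by blast
  show ?thesis unfolding x(3) bscale_bscale using beta_eq[OF g x(1)] x(2) t by (simp add: bscale_bscale)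
qed

lemma beta_rep:
  assumes g: "g \<in> C" and u: "u \<in> metric_bundle N C'"
  shows "beta u = bscale (blevel (res g) u) (fst u, g (fst u))"
  using beta_eq[OF g sub.blevel(3)[OF res_in[OF g] u] sub.blevel(1)[OF res_in[OF g] u]] sub.blevel(2)[OF res_in[OF g] u] by simp

text \<open>In the trivializations by \<open>res g\<close> and \<open>g\<close>, the lift is the
  identity on scales times the inclusion of \<open>N\<close>.\<close>

lemma smooth_beta: "smooth_map (bundle_mfd N C') (bundle_mfd M C) beta"
proof (rule smooth_mapI_into[OF sub.smooth_charts_bundle smooth_charts_bundle])
  fix V and K :: "real \<times> 'f \<Rightarrow> 'a bpt" assume V: "open V" and K: "smooth_into (bundle_mfd N C') V K"
  obtain g where g: "g \<in> C" using C_ex by blast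
  note d = sub.bundle_plotD[OF res_in[OF g] K]
  have "smooth_into (bundle_mfd M C) V (\<lambda>y. bscale (blevel (res g) (K y)) (fst (K y), g (fst (K y))))"
  proof (rule bundle_plotI[OF g V d(1)])
    show "blevel (res g) (K y) > 0" if "y \<in> V" for y using sub.blevel(1)[OF res_in[OF g] d(3)[OF that]] .
    show "smooth_into M V (\<lambda>y. fst (K y))" using d(2) smooth_into_submanifold[OF M N_def N V] by blast
  qed
  then show "smooth_into (bundle_mfd M C) V (\<lambda>y. beta (K y))"
    by (rule smooth_into_cong) (simp add: beta_rep[OF g d(3)])
qed

text \<open>The factorization through products with the ray consists of a homeomorphism, a subspace
  inclusion and another homeomorphism.\<close>

lemma embedding_beta: "embedding_map (mtop (bundle_mfd N C')) (mtop (bundle_mfd M C)) beta"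
proof -
  obtain g where g: "g \<in> C" using C_ex by blast
  have "homeomorphic_map (mtop (bundle_mfd N C')) (mtop (ray_times N)) (sub.triv_inv (res g))"
    using sub.triv_inv_homeo[OF res_in[OF g]] homeomorphic_map_maps by blast
  then have 1: "embedding_map (mtop (bundle_mfd N C')) (mtop (ray_times N)) (sub.triv_inv (res g))"
    using surjective_embedding_map by blast
  have "mtop (ray_times N) = subtopology (mtop (ray_times M)) ({0<..} \<times> S)"
    by (simp add: ray_times_def N_def submanifold_simps prod_topology_subtopology)
  then have 2: "embedding_map (mtop (ray_times N)) (mtop (ray_times M)) id"
    unfolding embedding_map_def by (simp add: subtopology_subtopology Int_absorb1 subtopology_restrict)
  have "homeomorphic_map (mtop (ray_times M)) (mtop (bundle_mfd M C)) (triv g)"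
    using triv_inv_homeo[OF g] homeomorphic_maps_sym homeomorphic_map_maps by blast
  then have 3: "embedding_map (mtop (ray_times M)) (mtop (bundle_mfd M C)) (triv g)"
    using surjective_embedding_map by blast
  show ?thesis
  proof (rule embedding_map_eq[OF embedding_map_compose[OF embedding_map_compose[OF 1 2] 3]])
    fix u assume "u \<in> points (bundle_mfd N C')"
    then show "(triv g \<circ> (id \<circ> sub.triv_inv (res g))) u = beta u"
      using beta_rep[OF g] by (simp add: sub.bundle_points triv_def sub.triv_inv_def)
  qed
qed

text \<open>In bundle charts adapted to \<open>res g\<close> and \<open>g\<close> the derivative is
  block diagonal: the identity on the fibre coordinate and the derivative of the inclusion on the
  base.\<close>

lemma immersion_beta:
  assumes u: "u \<in> metric_bundle N C'"
  shows "inj_on (push (bundle_mfd M C) beta u) (tangent_space (bundle_mfd N C') u)"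
proof -
  obtain g where g: "g \<in> C" using C_ex by blast
  note g' = res_in[OF g]
  have x: "fst u \<in> points N" by (rule sub.blevel(3)[OF g' u])
  obtain b where b: "b \<in> atlas N" "fst u \<in> fst b" using chart_exists[OF N x] by blast
  obtain c where c: "c \<in> atlas M" "fst u \<in> fst c" using chart_exists[OF M N_points(1)[OF x]] by blast
  have bc: "sub.bchart (res g) b \<in> atlas (bundle_mfd N C')" unfolding sub.bundle_atlas using g' b(1) by blast
  have ub: "u \<in> fst (sub.bchart (res g) b)" using u b by (simp add: sub.bchart_simps)
  have cc: "bchart g c \<in> atlas (bundle_mfd M C)" unfolding bundle_atlas using g c(1) by blast
  have uc: "beta u \<in> fst (bchart g c)" using beta[OF u] c by (simp add: bchart_simps QS_def)
  let ?f = "\<lambda>y. snd c (cinv b y)" and ?z = "(blevel (res g) u, snd b (fst u))"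
  let ?O = "{0::real<..} \<times> snd b ` fst b"
  have O: "open ?O" using chart_open[OF N b(1)] by (intro open_Times) auto
  have z: "?z \<in> ?O" using b sub.blevel(1)[OF g' u] by auto
  have cb: "cinv b (snd b (fst u)) = fst u" using cinv_chart[OF chart_inj[OF N b(1)] b(2)] .
  obtain O' where O': "open O'" "snd b (fst u) \<in> O'" "smooth_on O' ?f"
    using chart_rep_differentiable[OF N M inclusion b c(1)] c(2) unfolding id_apply by metis
  have fd: "?f differentiable (at (snd ?z))" using smooth_on_at[OF O'(3,1,2)] by simp
  have D: "((\<lambda>z. (fst z, ?f (snd z))) has_derivative (\<lambda>v. (fst v, dpartial (snd v) ?f (snd ?z)))) (at ?z)"
    by (rule has_derivative_Pair[OF has_derivative_fst[OF has_derivative_ident]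
        has_derivative_compose[OF has_derivative_snd[OF has_derivative_ident] has_derivative_dpartial[OF fd]]])
  have eq: "snd (bchart g c) (beta (cinv (sub.bchart (res g) b) z)) = (fst z, ?f (snd z))" if zO: "z \<in> ?O" for z
  proof -
    have z': "fst z > 0" "snd z \<in> snd b ` fst b" using zO by auto
    have p: "cinv b (snd z) \<in> points N" using cinv_in[OF z'(2)] chart_subset[OF N b(1)] by blast
    have "cinv (sub.bchart (res g) b) z = bscale (fst z) (cinv b (snd z), res g (cinv b (snd z)))"
      using sub.bchart_cinv[OF g' b(1) z'] by simp
    then show ?thesis
      using beta_eq[OF g p z'(1)] blevel_bscale[OF g N_points(1)[OF p] z'(1)] by (simp add: bchart_simps)
  qed
  have "v = 0" if v: "dpartial v (\<lambda>z. snd (bchart g c) (beta (cinv (sub.bchart (res g) b) z))) ?z = 0" for v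
  proof -
    have "dpartial v (\<lambda>z. (fst z, ?f (snd z))) ?z = 0"
      using v dpartial_cong[OF O z, of "\<lambda>z. snd (bchart g c) (beta (cinv (sub.bchart (res g) b) z))" "\<lambda>z. (fst z, ?f (snd z))" v] eq
      by simp
    then have "fst v = 0" "dpartial (snd v) ?f (snd b (fst u)) = 0"
      unfolding dpartial_eqI[OF D] by (simp_all add: zero_prod_def)
    moreover have "snd v = 0"
      by (rule submanifold_chart(7)[OF M b(1)[unfolded N_def] c(1) _ _ calculation(2)]) (use b c cb in auto)
    ultimately show "v = 0" by (simp add: prod_eq_iff)
  qed
  then show ?thesis
    unfolding push_inj_iff[OF sub.smooth_charts_bundle smooth_charts_bundle smooth_beta bc ub cc uc]
    by (simp add: sub.bchart_simps)
qed

text \<open>The form at \<open>u\<close> is the pullback of the form at \<open>beta u\<close>, and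
  lifting does not change the base point, so both sides evaluate one form on the same
  vectors.\<close>

lemma metric_beta:
  assumes u: "u \<in> metric_bundle N C'" and \<xi>: "\<xi> \<in> tangent_space (bundle_mfd N C') u" and \<eta>: "\<eta> \<in> tangent_space (bundle_mfd N C') u"
  shows "snd u (push N fst u \<xi>) (push N fst u \<eta>)
    = snd (beta u) (push M fst (beta u) (push (bundle_mfd M C) beta u \<xi>)) (push M fst (beta u) (push (bundle_mfd M C) beta u \<eta>))"
proof -
  have up: "u \<in> points (bundle_mfd N C')" using u by (simp add: sub.bundle_points)
  have x: "fst u \<in> points N" using smooth_map_points[OF sub.smooth_map_fst up] .
  have t: "push N fst u \<zeta> \<in> tangent_space N (fst u)" if "\<zeta> \<in> tangent_space (bundle_mfd N C') u" for \<zeta>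
    by (rule push_in_tangent_space[OF sub.smooth_charts_bundle N sub.smooth_map_fst up that])
  have "push M id (fst u) (push N fst u \<zeta>) = push M fst (beta u) (push (bundle_mfd M C) beta u \<zeta>)"
    if \<zeta>: "\<zeta> \<in> tangent_space (bundle_mfd N C') u" for \<zeta>
  proof -
    have "push M id (fst u) (push N fst u \<zeta>) = push M (id \<circ> fst) u \<zeta>"
      by (rule push_push[OF sub.smooth_charts_bundle N M sub.smooth_map_fst inclusion up])
    also have "\<dots> = push M (fst \<circ> beta) u \<zeta>"
      by (rule push_cong[OF sub.smooth_charts_bundle up \<zeta>]) (simp add: beta(3) sub.bundle_points)
    also have "\<dots> = push M fst (beta u) (push (bundle_mfd M C) beta u \<zeta>)"
      by (rule push_push[OF sub.smooth_charts_bundle smooth_charts_bundle M smooth_beta smooth_map_fst up, symmetric])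
    finally show ?thesis .
  qed
  moreover have "snd u = pull_form N M id (fst u) (snd (beta u))"
    using beta(2,3)[OF u] unfolding bundle_restrict_def by (metis snd_conv)
  ultimately show ?thesis using x t[OF \<xi>] t[OF \<eta>] \<xi> \<eta> by (simp add: pull_form_def)
qed

text \<open>Injectivity of the differential is tested after inclusion into \<open>P\<close>, where
  the composite is the differential of \<open>i\<close> after that of \<open>beta\<close>.\<close>

lemma embedding_into_submanifold:
  fixes P :: "('w, 'k::euclidean_space) mfd" and R :: "('w, 'l::euclidean_space) mfd"
  assumes P: "smooth_charts P" and i: "smooth_embedding (bundle_mfd M C) P i"
    and R_def: "R = submanifold P Z" and R: "smooth_charts R" and im: "i ` QS \<subseteq> Z"
  shows "smooth_embedding (bundle_mfd N C') R (i \<circ> beta)" "smooth_map (bundle_mfd N C') R (i \<circ> beta)"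
proof -
  note Q = smooth_charts_bundle and Q' = sub.smooth_charts_bundle
  have si: "smooth_map (bundle_mfd M C) P i" and ei: "embedding_map (mtop (bundle_mfd M C)) (mtop P) i"
    and ii: "\<And>u. u \<in> points (bundle_mfd M C) \<Longrightarrow> inj_on (push P i u) (tangent_space (bundle_mfd M C) u)"
    using i by (auto simp: smooth_embedding_def)
  have sP: "smooth_map (bundle_mfd N C') P (i \<circ> beta)" by (rule smooth_map_compose[OF Q' Q P smooth_beta si])
  have imZ: "(i \<circ> beta) ` points (bundle_mfd N C') \<subseteq> Z" using im beta(1) by (auto simp: sub.bundle_points)
  show sR: "smooth_map (bundle_mfd N C') R (i \<circ> beta)"
    by (rule smooth_map_into_submanifold[OF P R_def R Q' sP imZ])
  show "smooth_embedding (bundle_mfd N C') R (i \<circ> beta)" unfolding smooth_embedding_def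
  proof (intro conjI ballI sR)
    have "embedding_map (mtop (bundle_mfd N C')) (mtop P) (i \<circ> beta)"
      by (rule embedding_map_compose[OF embedding_beta ei])
    then show "embedding_map (mtop (bundle_mfd N C')) (mtop R) (i \<circ> beta)"
      unfolding R_def submanifold_simps embedding_map_in_subtopology using imZ by blast
    fix u assume up: "u \<in> points (bundle_mfd N C')"
    then have u: "u \<in> metric_bundle N C'" by (simp add: sub.bundle_points)
    show "inj_on (push R (i \<circ> beta) u) (tangent_space (bundle_mfd N C') u)"
    proof (rule inj_onI)
      fix v w assume v: "v \<in> tangent_space (bundle_mfd N C') u" and w: "w \<in> tangent_space (bundle_mfd N C') u"
        and e: "push R (i \<circ> beta) u v = push R (i \<circ> beta) u w"
      have c: "push P id ((i \<circ> beta) u) (push R (i \<circ> beta) u x) = push P i (beta u) (push (bundle_mfd M C) beta u x)" for x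
        unfolding push_push[OF Q' R P sR smooth_map_inclusion[OF P R_def R] up] push_push[OF Q' Q P smooth_beta si up] by simp
      have bp: "beta u \<in> points (bundle_mfd M C)" using smooth_map_points[OF smooth_beta up] .
      note t = push_in_tangent_space[OF Q' Q smooth_beta up]
      have "push P i (beta u) (push (bundle_mfd M C) beta u v) = push P i (beta u) (push (bundle_mfd M C) beta u w)"
        using c[of v] c[of w] e by simp
      then have "push (bundle_mfd M C) beta u v = push (bundle_mfd M C) beta u w"
        using inj_onD[OF ii[OF bp] _ t[OF v] t[OF w]] by blast
      then show "v = w" using inj_onD[OF immersion_beta[OF u] _ v w] by blast
    qed
  qed
qed

end


text \<open>Serves for the scale singularity set in \<open>M\<close> and for the ambient zero set in
  \<open>W\<close>. Working inside an open \<open>W\<close> with a locally smooth \<open>f\<close>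
  fits the ambient scale, whose smoothness and nonzero differential are established on
  \<open>W\<close>.\<close>

lemma hypersurface_manifold:
  fixes M :: "('a, 'e::euclidean_space) mfd"
  assumes M: "smooth_manifold M" and W: "openin (mtop M) W" and S: "S = {q \<in> W. f q = 0}"
    and f: "\<And>p. p \<in> S \<Longrightarrow> \<exists>U. openin (mtop M) U \<and> p \<in> U \<and> U \<subseteq> W \<and> fun_smooth M U f"
    and nz: "\<And>p. p \<in> S \<Longrightarrow> \<exists>v\<in>tangent_space M p. v f \<noteq> 0"
    and dim: "DIM('f::euclidean_space) + 1 = DIM('e)"
  shows "smooth_manifold (submanifold M S :: ('a, 'f) mfd)"
proof -
  have sc: "smooth_charts M" using M by (simp add: smooth_manifold_iff)
  have "smooth_charts (submanifold M S :: ('a, 'f) mfd)"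
  proof (rule smooth_charts_submanifold[OF sc])
    show "S \<subseteq> points M" using S openin_subset[OF W] by blast
    fix p assume p: "p \<in> S"
    obtain U where U: "openin (mtop M) U" "p \<in> U" "U \<subseteq> W" "fun_smooth M U f" using f[OF p] by blast
    obtain v where v: "v \<in> tangent_space M p" "v f \<noteq> 0" using nz[OF p] by blast
    then obtain c w where c: "c \<in> atlas M" "p \<in> fst c" "v = tv M c p w" unfolding tangent_space_def by blast
    have "S \<inter> U = {q \<in> U. f q = 0}" using S U(3) by blast
    from hypersurface_chart[OF sc U(1,2) this p U(4) c(1,2) _ dim, of w] v(2) c(3)
    show "\<exists>b\<in>atlas (submanifold M S :: ('a, 'f) mfd). p \<in> fst b" by blast
  qed
  then show ?thesis using M
    by (simp add: smooth_manifold_iff submanifold_simps Hausdorff_space_subtopology second_countable_subtopology)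
qed

section \<open>The scale singularity set and its ambient extension\<close>

locale ambient_einstein = conformal M C
  for M :: "('m, 'e::euclidean_space) mfd" and C :: "'m metric set" +
  fixes I :: "'m tractor"
    and Mt :: "('w, 'k::euclidean_space) mfd" and \<delta> :: "real \<Rightarrow> 'w \<Rightarrow> 'w"
    and i :: "'m bpt \<Rightarrow> 'w" and h :: "'w metric"
    and \<Phi> :: "'m tractor \<Rightarrow> 'm bpt \<Rightarrow> 'w tvec" and It :: "'w form1"
  assumes einstein: "almost_einstein M C I" and negative: "scalar_negative M C I"
    and FG: "FG_metric_all_orders M C Mt \<delta> i h"
    and corr: "tractor_correspondence M C Mt \<delta> i h \<Phi>"
    and extension: "ambient_parallel_extension M C Mt \<delta> i h \<Phi> I It"
begin

lemma ambient: "ambient_manifold M C Mt \<delta> i" "ambient_metric M C Mt \<delta> i h" "ricci_flat_along Mt h (i ` metric_bundle M C)"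
  using FG by (simp_all add: FG_metric_all_orders_def)

lemma Mt_manifold: "smooth_manifold Mt" and Mt_dim: "DIM('k) = DIM('e) + 2"
  and \<delta>_smooth_map: "smooth_map (ray_times Mt) Mt (\<lambda>(s, p). \<delta> s p)"
  and \<delta>_one: "p \<in> points Mt \<Longrightarrow> \<delta> 1 p = p"
  and \<delta>_mult: "p \<in> points Mt \<Longrightarrow> s > 0 \<Longrightarrow> t > 0 \<Longrightarrow> \<delta> s (\<delta> t p) = \<delta> (s * t) p"
  and \<delta>_free: "p \<in> points Mt \<Longrightarrow> s > 0 \<Longrightarrow> \<delta> s p = p \<Longrightarrow> s = 1"
  and i_embedding: "smooth_embedding (bundle_mfd M C) Mt i"
  and i_equivariant: "u \<in> metric_bundle M C \<Longrightarrow> s > 0 \<Longrightarrow> i (bscale s u) = \<delta> s (i u)"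
  using ambient(1) unfolding ambient_manifold_def by blast+

lemma h_metric: "metric_sig Mt (DIM('e) + 1) 1 h"
  and h_lie: "p \<in> points Mt \<Longrightarrow> v \<in> tangent_space Mt p \<Longrightarrow> w \<in> tangent_space Mt p \<Longrightarrow>
    ((\<lambda>s. pullback Mt Mt (\<delta> s) h p v w) has_real_derivative 2 * h p v w) (at 1)"
  and h_bundle: "u \<in> metric_bundle M C \<Longrightarrow> \<xi> \<in> tangent_space (bundle_mfd M C) u \<Longrightarrow> \<eta> \<in> tangent_space (bundle_mfd M C) u \<Longrightarrow>
    h (i u) (push Mt i u \<xi>) (push Mt i u \<eta>) = snd u (push M fst u \<xi>) (push M fst u \<eta>)"
  using ambient(2) unfolding ambient_metric_def by blast+

lemma Mt: "smooth_charts Mt"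
  using Mt_manifold by (simp add: smooth_manifold_iff)

lemma i_points: "u \<in> metric_bundle M C \<Longrightarrow> i u \<in> points Mt"
  using i_embedding smooth_map_points[of "bundle_mfd M C" Mt i u] by (simp add: smooth_embedding_def bundle_points)

lemma \<delta>_points: "s > 0 \<Longrightarrow> p \<in> points Mt \<Longrightarrow> \<delta> s p \<in> points Mt"
  using smooth_map_points[OF \<delta>_smooth_map, of "(s, p)"] by (simp add: ray_points[OF Mt])

lemma \<delta>_plot:
  assumes "open V" "smooth_on V s" "\<And>y. y \<in> V \<Longrightarrow> s y > 0" "smooth_into Mt V G"
  shows "smooth_into Mt V (\<lambda>y. \<delta> (s y) (G y))"
proof -
  have "smooth_into (ray_times Mt) V (\<lambda>y. (s y, G y))"
    unfolding smooth_into_ray[OF Mt assms(1)] using assms by simp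
  from smooth_map_imp_into[OF smooth_charts_ray[OF Mt] Mt \<delta>_smooth_map this] show ?thesis by simp
qed

lemma \<delta>_smooth: "s > 0 \<Longrightarrow> smooth_map Mt Mt (\<delta> s)"
  by (rule smooth_mapI_into[OF Mt Mt]) (rule \<delta>_plot, auto)

lemma push_\<delta>_mult:
  assumes "p \<in> points Mt" "v \<in> tangent_space Mt p" "s > 0" "t > 0"
  shows "push Mt (\<delta> s) (\<delta> t p) (push Mt (\<delta> t) p v) = push Mt (\<delta> (s * t)) p v"
  unfolding push_push[OF Mt Mt Mt \<delta>_smooth[OF assms(4)] \<delta>_smooth[OF assms(3)] assms(1)]
  by (rule push_cong[OF Mt assms(1,2)]) (simp add: \<delta>_mult assms)

lemma push_\<delta>_one:
  assumes "p \<in> points Mt" "v \<in> tangent_space Mt p" shows "push Mt (\<delta> 1) p v = v"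
  using push_cong[OF Mt assms, of "\<delta> 1" id Mt] push_id[OF Mt assms] \<delta>_one by simp

lemma push_\<delta>_tangent:
  "p \<in> points Mt \<Longrightarrow> v \<in> tangent_space Mt p \<Longrightarrow> s > 0 \<Longrightarrow> push Mt (\<delta> s) p v \<in> tangent_space Mt (\<delta> s p)"
  using push_in_tangent_space[OF Mt Mt \<delta>_smooth] by blast

text \<open>The flow of the generator integrates the infinitesimal homogeneity of \<open>h\<close>.\<close>

lemma homothety:
  assumes p: "p \<in> points Mt" and v: "v \<in> tangent_space Mt p" and w: "w \<in> tangent_space Mt p" and s: "s > 0"
  shows "h (\<delta> s p) (push Mt (\<delta> s) p v) (push Mt (\<delta> s) p w) = s\<^sup>2 * h p v w"
proof -
  define \<phi> where "\<phi> t = h (\<delta> t p) (push Mt (\<delta> t) p v) (push Mt (\<delta> t) p w)" for t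
  \<comment> \<open>The infinitesimal condition at \<open>\<delta> t p\<close>, moved along the
    orbit by multiplicativity of the action, becomes the equation t \<phi>'(t) = 2 \<phi>(t), whose
    solutions are multiples of t^2.\<close>
  have d: "(\<phi> has_real_derivative 2 * \<phi> t * (1 / t)) (at t)" if t: "t > 0" for t
  proof (rule has_field_derivative_transform_within_open)
    let ?p = "\<delta> t p" and ?v = "push Mt (\<delta> t) p v" and ?w = "push Mt (\<delta> t) p w"
    note tp = \<delta>_points[OF t p] and tt = push_\<delta>_tangent[OF p v t] push_\<delta>_tangent[OF p w t]
    have "((\<lambda>s. pullback Mt Mt (\<delta> s) h ?p ?v ?w) has_real_derivative 2 * \<phi> t) (at (t / t))"
      using h_lie[OF tp tt] t by (simp add: \<phi>_def)
    moreover have "((\<lambda>x. x / t) has_real_derivative 1 / t) (at t)" using t by (auto intro!: derivative_eq_intros)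
    ultimately show "((\<lambda>x. pullback Mt Mt (\<delta> (x / t)) h ?p ?v ?w) has_real_derivative 2 * \<phi> t * (1 / t)) (at t)"
      by (rule DERIV_chain2)
    show "pullback Mt Mt (\<delta> (x / t)) h ?p ?v ?w = \<phi> x" if "x \<in> {0<..}" for x
    proof -
      have x: "x / t > 0" "x / t * t = x" using that t by auto
      show ?thesis
        unfolding pullback_apply[OF Mt Mt \<delta>_smooth[OF x(1)] tp tt] push_\<delta>_mult[OF p v x(1) t] push_\<delta>_mult[OF p w x(1) t]
          \<delta>_mult[OF p x(1) t] x(2) \<phi>_def ..
    qed
  qed (use t in auto)
  have "((\<lambda>t. \<phi> t / t\<^sup>2) has_real_derivative 0) (at t within {0<..})" if "t \<in> {0<..}" for t
  proof -
    have t: "t > 0" using that by simp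
    have "((\<lambda>t. \<phi> t / t\<^sup>2) has_real_derivative ((2 * \<phi> t * (1 / t)) * t\<^sup>2 - \<phi> t * (2 * t)) / (t\<^sup>2 * t\<^sup>2)) (at t)"
      using t by (intro DERIV_divide d) (auto intro!: derivative_eq_intros)
    then show ?thesis using t by (simp add: power2_eq_square has_field_derivative_at_within)
  qed
  then obtain k where k: "\<And>t. t > 0 \<Longrightarrow> \<phi> t / t\<^sup>2 = k"
    using has_field_derivative_zero_constant[of "{0::real<..}" "\<lambda>t. \<phi> t / t\<^sup>2"] by (auto simp: convex_real_interval)
  have "k = \<phi> 1" using k[of 1] by simp
  then have "\<phi> s = s\<^sup>2 * \<phi> 1" using k[OF s] s by (simp add: field_simps)
  then show ?thesis using push_\<delta>_one[OF p] v w \<delta>_one[OF p] by (simp add: \<phi>_def)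
qed

abbreviation "\<sigma> \<equiv> ambient_scale Mt \<delta> h It"

lemma It_smooth: "smooth_form Mt It"
  and It_parallel: "parallel_form_along Mt h It (i ` metric_bundle M C)"
  and sharp_It: "u \<in> metric_bundle M C \<Longrightarrow> sharp Mt h (i u) (It (i u)) = \<Phi> I u"
  and \<sigma>_homogeneous: "p \<in> points Mt \<Longrightarrow> s > 0 \<Longrightarrow> \<sigma> (\<delta> s p) = s * \<sigma> p"
  and It_d\<sigma>: "p \<in> points Mt \<Longrightarrow> v \<in> tangent_space Mt p \<Longrightarrow> It p v = v \<sigma>"
  using extension unfolding ambient_parallel_extension_def by blast+

definition nor :: "'w \<Rightarrow> 'w tvec" where "nor p = sharp Mt h p (It p)"

definition W :: "'w set" where "W = {p \<in> points Mt. h p (nor p) (nor p) > 0}"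

lemma It_linear:
  assumes "c \<in> atlas Mt" "p \<in> fst c" shows "linear (\<lambda>v. It p (tv Mt c p v))"
proof -
  have "It p (tv Mt c p v) = tv Mt c p v \<sigma>" for v
    using subsetD[OF chart_subset[OF Mt assms(1)] assms(2)] tangent_space_chart[OF Mt assms] by (intro It_d\<sigma>) auto
  then show ?thesis using tv_linear[OF Mt assms] by simp
qed

lemma nor:
  assumes p: "p \<in> points Mt"
  shows "nor p \<in> tangent_space Mt p" "\<And>w. w \<in> tangent_space Mt p \<Longrightarrow> h p (nor p) w = It p w"
    "\<And>v. v \<in> tangent_space Mt p \<Longrightarrow> (\<And>w. w \<in> tangent_space Mt p \<Longrightarrow> h p v w = It p w) \<Longrightarrow> nor p = v"
proof -
  obtain c where c: "c \<in> atlas Mt" "p \<in> fst c" using chart_exists[OF Mt p] by blast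
  note s = sharp_chart[OF Mt h_metric c It_linear[OF c], folded nor_def]
  show "nor p \<in> tangent_space Mt p" unfolding s(1) tangent_space_chart[OF Mt c] by blast
  show "\<And>w. w \<in> tangent_space Mt p \<Longrightarrow> h p (nor p) w = It p w" by (rule s(2))
  show "\<And>v. v \<in> tangent_space Mt p \<Longrightarrow> (\<And>w. w \<in> tangent_space Mt p \<Longrightarrow> h p v w = It p w) \<Longrightarrow> nor p = v" by (rule s(3))
qed

lemma W_points: "p \<in> W \<Longrightarrow> p \<in> points Mt"
  by (simp add: W_def)

lemma W_pos: "p \<in> W \<Longrightarrow> nor p \<sigma> > 0"
  using nor(2)[OF _ nor(1)] It_d\<sigma>[OF _ nor(1)] by (auto simp: W_def)

text \<open>Where \<open>\<sigma>\<close> is not smooth, all derivations give \<open>0\<close> on it, so that \<open>It\<close> vanishes.\<close>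

lemma \<sigma>_near:
  assumes "p \<in> W" shows "smooth_near Mt p \<sigma>"
proof (rule ccontr)
  assume "\<not> smooth_near Mt p \<sigma>"
  then have "nor p \<sigma> = 0" using nor(1)[OF W_points[OF assms]] by (auto simp: tangent_space_def tv_apply[OF Mt])
  then show False using W_pos[OF assms] by simp
qed

lemma form_chart:
  assumes c: "c \<in> atlas Mt"
  shows "form_on_metric (mcoords Mt h c) (snd c ` fst c) (fcoords Mt It c)"
proof -
  interpret pseudo_metric "mcoords Mt h c" "snd c ` fst c" by (rule metric_pseudo_metric[OF Mt h_metric c])
  show ?thesis
    using It_smooth c unfolding smooth_form_def
    by (intro form_on_metric.intro pseudo_metric_axioms form_on_metric_axioms.intro) blast+
qed

lemma fcoords_chart: "c \<in> atlas Mt \<Longrightarrow> p \<in> fst c \<Longrightarrow> fcoords Mt It c (snd c p) v = It p (tv Mt c p v)"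
  by (simp add: fcoords_def cinv_chart[OF chart_inj[OF Mt]])

lemma mcoords_chart: "c \<in> atlas Mt \<Longrightarrow> p \<in> fst c \<Longrightarrow> mcoords Mt h c (snd c p) = (\<lambda>v w. h p (tv Mt c p v) (tv Mt c p w))"
  by (intro ext) (simp add: mcoords_def cinv_chart[OF chart_inj[OF Mt]])

text \<open>Writes the squared length of the gradient in the form used by the assumption
  \<open>positive\<close> of \<open>coordinate_hypersurface\<close>; in this form it is also visibly
  smooth, which makes \<open>W\<close> open.\<close>

lemma nor_chart:
  assumes c: "c \<in> atlas Mt" "p \<in> fst c"
  shows "h p (nor p) (nor p) = fcoords Mt It c (snd c p) (\<Sum>k\<in>Basis. fcoords Mt It c (snd c p) k *\<^sub>R bsolve (mcoords Mt h c (snd c p)) k)"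
proof -
  have p: "p \<in> points Mt" using c chart_subset[OF Mt] by blast
  have "h p (nor p) (nor p) = It p (nor p)" by (rule nor(2)[OF p nor(1)[OF p]])
  then show ?thesis
    unfolding fcoords_chart[OF c] mcoords_chart[OF c]
    using sharp_chart(1)[OF Mt h_metric c It_linear[OF c], folded nor_def] by simp
qed

lemma W_open: "openin (mtop Mt) W"
proof (subst openin_subopen, intro ballI)
  fix p assume p: "p \<in> W"
  then obtain c where c: "c \<in> atlas Mt" "p \<in> fst c" using chart_exists[OF Mt W_points] by blast
  interpret form_on_metric "mcoords Mt h c" "snd c ` fst c" "fcoords Mt It c" by (rule form_chart[OF c(1)])
  let ?f = "\<lambda>x. fcoords Mt It c x (\<Sum>k\<in>Basis. fcoords Mt It c x k *\<^sub>R bsolve (mcoords Mt h c x) k)"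
  have "smooth_on (snd c ` fst c) ?f"
    by (intro smooth_on_linear_family[OF T lin\<alpha> sm\<alpha>] smooth_on_sum smooth_on_scaleR T smooth_\<alpha> smooth_on_bsolve[OF T nd sm])
  then have o: "open (snd c ` fst c \<inter> ?f -` {0<..})"
    using continuous_open_preimage[OF smooth_on_continuous T] by (meson open_greaterThan)
  let ?U = "{q \<in> fst c. snd c q \<in> snd c ` fst c \<inter> ?f -` {0<..}}"
  have "openin (mtop Mt) ?U" by (rule chart_vimage_open[OF Mt c(1) o])
  moreover have "?U \<subseteq> W" using nor_chart[OF c(1)] chart_subset[OF Mt c(1)] by (auto simp: W_def)
  moreover have "p \<in> ?U" using nor_chart[OF c] p c by (auto simp: W_def)
  ultimately show "\<exists>U. openin (mtop Mt) U \<and> p \<in> U \<and> U \<subseteq> W" by blast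
qed

text \<open>The map \<open>\<delta> s\<close> scales \<open>h\<close> by s^2 and \<open>It\<close>
  by s. So it carries the gradient at \<open>p\<close> to s times the gradient at
  \<open>\<delta> s p\<close>, and the squared length of the gradient is unchanged.\<close>

lemma W_invariant:
  assumes p: "p \<in> W" and s: "s > 0" shows "\<delta> s p \<in> W"
proof -
  note pM = W_points[OF p] and si = inverse_positive_iff_positive[THEN iffD2, OF s]
  let ?q = "\<delta> s p"
  have q: "?q \<in> points Mt" by (rule \<delta>_points[OF s pM])
  have bk: "\<delta> (inverse s) ?q = p" using \<delta>_mult[OF pM si s] \<delta>_one[OF pM] s by simp
  \<comment> \<open>Smoothness of \<sigma> is transported first, since otherwise \<open>push\<close>
    would return its default value 0 on \<sigma>.\<close>
  have sq: "smooth_near Mt ?q \<sigma>"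
  proof (rule smooth_near_cong[OF Mt openin_topspace q])
    have "smooth_near Mt ?q (\<lambda>r. \<sigma> (\<delta> (inverse s) r))"
      by (rule smooth_map_near[OF Mt Mt \<delta>_smooth[OF si] q]) (simp add: bk \<sigma>_near[OF p])
    then show "smooth_near Mt ?q (\<lambda>r. s * \<sigma> (\<delta> (inverse s) r))"
      by (rule smooth_near_mult[OF Mt smooth_near_const[OF Mt q]])
    show "s * \<sigma> (\<delta> (inverse s) r) = \<sigma> r" if "r \<in> points Mt" for r using \<sigma>_homogeneous[OF that si] s by simp
  qed
  have It_push: "It ?q (push Mt (\<delta> s) p v) = s * It p v" if v: "v \<in> tangent_space Mt p" for v
  proof -
    have "It ?q (push Mt (\<delta> s) p v) = v (\<lambda>r. \<sigma> (\<delta> s r))"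
      using It_d\<sigma>[OF q push_\<delta>_tangent[OF pM v s]] sq by (simp add: push_def o_def)
    also have "\<dots> = v (\<lambda>r. s * \<sigma> r)"
      by (rule tangent_cong[OF Mt openin_topspace pM _ v]) (rule \<sigma>_homogeneous[OF _ s])
    also have "\<dots> = s * v \<sigma>" by (rule tangent_scale_fun[OF Mt v pM]) (use s in simp)
    finally show ?thesis using It_d\<sigma>[OF pM v] by simp
  qed
  have surj: "\<exists>v\<in>tangent_space Mt p. w = push Mt (\<delta> s) p v" if w: "w \<in> tangent_space Mt ?q" for w
  proof -
    have "push Mt (\<delta> s) p (push Mt (\<delta> (inverse s)) ?q w) = w"
      using push_\<delta>_mult[OF q w s si] push_\<delta>_one[OF q w] bk s by simp
    moreover have "push Mt (\<delta> (inverse s)) ?q w \<in> tangent_space Mt p"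
      using push_\<delta>_tangent[OF q w si] bk by simp
    ultimately show ?thesis by metis
  qed
  let ?n = "push Mt (\<delta> s) p (nor p)"
  note nT = nor(1)[OF pM] and nT' = push_\<delta>_tangent[OF pM nor(1)[OF pM] s]
  have "nor ?q = (\<lambda>f. inverse s * ?n f)"
  proof (rule nor(3)[OF q])
    show "(\<lambda>f. inverse s * ?n f) \<in> tangent_space Mt ?q" by (rule tangent_scale[OF Mt nT'])
    fix w assume w: "w \<in> tangent_space Mt ?q"
    then obtain v where v: "v \<in> tangent_space Mt p" "w = push Mt (\<delta> s) p v" using surj by blast
    have "h ?q (\<lambda>f. inverse s * ?n f) w = inverse s * h ?q ?n w" by (rule metric_scale(1)[OF Mt h_metric nT' w q])
    also have "\<dots> = s * It p v"
      unfolding v(2) homothety[OF pM nT v(1) s] nor(2)[OF pM v(1)] using s by (simp add: power2_eq_square)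
    also have "\<dots> = It ?q w" unfolding v(2) It_push[OF v(1)] ..
    finally show "h ?q (\<lambda>f. inverse s * ?n f) w = It ?q w" .
  qed
  then have "h ?q (nor ?q) (nor ?q) = inverse s * (inverse s * h ?q ?n ?n)"
    using metric_scale[OF Mt h_metric nT' _ q] tangent_scale[OF Mt nT', of "inverse s"] nT' by simp
  also have "\<dots> = h p (nor p) (nor p)" unfolding homothety[OF pM nT nT s] using s by (simp add: power2_eq_square field_simps)
  finally show ?thesis using p q by (simp add: W_def)
qed

section \<open>The two zero sets\<close>

abbreviation "\<Sigma> \<equiv> scale_singularity M C I"
definition Z :: "'w set" where "Z = {p \<in> W. \<sigma> p = 0}"

lemma Z_invariant: "p \<in> Z \<Longrightarrow> s > 0 \<Longrightarrow> \<delta> s p \<in> Z"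
  using W_invariant \<sigma>_homogeneous W_points by (simp add: Z_def)

lemma section_I: "tractor_section M C I" and parallel_I: "parallel_tractor M C I"
  using einstein by (simp_all add: almost_einstein_def)

text \<open>Pairing with the canonical section extracts the first slot, which changes by a positive
  factor when the metric changes.\<close>

lemma \<Sigma>_iff:
  assumes g: "g \<in> C" shows "x \<in> \<Sigma> \<longleftrightarrow> x \<in> points M \<and> tsig (I g) x = 0"
proof -
  have "tractor_h M g' x canonical_X (I g') = tsig (I g') x" for g'
    by (simp add: tractor_h_def canonical_X_def cometric_def)
  moreover have "tsig (I g') x = 0 \<longleftrightarrow> tsig (I g) x = 0" if g': "g' \<in> C" "x \<in> points M" for g'
  proof -
    obtain \<omega> where "conf_related M \<omega> g g'" using rel[OF g g'(1)] by blast
    then have "tsig (I g') x = exp (\<omega> x) * tsig (I g) x"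
      using section_I g g' unfolding tractor_section_def Let_def by blast
    then show ?thesis by simp
  qed
  ultimately show ?thesis using g unfolding scale_singularity_def by auto
qed

text \<open>Where the first slot vanishes, the tractor norm reduces to the norm of the middle slot,
  which is positive by scalar negativity. The first component of the parallel equation says that the
  middle slot is the differential of the first, so this differential has no zero on
  \<Sigma>.\<close>

lemma \<Sigma>_manifold:
  assumes dim: "DIM('f::euclidean_space) + 1 = DIM('e)"
  shows "smooth_manifold (submanifold M \<Sigma> :: ('m, 'f) mfd)"
proof -
  obtain g where g: "g \<in> C" using C_ex by blast
  let ?s = "tsig (I g)" and ?\<mu> = "tmu (I g)"
  have fs: "fun_smooth M (points M) ?s" and sf: "smooth_form M ?\<mu>"
    using section_I g unfolding tractor_section_def by blast+
  have man: "smooth_manifold M" using conformal by (simp add: conformal_manifold_def)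
  show ?thesis
  proof (rule hypersurface_manifold[OF man openin_topspace, of _ ?s])
    show "\<Sigma> = {q \<in> points M. ?s q = 0}" using \<Sigma>_iff[OF g] by blast
    fix p assume p: "p \<in> \<Sigma>"
    then have pM: "p \<in> points M" and s0: "?s p = 0" using \<Sigma>_iff[OF g] by auto
    show "\<exists>U. openin (mtop M) U \<and> p \<in> U \<and> U \<subseteq> points M \<and> fun_smooth M U ?s" using fs pM by blast
    obtain c where c: "c \<in> atlas M" "p \<in> fst c" using chart_exists[OF M pM] by blast
    have fc: "fcoords M ?\<mu> c (snd c p) = (\<lambda>v. ?\<mu> p (tv M c p v))"
      by (intro ext) (simp add: fcoords_def cinv_chart[OF chart_inj[OF M c(1)] c(2)])
    have l: "linear (\<lambda>v. ?\<mu> p (tv M c p v))" using sf c unfolding smooth_form_def fc[symmetric] by blast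
    obtain w where w: "sharp M g p (?\<mu> p) = tv M c p w" using sharp_chart(1)[OF M riem[OF g] c l] by blast
    have "tractor_h M g p (I g) (I g) > 0" using negative g pM unfolding scalar_negative_def by force
    then have pos: "?\<mu> p (tv M c p w) > 0" using s0 w by (simp add: tractor_h_def cometric_def)
    have nr: "smooth_near M p ?s" using fs pM fs_iff by blast
    have d: "(\<lambda>x. ?s (cinv c x)) differentiable (at (snd c p))" by (rule smooth_near_differentiable[OF M nr c])
    have dk: "dpartial k (\<lambda>x. ?s (cinv c x)) (snd c p) = ?\<mu> p (tv M c p k)" if "k \<in> Basis" for k
    proof -
      have "tnabla1 M g c (I g) (snd c p) k = 0" using parallel_I g c that unfolding parallel_tractor_def by blast
      then show ?thesis unfolding tnabla1_def fc by (simp add: o_def)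
    qed
    have "tv M c p w ?s = (\<Sum>k\<in>Basis. (w \<bullet> k) *\<^sub>R ?\<mu> p (tv M c p k))"
      using nr dpartial_Basis[OF d, of w] dk by (simp add: tv_apply[OF M])
    also have "\<dots> = ?\<mu> p (tv M c p w)" using linear_Basis_sum[OF l, of w] by simp
    finally have "tv M c p w ?s \<noteq> 0" using pos by simp
    then show "\<exists>v\<in>tangent_space M p. v ?s \<noteq> 0" using c unfolding tangent_space_def by blast
  qed (rule dim)
qed

lemma Z_manifold:
  assumes dim: "DIM('l::euclidean_space) + 1 = DIM('k)"
  shows "smooth_manifold (submanifold Mt Z :: ('w, 'l) mfd)"
proof (rule hypersurface_manifold[OF Mt_manifold W_open, of _ \<sigma>])
  show "Z = {q \<in> W. \<sigma> q = 0}" by (simp add: Z_def)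
  fix p assume p: "p \<in> Z"
  then have pW: "p \<in> W" by (simp add: Z_def)
  show "\<exists>U. openin (mtop Mt) U \<and> p \<in> U \<and> U \<subseteq> W \<and> fun_smooth Mt U \<sigma>"
    using W_open pW fun_smooth_iff[OF Mt W_open] \<sigma>_near by blast
  show "\<exists>v\<in>tangent_space Mt p. v \<sigma> \<noteq> 0" using W_pos[OF pW] nor(1)[OF W_points[OF pW]] by (intro bexI[of _ "nor p"]) auto
qed (rule dim)

lemma corr_tangent:
  assumes "tractor_section M C J" "u \<in> metric_bundle M C" shows "\<Phi> J u \<in> tangent_space Mt (i u)"
proof -
  have "fibre_parallel M C Mt i h (\<Phi> J)"
    using conjunct1[OF corr[unfolded tractor_correspondence_def], rule_format, OF assms(1)] .
  from conjunct1[OF conjunct1[OF this[unfolded fibre_parallel_def], unfolded smooth_along_def]]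
  show ?thesis using assms(2) unfolding bundle_points by blast
qed

lemma corr_h:
  assumes "tractor_section M C J" "tractor_section M C J'" "u \<in> metric_bundle M C" "g \<in> C"
  shows "h (i u) (\<Phi> J u) (\<Phi> J' u) = tractor_h M g (fst u) (J g) (J' g)"
  by (rule corr[unfolded tractor_correspondence_def, THEN conjunct2, THEN conjunct2, THEN conjunct2, THEN conjunct2,
        THEN conjunct1, rule_format]) (use assms in simp_all)

lemma bundle_in_W:
  assumes u: "u \<in> metric_bundle M C" shows "i u \<in> W"
proof -
  obtain g where g: "g \<in> C" using C_ex by blast
  have "tractor_h M g (fst u) (I g) (I g) > 0" using negative g blevel(3)[OF g u] unfolding scalar_negative_def by force
  then show ?thesis using corr_h[OF section_I section_I u g] i_points[OF u] by (simp add: W_def nor_def sharp_It[OF u])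
qed

text \<open>\<open>\<tau>\<close> is the density of weight \<open>-1\<close> that equals \<open>1\<close> on the section of the bundle given
  by \<open>g\<close>.\<close>

lemma \<sigma>_bundle:
  assumes u: "u \<in> metric_bundle M C" and x: "fst u \<in> \<Sigma>" shows "\<sigma> (i u) = 0"
proof -
  obtain g where g: "g \<in> C" using C_ex by blast
  define \<tau> where "\<tau> v = inverse (blevel g v)" for v
  \<comment> \<open>The section \<tau>X: the correspondence speaks of \<open>X\<close> only after
    multiplication by a density of weight -1, because \<open>X\<close> itself has weight 1.\<close>
  define K where "K = (\<lambda>g'. Trac (\<lambda>_. 0) (\<lambda>_ _. 0) (\<lambda>x. \<tau> (x, g' x)))"
  have in_bundle: "(x, g' x) \<in> metric_bundle M C" if "g' \<in> C" "x \<in> points M" for g' x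
    using that unfolding metric_bundle_def by blast
  have \<tau>_scale: "\<tau> (bscale s v) = inverse s * \<tau> v" if "v \<in> metric_bundle M C" "s > 0" for s v
    using blevel_scale[OF g that] by (simp add: \<tau>_def)
  have density: "density M C (-1) \<tau>" unfolding density_def
  proof (intro conjI ballI allI impI)
    have "fun_smooth (bundle_mfd M C) (points (bundle_mfd M C)) \<tau>"
    proof (rule fun_smoothI_plot[OF smooth_charts_bundle])
      fix V and G :: "real \<times> 'e \<Rightarrow> 'm bpt" assume V: "open V" "smooth_into (bundle_mfd M C) V G"
      note d = bundle_plotD[OF g V(2)]
      show "smooth_on V (\<lambda>y. \<tau> (G y))" unfolding \<tau>_def
        by (rule smooth_on_inverse[OF V(1) d(1)]) (use blevel(1)[OF g d(3)] in force)
    qed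
    then show "fun_smooth (bundle_mfd M C) (metric_bundle M C) \<tau>" by (simp add: bundle_points)
    show "\<tau> (bscale s v) = s powr - 1 * \<tau> v" if "v \<in> metric_bundle M C" "0 < s" for s v
      using \<tau>_scale[OF that] that by (simp add: powr_minus)
  qed
  \<comment> \<open>The transformation law of the third slot pairs d\<omega> with the middle slot,
    which is 0 here; the vector dual to the zero form is the zero vector.\<close>
  have cz: "cometric M g1 x \<Upsilon> (\<lambda>_. 0) = 0" if g1: "g1 \<in> C" "x \<in> points M" "\<Upsilon> = (\<lambda>v. v \<omega>)" for g1 x \<Upsilon> \<omega>
  proof -
    obtain c where c: "c \<in> atlas M" "x \<in> fst c" using chart_exists[OF M g1(2)] by blast
    have "linear (\<lambda>v::'e. 0::real)" by (rule linear_zero)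
    from sharp_chart(1)[OF M riem[OF g1(1)] c, of "\<lambda>_. 0", OF this] have "sharp M g1 x (\<lambda>_. 0) = tv M c x 0" by simp
    then show ?thesis using linear_0[OF tv_linear[OF M c, of \<omega>]] g1(3) by (simp add: cometric_def)
  qed
  have "tractor_section M C K" unfolding tractor_section_def Let_def
  proof (intro conjI ballI allI impI)
    fix g' assume g': "g' \<in> C"
    show "fun_smooth M (points M) (tsig (K g'))" using smooth_near_const[OF M] by (simp add: K_def fs_iff)
    show "smooth_form M (tmu (K g'))" by (simp add: K_def smooth_form_def fcoords_def[abs_def] linear_zero)
    obtain \<omega> where \<omega>: "conf_related M \<omega> g g'" using rel[OF g g'] by blast
    have fs: "fun_smooth M (points M) \<omega>" using \<omega> by (simp add: conf_related_def)
    show "fun_smooth M (points M) (trho (K g'))"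
    proof (rule fun_smoothI_plot[OF M])
      fix V and G :: "'e \<Rightarrow> 'm" assume V: "open V" "smooth_into M V G"
      show "smooth_on V (\<lambda>y. trho (K g') (G y))"
      proof (rule smooth_on_cong[OF V(1)])
        show "smooth_on V (\<lambda>y. inverse (exp (\<omega> (G y))))"
          by (intro smooth_on_inverse smooth_on_exp_comp V(1) fun_smooth_plot[OF M fs V(2)]) simp
        show "inverse (exp (\<omega> (G y))) = trho (K g') (G y)" if "y \<in> V" for y
          using blevel_change[OF g g' \<omega> smooth_into_points[OF M V(2) that], of 1]
          by (simp add: K_def \<tau>_def bscale_def)
      qed
    qed
  next
    fix g1 g2 \<omega> x assume g12: "g1 \<in> C" "g2 \<in> C" "conf_related M \<omega> g1 g2" "x \<in> points M"
    show "tsig (K g2) x = exp (\<omega> x) * tsig (K g1) x" by (simp add: K_def)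
    show "tmu (K g2) x v = exp (\<omega> x) * (tmu (K g1) x v + tsig (K g1) x * v \<omega>)" for v by (simp add: K_def)
    show "trho (K g2) x = exp (- \<omega> x) * (trho (K g1) x - cometric M g1 x (\<lambda>v. v \<omega>) (tmu (K g1) x)
        - 1 / 2 * tsig (K g1) x * cometric M g1 x (\<lambda>v. v \<omega>) (\<lambda>v. v \<omega>))"
      using cz[OF g12(1,4) refl, of \<omega>] \<tau>_scale[OF in_bundle[OF g12(1,4)], of "exp (\<omega> x)"] conf_eq[OF g12]
      by (simp add: K_def exp_minus)
  qed
  note K = this
  have "tractor_eq M C K (\<lambda>g. Trac (\<lambda>x. \<tau> (x, g x) * tsig canonical_X x) (\<lambda>x v. \<tau> (x, g x) * tmu canonical_X x v)
      (\<lambda>x. \<tau> (x, g x) * trho canonical_X x))"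
    by (simp add: tractor_eq_def K_def canonical_X_def)
  then have gen: "\<Phi> K u q = \<tau> u * generator Mt \<delta> (i u) q" for q
    by (intro corr[unfolded tractor_correspondence_def, THEN conjunct2, THEN conjunct2, THEN conjunct2, THEN conjunct1,
          rule_format] conjI K density u)
  have \<tau>0: "\<tau> u \<noteq> 0" using blevel(1)[OF g u] by (simp add: \<tau>_def)
  have geq: "generator Mt \<delta> (i u) = (\<lambda>q. inverse (\<tau> u) * \<Phi> K u q)" using gen \<tau>0 by (simp add: fun_eq_iff)
  have "\<sigma> (i u) = h (i u) (\<lambda>q. inverse (\<tau> u) * \<Phi> K u q) (\<Phi> I u)"
    unfolding ambient_scale_def sharp_It[OF u] geq ..
  also have "\<dots> = inverse (\<tau> u) * tractor_h M g (fst u) (K g) (I g)"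
    unfolding metric_scale(1)[OF Mt h_metric corr_tangent[OF K u] corr_tangent[OF section_I u] i_points[OF u]] corr_h[OF K section_I u g] ..
  also have "tractor_h M g (fst u) (K g) (I g) = 0"
    using x \<Sigma>_iff[OF g] by (simp add: tractor_h_def K_def cometric_def)
  finally show ?thesis by simp
qed

end


section \<open>The ambient zero set as an ambient space over the scale singularity set\<close>

context ambient_einstein
begin

lemma hess_flat:
  assumes c: "c \<in> atlas Mt" "p \<in> fst c" and p: "p \<in> i ` metric_bundle M C" and ab: "a \<in> Basis" "b \<in> Basis"
  shows "flat_on (snd c ` fst c) (snd c p) (\<lambda>x. form_on_metric.hess (mcoords Mt h c) (fcoords Mt It c) x a b)"
proof -
  interpret form_on_metric "mcoords Mt h c" "snd c ` fst c" "fcoords Mt It c" by (rule form_chart[OF c(1)])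
  have x: "snd c p \<in> snd c ` fst c" using c by blast
  have "vanishes_all_orders (\<lambda>x. nabla_form (mcoords Mt h c) (fcoords Mt It c) x a b) (snd c p)"
    using It_parallel c p ab unfolding parallel_form_along_def by blast
  from vanishes_cong[OF T x hess_nabla_form this] show ?thesis unfolding flat_on_def using smooth_hess by blast
qed

lemma ricci_flat_ambient:
  assumes c: "c \<in> atlas Mt" "p \<in> fst c" and p: "p \<in> i ` metric_bundle M C" and ab: "a \<in> Basis" "b \<in> Basis"
  shows "flat_on (snd c ` fst c) (snd c p) (\<lambda>x. ricci (mcoords Mt h c) x a b)"
proof -
  interpret pseudo_metric "mcoords Mt h c" "snd c ` fst c" by (rule metric_pseudo_metric[OF Mt h_metric c(1)])
  show ?thesis using ambient(3) c p ab ricci_smooth unfolding ricci_flat_along_def flat_on_def by blast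
qed

context
  fixes N :: "('m, 'f::euclidean_space) mfd" and R :: "('w, 'l::euclidean_space) mfd"
  assumes N_def: "N = submanifold M \<Sigma>" and R_def: "R = submanifold Mt Z"
    and dimN: "DIM('f) + 1 = DIM('e)" and dimR: "DIM('l) + 1 = DIM('k)"
begin

lemma N_conformal: "conformal_submanifold M C \<Sigma> N"
  using \<Sigma>_manifold[OF dimN] N_def by (intro conformal_submanifold.intro conformal_axioms conformal_submanifold_axioms.intro) auto

interpretation s: conformal_submanifold M C \<Sigma> N by (rule N_conformal)

lemma R_manifold: "smooth_manifold R"
  unfolding R_def by (rule Z_manifold[OF dimR])

lemma R: "smooth_charts R"
  using R_manifold by (simp add: smooth_manifold_iff)

lemma R_points: "points R = Z"
  unfolding R_def submanifold_simps using W_points by (auto simp: Z_def)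

lemma Z_points: "p \<in> Z \<Longrightarrow> p \<in> points Mt"
  using W_points by (simp add: Z_def)

lemmas R_inclusion = smooth_map_inclusion[OF Mt R_def R]

abbreviation "hR \<equiv> pullback R Mt id h"

text \<open>\<open>It\<close> is the differential of \<sigma>, and \<sigma> is constant on the zero
  set; \<open>\<sigma>_near\<close> ensures that \<open>push\<close> really differentiates
  \<sigma>.\<close>

lemma It_tangent:
  assumes p: "p \<in> points R" and v: "v \<in> tangent_space R p" shows "It p (push Mt id p v) = 0"
proof -
  have pZ: "p \<in> Z" "p \<in> W" using p by (auto simp: R_points Z_def)
  have "It p (push Mt id p v) = push Mt id p v \<sigma>"
    using It_d\<sigma>[OF Z_points[OF pZ(1)]] push_in_tangent_space[OF R Mt R_inclusion p v] by simp
  also have "\<dots> = v \<sigma>" using \<sigma>_near[OF pZ(2)] by (simp add: push_def)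
  also have "\<dots> = v (\<lambda>_. 0)" by (rule tangent_cong[OF R openin_topspace p _ v]) (simp add: R_points Z_def)
  also have "\<dots> = 0" using v by (auto simp: tangent_space_def tv_apply[OF R])
  finally show ?thesis .
qed

lemma It_tangent_chart:
  assumes b: "b \<in> atlas R" "p \<in> fst b" and c: "c \<in> atlas Mt" "p \<in> fst c"
  shows "It p (tv Mt c p (dpartial v (\<lambda>y. snd c (cinv b y)) (snd b p))) = 0"
proof -
  have "p \<in> points R" using b chart_subset[OF R] by blast
  moreover have "tv R b p v \<in> tangent_space R p" unfolding tangent_space_chart[OF R b] by blast
  ultimately have "It p (push Mt id p (tv R b p v)) = 0" by (rule It_tangent)
  then show ?thesis using push_tv[OF R Mt R_inclusion b c(1)] c(2) by simp
qed

lemma hR_metric: "metric_sig R (DIM('f) + 1) 1 hR"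
proof (rule pullback_metric[OF R Mt R_inclusion h_metric])
  fix p b c assume b: "b \<in> atlas R" "p \<in> fst b" and c0: "c \<in> atlas Mt" "id p \<in> fst c"
    and l0: "linear (\<lambda>v. dpartial v (\<lambda>y. snd c (id (cinv b y))) (snd b p))"
  let ?D = "\<lambda>v. dpartial v (\<lambda>y. snd c (cinv b y)) (snd b p)"
  have c: "c \<in> atlas Mt" "p \<in> fst c" and l: "linear ?D" using c0 l0 by simp_all
  have pR: "p \<in> points R" using b chart_subset[OF R] by blast
  then have pW: "p \<in> W" and pM: "p \<in> points Mt" using W_points by (auto simp: R_points Z_def)
  note f = metric_form[OF Mt h_metric c]
  obtain n where n: "nor p = tv Mt c p n" using nor(1)[OF pM] unfolding tangent_space_chart[OF Mt c] by blast
  have "has_signature (\<lambda>v w. h p (tv Mt c p (?D v)) (tv Mt c p (?D w))) (DIM('f) + 1) 1"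
  proof (rule has_signature_orthogonal_complement[OF f(1) f(2), of _ _ n])
    \<comment> \<open>The \<open>DIM('e) + 1\<close> positive directions of the ambient metric,
      rewritten by \<open>DIM('f) + 1 = DIM('e)\<close>; the successor is the direction of the
      gradient.\<close>
    show "has_signature (\<lambda>v w. h p (tv Mt c p v) (tv Mt c p w)) (Suc (DIM('f) + 1)) 1"
      using f(3) dimN by (simp add: numeral_eq_Suc)
    show "0 < h p (tv Mt c p n) (tv Mt c p n)" using pW n by (simp add: W_def)
    show "linear ?D" by (rule l)
    show "inj ?D" unfolding linear_injective_0[OF l]
      using push_inj_iff[OF R Mt R_inclusion b c0] inclusion_immersion[OF Mt R_def R pR] unfolding id_apply by blast
    show "h p (tv Mt c p (?D v)) (tv Mt c p n) = 0" for v
      using f(2)[of "?D v" n] nor(2)[OF pM, of "tv Mt c p (?D v)"] It_tangent_chart[OF b c, of v]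
      unfolding n tangent_space_chart[OF Mt c] by simp
    show "DIM('l) + 1 = DIM('k)" by (rule dimR)
  qed
  then show "has_signature (\<lambda>v w. h (id p) (tv Mt c (id p) (dpartial v (\<lambda>y. snd c (id (cinv b y))) (snd b p)))
      (tv Mt c (id p) (dpartial w (\<lambda>y. snd c (id (cinv b y))) (snd b p)))) (DIM('f) + 1) 1" by simp
qed

text \<open>The bridge from the manifolds to the coordinate locale. The chart image is shrunk to
  \<open>S'\<close> so that the inclusion stays inside the one ambient chart
  \<open>c\<close>.\<close>

lemma chart_hypersurface:
  assumes b: "b \<in> atlas R" "p \<in> fst b" and c: "c \<in> atlas Mt" "p \<in> fst c"
  obtains S' where "snd b p \<in> S'"
    "coordinate_hypersurface (mcoords Mt h c) (snd c ` fst c) (fcoords Mt It c) (mcoords R hR b) S' (\<lambda>y. snd c (cinv b y))"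
proof -
  obtain S' where S': "open S'" "snd b p \<in> S'" "S' \<subseteq> snd b ` fst b" "\<And>y. y \<in> S' \<Longrightarrow> cinv b y \<in> fst c"
    "smooth_on S' (\<lambda>y. snd c (cinv b y))"
    using chart_rep_differentiable[OF R Mt R_inclusion b c(1)] c(2) unfolding id_apply by metis
  interpret r: pseudo_metric "mcoords R hR b" "snd b ` fst b" by (rule metric_pseudo_metric[OF R hR_metric b(1)])
  have sub: "pseudo_metric (mcoords R hR b) S'"
    by unfold_locales (use S'(1,3) r.nd r.sym smooth_on_subset[OF r.sm] in blast)+
  have "coordinate_hypersurface (mcoords Mt h c) (snd c ` fst c) (fcoords Mt It c) (mcoords R hR b) S' (\<lambda>y. snd c (cinv b y))"
  proof (intro coordinate_hypersurface.intro form_chart[OF c(1)] sub coordinate_hypersurface_axioms.intro)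
    show "smooth_on S' (\<lambda>y. snd c (cinv b y))" by (rule S'(5))
    show "(\<lambda>y. snd c (cinv b y)) ` S' \<subseteq> snd c ` fst c" using S'(4) by blast
    show "DIM('l) + 1 = DIM('k)" by (rule dimR)
    fix y assume y: "y \<in> S'"
    then have yb: "y \<in> snd b ` fst b" using S'(3) by blast
    note q = cinv_in[OF yb] and qc = S'(4)[OF y]
    have by_eq: "snd b (cinv b y) = y" by (rule chart_cinv[OF yb])
    show "mcoords R hR b y v w = mcoords Mt h c (snd c (cinv b y)) (dpartial v (\<lambda>y. snd c (cinv b y)) y) (dpartial w (\<lambda>y. snd c (cinv b y)) y)" for v w
      using pullback_coords[OF R Mt R_inclusion b(1) q c(1), of h v w] qc
      by (simp add: mcoords_chart[OF c(1) qc] by_eq) (simp add: mcoords_def)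
    show "fcoords Mt It c (snd c (cinv b y)) (dpartial v (\<lambda>y. snd c (cinv b y)) y) = 0" for v
      using It_tangent_chart[OF b(1) q c(1) qc, of v] by (simp add: fcoords_chart[OF c(1) qc] by_eq)
    have "cinv b y \<in> W" using q chart_subset[OF R b(1)] by (auto simp: R_points Z_def)
    then show "fcoords Mt It c (snd c (cinv b y)) (\<Sum>k\<in>Basis. fcoords Mt It c (snd c (cinv b y)) k *\<^sub>R
        bsolve (mcoords Mt h c (snd c (cinv b y))) k) \<noteq> 0"
      using nor_chart[OF c(1) qc] by (simp add: W_def)
  qed
  then show thesis using that S'(2) by blast
qed

lemma R_totally_geodesic:
  assumes X: "X \<subseteq> i ` metric_bundle M C" shows "totally_geodesic_along Mt h R X"
  unfolding totally_geodesic_along_def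
proof (intro ballI)
  fix b c p and j m :: 'l and k :: 'k
  assume b: "b \<in> atlas R" and c: "c \<in> atlas Mt" and p: "p \<in> fst b \<inter> fst c \<inter> X" and k: "k \<in> Basis"
  have pb: "p \<in> fst b" and pc: "p \<in> fst c" and pX: "p \<in> i ` metric_bundle M C" using p X by auto
  obtain S' where S': "snd b p \<in> S'"
    "coordinate_hypersurface (mcoords Mt h c) (snd c ` fst c) (fcoords Mt It c) (mcoords R hR b) S' (\<lambda>y. snd c (cinv b y))"
    by (rule chart_hypersurface[OF b pb c pc])
  interpret coordinate_hypersurface "mcoords Mt h c" "snd c ` fst c" "fcoords Mt It c" "mcoords R hR b" S' "\<lambda>y. snd c (cinv b y)"
    by (rule S'(2))
  have "cinv b (snd b p) = p" using cinv_chart[OF chart_inj[OF R b] pb] .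
  then have "flat_on S' (snd b p) (\<lambda>y. II y j m \<bullet> k)"
    by (intro II_flat[OF S'(1)]) (simp add: hess_flat[OF c pc pX])
  then have "vanishes_all_orders (\<lambda>y. II y j m \<bullet> k) (snd b p)" by (simp add: flat_on_def)
  then show "vanishes_all_orders (\<lambda>y. second_ff Mt h R b c y j m k) (snd b p)"
    by (rule vanishes_cong[OF sub.T S'(1), rotated])
      (simp add: II_component[OF _ k] second_ff_def coordf_def)
qed

lemma R_ricci_flat:
  assumes X: "X \<subseteq> i ` metric_bundle M C" "X \<subseteq> Z" shows "ricci_flat_along R hR X"
  unfolding ricci_flat_along_def
proof (intro ballI)
  fix b p and j m :: 'l
  assume b: "b \<in> atlas R" and p: "p \<in> fst b \<inter> X"
  have pb: "p \<in> fst b" and pX: "p \<in> i ` metric_bundle M C" using p X by auto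
  have "p \<in> points Mt" using p X(2) Z_points by blast
  then obtain c where c: "c \<in> atlas Mt" and pc: "p \<in> fst c" using chart_exists[OF Mt] by blast
  obtain S' where S': "snd b p \<in> S'"
    "coordinate_hypersurface (mcoords Mt h c) (snd c ` fst c) (fcoords Mt It c) (mcoords R hR b) S' (\<lambda>y. snd c (cinv b y))"
    by (rule chart_hypersurface[OF b pb c pc])
  interpret coordinate_hypersurface "mcoords Mt h c" "snd c ` fst c" "fcoords Mt It c" "mcoords R hR b" S' "\<lambda>y. snd c (cinv b y)"
    by (rule S'(2))
  have "cinv b (snd b p) = p" using cinv_chart[OF chart_inj[OF R b] pb] .
  then have "flat_on S' (snd b p) (\<lambda>y. ricci (mcoords R hR b) y j m)"
    by (intro ricci_flat[OF S'(1)]) (simp_all add: hess_flat[OF c pc pX] ricci_flat_ambient[OF c pc pX])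
  then show "vanishes_all_orders (\<lambda>y. ricci (mcoords R hR b) y j m) (snd b p)" by (simp add: flat_on_def)
qed

lemma i_QS: "i ` s.QS \<subseteq> Z"
  using bundle_in_W \<sigma>_bundle by (auto simp: s.QS_def Z_def s.N_points(2))

lemma \<delta>_R: "smooth_map (ray_times R) R (\<lambda>(s, p). \<delta> s p)"
proof (rule smooth_map_into_submanifold[OF Mt R_def R smooth_charts_ray[OF R]])
  show "(\<lambda>(s, p). \<delta> s p) ` points (ray_times R) \<subseteq> Z"
    unfolding ray_points[OF R] R_points using Z_invariant by auto
  show "smooth_map (ray_times R) Mt (\<lambda>(s, p). \<delta> s p)"
  proof (rule smooth_mapI_into[OF smooth_charts_ray[OF R] Mt])
    fix V and G :: "real \<times> 'l \<Rightarrow> real \<times> 'w" assume V: "open V" and G: "smooth_into (ray_times R) V G"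
    note G' = G[unfolded smooth_into_ray[OF R V] smooth_into_submanifold[OF Mt R_def R V]]
    show "smooth_into Mt V (\<lambda>y. (\<lambda>(s, p). \<delta> s p) (G y))"
      unfolding case_prod_unfold by (rule \<delta>_plot[OF V]) (use G' in auto)
  qed
qed

lemma R_ambient_manifold: "ambient_manifold N s.C' R \<delta> (i \<circ> s.beta)"
  unfolding ambient_manifold_def
proof (intro conjI ballI allI impI)
  show "smooth_manifold R" by (rule R_manifold)
  show "DIM('l) = DIM('f) + 2" using dimN dimR Mt_dim by simp
  show "smooth_map (ray_times R) R (\<lambda>(s, p). \<delta> s p)" by (rule \<delta>_R)
  show "smooth_embedding (bundle_mfd N s.C') R (i \<circ> s.beta)"
    by (rule s.embedding_into_submanifold(1)[OF Mt i_embedding R_def R i_QS])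
  show "(i \<circ> s.beta) (bscale t u) = \<delta> t ((i \<circ> s.beta) u)" if "u \<in> metric_bundle N s.C'" "0 < t" for u t
    using s.beta_bscale[OF that] i_equivariant[OF _ that(2)] s.beta(1)[OF that(1)] by (simp add: s.QS_def)
  fix p assume "p \<in> points R"
  then have p: "p \<in> points Mt" using R_points Z_points by simp
  show "\<delta> 1 p = p" "\<And>s t. 0 < s \<Longrightarrow> 0 < t \<Longrightarrow> \<delta> s (\<delta> t p) = \<delta> (s * t) p" "\<And>s. 0 < s \<Longrightarrow> \<delta> s p = p \<Longrightarrow> s = 1"
    using \<delta>_one[OF p] \<delta>_mult[OF p] \<delta>_free[OF p] by blast+
qed

text \<open>The inclusion commutes with the action, so the integrated homothety of \<open>h\<close>
  can be pulled back; the Lie derivative on the hypersurface is then the derivative of s^2 at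
  1.\<close>

lemma hR_homothety:
  assumes p: "p \<in> points R" "v \<in> tangent_space R p" "w \<in> tangent_space R p" and s: "s > 0"
  shows "pullback R R (\<delta> s) hR p v w = s\<^sup>2 * hR p v w"
proof -
  have sR: "smooth_map R R (\<delta> s)"
  proof (rule smooth_map_into_submanifold[OF Mt R_def R R])
    show "smooth_map R Mt (\<delta> s)" using smooth_map_compose[OF R Mt Mt R_inclusion \<delta>_smooth[OF s]] by simp
    show "\<delta> s ` points R \<subseteq> Z" using R_points Z_invariant s by auto
  qed
  note pM = Z_points[OF p(1)[unfolded R_points]] and t = push_in_tangent_space[OF R Mt R_inclusion p(1)]
  have "pullback R R (\<delta> s) hR p v w = pullback R Mt (id \<circ> \<delta> s) h p v w"
    by (rule pullback_pullback[OF R R Mt sR R_inclusion p])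
  also have "\<dots> = pullback R Mt id (pullback Mt Mt (\<delta> s) h) p v w"
    using pullback_pullback[OF R Mt Mt R_inclusion \<delta>_smooth[OF s] p, of h] by simp
  also have "\<dots> = pullback Mt Mt (\<delta> s) h p (push Mt id p v) (push Mt id p w)"
    using pullback_apply[OF R Mt R_inclusion p] by simp
  also have "\<dots> = h (\<delta> s p) (push Mt (\<delta> s) p (push Mt id p v)) (push Mt (\<delta> s) p (push Mt id p w))"
    using pullback_apply[OF Mt Mt \<delta>_smooth[OF s] pM] t[OF p(2)] t[OF p(3)] by simp
  also have "\<dots> = s\<^sup>2 * h p (push Mt id p v) (push Mt id p w)"
    using homothety[OF pM _ _ s] t[OF p(2)] t[OF p(3)] by simp
  also have "\<dots> = s\<^sup>2 * hR p v w" using pullback_apply[OF R Mt R_inclusion p, of h] by simp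
  finally show ?thesis .
qed

lemma R_ambient_metric: "ambient_metric N s.C' R \<delta> (i \<circ> s.beta) hR"
  unfolding ambient_metric_def
proof (intro conjI ballI)
  show "metric_sig R (DIM('f) + 1) 1 hR" by (rule hR_metric)
  show "((\<lambda>s. pullback R R (\<delta> s) hR p v w) has_real_derivative 2 * hR p v w) (at 1)"
    if p: "p \<in> points R" "v \<in> tangent_space R p" "w \<in> tangent_space R p" for p v w
  proof (rule has_field_derivative_transform_within_open)
    show "((\<lambda>s. s\<^sup>2 * hR p v w) has_real_derivative 2 * hR p v w) (at 1)" by (auto intro!: derivative_eq_intros)
    show "s\<^sup>2 * hR p v w = pullback R R (\<delta> s) hR p v w" if "s \<in> {0<..}" for s
      using hR_homothety[OF p, of s] that by simp
  qed auto
  fix u \<xi> \<eta> assume u: "u \<in> metric_bundle N s.C'" and \<xi>: "\<xi> \<in> tangent_space (bundle_mfd N s.C') u"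
    and \<eta>: "\<eta> \<in> tangent_space (bundle_mfd N s.C') u"
  have up: "u \<in> points (bundle_mfd N s.C')" using u by (simp add: s.sub.bundle_points)
  note sm = s.embedding_into_submanifold(2)[OF Mt i_embedding R_def R i_QS]
  have si: "smooth_map (bundle_mfd M C) Mt i" using i_embedding by (simp add: smooth_embedding_def)
  let ?j = "i \<circ> s.beta"
  \<comment> \<open>Two factorizations of one map into \<open>Mt\<close>: through the hypersurface
    and through the bundle over \<open>M\<close>.\<close>
  have P: "push Mt id (?j u) (push R ?j u \<zeta>) = push Mt i (s.beta u) (push (bundle_mfd M C) s.beta u \<zeta>)" for \<zeta>
    unfolding push_push[OF s.sub.smooth_charts_bundle R Mt sm R_inclusion up]
      push_push[OF s.sub.smooth_charts_bundle smooth_charts_bundle Mt s.smooth_beta si up] by simp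
  have bu: "s.beta u \<in> metric_bundle M C" using s.beta(1)[OF u] by (simp add: s.QS_def)
  note t = push_in_tangent_space[OF s.sub.smooth_charts_bundle R sm up]
    and t' = push_in_tangent_space[OF s.sub.smooth_charts_bundle smooth_charts_bundle s.smooth_beta up]
  have "hR (?j u) (push R ?j u \<xi>) (push R ?j u \<eta>)
      = h (?j u) (push Mt id (?j u) (push R ?j u \<xi>)) (push Mt id (?j u) (push R ?j u \<eta>))"
    using pullback_apply[OF R Mt R_inclusion smooth_map_points[OF sm up] t[OF \<xi>] t[OF \<eta>], of h] by simp
  also have "\<dots> = snd (s.beta u) (push M fst (s.beta u) (push (bundle_mfd M C) s.beta u \<xi>)) (push M fst (s.beta u) (push (bundle_mfd M C) s.beta u \<eta>))"
    unfolding P using h_bundle[OF bu t'[OF \<xi>] t'[OF \<eta>]] by simp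
  also have "\<dots> = snd u (push N fst u \<xi>) (push N fst u \<eta>)" by (rule s.metric_beta[OF u \<xi> \<eta>, symmetric])
  finally show "hR (?j u) (push R ?j u \<xi>) (push R ?j u \<eta>) = snd u (push N fst u \<xi>) (push N fst u \<eta>)" .
qed

lemma induced_bundle_map_beta: "induced_bundle_map N M C i = i \<circ> s.beta"
  by (auto simp: induced_bundle_map_def s.beta_def s.QS_def fun_eq_iff)

lemma R_FG: "FG_metric_all_orders N s.C' R \<delta> (induced_bundle_map N M C i) hR"
  unfolding FG_metric_all_orders_def induced_bundle_map_beta
proof (intro conjI s.conformal_N R_ambient_manifold R_ambient_metric)
  have "s.beta ` metric_bundle N s.C' \<subseteq> s.QS" using s.beta(1) by blast
  then have "(i \<circ> s.beta) ` metric_bundle N s.C' \<subseteq> i ` s.QS" by (auto simp: image_comp[symmetric])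
  then show "ricci_flat_along R hR ((i \<circ> s.beta) ` metric_bundle N s.C')"
    using i_QS by (intro R_ricci_flat) (auto simp: s.QS_def)
qed

end

end

theorem theorem6p3:
  fixes M :: "('m, 'e::euclidean_space) mfd" and C :: "'m metric set" and I :: "'m tractor"
    and Mt :: "('w, 'k::euclidean_space) mfd" and \<delta> :: "real \<Rightarrow> 'w \<Rightarrow> 'w"
    and i :: "'m bpt \<Rightarrow> 'w" and h :: "'w metric"
    and \<Phi> :: "'m tractor \<Rightarrow> 'm bpt \<Rightarrow> 'w tvec" and It :: "'w form1"
  assumes "almost_einstein M C I" and "scalar_negative M C I"
    and "DIM('e) \<ge> 3" and "odd DIM('e)"
    and "scale_singularity M C I \<noteq> {}"
    and "FG_metric_all_orders M C Mt \<delta> i h"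
    and "tractor_correspondence M C Mt \<delta> i h \<Phi>"
    and "ambient_parallel_extension M C Mt \<delta> i h \<Phi> I It"
    and "DIM('f::euclidean_space) + 1 = DIM('e)"
    and "DIM('l::euclidean_space) + 1 = DIM('k)"
  shows "\<exists>W. openin (mtop Mt) W \<and> (\<forall>s>0. \<delta> s ` W \<subseteq> W) \<and> i ` metric_bundle M C \<subseteq> W \<and>
    (let \<Sigma> = (submanifold M (scale_singularity M C I) :: ('m, 'f) mfd);
         \<Sigma>t = (submanifold Mt {p \<in> W. ambient_scale Mt \<delta> h It p = 0} :: ('w, 'l) mfd)
     in smooth_manifold \<Sigma>t
        \<and> totally_geodesic_along Mt h \<Sigma>t (i ` {u \<in> metric_bundle M C. fst u \<in> points \<Sigma>})
        \<and> FG_metric_all_orders \<Sigma> (induced_class \<Sigma> M C) \<Sigma>t \<delta> (induced_bundle_map \<Sigma> M C i)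
             (pullback \<Sigma>t Mt id h))"
proof -
  have "conformal_manifold M C" using assms(1) by (simp add: almost_einstein_def)
  then interpret ambient_einstein M C I Mt \<delta> i h \<Phi> It
    by (intro ambient_einstein.intro conformal.intro ambient_einstein_axioms.intro assms)
  note f = R_manifold[OF refl refl assms(9,10)] R_totally_geodesic[OF refl refl assms(9,10)]
    R_FG[OF refl refl assms(9,10)]
  show ?thesis
  \<comment> \<open>With this witness the zero set in the conclusion is \<open>Z\<close> by
    definition, which \<open>Z_def[symmetric]\<close> folds.\<close>
  proof (intro exI[of _ W] conjI allI impI)
    show "openin (mtop Mt) W" by (rule W_open)
    show "\<delta> s ` W \<subseteq> W" if "s > 0" for s using W_invariant that by blast
    show "i ` metric_bundle M C \<subseteq> W" using bundle_in_W by blast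
  qed (unfold Let_def Z_def[symmetric], intro conjI f, auto)
qed

end
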